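(* Let $p$ be a prime, let $q=p^u$ and $Q=p^s$ with integers $u,s\ge1$, and let $k\ge0$. Let $f(x)\in\mathbb F_Q[x]$ be a nonzero polynomial that is an $\mathbb F_Q$-linear combination of the monomials $x^{p^i+p^j}$ with $0\le i,j\le k$, and assume that $\deg f$ is coprime to $p$. Then the curve $$y^q-y=f(x)$$ over $\mathbb F_Q$ is supersingular.
   Context: The curve means the smooth projective absolutely irreducible curve $X$ over $\mathbb F_Q$ with the given affine equation; let $g$ be its genus. The $L$-polynomial of $X/\mathbb F_Q$ is $L_X(T)=\exp\left(\sum_{i\ge1}(\#X(\mathbb F_{Q^i})-Q^i-1)\frac{T^i}{i}\right)=\sum_{i=0}^{2g}c_iT^i\in\mathbb Z[T]$. The Newton polygon of $X/\mathbb F_Q$ is the lower convex hull of the points $(i,\mathrm{ord}_p(c_i)/s)$, $0\le i\le 2g$ (with $\mathrm{ord}_p(0)=\infty$). $X$ is called supersingular if its Newton polygon is a straight line segment of slope $1/2$. *)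

theory Defs
  imports
    "HOL-Analysis.Analysis"
    "HOL-Algebra.Algebraic_Closure_Type"
    "HOL-Library.Function_Algebras"
    "HOL-Library.FuncSet"
begin

text \<open>
  Curves over the finite field \<open>k = 'a\<close> are given by their function fields.  All fields in sight
  live inside one algebraic closure of the rational function field \<open>k(x)\<close>; it contains an
  algebraic closure of \<open>k\<close>, and every one-variable function field over \<open>k\<close> is isomorphic over
  \<open>k\<close> to a subfield of it.
\<close>

type_synonym 'a ambient = "'a poly fract alg_closure"

definition const :: "'a::field \<Rightarrow> 'a ambient" where
  "const c = to_ac (to_fract [:c:])"

definition xcoord :: "'a::field ambient" where
  "xcoord = to_ac (to_fract [:0, 1:])"

definition is_subring :: "'b::field set \<Rightarrow> bool" where
  "is_subring R \<longleftrightarrow> 1 \<in> R \<and> (\<forall>a\<in>R. \<forall>b\<in>R. a - b \<in> R \<and> a * b \<in> R)"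

definition is_subfield :: "'b::field set \<Rightarrow> bool" where
  "is_subfield F \<longleftrightarrow> is_subring F \<and> (\<forall>a\<in>F. inverse a \<in> F)"

text \<open>
  The function field \<open>k(x,y)\<close> of the plane curve with generic point \<open>(x,y)\<close>.
\<close>

definition function_field :: "'a::field ambient \<Rightarrow> 'a ambient set" where
  "function_field y = is_subfield hull (range const \<union> {xcoord, y})"

text \<open>
  The smooth projective curve \<open>X\<close> with function field \<open>F\<close> is the regular projective model of
  \<open>F/k\<close>: its closed points are the places of \<open>F/k\<close>, represented by their local rings, the
  valuation rings \<open>V\<close> with \<open>k \<subseteq> V \<subset> F\<close>.
\<close>

definition places :: "'a::field ambient set \<Rightarrow> 'a ambient set set" where
  "places F = {V. is_subring V \<and> range const \<subseteq> V \<and> V \<subset> F \<and>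
                  (\<forall>z\<in>F. z \<in> V \<or> inverse z \<in> V)}"

text \<open>The extension of degree \<open>n\<close> of \<open>k\<close> inside the ambient field.\<close>

definition const_ext :: "nat \<Rightarrow> 'a::{field,finite} ambient set" where
  "const_ext n = {z. z ^ (CARD('a) ^ n) = z}"

text \<open>
  Let \<open>k\<^sub>n\<close> be the extension of degree \<open>n\<close>.  A \<open>k\<^sub>n\<close>-rational point is a morphism from the
  spectrum of \<open>k\<^sub>n\<close> to \<open>X\<close> over \<open>k\<close>, that is, a closed point together with a \<open>k\<close>-algebra
  homomorphism from its local ring to \<open>k\<^sub>n\<close>.  The kernel of such a homomorphism is
  automatically the maximal ideal, since the local ring is not algebraic over \<open>k\<close>.
\<close>

definition rational_points ::
    "'a::{field,finite} ambient set \<Rightarrow> nat \<Rightarrow> ('a ambient set \<times> ('a ambient \<Rightarrow> 'a ambient)) set"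
where
  "rational_points F n =
     {(V, \<phi>). V \<in> places F \<and> \<phi> \<in> V \<rightarrow>\<^sub>E const_ext n \<and>
        (\<forall>a\<in>V. \<forall>b\<in>V. \<phi> (a + b) = \<phi> a + \<phi> b \<and> \<phi> (a * b) = \<phi> a * \<phi> b) \<and>
        (\<forall>c. \<phi> (const c) = const c)}"

text \<open>
  The genus is the dimension of the space of global regular differentials.  As \<open>k\<close> is perfect,
  the differentials of \<open>F/k\<close> are the \<open>F\<close>-linear forms on the one-dimensional \<open>F\<close>-space of
  \<open>k\<close>-derivations of \<open>F\<close>, with \<open>a db\<close> the form \<open>D \<mapsto> a (D b)\<close>.  Derivations are extended by \<open>0\<close>
  outside \<open>F\<close>, and forms by \<open>0\<close> outside the set of derivations.
\<close>

definition derivations :: "'a::field ambient set \<Rightarrow> ('a ambient \<Rightarrow> 'a ambient) set" where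
  "derivations F =
     {D. (\<forall>a\<in>F. D a \<in> F) \<and> (\<forall>a. a \<notin> F \<longrightarrow> D a = 0) \<and>
         (\<forall>a\<in>F. \<forall>b\<in>F. D (a + b) = D a + D b \<and> D (a * b) = a * D b + b * D a) \<and>
         (\<forall>c. D (const c) = 0)}"

type_synonym 'a form = "('a ambient \<Rightarrow> 'a ambient) \<Rightarrow> 'a ambient"

definition scale_form :: "'a::field \<Rightarrow> 'a form \<Rightarrow> 'a form" where
  "scale_form c \<omega> = (\<lambda>D. const c * \<omega> D)"

lemma const_simps:
  "const (a + b) = const a + const b"
  "const (a * b) = const a * const b"
  "const 0 = 0"
  "const 1 = 1"
proof -
  have "[:a * b:] = [:a:] * [:b:]" by simp
  then show "const (a * b) = const a * const b"
    unfolding const_def by (metis to_ac_mult to_fract_mult)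
  have "[:a + b:] = [:a:] + [:b:]" by simp
  then show "const (a + b) = const a + const b"
    unfolding const_def by (metis to_ac_add to_fract_add)
  show "const 0 = 0" by (simp add: const_def)
  show "const 1 = 1" by (simp add: const_def flip: one_pCons)
qed

lemma vector_space_scale_form: "vector_space (scale_form :: 'a::field \<Rightarrow> 'a form \<Rightarrow> 'a form)"
  by unfold_locales (auto simp: scale_form_def const_simps fun_eq_iff algebra_simps)

definition differential ::
    "'a::field ambient set \<Rightarrow> 'a ambient \<Rightarrow> 'a ambient \<Rightarrow> 'a form" where
  "differential F a b = (\<lambda>D. if D \<in> derivations F then a * D b else 0)"

text \<open>
  A differential is regular at \<open>V\<close> if it comes from the Kaehler differentials of \<open>V\<close> over \<open>k\<close>,
  i.e. if it is a sum of differentials \<open>a db\<close> with \<open>a, b \<in> V\<close>.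
\<close>

definition regular_at :: "'a::field ambient set \<Rightarrow> 'a ambient set \<Rightarrow> 'a form set" where
  "regular_at F V = module.span scale_form {differential F a b | a b. a \<in> V \<and> b \<in> V}"

definition genus :: "'a::field ambient set \<Rightarrow> nat" where
  "genus F = vector_space.dim scale_form (\<Inter>V\<in>places F. regular_at F V)"

text \<open>The inner series has constant coefficient \<open>0\<close>, because division by \<open>0\<close> gives \<open>0\<close>.\<close>

definition L_series :: "'a::{field,finite} ambient set \<Rightarrow> rat fps" where
  "L_series F =
     fps_exp 1 oo
       Abs_fps (\<lambda>i. (of_nat (card (rational_points F i)) - of_nat CARD('a) ^ i - 1) / of_nat i)"

definition L_polynomial :: "'a::{field,finite} ambient set \<Rightarrow> int poly" where
  "L_polynomial F = (THE P. fps_of_poly (map_poly of_int P) = L_series F)"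

text \<open>
  The arguments \<open>p\<close>, \<open>s\<close> are those with \<open>card k = p ^ s\<close>.  Vanishing coefficients have infinite
  valuation and so contribute no point.
\<close>

definition newton_points :: "nat \<Rightarrow> nat \<Rightarrow> 'a::{field,finite} ambient set \<Rightarrow> (real \<times> real) set" where
  "newton_points p s F =
     {(real i, real (multiplicity (int p) (Polynomial.coeff (L_polynomial F) i)) / real s) | i.
        i \<le> 2 * genus F \<and> Polynomial.coeff (L_polynomial F) i \<noteq> 0}"

definition lower_convex_hull :: "(real \<times> real) set \<Rightarrow> (real \<times> real) set" where
  "lower_convex_hull S =
     {(t, v). (t, v) \<in> convex hull S \<and> (\<forall>w. (t, w) \<in> convex hull S \<longrightarrow> v \<le> w)}"

definition newton_polygon :: "nat \<Rightarrow> nat \<Rightarrow> 'a::{field,finite} ambient set \<Rightarrow> (real \<times> real) set" where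
  "newton_polygon p s F = lower_convex_hull (newton_points p s F)"

text \<open>
  The Newton polygon starts at the origin and lives over the interval from \<open>0\<close> to \<open>2g\<close>, so a
  single segment of slope \<open>1/2\<close> is the one from \<open>(0, 0)\<close> to \<open>(2g, g)\<close>.
\<close>

definition supersingular :: "nat \<Rightarrow> nat \<Rightarrow> 'a::{field,finite} ambient set \<Rightarrow> bool" where
  "supersingular p s F \<longleftrightarrow>
     newton_polygon p s F = closed_segment (0, 0) (real (2 * genus F), real (genus F))"

end

theory Submission
  imports Defs "HOL-Combinatorics.Cycles" "HOL-Computational_Algebra.Polynomial_FPS" "HOL-Number_Theory.Residues"
begin

text \<open>
  For an additive character \<open>\<chi>\<close> of the prime field, the number of affine points over the extension of
  degree \<open>n\<close> is the sum of the \<open>S\<^sub>n(c) = \<Sum>\<^sub>x \<chi>(Tr(c f(x)))\<close>, where \<open>c\<close> ranges over the intersection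
  of \<open>GF(q)\<close> with that extension. For \<open>c \<noteq> 0\<close> the Euler product of these sums is a
  polynomial of degree \<open>d - 1\<close>, where \<open>d = deg f\<close>, so that \<open>- S\<^sub>n(c)\<close> is a sum of \<open>d - 1\<close> \<open>n\<close>-th powers
  of Frobenius eigenvalues.

  The exponents \<open>p\<^sup>i + p\<^sup>j\<close> make \<open>x \<mapsto> Tr(c f(x))\<close> a quadratic form over the prime field, and coprimality
  forces \<open>d = 1 + p\<^sup>h\<close>. Over large extensions its radical has \<open>p\<^sup>2\<^sup>h\<close> elements, so that
  \<open>S\<^sub>n(c)\<^sup>4 = p\<^sup>2\<^sup>n p\<^sup>4\<^sup>h\<close>; as there are just \<open>p\<^sup>h\<close> eigenvalues, suitable powers of them all
  agree and are powers of \<open>p\<close>. Hence the L-polynomial divides a power of \<open>1 - p\<^sup>r T\<^sup>m\<close> with \<open>2 r = s m\<close>,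
  and Gauss's lemma bounds the valuations of its coefficients from below; the leading coefficient attains the bound.

  The curve has one place at infinity, at which \<open>x\<close> and \<open>y\<close> have poles of the coprime orders \<open>q\<close> and \<open>d\<close>,
  and its other places are the points of the smooth affine plane curve. The order of the pole of a polynomial in \<open>x, y\<close>
  at infinity can be read off its monomials, so the forms \<open>x\<^sup>i y\<^sup>j dx\<close> with \<open>q i + d j \<le> (q - 1)(d - 1) - 2\<close>
  are a basis of the regular differentials, and \<open>2 g = (q - 1)(d - 1)\<close> is the degree of the L-polynomial.
\<close>

section \<open>Euler products\<close>

text \<open>Rationality of the zeta function, the sizes of its zeros and the genus all come from
  explicit computation on this one curve; the degree of the L-polynomial and 2 g are found
  independently and then seen to agree. The exponents u and s are unrelated, so a character of GF(q)
  need not be defined over the base field and Frobenius permutes the parameters c. The Euler product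
  is therefore formed over pairs (c, x), and weights are multiplicative only on Frobenius-stable
  multisets. A quadratic character sum is known only up to a root of unity. Its fourth power removes
  this ambiguity and can be computed from the form and its polarisation without dividing by 2, so p
  = 2 is not a separate case. The Frobenius eigenvalues are complex numbers and carry no p-adic
  valuation. Everything p-adic is therefore said about integer coefficients: the product of the
  factors 1 - x T is compared with a polynomial whose coefficients are explicit powers of p.\<close>

text \<open>
  \<open>\<phi>\<close> is a Frobenius acting on a set \<open>Om\<close> of geometric points, effective divisors are
  the \<open>\<phi>\<close>-stable multisets, and \<open>w\<close> is a multiplicative weight on them.
\<close>

locale euler_product =
  fixes Om :: "'i set" and \<phi> :: "'i \<Rightarrow> 'i" and w :: "'i multiset \<Rightarrow> 'c::field_char_0"
  assumes phi_in: "x \<in> Om \<Longrightarrow> \<phi> x \<in> Om"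
    and phi_inj: "x \<in> Om \<Longrightarrow> y \<in> Om \<Longrightarrow> \<phi> x = \<phi> y \<Longrightarrow> x = y"
    and fin_fix: "n \<ge> 1 \<Longrightarrow> finite {x \<in> Om. (\<phi> ^^ n) x = x}"
    and w_empty: "w {#} = 1"
    and w_union: "set_mset M \<subseteq> Om \<Longrightarrow> set_mset N \<subseteq> Om \<Longrightarrow> image_mset \<phi> M = M \<Longrightarrow> image_mset \<phi> N = N
      \<Longrightarrow> w (M + N) = w M * w N"
begin

definition Fix :: "nat \<Rightarrow> 'i set" where "Fix n = {x \<in> Om. (\<phi> ^^ n) x = x}"

definition Div :: "nat \<Rightarrow> 'i multiset set" where
  "Div n = {M. set_mset M \<subseteq> Om \<and> image_mset \<phi> M = M \<and> size M = n}"

text \<open>If x has exact period m dividing n, this is n/m times the closed point of x. Hence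
  \<open>S n\<close> collects the powers w(P)^(n/m) that make up the logarithmic derivative of an
  Euler product.\<close>

definition orb :: "'i \<Rightarrow> nat \<Rightarrow> 'i multiset" where
  "orb x n = image_mset (\<lambda>i. (\<phi> ^^ i) x) (mset_set {..<n})"

definition S :: "nat \<Rightarrow> 'c" where "S n = (\<Sum>x\<in>Fix n. w (orb x n))"

definition A :: "nat \<Rightarrow> 'c" where "A n = (\<Sum>M\<in>Div n. w M)"

lemma funpow_in: "x \<in> Om \<Longrightarrow> (\<phi> ^^ n) x \<in> Om"
  by (induction n) (auto intro: phi_in)

lemma funpow_inj: "x \<in> Om \<Longrightarrow> y \<in> Om \<Longrightarrow> (\<phi> ^^ n) x = (\<phi> ^^ n) y \<Longrightarrow> x = y"
  by (induction n) (auto dest: phi_inj[OF funpow_in funpow_in])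

lemma size_orb [simp]: "size (orb x n) = n" by (simp add: orb_def)

lemma set_orb: "set_mset (orb x n) = (\<lambda>i. (\<phi> ^^ i) x) ` {..<n}"
  by (auto simp: orb_def)

lemma orb_stable:
  assumes "x \<in> Fix n" shows "image_mset \<phi> (orb x n) = orb x n"
proof (cases n)
  case (Suc m)
  have 0: "mset_set {..<n} = add_mset 0 (image_mset Suc (mset_set {..<m}))"
    unfolding Suc lessThan_Suc_eq_insert_0 by (subst mset_set.insert) (auto simp: image_mset_mset_set)
  have m: "mset_set {..<n} = add_mset m (mset_set {..<m})"
    unfolding Suc lessThan_Suc by (rule mset_set.insert) auto
  have "image_mset \<phi> (orb x n) = add_mset ((\<phi> ^^ n) x) (image_mset (\<lambda>i. (\<phi> ^^ Suc i) x) (mset_set {..<m}))"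
    unfolding orb_def m by (simp add: image_mset.compositionality comp_def Suc)
  also have "(\<phi> ^^ n) x = x" using assms by (simp add: Fix_def)
  also have "add_mset x (image_mset (\<lambda>i. (\<phi> ^^ Suc i) x) (mset_set {..<m})) = orb x n"
    unfolding orb_def 0 by (simp add: image_mset.compositionality comp_def)
  finally show ?thesis .
qed (simp add: orb_def)

lemma orb_in: "x \<in> Fix n \<Longrightarrow> orb x n \<in> Div n"
  using funpow_in by (auto simp: Div_def orb_stable set_orb Fix_def)

lemma Div_union: "M \<in> Div m \<Longrightarrow> N \<in> Div n \<Longrightarrow> M + N \<in> Div (m + n)"
  by (auto simp: Div_def)

lemma Div_diff:
  assumes "M \<in> Div m" "N \<in> Div n" "N \<subseteq># M" shows "M - N \<in> Div (m - n)"
  using assms by (auto simp: Div_def image_mset_Diff size_Diff_submset dest: in_diffD)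

lemma stable_count:
  assumes "M \<in> Div m" "x \<in> Om" shows "count M (\<phi> x) = count M x"
proof -
  have "count (image_mset \<phi> M) (\<phi> x) = (\<Sum>y\<in>\<phi> -` {\<phi> x} \<inter> set_mset M. count M y)"
    by (rule count_image_mset)
  also have "\<phi> -` {\<phi> x} \<inter> set_mset M = {x} \<inter> set_mset M"
    using assms phi_inj by (auto simp: Div_def)
  also have "(\<Sum>y\<in>{x} \<inter> set_mset M. count M y) = count M x"
    by (cases "x \<in># M") (auto simp: not_in_iff)
  finally show ?thesis using assms by (simp add: Div_def)
qed

lemma stable_count_funpow:
  assumes "M \<in> Div m" "x \<in> Om" shows "count M ((\<phi> ^^ i) x) = count M x"
  using assms by (induction i) (auto simp: stable_count funpow_in)

text \<open>Multiplicity is constant along a Frobenius orbit, so the forward orbit stays in a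
  support of at most m points and repeats within m steps; injectivity of \<phi> moves the repetition
  back to \<open>x\<close>.\<close>

lemma Div_periodic:
  assumes "M \<in> Div m" "x \<in># M"
  obtains i where "i \<ge> 1" "i \<le> m" "x \<in> Fix i"
proof -
  have x: "x \<in> Om" using assms by (auto simp: Div_def)
  have sub: "(\<lambda>i. (\<phi> ^^ i) x) ` {..m} \<subseteq> set_mset M"
    using stable_count_funpow[OF assms(1) x] assms(2)
    by (metis (no_types, lifting) count_greater_zero_iff image_subsetI)
  have "(\<Sum>x\<in>set_mset M. 1) \<le> (\<Sum>x\<in>set_mset M. count M x)"
    by (intro sum_mono) (simp add: Suc_leI)
  hence "card (set_mset M) \<le> m"
    using assms by (simp add: Div_def size_multiset_overloaded_eq)
  hence "card ((\<lambda>i. (\<phi> ^^ i) x) ` {..m}) < card {..m}"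
    using card_mono[OF finite_set_mset sub] unfolding card_atMost by linarith
  hence "\<not> inj_on (\<lambda>i. (\<phi> ^^ i) x) {..m}" by (rule pigeonhole)
  then obtain i j where ij: "i \<le> m" "j \<le> m" "i \<noteq> j" "(\<phi> ^^ i) x = (\<phi> ^^ j) x"
    by (auto simp: inj_on_def)
  define a b where "a = min i j" and "b = max i j"
  have "(\<phi> ^^ a) x = (\<phi> ^^ (a + (b - a))) x" "a < b" "b \<le> m" using ij by (auto simp: a_def b_def min_def max_def)
  hence "(\<phi> ^^ a) ((\<phi> ^^ (b - a)) x) = (\<phi> ^^ a) x" by (metis comp_apply funpow_add)
  hence "(\<phi> ^^ (b - a)) x = x" using funpow_inj[OF funpow_in[OF x] x] by blast
  thus ?thesis using that[of "b - a"] \<open>a < b\<close> \<open>b \<le> m\<close> x by (auto simp: Fix_def)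
qed

lemma finite_Fix: "n \<ge> 1 \<Longrightarrow> finite (Fix n)" using fin_fix by (simp add: Fix_def)

lemma finite_Div: "finite (Div n)"
proof -
  let ?U = "\<Union>i\<in>{1..n}. Fix i"
  have "finite ?U" using finite_Fix by auto
  have sub: "Div n \<subseteq> mset ` {xs. set xs \<subseteq> ?U \<and> length xs = n}"
  proof
    fix M assume M: "M \<in> Div n"
    obtain xs where xs: "M = mset xs" by (metis ex_mset)
    have "set xs \<subseteq> ?U"
    proof
      fix x assume "x \<in> set xs"
      hence "x \<in># M" using xs by simp
      from Div_periodic[OF M this] show "x \<in> ?U" by force
    qed
    thus "M \<in> mset ` {xs. set xs \<subseteq> ?U \<and> length xs = n}"
      using M xs by (auto simp: Div_def)
  qed
  have "finite {xs. set xs \<subseteq> ?U \<and> length xs = n}"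
    using \<open>finite ?U\<close> by (rule finite_lists_length_eq)
  thus ?thesis by (rule finite_subset[OF sub finite_imageI])
qed

text \<open>If d is the exact period of \<open>x\<close>, the admissible i are multiples d r, and
  the orbit taken d r times is r times the closed point. By stability it fits into \<open>M\<close>
  exactly when r is at most the multiplicity of \<open>x\<close>.\<close>

lemma card_orb_le:
  assumes "M \<in> Div m" "x \<in># M"
  shows "card {i. i \<ge> 1 \<and> x \<in> Fix i \<and> orb x i \<subseteq># M} = count M x"
proof -
  have x: "x \<in> Om" using assms by (auto simp: Div_def)
  define d where "d = (LEAST i. i \<ge> 1 \<and> x \<in> Fix i)"
  have "d \<ge> 1 \<and> x \<in> Fix d" unfolding d_def by (rule LeastI_ex) (use Div_periodic[OF assms] in metis)
  hence d: "d \<ge> 1" "(\<phi> ^^ d) x = x" by (auto simp: Fix_def)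
  have dmin: "(\<phi> ^^ i) x \<noteq> x" if "1 \<le> i" "i < d" for i
    using that not_less_Least[of i "\<lambda>i. i \<ge> 1 \<and> x \<in> Fix i"] x by (auto simp: d_def Fix_def)
  have dmult: "(\<phi> ^^ (d * r)) x = x" for r
    by (induction r) (auto simp: funpow_add d)
  have fix_iff: "(\<phi> ^^ i) x = x \<longleftrightarrow> d dvd i" for i
  proof
    assume i: "(\<phi> ^^ i) x = x"
    have "(\<phi> ^^ (i mod d)) ((\<phi> ^^ (d * (i div d))) x) = (\<phi> ^^ i) x"
      by (metis comp_apply funpow_add mod_mult_div_eq)
    hence "(\<phi> ^^ (i mod d)) x = x" using i dmult by simp
    thus "d dvd i" using dmin[of "i mod d"] d(1) by (metis mod_greater_zero_iff_not_dvd
          mod_less_divisor One_nat_def Suc_le_eq)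
  qed (use dmult in auto)
  have Fd: "orb x (d * r) \<in> Div (d * r)" for r using orb_in x dmult by (simp add: Fix_def)
  have cnt: "count (orb x (d * r)) x = r" for r
  proof -
    have "count (orb x (d * r)) x = card {i. i < d * r \<and> d dvd i}"
      unfolding orb_def count_image_mset' by (simp add: fix_iff eq_commute[of x])
    also have "{i. i < d * r \<and> d dvd i} = (\<lambda>j. d * j) ` {..<r}" using d by auto
    also have "card \<dots> = r" using d by (subst card_image) (auto simp: inj_on_def)
    finally show ?thesis .
  qed
  have sub: "orb x (d * r) \<subseteq># M \<longleftrightarrow> r \<le> count M x" if "r \<ge> 1" for r
  proof
    assume "r \<le> count M x"
    show "orb x (d * r) \<subseteq># M"
    proof (rule mset_subset_eqI)
      fix y
      show "count (orb x (d * r)) y \<le> count M y"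
      proof (cases "y \<in># orb x (d * r)")
        case True
        then obtain i where "y = (\<phi> ^^ i) x" by (auto simp: set_orb)
        thus ?thesis using stable_count_funpow[OF Fd x] stable_count_funpow[OF assms(1) x] cnt
            \<open>r \<le> count M x\<close> by simp
      qed (simp add: not_in_iff)
    qed
  qed (metis cnt mset_subset_eq_count)
  have "{i. i \<ge> 1 \<and> x \<in> Fix i \<and> orb x i \<subseteq># M} = (\<lambda>r. d * r) ` {1..count M x}"
    using x sub d(1) by (auto simp: Fix_def fix_iff elim!: dvdE)
  thus ?thesis using d by (simp add: card_image inj_on_def)
qed

text \<open>Double count of triples (M, x, i): removing \<open>orb x i\<close> from \<open>M\<close>
  gives the terms on the right, while for fixed \<open>M\<close> the number of pairs (x, i) is the
  sum of all multiplicities, that is n.\<close>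

theorem newton_identity: "of_nat n * A n = (\<Sum>i=1..n. S i * A (n - i))"
proof -
  define P where "P = (SIGMA i:{1..n}. Fix i \<times> Div (n - i))"
  have "(\<Sum>i=1..n. S i * A (n - i)) = (\<Sum>i=1..n. \<Sum>(x,M')\<in>Fix i \<times> Div (n - i). w (orb x i + M'))"
  proof (intro sum.cong refl)
    fix i
    have "w (orb x i + M') = w (orb x i) * w M'" if "x \<in> Fix i" "M' \<in> Div (n - i)" for x M'
      using that orb_in by (intro w_union) (auto simp: Div_def)
    thus "S i * A (n - i) = (\<Sum>(x,M')\<in>Fix i \<times> Div (n - i). w (orb x i + M'))"
      by (auto simp: S_def A_def sum_product sum.cartesian_product intro!: sum.cong)
  qed
  also have "\<dots> = (\<Sum>(i,x,M')\<in>P. w (orb x i + M'))"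
    unfolding P_def by (subst sum.Sigma) (use finite_Fix finite_Div in auto)
  also have "\<dots> = (\<Sum>(M,x,i)\<in>(SIGMA M:Div n. SIGMA x:set_mset M. {i. i \<ge> 1 \<and> x \<in> Fix i \<and> orb x i \<subseteq># M}). w M)"
  proof (rule sum.reindex_bij_witness[of _ "\<lambda>(M,x,i). (i, x, M - orb x i)" "\<lambda>(i,x,M'). (orb x i + M', x, i)"])
    fix a assume a: "a \<in> (SIGMA M:Div n. SIGMA x:set_mset M. {i. i \<ge> 1 \<and> x \<in> Fix i \<and> orb x i \<subseteq># M})"
    then obtain M x i where a: "a = (M,x,i)" "M \<in> Div n" "x \<in># M" "i \<ge> 1" "x \<in> Fix i" "orb x i \<subseteq># M" by auto
    have "i \<le> n" using size_mset_mono[OF a(6)] a(2) by (simp add: Div_def)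
    thus "(\<lambda>(M,x,i). (i, x, M - orb x i)) a \<in> P"
      using a Div_diff[OF a(2) orb_in[OF a(5)] a(6)] by (simp add: P_def)
  next
    fix a assume "a \<in> P"
    then obtain i x M' where a: "a = (i,x,M')" "1 \<le> i" "i \<le> n" "x \<in> Fix i" "M' \<in> Div (n - i)"
      by (auto simp: P_def)
    have "x \<in># orb x i" using a by (auto simp: set_orb intro!: image_eqI[of _ _ 0])
    thus "(\<lambda>(i,x,M'). (orb x i + M', x, i)) a \<in> (SIGMA M:Div n. SIGMA x:set_mset M. {i. i \<ge> 1 \<and> x \<in> Fix i \<and> orb x i \<subseteq># M})"
      using a Div_union[OF orb_in[OF a(4)] a(5)] by simp
  qed auto
  also have "\<dots> = (\<Sum>M\<in>Div n. \<Sum>x\<in>set_mset M. \<Sum>i | i \<ge> 1 \<and> x \<in> Fix i \<and> orb x i \<subseteq># M. w M)"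
  proof -
    have fin: "finite {i. i \<ge> 1 \<and> x \<in> Fix i \<and> orb x i \<subseteq># M}" for M x
      by (rule finite_subset[of _ "{..size M}"]) (auto dest: size_mset_mono)
    have "(\<Sum>M\<in>Div n. \<Sum>x\<in>set_mset M. \<Sum>i | i \<ge> 1 \<and> x \<in> Fix i \<and> orb x i \<subseteq># M. w M) =
      (\<Sum>M\<in>Div n. \<Sum>(x,i)\<in>(SIGMA x:set_mset M. {i. i \<ge> 1 \<and> x \<in> Fix i \<and> orb x i \<subseteq># M}). w M)"
      using fin by (intro sum.cong refl sum.Sigma) auto
    also have "\<dots> = (\<Sum>(M,x,i)\<in>(SIGMA M:Div n. SIGMA x:set_mset M. {i. i \<ge> 1 \<and> x \<in> Fix i \<and> orb x i \<subseteq># M}). w M)"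
      by (rule sum.Sigma) (use finite_Div fin in \<open>blast intro: finite_SigmaI\<close>)+
    finally show ?thesis by (rule sym)
  qed
  also have "\<dots> = (\<Sum>M\<in>Div n. of_nat n * w M)"
  proof (intro sum.cong refl)
    fix M assume M: "M \<in> Div n"
    have "(\<Sum>x\<in>set_mset M. \<Sum>i | i \<ge> 1 \<and> x \<in> Fix i \<and> orb x i \<subseteq># M. w M) = of_nat (\<Sum>x\<in>set_mset M. count M x) * w M"
      using card_orb_le[OF M] by (simp add: sum_distrib_right)
    thus "(\<Sum>x\<in>set_mset M. \<Sum>i | i \<ge> 1 \<and> x \<in> Fix i \<and> orb x i \<subseteq># M. w M) = of_nat n * w M"
      using M by (simp add: Div_def size_multiset_overloaded_eq del: of_nat_sum)
  qed
  finally show ?thesis by (simp add: A_def sum_distrib_left)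
qed

lemma A_0: "A 0 = 1"
proof -
  have "Div 0 = {{#}}" by (auto simp: Div_def)
  thus ?thesis by (simp add: A_def w_empty)
qed

text \<open>The form in which sums are compared later: a series with constant term 1 is determined
  by its logarithmic derivative.\<close>

lemma fps_deriv_A: "fps_deriv (Abs_fps A) = Abs_fps A * Abs_fps (\<lambda>n. S (Suc n))"
proof (rule fps_ext)
  fix n
  have "fps_nth (fps_deriv (Abs_fps A)) n = of_nat (Suc n) * A (Suc n)" by simp
  also have "\<dots> = (\<Sum>i=1..Suc n. S i * A (Suc n - i))" by (rule newton_identity)
  also have "\<dots> = (\<Sum>i=0..n. S (Suc i) * A (n - i))"
    by (rule sum.reindex_bij_witness[of _ Suc "\<lambda>i. i - 1"]) auto
  also have "\<dots> = fps_nth (Abs_fps (\<lambda>n. S (Suc n)) * Abs_fps A) n" by (simp add: fps_mult_nth)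
  finally show "fps_nth (fps_deriv (Abs_fps A)) n = fps_nth (Abs_fps A * Abs_fps (\<lambda>n. S (Suc n))) n"
    by (simp add: mult.commute)
qed

end

section \<open>Power series with a given logarithmic derivative\<close>

lemma fps_deriv_eq_unique:
  fixes F G H :: "'a::field_char_0 fps"
  assumes "fps_deriv F = F * H" "fps_deriv G = G * H" "fps_nth F 0 = fps_nth G 0" "fps_nth G 0 \<noteq> 0"
  shows "F = G"
proof -
  have "fps_deriv (F / G) = 0"
  proof -
    have "fps_deriv (F * inverse G) = 0"
      using assms fps_inverse_deriv[OF assms(4)] inverse_mult_eq_1[OF assms(4)]
      by (simp add: power2_eq_square algebra_simps)
    thus ?thesis using assms by (simp add: fps_divide_unit)
  qed
  hence "F / G = fps_const (fps_nth (F / G) 0)" using fps_deriv_eq_0_iff by blast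
  moreover have "fps_nth (F / G) 0 = 1" using assms by (simp add: fps_divide_unit)
  ultimately have "F * inverse G = 1" using assms by (simp add: fps_divide_unit)
  thus ?thesis using inverse_mult_eq_1[OF assms(4)]
    by (metis mult.assoc mult.commute mult_1)
qed

lemma fps_exp_oo_deriv:
  fixes S :: "nat \<Rightarrow> 'a::field_char_0"
  defines "E \<equiv> fps_exp 1 oo Abs_fps (\<lambda>i. S i / of_nat i)"
  shows "fps_deriv E = E * Abs_fps (\<lambda>n. S (Suc n))" "fps_nth E 0 = 1"
proof -
  have "fps_deriv (Abs_fps (\<lambda>i. S i / of_nat i)) = Abs_fps (\<lambda>n. S (Suc n))"
    by (rule fps_ext) (simp del: of_nat_Suc)
  thus "fps_deriv E = E * Abs_fps (\<lambda>n. S (Suc n))"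
    unfolding E_def by (subst fps_compose_deriv) (auto simp: fps_exp_deriv fps_const_mult_apply_left)
qed (simp add: E_def)

lemma fps_exp_oo_unique:
  fixes S :: "nat \<Rightarrow> 'a::field_char_0"
  assumes "fps_deriv F = F * Abs_fps (\<lambda>n. S (Suc n))" "fps_nth F 0 = 1"
  shows "fps_exp 1 oo Abs_fps (\<lambda>i. S i / of_nat i) = F"
  using fps_deriv_eq_unique[of F "Abs_fps (\<lambda>n. S (Suc n))"] fps_exp_oo_deriv[of S] assms by simp

declare One_nat_def [simp del]

section \<open>Artin-Schreier equations and additive characters\<close>

text \<open>A repeated linear factor would give a common zero of \<open>P\<close> and its
  derivative, so the multiset of roots is a set.\<close>

lemma alg_closed_card_roots:
  fixes P :: "'b::alg_closed_field poly"
  assumes "P \<noteq> 0" and sep: "\<And>x. poly P x = 0 \<Longrightarrow> poly (pderiv P) x \<noteq> 0"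
  shows "card {x. poly P x = 0} = Polynomial.degree P"
proof -
  obtain A where A: "size A = Polynomial.degree P"
    "P = Polynomial.smult (Polynomial.lead_coeff P) (\<Prod>x\<in>#A. [:-x, 1:])"
    using alg_closed_imp_factorization[OF assms(1)] by blast
  have roots: "{x. poly P x = 0} = set_mset A"
    by (subst A(2)) (use assms(1) in \<open>auto simp: poly_prod_mset image_iff prod_mset_zero_iff\<close>)
  have "count A x \<le> 1" for x
  proof (rule ccontr)
    assume "\<not> count A x \<le> 1"
    hence "add_mset x {#x#} \<subseteq># A"
      by (intro mset_subset_eqI) auto
    then obtain B where B: "A = add_mset x {#x#} + B" by (metis subset_mset.less_eqE)
    define R where "R = Polynomial.smult (Polynomial.lead_coeff P) (\<Prod>x\<in>#B. [:-x, 1:])"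
    have R: "P = [:-x,1:] * ([:-x,1:] * R)"
      by (subst A(2), subst B) (simp only: R_def image_mset_union prod_mset.union
          image_mset_add_mset prod_mset.add_mset image_mset_empty prod_mset.empty
          mult_smult_right mult_1_right mult.assoc)
    have "poly P x = 0" by (subst R, simp only: poly_mult) simp
    moreover have "poly (pderiv P) x = 0"
      by (subst R, simp only: pderiv_mult poly_add poly_mult) simp
    ultimately
    show False using sep by blast
  qed
  hence "size A = card (set_mset A)"
    by (metis (no_types, lifting) One_nat_def count_greater_eq_one_iff le_antisym
        size_multiset_overloaded_eq sum.cong card_eq_sum)
  thus ?thesis using roots A by simp
qed

lemma sum_nontrivial_hom_eq_0:
  fixes \<psi> :: "'b::ab_group_add \<Rightarrow> complex"
  assumes "t \<in> A" "\<And>x. x \<in> A \<Longrightarrow> x + t \<in> A" "\<And>x. x \<in> A \<Longrightarrow> x - t \<in> A"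
    "\<And>x. x \<in> A \<Longrightarrow> \<psi> (x + t) = \<psi> x * \<psi> t" "\<psi> t \<noteq> 1"
  shows "sum \<psi> A = 0"
proof -
  have "sum \<psi> A = (\<Sum>x\<in>A. \<psi> (x + t))"
    by (rule sum.reindex_bij_witness[of _ "\<lambda>x. x + t" "\<lambda>x. x - t"]) (use assms in auto)
  also have "\<dots> = sum \<psi> A * \<psi> t" using assms by (simp add: sum_distrib_right)
  finally show ?thesis using assms(5) by simp
qed

lemma sum_lessThan_add: "(\<Sum>i<a + b. g i) = (\<Sum>i<a. g i) + (\<Sum>j<b. g (a + j :: nat))"
  for g :: "nat \<Rightarrow> 'c::comm_monoid_add"
  by (induction b) (auto simp: add.assoc)

section \<open>Finite fields, traces and additive characters inside an algebraically closed
  field\<close>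

locale alg_closed_char =
  fixes p :: nat and ty :: "'b::alg_closed_field itself"
  assumes CHAR: "CHAR('b) = p" and prime_p: "Factorial_Ring.prime p"
begin

lemma p_gt1: "p > 1" and p_pos[simp]: "p > 0" and p_neq0[simp]: "p \<noteq> 0"
  using prime_gt_1_nat[OF prime_p] by auto

lemma prime_CHAR: "Factorial_Ring.prime CHAR('b)" using CHAR prime_p by simp

lemma of_nat_p [simp]: "(of_nat p :: 'b) = 0" using CHAR of_nat_CHAR by metis

lemma of_nat_eq_0: "(of_nat n :: 'b) = 0 \<longleftrightarrow> p dvd n"
  using CHAR of_nat_eq_0_iff_char_dvd by metis

lemma frob_add: "(x + y :: 'b) ^ (p ^ i) = x ^ (p ^ i) + y ^ (p ^ i)"
  by (rule freshmans_dream'[OF prime_CHAR]) (simp add: CHAR)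

lemma frob_sum: "(\<Sum>x\<in>A. g x :: 'b) ^ (p ^ i) = (\<Sum>x\<in>A. g x ^ (p ^ i))"
  by (rule freshmans_dream_sum'[OF prime_CHAR]) (simp add: CHAR)

lemma frob_diff: "(x - y :: 'b) ^ (p ^ i) = x ^ (p ^ i) - y ^ (p ^ i)"
  using frob_add[of "x - y" y i] by simp

lemma frob_0 [simp]: "(0 :: 'b) ^ (p ^ i) = 0" by (simp add: power_0_left)

lemma frob_uminus: "(- y :: 'b) ^ (p ^ i) = - (y ^ (p ^ i))"
  using frob_diff[of 0 y i] by simp

lemma frob_inj: "(x :: 'b) ^ (p ^ i) = y ^ (p ^ i) \<longleftrightarrow> x = y"
  using frob_diff[of x y i] by auto

text \<open>The subfield of p^m elements if m is positive. For m = 0 the condition is void and gives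
  the whole field, which explains the hypotheses \<open>m \<ge> 1\<close>.\<close>

definition GF :: "nat \<Rightarrow> 'b set" where "GF m = {z. z ^ (p ^ m) = z}"

lemma GF_closed:
  "0 \<in> GF m" "1 \<in> GF m"
  "x \<in> GF m \<Longrightarrow> y \<in> GF m \<Longrightarrow> x + y \<in> GF m"
  "x \<in> GF m \<Longrightarrow> y \<in> GF m \<Longrightarrow> x - y \<in> GF m"
  "x \<in> GF m \<Longrightarrow> - x \<in> GF m"
  "x \<in> GF m \<Longrightarrow> y \<in> GF m \<Longrightarrow> x * y \<in> GF m"
  "x \<in> GF m \<Longrightarrow> y \<in> GF m \<Longrightarrow> x / y \<in> GF m"
  "x \<in> GF m \<Longrightarrow> inverse x \<in> GF m"
  "x \<in> GF m \<Longrightarrow> x ^ n \<in> GF m"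
  unfolding GF_def
  by (auto simp: frob_add frob_diff frob_uminus power_mult_distrib power_divide power_inverse
      simp flip: power_mult)
    (metis mult.commute power_mult)

lemma GF_sum: "(\<And>x. x \<in> A \<Longrightarrow> g x \<in> GF m) \<Longrightarrow> sum g A \<in> GF m"
  by (induction A rule: infinite_finite_induct) (auto intro: GF_closed)

lemma GF_of_nat: "of_nat n \<in> GF m" by (induction n) (auto intro: GF_closed)

lemma frob_pow_add: "(z :: 'b) ^ (p ^ (i + j)) = (z ^ (p ^ i)) ^ (p ^ j)"
  by (simp add: power_add power_mult)

lemma GF_mult: "z \<in> GF m \<Longrightarrow> z \<in> GF (m * r)"
proof (induction r)
  case (Suc r)
  thus ?case using frob_pow_add[of z m "m * r"] by (simp add: GF_def)
qed (simp add: GF_def)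

lemma GF_dvd: "m dvd n \<Longrightarrow> GF m \<subseteq> GF n" using GF_mult by auto

lemma degree_AS:
  assumes "n > 1"
  shows "Polynomial.degree (Polynomial.monom 1 n - Polynomial.monom 1 1 - [:c:] :: 'b poly) = n"
    "Polynomial.lead_coeff (Polynomial.monom 1 n - Polynomial.monom 1 1 - [:c:] :: 'b poly) = 1"
proof -
  let ?P = "Polynomial.monom 1 n - Polynomial.monom 1 1 - [:c:] :: 'b poly"
  have c: "Polynomial.coeff ?P i = (if i = n then 1 else if i = 1 then -1 else if i = 0 then -c else 0)" for i
    using assms by (cases i) (auto simp: coeff_pCons)
  have "Polynomial.degree ?P \<le> n" by (rule degree_le) (use assms in \<open>auto simp: c simp del: Polynomial.coeff_diff One_nat_def\<close>)
  moreover have "Polynomial.degree ?P \<ge> n" by (rule le_degree) (use assms in \<open>auto simp: c simp del: Polynomial.coeff_diff One_nat_def\<close>)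
  ultimately show "Polynomial.degree ?P = n" by simp
  thus "Polynomial.lead_coeff ?P = 1" using c[of n] by simp
qed

lemma card_AS:
  assumes "m \<ge> 1"
  shows "card {y :: 'b. y ^ (p ^ m) - y = c} = p ^ m"
proof -
  let ?P = "Polynomial.monom 1 (p ^ m) - Polynomial.monom 1 1 - [:c:] :: 'b poly"
  have g: "p ^ m > 1" using assms p_gt1 by (intro one_less_power) auto
  have "?P \<noteq> 0" using degree_AS[OF g, of c] g by (metis Polynomial.degree_0 not_one_less_zero)
  moreover have "pderiv ?P = - 1"
    using assms by (simp add: pderiv_diff pderiv_monom pderiv_pCons power_0_left one_pCons)
  ultimately have "card {x. poly ?P x = 0} = p ^ m"
    using alg_closed_card_roots[of ?P] degree_AS[OF g, of c] by (simp)
  moreover have "{x. poly ?P x = 0} = {y. y ^ (p ^ m) - y = c}" by (auto simp: poly_monom)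
  ultimately show ?thesis by simp
qed

lemma card_GF: "m \<ge> 1 \<Longrightarrow> card (GF m) = p ^ m"
  using card_AS[of m 0] by (simp add: GF_def)

lemma finite_GF: "m \<ge> 1 \<Longrightarrow> finite (GF m)"
  using card_GF by (metis card_eq_0_iff p_neq0 power_not_zero)

text \<open>On \<open>GF m\<close> this is the trace to the prime field. As a polynomial function on
  the whole field it is additive and satisfies the tower formula without side conditions.\<close>

definition T :: "nat \<Rightarrow> 'b \<Rightarrow> 'b" where "T m z = (\<Sum>i<m. z ^ (p ^ i))"

lemma T_add: "T m (x + y) = T m x + T m y"
  by (simp add: T_def frob_add sum.distrib)

lemma T_diff: "T m (x - y) = T m x - T m y"
  by (simp add: T_def frob_diff sum_subtractf)

lemma T_0 [simp]: "T m 0 = 0" by (simp add: T_def)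

lemma T_sum: "T m (sum g A) = (\<Sum>x\<in>A. T m (g x))"
  by (induction A rule: infinite_finite_induct) (auto simp: T_add)

lemma T_frob1: assumes "z \<in> GF m" shows "T m (z ^ p) = T m z"
proof (cases m)
  case (Suc k)
  have "T m (z ^ p) = (\<Sum>i<Suc k. z ^ (p ^ Suc i))"
    unfolding T_def Suc by (intro sum.cong refl) (simp flip: power_mult)
  also have "\<dots> = (\<Sum>i<k. z ^ (p ^ Suc i)) + z ^ (p ^ 0)"
    using assms Suc by (simp add: GF_def)
  also have "\<dots> = T m z" unfolding T_def Suc by (subst sum.lessThan_Suc_shift) (simp add: add.commute)
  finally show ?thesis .
qed (simp add: T_def)

lemma T_frob: "z \<in> GF m \<Longrightarrow> T m (z ^ (p ^ i)) = T m z"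
proof (induction i)
  case (Suc i)
  have "T m ((z ^ (p ^ i)) ^ p) = T m (z ^ (p ^ i))"
    by (rule T_frob1) (use Suc in \<open>auto intro: GF_closed\<close>)
  thus ?case using Suc by (simp add: mult.commute flip: power_mult)
qed simp

lemma T_in_GF1: "z \<in> GF m \<Longrightarrow> T m z \<in> GF 1"
  using T_frob1[of z m] frob_sum[of "\<lambda>i. z ^ (p ^ i)" "{..<m}" 1]
  by (simp add: GF_def T_def mult.commute flip: power_mult)

lemma T_scale: "c \<in> GF 1 \<Longrightarrow> T m (c * z) = c * T m z"
  using GF_mult[of c 1] by (simp add: T_def GF_def power_mult_distrib sum_distrib_left)

text \<open>Transitivity of the trace: the exponents below m r are split as m i + j, and the sum
  over j is the trace from \<open>GF m\<close>.\<close>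

lemma T_tower: "T (m * r) z = T m (\<Sum>i<r. z ^ (p ^ (m * i)))"
proof -
  have "T (m * r) z = (\<Sum>i<r. \<Sum>j<m. z ^ (p ^ (m * i + j)))"
    unfolding T_def
  proof (induction r)
    case (Suc r)
    have "(\<Sum>i<m * Suc r. z ^ p ^ i) = (\<Sum>i<m * r + m. z ^ p ^ i)" by (simp add: add.commute)
    also have "\<dots> = (\<Sum>i<m * r. z ^ p ^ i) + (\<Sum>j<m. z ^ p ^ (m * r + j))"
      by (rule sum_lessThan_add)
    finally show ?case using Suc by simp
  qed simp
  also have "\<dots> = T m (\<Sum>i<r. z ^ (p ^ (m * i)))"
    unfolding T_def frob_sum
    by (subst sum.swap) (simp add: power_add power_mult)
  finally show ?thesis .
qed


text \<open>Additive (linearised) polynomials. The derivative is the constant \<open>e 0\<close>, so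
  they are separable as soon as the linear coefficient is nonzero.\<close>

definition addpoly :: "(nat \<Rightarrow> 'b) \<Rightarrow> nat \<Rightarrow> 'b poly" where
  "addpoly e N = (\<Sum>i\<le>N. Polynomial.monom (e i) (p ^ i))"

lemma poly_addpoly: "poly (addpoly e N) z = (\<Sum>i\<le>N. e i * z ^ (p ^ i))"
  by (simp add: addpoly_def poly_sum poly_monom)

lemma degree_addpoly:
  assumes "e N \<noteq> 0" shows "Polynomial.degree (addpoly e N) = p ^ N"
proof (rule antisym)
  show "Polynomial.degree (addpoly e N) \<le> p ^ N"
    unfolding addpoly_def
    by (intro degree_sum_le) (auto intro!: order.trans[OF degree_monom_le] power_increasing Suc_leI less_imp_le[OF p_gt1])
  have "Polynomial.coeff (addpoly e N) (p ^ N) = (\<Sum>i\<le>N. if i = N then e i else 0)"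
    unfolding addpoly_def coeff_sum using p_gt1 by (intro sum.cong refl) auto
  thus "p ^ N \<le> Polynomial.degree (addpoly e N)" using assms by (intro le_degree) simp
qed

lemma pderiv_sum': "pderiv (\<Sum>i\<in>A. g i :: 'b poly) = (\<Sum>i\<in>A. pderiv (g i))"
  by (induction A rule: infinite_finite_induct) (auto simp: pderiv_add)

lemma pderiv_addpoly: "pderiv (addpoly e N) = [:e 0:]"
proof -
  have "pderiv (addpoly e N) = (\<Sum>i\<le>N. if i = 0 then [:e 0:] else 0)"
    unfolding addpoly_def pderiv_sum'
  proof (intro sum.cong refl)
    fix i
    show "pderiv (Polynomial.monom (e i) (p ^ i)) = (if i = 0 then [:e 0:] else 0)"
      by (cases i) (simp_all add: pderiv_monom Polynomial.monom_0)
  qed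
  thus ?thesis by (simp add: sum.delta)
qed

lemma card_roots_addpoly:
  assumes "e N \<noteq> 0" "e 0 \<noteq> 0"
  shows "card {z. poly (addpoly e N) z = 0} = p ^ N"
proof -
  have "addpoly e N \<noteq> 0" using degree_addpoly[of e N] assms by auto
  thus ?thesis using alg_closed_card_roots[of "addpoly e N"] degree_addpoly[of e N] assms
    by (auto simp: pderiv_addpoly)
qed

text \<open>The trace is a polynomial function of degree p^(m-1), too small to vanish at all p^m
  elements of \<open>GF m\<close>; division by \<open>w\<close> adapts the witness.\<close>

lemma T_nontrivial:
  assumes "m \<ge> 1" "w \<in> GF m" "w \<noteq> 0"
  obtains z where "z \<in> GF m" "T m (w * z) \<noteq> 0"
proof -
  obtain k where m: "m = Suc k" using assms(1) by (cases m) auto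
  let ?P = "addpoly (\<lambda>_. 1) k"
  have P: "poly ?P z = T m z" for z
    by (simp add: poly_addpoly T_def m lessThan_Suc_atMost)
  have "\<exists>v\<in>GF m. T m v \<noteq> 0"
  proof (rule ccontr)
    assume "\<not> ?thesis"
    hence "GF m \<subseteq> {z. poly ?P z = 0}" by (auto simp: P)
    moreover have c: "card {z. poly ?P z = 0} = p ^ k" by (rule card_roots_addpoly) auto
    hence "finite {z. poly ?P z = 0}" by (metis card_eq_0_iff p_neq0 power_not_zero)
    ultimately have "card (GF m) \<le> p ^ k" using c card_mono by metis
    moreover have "p ^ k < p ^ m" using m p_gt1 by simp
    ultimately show False using card_GF[OF assms(1)] by simp
  qed
  then obtain v where "v \<in> GF m" "T m v \<noteq> 0" by blast
  thus ?thesis using that[of "v / w"] assms by (auto intro: GF_closed)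
qed

lemma of_nat_inj_less:
  assumes "a < p" "b < p" "(of_nat a :: 'b) = of_nat b" shows "a = b"
proof -
  have *: "a = b" if "a \<le> b" "b < p" "(of_nat a :: 'b) = of_nat b" for a b
  proof -
    have "(of_nat (b - a) :: 'b) = 0" using that by (simp add: of_nat_diff)
    hence "p dvd b - a" by (simp only: of_nat_eq_0)
    thus ?thesis using that by (auto dest: dvd_imp_le)
  qed
  show ?thesis using *[of a b] *[of b a] assms by (cases "a \<le> b") auto
qed

lemma of_nat_mod: "(of_nat (a mod p) :: 'b) = of_nat a"
proof -
  have "(of_nat a :: 'b) = of_nat (p * (a div p) + a mod p)" by simp
  thus ?thesis by (simp only: of_nat_add of_nat_mult of_nat_p) simp
qed

lemma GF1_eq: "GF 1 = of_nat ` {..<p}"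
proof -
  have "inj_on (of_nat :: nat \<Rightarrow> 'b) {..<p}" by (rule inj_onI) (auto intro: of_nat_inj_less)
  hence "card (of_nat ` {..<p} :: 'b set) = p" by (simp add: card_image)
  thus ?thesis using card_GF[of 1] finite_GF[of 1] card_subset_eq[of "GF 1" "of_nat ` {..<p}"]
    by (auto intro: GF_of_nat)
qed

text \<open>The character taking the class of n to exp(2 pi i n / p). Every natural representative
  gives the same value; only arguments in the prime field \<open>GF 1\<close> are
  meaningful.\<close>

definition chi :: "'b \<Rightarrow> complex" where
  "chi z = cis (2 * pi * real (LEAST n. of_nat n = z) / real p)"

lemma cis_mod: "cis (2 * pi * real (a mod p) / real p) = cis (2 * pi * real a / real p)"
proof -
  have "real a = real (a mod p) + real p * real (a div p)"
    by (metis mod_mult_div_eq of_nat_add of_nat_mult)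
  hence "2 * pi * real a / real p = 2 * pi * real (a mod p) / real p + 2 * pi * of_int (int (a div p))"
    by (simp add: field_simps)
  thus ?thesis by (simp only: cis_mult[symmetric] cis_multiple_2pi) simp
qed

lemma chi_of_nat: "chi (of_nat a) = cis (2 * pi * real a / real p)"
proof -
  define l where "l = (LEAST n. of_nat n = (of_nat a :: 'b))"
  have "of_nat l = (of_nat a :: 'b)" unfolding l_def by (rule LeastI) simp
  hence "l mod p = a mod p" by (intro of_nat_inj_less) (simp_all add: of_nat_mod)
  thus ?thesis unfolding chi_def l_def[symmetric] using cis_mod[of l] cis_mod[of a] by simp
qed

lemma chi_add: assumes "x \<in> GF 1" "y \<in> GF 1" shows "chi (x + y) = chi x * chi y"
proof -
  obtain a b where ab: "x = of_nat a" "y = of_nat b" using assms by (auto simp: GF1_eq)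
  have "chi (x + y) = cis (2 * pi * real (a + b) / real p)"
    unfolding ab by (simp only: chi_of_nat flip: of_nat_add)
  also have "2 * pi * real (a + b) / real p = 2 * pi * real a / real p + 2 * pi * real b / real p"
    by (simp add: field_simps)
  finally show ?thesis by (simp only: ab chi_of_nat cis_mult)
qed

lemma chi_0 [simp]: "chi 0 = 1" using chi_of_nat[of 0] by simp

lemma chi_neq1: "x \<in> GF 1 \<Longrightarrow> x \<noteq> 0 \<Longrightarrow> chi x \<noteq> 1"
proof
  assume "x \<in> GF 1" "x \<noteq> 0" "chi x = 1"
  then obtain a where a: "a < p" "x = of_nat a" by (auto simp: GF1_eq)
  hence a0: "a \<noteq> 0" using \<open>x \<noteq> 0\<close> by (intro notI) simp
  have "cos (2 * pi * real a / real p) = 1"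
    using \<open>chi x = 1\<close> a by (simp add: chi_of_nat complex_eq_iff)
  then obtain n :: int where "2 * pi * real a / real p = of_int n * 2 * pi"
    using cos_one_2pi_int by blast
  hence "real a = of_int n * real p" by (simp add: field_simps)
  hence "real_of_int (int a) = of_int (n * int p)" by simp
  hence "int a = n * int p" by linarith
  hence "p dvd a" by (metis dvd_triv_right int_dvd_int_iff)
  thus False using a a0 by (auto dest: dvd_imp_le)
qed

lemma chi_T_hom:
  "x \<in> GF m \<Longrightarrow> y \<in> GF m \<Longrightarrow> chi (T m (x + y)) = chi (T m x) * chi (T m y)"
  using chi_add T_in_GF1 T_add by metis

lemma sum_chi_T:
  assumes "m \<ge> 1" "w \<in> GF m"
  shows "(\<Sum>z\<in>GF m. chi (T m (w * z))) = (if w = 0 then of_nat (p ^ m) else 0)"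
proof (cases "w = 0")
  case False
  then obtain t where t: "t \<in> GF m" "T m (w * t) \<noteq> 0" using T_nontrivial assms by metis
  hence "chi (T m (w * t)) \<noteq> 1" using assms by (intro chi_neq1 T_in_GF1 GF_closed)
  hence "sum (\<lambda>z. chi (T m (w * z))) (GF m) = 0"
    using t assms by (intro sum_nontrivial_hom_eq_0[of t])
      (auto intro!: GF_closed chi_T_hom simp: ring_distribs)
  thus ?thesis using False by simp
qed (use assms card_GF in simp)

lemma AS_kernel:
  assumes z: "z \<in> GF n"
  shows "{y \<in> GF n. y ^ (p ^ u) - y = z ^ (p ^ u) - z} = (\<lambda>e. z + e) ` (GF u \<inter> GF n)"
proof (intro equalityI subsetI)
  fix y assume "y \<in> {y \<in> GF n. y ^ (p ^ u) - y = z ^ (p ^ u) - z}"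
  hence "y - z \<in> GF u \<inter> GF n" "y = z + (y - z)"
    using z by (auto simp: GF_def frob_diff algebra_simps)
  thus "y \<in> (\<lambda>e. z + e) ` (GF u \<inter> GF n)" by blast
qed (use z in \<open>auto simp: GF_def frob_add\<close>)

text \<open>The image of \<open>y \<mapsto> y\<^sup>q - y\<close> is contained in the common kernel of the traces \<open>z \<mapsto> T (c z)\<close>,
  \<open>c \<in> GF u\<close>; both have the same cardinality.\<close>

lemma card_AS_eq_sum_chi:
  assumes n: "n \<ge> 1" and u: "u \<ge> 1" and z: "z \<in> GF n"
  shows "of_nat (card {y \<in> GF n. y ^ (p ^ u) - y = z}) = (\<Sum>c\<in>GF u \<inter> GF n. chi (T n (c * z)))"
proof -
  define E where "E = GF u \<inter> GF n"
  define H where "H = (\<lambda>y. y ^ (p ^ u) - y) ` GF n"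
  define Z where "Z = {z \<in> GF n. \<forall>c\<in>E. T n (c * z) = 0}"
  have finG: "finite (GF n)" and finE: "finite E" unfolding E_def using finite_GF n by auto
  have E0: "0 \<in> E" by (auto simp: E_def intro: GF_closed)
  have HZ: "H \<subseteq> Z"
  proof -
    have "T n (c * (y ^ (p ^ u) - y)) = 0" if "c \<in> E" "y \<in> GF n" for c y
    proof -
      have "c * (y ^ (p ^ u) - y) = (c * y) ^ (p ^ u) - c * y"
        using that by (simp add: E_def GF_def power_mult_distrib algebra_simps)
      thus ?thesis using that by (simp add: T_diff T_frob E_def GF_closed)
    qed
    thus ?thesis by (auto simp: H_def Z_def intro: GF_closed)
  qed
  have fib: "card {y \<in> GF n. y ^ (p ^ u) - y = h} = card E" if h: "h \<in> H" for h
  proof -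
    from h obtain z where "z \<in> GF n" "h = z ^ (p ^ u) - z" unfolding H_def by blast
    thus ?thesis using AS_kernel[of z n u] by (simp add: card_image E_def)
  qed
  have cH: "card (GF n) = card H * card E"
  proof -
    have "card (GF n) = (\<Sum>h\<in>H. card {y \<in> GF n. y ^ (p ^ u) - y = h})"
      unfolding H_def using sum.image_gen[OF finG, of "\<lambda>_. 1::nat" "\<lambda>y. y ^ (p ^ u) - y"] by simp
    thus ?thesis using fib by simp
  qed
  have inner: "(\<Sum>c\<in>E. chi (T n (c * z))) = (if z \<in> Z then of_nat (card E) else 0)" if z: "z \<in> GF n" for z
  proof (cases "z \<in> Z")
    case False
    then obtain t where "t \<in> E" "T n (t * z) \<noteq> 0" using z by (auto simp: Z_def)
    hence "chi (T n (t * z)) \<noteq> 1" using z by (intro chi_neq1 T_in_GF1 GF_closed) (auto simp: E_def)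
    hence "sum (\<lambda>c. chi (T n (c * z))) E = 0"
      using z \<open>t \<in> E\<close> by (intro sum_nontrivial_hom_eq_0[of t])
        (auto intro!: GF_closed chi_T_hom simp: ring_distribs E_def)
    thus ?thesis using False by simp
  qed (simp add: Z_def)
  \<comment> \<open>Summing over z first gives |Z| |E|, summing over c first gives |GF n| = |H| |E|;
    so \<open>H\<close> and \<open>Z\<close> have the same size.\<close>
  have "of_nat (card Z * card E) = (\<Sum>z\<in>GF n. \<Sum>c\<in>E. chi (T n (c * z)))"
  proof -
    have "(\<Sum>z\<in>GF n. \<Sum>c\<in>E. chi (T n (c * z))) = (\<Sum>z\<in>GF n. if z \<in> Z then of_nat (card E) else 0)"
      using inner by simp
    also have "\<dots> = of_nat (card (GF n \<inter> Z) * card E)" using finG by (simp add: sum.If_cases)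
    also have "GF n \<inter> Z = Z" by (auto simp: Z_def)
    finally show ?thesis by simp
  qed
  also have "\<dots> = (\<Sum>c\<in>E. \<Sum>z\<in>GF n. chi (T n (c * z)))" by (rule sum.swap)
  also have "\<dots> = (\<Sum>c\<in>E. if c = 0 then of_nat (p ^ n) else 0)"
    by (intro sum.cong refl sum_chi_T n) (simp add: E_def)
  also have "\<dots> = of_nat (card (GF n))" using E0 finE card_GF[OF n] by simp
  finally have "card Z * card E = card H * card E" using cH by (metis of_nat_eq_iff)
  moreover have "card E > 0" using E0 finE by (auto simp: card_gt_0_iff)
  ultimately have HZ': "H = Z" using HZ finG by (intro card_subset_eq) (auto simp: Z_def)
  have "{y \<in> GF n. y ^ (p ^ u) - y = z} = {}" if "z \<notin> H" using that by (auto simp: H_def)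
  hence "card {y \<in> GF n. y ^ (p ^ u) - y = z} = 0" if "z \<notin> H" using that by (metis card.empty)
  thus ?thesis using HZ' inner[OF z] fib[of z] by (cases "z \<in> H") (simp_all add: E_def)
qed

text \<open>A nonzero square has at most two roots and 0 has one, so there are at least (p + 1)/2
  squares. The squares and the elements -1 - s, s a square, therefore cannot be disjoint among p
  elements. This includes p = 2.\<close>

lemma sum_two_squares_minus_one:
  obtains a b where "a \<in> GF 1" "b \<in> GF 1" "a\<^sup>2 + b\<^sup>2 = (-1 :: 'b)"
proof -
  define S where "S = (\<lambda>a. a\<^sup>2) ` GF 1"
  have fin: "finite S" "finite (GF 1)" using finite_GF[of 1] by (auto simp: S_def)
  have sub: "S \<subseteq> GF 1" by (auto simp: S_def intro: GF_closed)
  have "p \<le> 2 * card S - 1 \<and> card S \<ge> 1"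
  proof -
    have fib: "card {a \<in> GF 1. a\<^sup>2 = s} \<le> (if s = 0 then 1 else 2)" if s: "s \<in> S" for s
    proof -
      obtain a where a: "s = a\<^sup>2" using s by (auto simp: S_def)
      have "{b \<in> GF 1. b\<^sup>2 = s} \<subseteq> {a, -a}" by (auto simp: a power2_eq_iff)
      hence "card {b \<in> GF 1. b\<^sup>2 = s} \<le> card {a, -a}" by (intro card_mono) auto
      also have "\<dots> \<le> (if s = 0 then 1 else 2)" by (auto simp: a card_insert_if)
      finally show ?thesis .
    qed
    have 0: "0 \<in> S" unfolding S_def by (rule image_eqI[of _ _ 0]) (auto intro: GF_closed)
    have "p = card (GF 1)" using card_GF[of 1] by simp
    also have "\<dots> = (\<Sum>s\<in>S. card {a \<in> GF 1. a\<^sup>2 = s})"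
      unfolding S_def using sum.image_gen[OF fin(2), of "\<lambda>_. 1::nat" "\<lambda>a. a\<^sup>2"] by simp
    also have "\<dots> \<le> (\<Sum>s\<in>S. if s = 0 then 1 else 2)" by (intro sum_mono fib)
    also have "\<dots> = 1 + (\<Sum>s\<in>S - {0}. 2)"
      using 0 fin by (subst sum.remove[of _ 0]) auto
    also have "\<dots> = 1 + 2 * (card S - 1)" using 0 fin by simp
    finally have "p \<le> 1 + 2 * (card S - 1)" .
    moreover have "card S \<ge> 1" using 0 fin by (metis One_nat_def Suc_leI card_gt_0_iff empty_iff)
    ultimately show ?thesis by simp
  qed
  define S' where "S' = (\<lambda>s. -1 - s) ` S"
  have "card S' = card S" unfolding S'_def by (intro card_image) (auto simp: inj_on_def)
  moreover have "S' \<subseteq> GF 1" using sub by (auto simp: S'_def intro!: GF_closed)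
  ultimately have "S \<inter> S' \<noteq> {}"
    using fin sub \<open>p \<le> 2 * card S - 1 \<and> card S \<ge> 1\<close> card_Un_disjoint[of S S'] card_mono[of "GF 1" "S \<union> S'"]
      card_GF[of 1] by (auto simp: S'_def)
  then obtain a b where "a \<in> GF 1" "b \<in> GF 1" "a\<^sup>2 = -1 - b\<^sup>2" by (auto simp: S_def S'_def)
  thus ?thesis using that[of a b] by simp
qed

end

section \<open>The L-function of an additive character sum\<close>

text \<open>Over an algebraically closed field multisets stand for monic polynomials, that is, for
  effective divisors on the affine line.\<close>

definition prodX :: "'b::alg_closed_field multiset \<Rightarrow> 'b poly" where
  "prodX N = (\<Prod>x\<in>#N. [:-x, 1:])"

lemma prodX_empty [simp]: "prodX {#} = 1" by (simp add: prodX_def)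

lemma prodX_add [simp]: "prodX (add_mset x N) = [:-x, 1:] * prodX N"
  by (simp only: prodX_def image_mset_add_mset prod_mset.add_mset)

lemma prodX_nz [simp]: "prodX N \<noteq> 0"
  by (induction N) (auto simp del: mult_pCons_left)

lemma degree_prodX [simp]: "Polynomial.degree (prodX N) = size N"
proof (induction N)
  case (add x N)
  have "Polynomial.degree ([:-x,1:] * prodX N) = Polynomial.degree [:-x,1:] + Polynomial.degree (prodX N)"
    by (rule Polynomial.degree_mult_eq) auto
  thus ?case using add by (simp del: mult_pCons_left)
qed simp

lemma lead_coeff_prodX: "Polynomial.coeff (prodX N) (size N) = 1"
proof -
  have "Polynomial.lead_coeff (prodX N) = 1"
    by (induction N) (simp_all add: Polynomial.lead_coeff_mult del: mult_pCons_left degree_prodX)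
  thus ?thesis by simp
qed

lemma proots_prodX [simp]: "proots (prodX N) = N"
  by (induction N) (simp_all add: proots_mult del: mult_pCons_left)

lemma prodX_inj: "prodX M = prodX N \<Longrightarrow> M = N" by (metis proots_prodX)

lemma ex_prodX:
  assumes "Polynomial.lead_coeff P = 1"
  shows "\<exists>N. prodX N = P"
proof -
  have "P \<noteq> 0" using assms by auto
  from alg_closed_imp_factorization[OF this] show ?thesis using assms unfolding prodX_def by auto
qed

text \<open>Adds \<open>t\<close> to the coefficient that is, up to sign, the d-th elementary
  symmetric function of the roots. This coefficient exists only for d at most \<open>size N\<close>,
  whence the condition \<open>t = 0 \<or> d \<le> size N\<close> in the lemmas below.\<close>

definition shift_roots :: "nat \<Rightarrow> 'b::alg_closed_field \<Rightarrow> 'b multiset \<Rightarrow> 'b multiset" where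
  "shift_roots d t N = proots (prodX N + Polynomial.monom t (size N - d))"

lemma prodX_shift:
  assumes "t = 0 \<or> d \<le> size N" "d \<ge> 1"
  shows "prodX (shift_roots d t N) = prodX N + Polynomial.monom t (size N - d)"
    "size (shift_roots d t N) = size N"
proof -
  let ?P = "prodX N + Polynomial.monom t (size N - d)"
  have c: "Polynomial.coeff ?P (size N) = 1" using assms lead_coeff_prodX[of N] by auto
  have "Polynomial.degree ?P \<le> size N"
    by (intro Polynomial.degree_add_le order.trans[OF degree_monom_le]) auto
  moreover have "Polynomial.degree ?P \<ge> size N" by (rule le_degree) (use c in simp)
  ultimately have dP: "Polynomial.degree ?P = size N" by simp
  then obtain K where K: "prodX K = ?P" using ex_prodX[of ?P] c by auto
  have "shift_roots d t N = K" unfolding shift_roots_def K[symmetric] by simp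
  thus "prodX (shift_roots d t N) = ?P" using K by simp
  thus "size (shift_roots d t N) = size N" using dP degree_prodX by metis
qed

lemma shift_roots_0 [simp]: "shift_roots d 0 N = N"
  by (simp add: shift_roots_def)

lemma shift_roots_inj:
  assumes "shift_roots d t M = shift_roots d t N" "size M = size N" "t = 0 \<or> d \<le> size N" "d \<ge> 1"
  shows "M = N"
  using prodX_shift[of t d M] prodX_shift[of t d N] assms by (auto intro: prodX_inj)

text \<open>The product of the factors 1 - x T over the roots x.\<close>

definition recipX :: "'b::alg_closed_field multiset \<Rightarrow> 'b fps" where
  "recipX N = fps_of_poly (reflect_poly (prodX N))"

definition psum :: "'b::alg_closed_field multiset \<Rightarrow> 'b fps" where
  "psum N = Abs_fps (\<lambda>i. if i = 0 then 0 else (\<Sum>x\<in>#N. x ^ i))"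

lemma recipX_add: "recipX (add_mset x N) = (1 - fps_const x * fps_X) * recipX N"
proof -
  have "reflect_poly [:-x,1:] = [:1,-x:]"
    by (rule poly_eqI) (auto simp: coeff_reflect_poly coeff_pCons split: nat.splits)
  hence "fps_of_poly (reflect_poly [:-x,1:]) = 1 - fps_const x * fps_X"
    by (simp add: fps_of_poly_linear' flip: fps_const_neg)
  thus ?thesis
    by (simp add: recipX_def reflect_poly_mult fps_of_poly_mult del: mult_pCons_left)
qed

text \<open>Each factor 1 - x T contributes the series x T + x^2 T^2 + ... to the negative of T
  times the logarithmic derivative.\<close>

lemma newton_girard: "fps_X * fps_deriv (recipX N) = - (recipX N * psum N)"
proof (induction N)
  case empty
  show ?case by (simp add: recipX_def psum_def fps_eq_iff)
next
  case (add x N)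
  define g where "g = Abs_fps (\<lambda>i. if i = 0 then 0 else x ^ i)"
  have g: "(1 - fps_const x * fps_X) * g = fps_const x * fps_X"
  proof (rule fps_ext)
    fix n
    have "(1 - fps_const x * fps_X) * g = g - fps_const x * (fps_X * g)" by (simp add: algebra_simps)
    thus "fps_nth ((1 - fps_const x * fps_X) * g) n = fps_nth (fps_const x * fps_X) n"
      by (cases n; cases "n - 1") (simp_all add: g_def fps_X_nth)
  qed
  have p: "psum (add_mset x N) = g + psum N" by (rule fps_ext) (simp add: psum_def g_def)
  have "fps_X * fps_deriv (recipX (add_mset x N)) =
     - (fps_const x * fps_X * recipX N) + (1 - fps_const x * fps_X) * (fps_X * fps_deriv (recipX N))"
    by (simp add: recipX_add algebra_simps)
  also have "\<dots> = - ((1 - fps_const x * fps_X) * g * recipX N) - (1 - fps_const x * fps_X) * (recipX N * psum N)"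
    unfolding g add.IH by simp
  also have "\<dots> = - (recipX (add_mset x N) * psum (add_mset x N))"
    unfolding p recipX_add by (simp add: algebra_simps)
  finally show ?case .
qed

lemma recipX_nth0: "fps_nth (recipX N) 0 = 1"
  using lead_coeff_prodX[of N] by (simp add: recipX_def)

text \<open>The reciprocal polynomial changes by t T^d only, so T times its logarithmic derivative
  changes by d t T^d up to higher order. The factor d, which is 0 in characteristic p exactly when p
  divides d, enters here.\<close>

lemma power_sums_shift:
  assumes eq: "prodX N' = prodX N + Polynomial.monom t (size N - d)" and sz: "size N' = size N"
    and d: "1 \<le> d" "d \<le> size N"
  shows "i < d \<Longrightarrow> (\<Sum>x\<in>#N'. x ^ i) = (\<Sum>x\<in>#N. x ^ i)"
    "(\<Sum>x\<in>#N'. x ^ d) = (\<Sum>x\<in>#N. x ^ d) - of_nat d * t"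
proof -
  have H: "recipX N' = recipX N + fps_const t * fps_X ^ d"
  proof (rule fps_ext)
    fix n
    have "Polynomial.coeff (prodX N') (size N - n) = Polynomial.coeff (prodX N) (size N - n)
      + (if size N - d = size N - n then t else 0)" unfolding eq by simp
    thus "fps_nth (recipX N') n = fps_nth (recipX N + fps_const t * fps_X ^ d) n"
      using d sz by (auto simp: recipX_def coeff_reflect_poly)
  qed
  have XD: "fps_X * fps_deriv (fps_X ^ d :: 'a fps) = of_nat d * fps_X ^ d"
    by (induction d) (auto simp: algebra_simps)
  have "recipX N' * psum N' = recipX N * psum N - fps_const (of_nat d * t) * fps_X ^ d"
  proof -
    have "- (recipX N' * psum N') = fps_X * fps_deriv (recipX N')" by (simp only: newton_girard)
    also have "\<dots> = fps_X * fps_deriv (recipX N) + fps_const t * (fps_X * fps_deriv (fps_X ^ d))"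
      unfolding H by (simp add: algebra_simps)
    also have "\<dots> = - (recipX N * psum N) + fps_const (of_nat d * t) * fps_X ^ d"
      unfolding newton_girard XD by (simp add: fps_of_nat[symmetric] algebra_simps flip: fps_const_mult)
    finally show ?thesis by (simp add: algebra_simps)
  qed
  hence "recipX N * (psum N' - psum N) = fps_X ^ d * (- fps_const (of_nat d * t) - fps_const t * psum N')"
    unfolding H by (simp add: algebra_simps del: fps_const_neg)
  moreover have "inverse (recipX N) * recipX N = 1"
    using inverse_mult_eq_1[of "recipX N"] recipX_nth0[of N] by simp
  ultimately have D: "psum N' - psum N = fps_X ^ d * ((- fps_const (of_nat d * t) - fps_const t * psum N') * inverse (recipX N))"
    by (metis (no_types, lifting) mult.assoc mult.commute mult_1)
  show "(\<Sum>x\<in>#N'. x ^ i) = (\<Sum>x\<in>#N. x ^ i)" if "i < d"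
  proof (cases "i = 0")
    case False
    have "fps_nth (psum N' - psum N) i = 0" using that unfolding D by (simp add: fps_X_power_mult_nth)
    thus ?thesis using False by (simp add: psum_def)
  qed (use sz in simp)
  have "fps_nth (psum N' - psum N) d = - (of_nat d * t)"
    unfolding D by (simp add: fps_X_power_mult_nth recipX_nth0 psum_def)
  thus "(\<Sum>x\<in>#N'. x ^ d) = (\<Sum>x\<in>#N. x ^ d) - of_nat d * t"
    using d by (simp add: psum_def algebra_simps)
qed

lemma sum_poly_shift:
  assumes "1 \<le> d" "t = 0 \<or> d \<le> size N" and d: "d = Polynomial.degree f"
  shows "(\<Sum>x\<in>#shift_roots d t N. poly f x) =
    (\<Sum>x\<in>#N. poly f x) - Polynomial.lead_coeff f * of_nat d * t"
proof (cases "t = 0")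
  case False
  hence "d \<le> size N" using assms by simp
  note ps = power_sums_shift[OF prodX_shift[OF assms(2,1)] assms(1) this]
  have ex: "(\<Sum>x\<in>#M. poly f x) = (\<Sum>i<d. Polynomial.coeff f i * (\<Sum>x\<in>#M. x ^ i))
      + Polynomial.coeff f d * (\<Sum>x\<in>#M. x ^ d)" for M
  proof -
    have "(\<Sum>x\<in>#M. poly f x) = (\<Sum>i\<le>d. Polynomial.coeff f i * (\<Sum>x\<in>#M. x ^ i))"
      by (induction M) (simp_all add: poly_altdef d sum.distrib ring_distribs)
    thus ?thesis by (simp flip: lessThan_Suc_atMost)
  qed
  show ?thesis unfolding ex ps(2) by (simp add: ps(1) ring_distribs mult.assoc flip: d)
qed simp

text \<open>A multiset of pairs amounts to a family of multisets indexed by the first component,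
  hence to a family of monic polynomials; \<open>part\<close> and \<open>join\<close> pass between
  the two views.\<close>

definition part :: "'c \<Rightarrow> ('c \<times> 'b) multiset \<Rightarrow> 'b multiset" where
  "part c M = image_mset snd (filter_mset (\<lambda>z. fst z = c) M)"

definition join :: "'c set \<Rightarrow> ('c \<Rightarrow> 'b multiset) \<Rightarrow> ('c \<times> 'b) multiset" where
  "join C N = (\<Sum>c\<in>C. image_mset (Pair c) (N c))"

lemma part_simps [simp]:
  "part c {#} = {#}"
  "part c (add_mset z M) = (if fst z = c then add_mset (snd z) (part c M) else part c M)"
  "part c (M + N) = part c M + part c N"
  by (auto simp: part_def)

lemma part_Pair [simp]: "part c (image_mset (Pair c') N) = (if c = c' then N else {#})"
  by (induction N) auto

lemma image_mset_Sum: "image_mset g (\<Sum>i\<in>I. M i) = (\<Sum>i\<in>I. image_mset g (M i))"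
  by (induction I rule: infinite_finite_induct) auto

lemma part_sum: "part c (\<Sum>i\<in>I. M i) = (\<Sum>i\<in>I. part c (M i))"
  by (induction I rule: infinite_finite_induct) auto

lemma part_join: "finite C \<Longrightarrow> part c (join C N) = (if c \<in> C then N c else {#})"
  by (simp add: join_def part_sum)

lemma join_part:
  assumes "finite C" "fst ` set_mset M \<subseteq> C" shows "join C (\<lambda>c. part c M) = M"
  using assms(2)
proof (induction M)
  case (add z M)
  have "join C (\<lambda>c. part c (add_mset z M)) =
      (\<Sum>c\<in>C. image_mset (Pair c) (part c M) + (if c = fst z then {#z#} else {#}))"
    unfolding join_def by (intro sum.cong) auto
  also have "\<dots> = M + {#z#}" using add assms(1) by (simp add: sum.distrib join_def)
  finally show ?case by simp
qed (simp add: join_def)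

lemma set_join: "finite C \<Longrightarrow> set_mset (join C N) = (SIGMA c:C. set_mset (N c))"
  unfolding join_def by (subst set_mset_sum) auto

lemma sum_join: "finite C \<Longrightarrow> (\<Sum>z\<in>#join C N. g z) = (\<Sum>c\<in>C. \<Sum>x\<in>#N c. g (c, x))"
  for g :: "_ \<Rightarrow> 'd::comm_monoid_add"
  unfolding join_def
  by (induction C rule: infinite_finite_induct) (auto simp: image_mset.compositionality comp_def)

lemma size_join: "finite C \<Longrightarrow> size (join C N) = (\<Sum>c\<in>C. size (N c))"
  unfolding join_def by (induction C rule: infinite_finite_induct) auto

text \<open>The base field is \<open>GF b\<close>, and \<open>C\<close> is a Frobenius-stable set of
  character parameters. Its elements need not lie in \<open>GF b\<close>, so Frobenius acts on both
  components of a pair (c, x).\<close>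

locale AS_sums = alg_closed_char p ty for p and ty :: "'b::alg_closed_field itself" +
  fixes b :: nat and f :: "'b poly" and C :: "'b set"
  assumes b: "b \<ge> 1" and f_coeff: "Polynomial.coeff f i \<in> GF b"
    and deg_pos: "Polynomial.degree f \<ge> 1" and deg_p: "\<not> p dvd Polynomial.degree f"
    and finC: "finite C" and C0: "0 \<notin> C" and C_frob: "c \<in> C \<Longrightarrow> c ^ (p ^ b) \<in> C"
begin

abbreviation F :: "'b \<Rightarrow> 'b" where "F x \<equiv> x ^ (p ^ b)"

definition frob :: "'b \<times> 'b \<Rightarrow> 'b \<times> 'b" where "frob = (\<lambda>(c, x). (F c, F x))"

definition val :: "'b \<times> 'b \<Rightarrow> 'b" where "val = (\<lambda>(c, x). c * poly f x)"

text \<open>On a Frobenius-stable multiset the sum of the values lies in \<open>GF b\<close>, so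
  that \<open>T b\<close> is a trace to the prime field and \<open>chi\<close> is
  multiplicative.\<close>

definition wt :: "('b \<times> 'b) multiset \<Rightarrow> complex" where
  "wt M = chi (T b (\<Sum>z\<in>#M. val z))"

lemma bn_pos: "1 \<le> n \<Longrightarrow> 1 \<le> b * n" using mult_le_mono[OF b, of 1 n] by simp

lemma poly_frob: "poly f x ^ (p ^ (b * i)) = poly f (x ^ (p ^ (b * i)))"
proof -
  have "Polynomial.coeff f j ^ (p ^ (b * i)) = Polynomial.coeff f j" for j
    using GF_mult[OF f_coeff, of j i] by (simp add: GF_def)
  thus ?thesis unfolding poly_altdef frob_sum
    by (intro sum.cong refl) (simp add: power_mult_distrib mult.commute flip: power_mult)
qed

lemma val_frob: "val (frob z) = F (val z)"
  using poly_frob[of "snd z" 1] by (cases z) (simp add: val_def frob_def power_mult_distrib)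

lemma frob_funpow: "(frob ^^ n) (c, x) = (c ^ (p ^ (b * n)), x ^ (p ^ (b * n)))"
proof (induction n)
  case (Suc n)
  show ?case using Suc frob_pow_add[of c "b * n" b] frob_pow_add[of x "b * n" b]
    by (simp add: frob_def add.commute)
qed simp

lemma val_funpow: "val ((frob ^^ n) z) = val z ^ (p ^ (b * n))"
proof (induction n)
  case (Suc n)
  thus ?case using frob_pow_add[of "val z" "b * n" b] by (simp add: val_frob add.commute)
qed simp

lemma frob_sum_mset: "(\<Sum>z\<in>#M. g z :: 'b) ^ (p ^ i) = (\<Sum>z\<in>#M. g z ^ (p ^ i))"
  by (induction M) (auto simp: frob_add)

lemma val_stable:
  assumes "image_mset frob M = M" shows "(\<Sum>z\<in>#M. val z) \<in> GF b"
proof -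
  have "F (\<Sum>z\<in>#M. val z) = (\<Sum>z\<in>#image_mset frob M. val z)"
    by (simp add: frob_sum_mset val_frob image_mset.compositionality comp_def)
  thus ?thesis using assms by (simp add: GF_def)
qed

lemma Fix_eq: "n \<ge> 1 \<Longrightarrow> {z \<in> C \<times> UNIV. (frob ^^ n) z = z} = (C \<inter> GF (b * n)) \<times> GF (b * n)"
  by (auto simp: frob_funpow GF_def)

sublocale EP: euler_product "C \<times> UNIV" frob wt
proof
  fix n :: nat assume "n \<ge> 1"
  thus "finite {z \<in> C \<times> UNIV. (frob ^^ n) z = z}"
    unfolding Fix_eq[OF \<open>n \<ge> 1\<close>] using finC bn_pos[OF \<open>n \<ge> 1\<close>] by (intro finite_cartesian_product finite_GF finite_Int) auto
next
  fix M N assume "image_mset frob M = M" "image_mset frob N = N"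
  thus "wt (M + N) = wt M * wt N" using chi_T_hom val_stable by (simp add: wt_def)
qed (auto simp: frob_def wt_def frob_inj C_frob)

text \<open>The trace from \<open>GF b\<close> of a sum along an orbit of length n is the trace from
  \<open>GF (b * n)\<close> of a single value.\<close>

lemma EP_S:
  assumes "n \<ge> 1"
  shows "EP.S n = (\<Sum>c\<in>C \<inter> GF (b * n). \<Sum>x\<in>GF (b * n). chi (T (b * n) (c * poly f x)))"
proof -
  have "wt (EP.orb z n) = chi (T (b * n) (val z))" for z
    unfolding wt_def EP.orb_def T_tower
    by (simp add: image_mset.compositionality comp_def val_funpow sum_unfold_sum_mset)
  thus ?thesis
    unfolding EP.S_def EP.Fix_def Fix_eq[OF assms]
    by (simp add: sum.cartesian_product val_def case_prod_unfold)
qed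

lemma part_frob: "part (F c) (image_mset frob M) = image_mset F (part c M)"
  by (induction M) (auto simp: frob_def frob_inj)

lemma part_stable: "image_mset frob M = M \<Longrightarrow> part (F c) M = image_mset F (part c M)"
  using part_frob by metis

lemma part_size_funpow:
  assumes "image_mset frob M = M" shows "size (part (c ^ (p ^ (b * i))) M) = size (part c M)"
proof (induction i)
  case (Suc i)
  have "c ^ (p ^ (b * Suc i)) = F (c ^ (p ^ (b * i)))" using frob_pow_add[of c "b * i" b] by (simp add: add.commute)
  thus ?case using Suc part_stable[OF assms, of "c ^ (p ^ (b * i))"] by simp
qed simp

lemma map_poly_frob_mult: "map_poly F (P * Q) = map_poly F P * map_poly F Q"
  by (rule poly_eqI) (simp add: coeff_map_poly Polynomial.coeff_mult frob_sum power_mult_distrib)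

lemma map_poly_frob_add: "map_poly F (P + Q) = map_poly F P + map_poly F Q"
  by (rule poly_eqI) (simp add: coeff_map_poly frob_add)

lemma map_poly_frob_prodX: "map_poly F (prodX N) = prodX (image_mset F N)"
proof (induction N)
  case (add x N)
  have "map_poly F [:-x,1:] = [:- F x, 1:]" by (simp add: map_poly_pCons frob_uminus)
  thus ?case using add by (simp add: map_poly_frob_mult del: mult_pCons_left)
qed simp

lemma shift_frob:
  assumes "t = 0 \<or> d \<le> size N" "d \<ge> 1"
  shows "shift_roots d (F t) (image_mset F N) = image_mset F (shift_roots d t N)"
proof (rule prodX_inj)
  have "F t = 0 \<or> d \<le> size (image_mset F N)" using assms by auto
  hence "prodX (shift_roots d (F t) (image_mset F N)) = prodX (image_mset F N) + Polynomial.monom (F t) (size N - d)"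
    using prodX_shift[of "F t" d "image_mset F N"] assms by simp
  also have "\<dots> = map_poly F (prodX (shift_roots d t N))"
    unfolding prodX_shift(1)[OF assms] map_poly_frob_add map_poly_frob_prodX
    by (simp add: map_poly_monom)
  finally show "prodX (shift_roots d (F t) (image_mset F N)) = prodX (image_mset F (shift_roots d t N))"
    by (simp add: map_poly_frob_prodX)
qed

lemma Div_fst: "M \<in> EP.Div n \<Longrightarrow> fst ` set_mset M \<subseteq> C"
  by (force simp: EP.Div_def)

lemma Div_join: "M \<in> EP.Div n \<Longrightarrow> join C (\<lambda>c. part c M) = M"
  by (rule join_part[OF finC Div_fst])

lemma Div_size: "M \<in> EP.Div n \<Longrightarrow> n = (\<Sum>c\<in>C. size (part c M))"
  using size_join[OF finC, of "\<lambda>c. part c M"] Div_join by (simp add: EP.Div_def)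

lemma bij_F_C: "bij_betw F C C"
  using finC C_frob frob_inj by (metis (no_types, lifting) bij_betw_def endo_inj_surj image_subset_iff inj_onI)

text \<open>
  The top power sum of the roots is affine-linear in one coefficient of the polynomial; moving that
  coefficient multiplies the weight by a nontrivial character value.
\<close>

lemma fibre_sum_zero:
  assumes c0: "c0 \<in> C" "v c0 \<ge> Polynomial.degree f"
  shows "(\<Sum>M | M \<in> EP.Div n \<and> (\<forall>c\<in>C. size (part c M) = v c). wt M) = 0"
proof -
  define d where "d = Polynomial.degree f"
  define D where "D = {M \<in> EP.Div n. \<forall>c\<in>C. size (part c M) = v c}"
  have d: "d \<ge> 1" using deg_pos by (simp add: d_def)
  have finD: "finite D" using EP.finite_Div by (simp add: D_def)
  show ?thesis
  proof (cases "D = {}")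
    case False
    then obtain M0 where M0: "M0 \<in> D" by blast
    hence "part c0 M0 \<noteq> {#}" using c0 d by (auto simp: D_def d_def)
    then obtain x0 where "(c0, x0) \<in># M0" by (auto simp: part_def multiset_eq_iff)
    then obtain m where m: "m \<ge> 1" "c0 \<in> GF (b * m)"
      using EP.Div_periodic[of M0 n "(c0,x0)"] M0 by (auto simp: D_def EP.Fix_def frob_funpow GF_def)
    \<comment> \<open>\<open>u * t\<close> is the change of the sum of \<open>f\<close> over the
      roots when \<open>t\<close> is added to the coefficient; it is nonzero for nonzero
      \<open>t\<close> because p does not divide d.\<close>
    define u where "u = - (Polynomial.lead_coeff f * of_nat d)"
    have u: "u \<in> GF b" "u \<noteq> 0" unfolding u_def d_def
      using f_coeff deg_p deg_pos of_nat_eq_0 by (auto intro!: GF_closed GF_of_nat)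
    have ubm: "u \<in> GF (b * m)" using u GF_mult by blast
    have "u * c0 \<noteq> 0" "u * c0 \<in> GF (b * m)" using u ubm m c0 C0 by (auto intro: GF_closed)
    moreover have "b * m \<ge> 1" using bn_pos m by simp
    ultimately obtain t0 where t0: "t0 \<in> GF (b * m)" "T (b * m) (u * c0 * t0) \<noteq> 0"
      using T_nontrivial by blast
    \<comment> \<open>A Galois-equivariant family of shifts supported on the orbit of
      \<open>c0\<close>: the conjugates of \<open>t0\<close> are distributed over those of
      \<open>c0\<close> and added up where the latter coincide. Equivariance keeps the shifted
      divisor Frobenius-stable.\<close>
    define t where "t c = (\<Sum>i<m. if c0 ^ (p ^ (b * i)) = c then t0 ^ (p ^ (b * i)) else 0)" for c
    have tF: "t (F c) = F (t c)" for c
    proof -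
      define G where "G i = (if c0 ^ (p ^ (b * i)) = F c then t0 ^ (p ^ (b * i)) else 0)" for i
      have Suc: "z ^ (p ^ (b + b * i)) = F (z ^ (p ^ (b * i)))" for z :: 'b and i
        using frob_pow_add[of z "b * i" b] by (simp add: add.commute)
      have "F (t c) = (\<Sum>i<m. F (if c0 ^ (p ^ (b * i)) = c then t0 ^ (p ^ (b * i)) else 0))"
        unfolding t_def frob_sum ..
      also have "\<dots> = (\<Sum>i<m. G (Suc i))"
        by (intro sum.cong refl) (auto simp: G_def Suc frob_inj)
      also have "\<dots> = (\<Sum>i<m. G i) + G m - G 0"
        using sum.lessThan_Suc_shift[of G m] by simp
      also have "G m = G 0" using m t0 by (simp add: G_def GF_def)
      finally show ?thesis by (simp add: t_def G_def)
    qed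
    have torb: "\<exists>i. c = c0 ^ (p ^ (b * i))" if "t c \<noteq> 0" for c
    proof (rule ccontr)
      assume "\<nexists>i. c = c0 ^ (p ^ (b * i))"
      hence "t c = 0" unfolding t_def by (intro sum.neutral) auto
      thus False using that by simp
    qed
    have c0C: "c0 ^ (p ^ (b * i)) \<in> C" for i
    proof (induction i)
      case (Suc i)
      thus ?case using C_frob[of "c0 ^ (p ^ (b * i))"] frob_pow_add[of c0 "b * i" b] by (simp add: add.commute)
    qed (use c0 in simp)
    \<comment> \<open>\<open>K\<close> is the total change of the sum of values under these shifts;
      by the choice of \<open>t0\<close> its trace is nonzero.\<close>
    define K where "K = (\<Sum>c\<in>C. c * (u * t c))"
    have "K = (\<Sum>i<m. \<Sum>c\<in>C. if c0 ^ (p ^ (b * i)) = c then c * (u * t0 ^ (p ^ (b * i))) else 0)"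
      unfolding K_def t_def sum_distrib_left by (subst sum.swap) (intro sum.cong refl, auto)
    also have "\<dots> = (\<Sum>i<m. c0 ^ (p ^ (b * i)) * (u * t0 ^ (p ^ (b * i))))"
      using finC c0C by simp
    also have "\<dots> = (\<Sum>i<m. (u * c0 * t0) ^ (p ^ (b * i)))"
    proof (intro sum.cong refl)
      fix i
      have "u ^ (p ^ (b * i)) = u" using GF_mult[OF u(1), of i] by (simp add: GF_def)
      thus "c0 ^ (p ^ (b * i)) * (u * t0 ^ (p ^ (b * i))) = (u * c0 * t0) ^ (p ^ (b * i))"
        by (simp add: power_mult_distrib)
    qed
    finally have TK: "T b K = T (b * m) (u * c0 * t0)" by (simp add: T_tower)
    have KGF: "K \<in> GF b"
    proof -
      have "F K = (\<Sum>c\<in>C. F c * (u * t (F c)))"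
        using u by (simp add: K_def frob_sum power_mult_distrib tF GF_def)
      also have "\<dots> = K" unfolding K_def using sum.reindex_bij_betw[OF bij_F_C, of "\<lambda>c. c * (u * t c)"] by simp
      finally show ?thesis by (simp add: GF_def)
    qed
    define \<Phi> where "\<Phi> M = join C (\<lambda>c. shift_roots d (t c) (part c M))" for M
    \<comment> \<open>A stable divisor has the same degree over all conjugates of \<open>c0\<close>,
      so the coefficient to be moved exists wherever the shift is nonzero.\<close>
    have big: "t c = 0 \<or> d \<le> size (part c M)" if "M \<in> D" "c \<in> C" for c M
    proof (cases "t c = 0")
      case False
      then obtain i where "c = c0 ^ (p ^ (b * i))" using torb by blast
      hence "size (part c M) = size (part c0 M)"
        using part_size_funpow[of M c0 i] that(1) by (simp add: D_def EP.Div_def)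
      thus ?thesis using that(1) c0 by (simp add: D_def d_def)
    qed simp
    have PhiD: "\<Phi> M \<in> D" if M: "M \<in> D" for M
    proof -
      have st: "image_mset frob M = M" using M by (auto simp: D_def EP.Div_def)
      have sz: "size (shift_roots d (t c) (part c M)) = v c" if "c \<in> C" for c
        using prodX_shift(2)[OF big[OF M that] d] M that by (simp add: D_def)
      have "image_mset frob (\<Phi> M) = (\<Sum>c\<in>C. image_mset (Pair (F c)) (image_mset F (shift_roots d (t c) (part c M))))"
        unfolding \<Phi>_def join_def
        unfolding image_mset_Sum by (simp add: image_mset.compositionality comp_def frob_def)
      also have "\<dots> = (\<Sum>c\<in>C. image_mset (Pair (F c)) (shift_roots d (t (F c)) (part (F c) M)))"
        using shift_frob[OF big[OF M] d] by (intro sum.cong refl) (simp add: tF part_stable[OF st])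
      also have "\<dots> = \<Phi> M" unfolding \<Phi>_def join_def
        by (rule sum.reindex_bij_betw[OF bij_F_C])
      finally have 1: "image_mset frob (\<Phi> M) = \<Phi> M" .
      have "size (\<Phi> M) = (\<Sum>c\<in>C. size (part c M))"
        unfolding \<Phi>_def size_join[OF finC] using sz M by (simp add: D_def)
      also have "\<dots> = n" using Div_size[of M n] M by (simp add: D_def)
      finally have "size (\<Phi> M) = n" .
      thus ?thesis using 1 sz by (auto simp: D_def EP.Div_def \<Phi>_def set_join[OF finC] part_join[OF finC])
    qed
    have Phiinj: "inj_on \<Phi> D"
    proof (rule inj_onI)
      fix M N assume MN: "M \<in> D" "N \<in> D" "\<Phi> M = \<Phi> N"
      have "part c M = part c N" if "c \<in> C" for c
      proof (rule shift_roots_inj[OF _ _ big[OF MN(2) that] d])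
        show "shift_roots d (t c) (part c M) = shift_roots d (t c) (part c N)"
          using arg_cong[OF MN(3), of "part c"] that by (simp add: \<Phi>_def part_join[OF finC])
      qed (use MN that in \<open>simp add: D_def\<close>)
      hence "join C (\<lambda>c. part c M) = join C (\<lambda>c. part c N)" by (simp add: join_def)
      thus "M = N" using Div_join[of M n] Div_join[of N n] MN by (simp add: D_def)
    qed
    have "\<Phi> ` D = D" using Phiinj PhiD finD by (intro endo_inj_surj) auto
    hence bij: "bij_betw \<Phi> D D" using Phiinj by (simp add: bij_betw_def)
    have w: "wt (\<Phi> M) = wt M * chi (T b K)" if M: "M \<in> D" for M
    proof -
      have "(\<Sum>z\<in>#\<Phi> M. val z) = (\<Sum>c\<in>C. c * (\<Sum>x\<in>#shift_roots d (t c) (part c M). poly f x))"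
        unfolding \<Phi>_def sum_join[OF finC] by (simp add: val_def sum_mset_distrib_left)
      also have "\<dots> = (\<Sum>c\<in>C. c * (\<Sum>x\<in>#part c M. poly f x) + c * (u * t c))"
      proof (intro sum.cong refl)
        fix c assume "c \<in> C"
        show "c * (\<Sum>x\<in>#shift_roots d (t c) (part c M). poly f x) = c * (\<Sum>x\<in>#part c M. poly f x) + c * (u * t c)"
          unfolding sum_poly_shift[OF d big[OF M \<open>c \<in> C\<close>] d_def] by (simp add: u_def algebra_simps)
      qed
      also have "\<dots> = (\<Sum>z\<in>#join C (\<lambda>c. part c M). val z) + K"
        unfolding sum_join[OF finC] by (simp add: val_def sum_mset_distrib_left sum.distrib K_def)
      also have "join C (\<lambda>c. part c M) = M" using Div_join[of M n] M by (simp add: D_def)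
      finally show ?thesis
        using chi_T_hom[OF val_stable[of M] KGF] M by (simp add: wt_def D_def EP.Div_def)
    qed
    have "(\<Sum>M\<in>D. wt M) = (\<Sum>M\<in>D. wt (\<Phi> M))" using sum.reindex_bij_betw[OF bij, of wt] by simp
    also have "\<dots> = (\<Sum>M\<in>D. wt M) * chi (T b K)" by (simp add: w sum_distrib_right)
    finally have "(\<Sum>M\<in>D. wt M) = 0 \<or> chi (T b K) = 1" by auto
    moreover have "chi (T b K) \<noteq> 1" using t0 TK T_in_GF1[OF KGF] by (intro chi_neq1) auto
    ultimately show ?thesis unfolding D_def[symmetric] by simp
  next
    case True
    show ?thesis unfolding D_def[symmetric] True by simp
  qed
qed

text \<open>Beyond this bound some fibre over C has degree at least deg f, and divisors grouped by
  their fibre degrees add up to zero. Only polynomiality is extracted here; the exact degree is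
  found later by comparing power sums.\<close>

lemma A_eventually_0:
  assumes "n > card C * Polynomial.degree f" shows "EP.A n = 0"
proof -
  define sz where "sz M = (\<lambda>c. if c \<in> C then size (part c M) else 0)" for M :: "('b \<times> 'b) multiset"
  have "EP.A n = (\<Sum>v\<in>sz ` EP.Div n. \<Sum>M | M \<in> EP.Div n \<and> sz M = v. wt M)"
    unfolding EP.A_def by (rule sum.image_gen[OF EP.finite_Div])
  also have "\<dots> = 0"
  proof (rule sum.neutral, rule ballI)
    fix v assume "v \<in> sz ` EP.Div n"
    then obtain M where M: "M \<in> EP.Div n" "v = sz M" by blast
    have "n = (\<Sum>c\<in>C. size (part c M))"
      using Div_size M by blast
    hence "\<exists>c\<in>C. size (part c M) \<ge> Polynomial.degree f"
      using assms sum_bounded_above[of C "\<lambda>c. size (part c M)" "Polynomial.degree f"]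
      by (metis less_imp_le not_le of_nat_id)
    then obtain c0 where "c0 \<in> C" "v c0 \<ge> Polynomial.degree f" using M by (auto simp: sz_def)
    moreover have "{M \<in> EP.Div n. sz M = v} = {M \<in> EP.Div n. \<forall>c\<in>C. size (part c M) = v c}"
      using M(2) by (auto simp: sz_def fun_eq_iff)
    ultimately show "(\<Sum>M | M \<in> EP.Div n \<and> sz M = v. wt M) = 0" using fibre_sum_zero by simp
  qed
  finally show ?thesis .
qed

end

section \<open>Quadratic character sums\<close>

text \<open>For a at most b the larger exponent is determined by p^b < p^a + p^b <= p^(b+1).\<close>

lemma prime_power_sum_unique:
  fixes p :: nat
  assumes p: "p \<ge> 2" and eq: "p ^ a + p ^ b = p ^ c + p ^ d"
  shows "(a = c \<and> b = d) \<or> (a = d \<and> b = c)"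
proof -
  have *: "b = d \<and> a = c" if "a \<le> b" "c \<le> d" "p ^ a + p ^ b = p ^ c + p ^ d" for a b c d
  proof -
    have bd: "p ^ y < p ^ x + p ^ y \<and> p ^ x + p ^ y \<le> p ^ Suc y" if "x \<le> y" for x y
    proof -
      have "p ^ x \<le> p ^ y" using that p by (intro power_increasing) auto
      moreover have "2 * p ^ y \<le> p * p ^ y" using p by (intro mult_right_mono) auto
      ultimately have "p ^ x + p ^ y \<le> p ^ Suc y" unfolding power_Suc by linarith
      thus ?thesis using p by simp
    qed
    have "p ^ b < p ^ Suc d" "p ^ d < p ^ Suc b"
      using bd[OF that(1)] bd[OF that(2)] that(3) by linarith+
    hence "b < Suc d" "d < Suc b" using p by (auto simp: power_strict_increasing_iff simp del: power_Suc)
    hence "b = d" by simp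
    thus ?thesis using that(3) p by (auto simp: power_inject_exp)
  qed
  show ?thesis using *[of a b c d] *[of b a c d] *[of a b d c] *[of b a d c] eq
    by (metis add.commute nle_le)
qed

lemma sum_swap4:
  "(\<Sum>x1\<in>A. \<Sum>x2\<in>A. \<Sum>y3\<in>A. \<Sum>y4\<in>A. g x1 x2 y3 y4) =
   (\<Sum>y3\<in>A. \<Sum>y4\<in>A. \<Sum>x1\<in>A. \<Sum>x2\<in>A. g x1 x2 y3 y4 :: 'c::comm_monoid_add)"
proof -
  have "(\<Sum>x1\<in>A. \<Sum>x2\<in>A. \<Sum>y3\<in>A. \<Sum>y4\<in>A. g x1 x2 y3 y4) = (\<Sum>x1\<in>A. \<Sum>y3\<in>A. \<Sum>y4\<in>A. \<Sum>x2\<in>A. g x1 x2 y3 y4)"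
    by (rule sum.cong[OF refl], subst sum.swap, rule sum.cong[OF refl], rule sum.swap)
  also have "\<dots> = (\<Sum>y3\<in>A. \<Sum>x1\<in>A. \<Sum>y4\<in>A. \<Sum>x2\<in>A. g x1 x2 y3 y4)" by (rule sum.swap)
  also have "\<dots> = (\<Sum>y3\<in>A. \<Sum>y4\<in>A. \<Sum>x1\<in>A. \<Sum>x2\<in>A. g x1 x2 y3 y4)"
    by (rule sum.cong[OF refl], rule sum.swap)
  finally show ?thesis .
qed

lemma sum_double_delta:
  fixes g :: "nat \<Rightarrow> nat \<Rightarrow> 'c::comm_monoid_add"
  assumes "i0 \<le> h" "j0 \<le> h" "\<And>i j. i \<le> h \<Longrightarrow> j \<le> h \<Longrightarrow> (i, j) \<noteq> (i0, j0) \<Longrightarrow> g i j = 0"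
  shows "(\<Sum>i\<le>h. \<Sum>j\<le>h. g i j) = g i0 j0"
proof -
  have "(\<Sum>i\<le>h. \<Sum>j\<le>h. g i j) = (\<Sum>(i,j)\<in>{..h}\<times>{..h}. g i j)" by (simp add: sum.cartesian_product)
  also have "\<dots> = (\<Sum>(i,j)\<in>{(i0,j0)}. g i j)"
    by (rule sum.mono_neutral_right) (use assms in auto)
  finally show ?thesis by simp
qed

context alg_closed_char
begin

text \<open>A power of Frobenius permutes the finite set, and a permutation of a finite set has
  finite order.\<close>

lemma finite_frob_stable_subset_GF:
  assumes "finite R" "\<And>z. z \<in> R \<Longrightarrow> z ^ (p ^ m) \<in> R" "m \<ge> 1"
  obtains N where "N \<ge> 1" "R \<subseteq> GF N"
proof -
  define \<pi> where "\<pi> z = (if z \<in> R then z ^ (p ^ m) else z)" for z :: 'b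
  have "bij_betw (\<lambda>z. z ^ (p ^ m)) R R"
    using assms frob_inj by (metis (no_types, lifting) bij_betw_def endo_inj_surj image_subset_iff inj_onI)
  hence "bij_betw \<pi> R R" by (rule bij_betw_cong[THEN iffD1, rotated]) (simp add: \<pi>_def)
  hence "\<pi> permutes R" by (intro bij_imp_permutes) (auto simp: \<pi>_def)
  hence "permutation \<pi>" using assms(1) by (auto simp: permutation_permutes)
  then obtain n where n: "\<pi> ^^ n = id" "n > 0" using permutation_is_nilpotent by blast
  have fp: "z \<in> R \<Longrightarrow> (\<pi> ^^ k) z = z ^ (p ^ (m * k)) \<and> z ^ (p ^ (m * k)) \<in> R" for z k
  proof (induction k)
    case (Suc k)
    thus ?case using frob_pow_add[of z "m * k" m] assms(2)[of "z ^ (p ^ (m * k))"]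
      by (simp add: \<pi>_def add.commute)
  qed simp
  have "z \<in> GF (m * n)" if "z \<in> R" for z using fp[OF that, of n] n by (simp add: GF_def)
  moreover have "m * n \<ge> 1" using n assms(3) by (metis One_nat_def Suc_leI mult_is_0 neq0_conv not_one_le_zero)
  ultimately show ?thesis using that[of "m * n"] by blast
qed

text \<open>
  Since \<open>-1 = a\<^sup>2 + b\<^sup>2\<close>, the sum of four copies of a quadratic form over the prime field vanishes
  on the subspace \<open>(x\<^sub>1, x\<^sub>2, a x\<^sub>1 + b x\<^sub>2, b x\<^sub>1 - a x\<^sub>2)\<close>, half the dimension of the whole space.
\<close>

lemma quadratic_sum_power4:
  fixes Q :: "'b \<Rightarrow> 'b" and n :: nat
  defines "B \<equiv> \<lambda>x z. Q (x + z) - Q x - Q z"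
  defines "W \<equiv> {z \<in> GF n. \<forall>x\<in>GF n. B x z = 0}"
  assumes n: "n \<ge> 1"
    and Q_in: "\<And>x. x \<in> GF n \<Longrightarrow> Q x \<in> GF 1"
    and Q_scale: "\<And>a x. a \<in> GF 1 \<Longrightarrow> x \<in> GF n \<Longrightarrow> Q (a * x) = a\<^sup>2 * Q x"
    and B_add: "\<And>x y z. x \<in> GF n \<Longrightarrow> y \<in> GF n \<Longrightarrow> z \<in> GF n \<Longrightarrow> B (x + y) z = B x z + B y z"
    and B_scale: "\<And>a x z. a \<in> GF 1 \<Longrightarrow> x \<in> GF n \<Longrightarrow> z \<in> GF n \<Longrightarrow> B (a * x) z = a * B x z"
    and Q_W: "\<And>x. x \<in> W \<Longrightarrow> Q x = 0"
  shows "(\<Sum>x\<in>GF n. chi (Q x)) ^ 4 = of_nat (card (GF n) ^ 2 * card W ^ 2)"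
proof -
  obtain a b where ab: "a \<in> GF 1" "b \<in> GF 1" "a\<^sup>2 + b\<^sup>2 = (-1 :: 'b)"
    using sum_two_squares_minus_one by blast
  let ?V = "GF n"
  have finV: "finite ?V" using finite_GF n by simp
  have abn: "a \<in> ?V" "b \<in> ?V" using ab GF_dvd[of 1 n] by auto
  have B_sym: "B x z = B z x" for x z by (simp add: B_def add.commute)
  have B_add': "B x (y + z) = B x y + B x z" if "x \<in> ?V" "y \<in> ?V" "z \<in> ?V" for x y z
    using B_add[of y z x] that B_sym by simp
  have B_scale': "B x (c * z) = c * B x z" if "c \<in> GF 1" "x \<in> ?V" "z \<in> ?V" for c x z
    using B_scale[of c z x] that B_sym by simp
  have B_minus: "B x (- z) = - B x z" if "x \<in> ?V" "z \<in> ?V" for x z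
    using B_scale'[of "-1" x z] that by (simp add: GF_closed)
  have B_in: "B x z \<in> GF 1" if "x \<in> ?V" "z \<in> ?V" for x z
    unfolding B_def using that by (intro GF_closed Q_in)
  have QB: "Q (x + z) = Q x + Q z + B x z" for x z by (simp add: B_def)
  have Q_minus: "Q (- z) = Q z" if "z \<in> ?V" for z using Q_scale[of "-1" z] that by (simp add: GF_closed)
  \<comment> \<open>The squares in x1, x2 carry the factor 1 + a^2 + b^2 = 0 and the two mixed terms
    cancel; for fixed y3, y4 the form becomes linear in x1 and x2.\<close>
  have iso: "Q x1 + Q x2 + Q (a * x1 + b * x2 + y3) + Q (b * x1 - a * x2 + y4) =
      Q y3 + Q y4 + (B x1 (a * y3 + b * y4) + B x2 (b * y3 - a * y4))"
    if V: "x1 \<in> ?V" "x2 \<in> ?V" "y3 \<in> ?V" "y4 \<in> ?V" for x1 x2 y3 y4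
  proof -
    note cl = V abn
    have lc: "Q (u * x1 + v * x2 + w) = u\<^sup>2 * Q x1 + v\<^sup>2 * Q x2 + u * v * B x1 x2 + Q w + u * B x1 w + v * B x2 w"
      if "u \<in> GF 1" "v \<in> GF 1" "w \<in> ?V" for u v w
    proof -
      have "u \<in> ?V" "v \<in> ?V" using that GF_dvd[of 1 n] by auto
      thus ?thesis using that cl by (simp add: QB B_add B_scale B_scale' Q_scale GF_closed)
    qed
    have 1: "Q (a * x1 + b * x2 + y3) = a\<^sup>2 * Q x1 + b\<^sup>2 * Q x2 + a * b * B x1 x2 + Q y3 + a * B x1 y3 + b * B x2 y3"
      by (rule lc) (use ab V in auto)
    have 2: "Q (b * x1 - a * x2 + y4) = b\<^sup>2 * Q x1 + a\<^sup>2 * Q x2 - a * b * B x1 x2 + Q y4 + b * B x1 y4 - a * B x2 y4"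
      using lc[of b "- a" y4] ab V by (simp add: GF_closed mult.commute)
    have 3: "B x1 (a * y3 + b * y4) = a * B x1 y3 + b * B x1 y4"
      using cl ab by (simp add: B_add' B_scale' GF_closed)
    have lb: "B x2 (u * y3 + v * y4) = u * B x2 y3 + v * B x2 y4" if "u \<in> GF 1" "v \<in> GF 1" for u v
    proof -
      have "u \<in> ?V" "v \<in> ?V" using that GF_dvd[of 1 n] by auto
      thus ?thesis using cl that by (simp add: B_add' B_scale' GF_closed)
    qed
    have 4: "B x2 (b * y3 - a * y4) = b * B x2 y3 - a * B x2 y4"
      using lb[of b "- a"] ab by (simp add: GF_closed)
    have "Q x1 + Q x2 + (a\<^sup>2 * Q x1 + b\<^sup>2 * Q x2) + (b\<^sup>2 * Q x1 + a\<^sup>2 * Q x2) = (1 + (a\<^sup>2 + b\<^sup>2)) * (Q x1 + Q x2)"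
      by (simp add: algebra_simps)
    also have "\<dots> = 0" using ab by simp
    finally show ?thesis unfolding 1 2 3 4 by (simp add: algebra_simps)
  qed
  have chi2: "chi (s + t + (v + w)) = chi s * chi t * (chi v * chi w)"
    if "s \<in> GF 1" "t \<in> GF 1" "v \<in> GF 1" "w \<in> GF 1" for s t v w
    using that by (simp add: chi_add GF_closed)
  have lin: "(\<Sum>x\<in>?V. chi (B x z)) = (if z \<in> W then of_nat (card ?V) else 0)" if z: "z \<in> ?V" for z
  proof (cases "z \<in> W")
    case False
    then obtain t where t: "t \<in> ?V" "B t z \<noteq> 0" using z by (auto simp: W_def)
    hence "chi (B t z) \<noteq> 1" using z by (intro chi_neq1 B_in)
    hence "(\<Sum>x\<in>?V. chi (B x z)) = 0"
      using t z by (intro sum_nontrivial_hom_eq_0[of t]) (auto simp: B_add chi_add B_in intro: GF_closed)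
    thus ?thesis using False by simp
  qed (simp add: W_def)
  \<comment> \<open>The matrix with rows (a, b) and (b, -a) has square -1, so it is invertible and
    maps pairs from the radical onto such pairs.\<close>
  have W_iff: "a * y3 + b * y4 \<in> W \<and> b * y3 - a * y4 \<in> W \<longleftrightarrow> y3 \<in> W \<and> y4 \<in> W"
    if V: "y3 \<in> ?V" "y4 \<in> ?V" for y3 y4
  proof -
    have W_add: "u \<in> W \<Longrightarrow> v \<in> W \<Longrightarrow> u + v \<in> W" for u v
      unfolding W_def by (auto simp: B_add' intro: GF_closed)
    have W_scale: "c \<in> GF 1 \<Longrightarrow> u \<in> W \<Longrightarrow> c * u \<in> W" for c u
      unfolding W_def using GF_dvd[of 1 n] by (auto simp: B_scale' intro: GF_closed)
    have W_minus: "u \<in> W \<Longrightarrow> - u \<in> W" for u using W_scale[of "-1" u] by (simp add: GF_closed)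
    show ?thesis
    proof
      assume A: "a * y3 + b * y4 \<in> W \<and> b * y3 - a * y4 \<in> W"
      have "a * (a * y3 + b * y4) + b * (b * y3 - a * y4) = (a\<^sup>2 + b\<^sup>2) * y3"
        by (simp add: algebra_simps power2_eq_square)
      moreover have "b * (a * y3 + b * y4) + - (a * (b * y3 - a * y4)) = (a\<^sup>2 + b\<^sup>2) * y4"
        by (simp add: algebra_simps power2_eq_square)
      ultimately have "- y3 = a * (a * y3 + b * y4) + b * (b * y3 - a * y4)"
         "- y4 = b * (a * y3 + b * y4) + - (a * (b * y3 - a * y4))" using ab by simp_all
      hence "- y3 \<in> W" "- y4 \<in> W" using A ab W_add W_scale W_minus by metis+
      thus "y3 \<in> W \<and> y4 \<in> W" using W_minus by fastforce
    next
      assume "y3 \<in> W \<and> y4 \<in> W"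
      moreover have "b * y3 - a * y4 = b * y3 + - (a * y4)" by simp
      ultimately show "a * y3 + b * y4 \<in> W \<and> b * y3 - a * y4 \<in> W"
        using W_add W_scale W_minus ab by metis
    qed
  qed
  define S where "S = (\<Sum>x\<in>?V. chi (Q x))"
  have "S ^ 4 = (\<Sum>x1\<in>?V. \<Sum>x2\<in>?V. \<Sum>x3\<in>?V. \<Sum>x4\<in>?V. chi (Q x1 + Q x2 + Q x3 + Q x4))"
  proof -
    have "S ^ 4 = S * (S * (S * S))" by (simp add: power4_eq_xxxx mult.assoc)
    also have "\<dots> = (\<Sum>x1\<in>?V. \<Sum>x2\<in>?V. \<Sum>x3\<in>?V. \<Sum>x4\<in>?V. chi (Q x1) * (chi (Q x2) * (chi (Q x3) * chi (Q x4))))"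
      unfolding S_def by (simp only: sum_distrib_right, simp only: sum_distrib_left)
    also have "\<dots> = (\<Sum>x1\<in>?V. \<Sum>x2\<in>?V. \<Sum>x3\<in>?V. \<Sum>x4\<in>?V. chi (Q x1 + Q x2 + Q x3 + Q x4))"
      by (intro sum.cong refl) (simp add: chi_add Q_in GF_closed mult.assoc)
    finally show ?thesis .
  qed
  also have "\<dots> = (\<Sum>x1\<in>?V. \<Sum>x2\<in>?V. \<Sum>y3\<in>?V. \<Sum>y4\<in>?V.
      chi (Q x1 + Q x2 + Q (a * x1 + b * x2 + y3) + Q (b * x1 - a * x2 + y4)))"
  proof (rule sum.cong[OF refl], rule sum.cong[OF refl])
    fix x1 x2 assume x: "x1 \<in> ?V" "x2 \<in> ?V"
    have tr: "(\<Sum>x\<in>?V. g x) = (\<Sum>y\<in>?V. g (v + y))" if "v \<in> ?V" for v and g :: "'b \<Rightarrow> complex"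
      by (rule sum.reindex_bij_witness[of _ "\<lambda>y. v + y" "\<lambda>x. x - v"]) (use that in \<open>auto intro: GF_closed\<close>)
    have v: "a * x1 + b * x2 \<in> ?V" "b * x1 - a * x2 \<in> ?V" using x abn by (auto intro: GF_closed)
    show "(\<Sum>x3\<in>?V. \<Sum>x4\<in>?V. chi (Q x1 + Q x2 + Q x3 + Q x4)) = (\<Sum>y3\<in>?V. \<Sum>y4\<in>?V.
      chi (Q x1 + Q x2 + Q (a * x1 + b * x2 + y3) + Q (b * x1 - a * x2 + y4)))"
      by (subst tr[OF v(1)]) (intro sum.cong refl tr[OF v(2)])
  qed
  also have "\<dots> = (\<Sum>x1\<in>?V. \<Sum>x2\<in>?V. \<Sum>y3\<in>?V. \<Sum>y4\<in>?V.
      chi (Q y3) * chi (Q y4) * (chi (B x1 (a * y3 + b * y4)) * chi (B x2 (b * y3 - a * y4))))"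
    by (intro sum.cong refl) (subst iso, assumption+, intro chi2 Q_in B_in GF_closed abn; assumption)
  also have "\<dots> = (\<Sum>y3\<in>?V. \<Sum>y4\<in>?V. \<Sum>x1\<in>?V. \<Sum>x2\<in>?V.
      chi (Q y3) * chi (Q y4) * (chi (B x1 (a * y3 + b * y4)) * chi (B x2 (b * y3 - a * y4))))"
    by (rule sum_swap4)
  also have "\<dots> = (\<Sum>y3\<in>?V. \<Sum>y4\<in>?V. chi (Q y3) * chi (Q y4) *
      ((\<Sum>x1\<in>?V. chi (B x1 (a * y3 + b * y4))) * (\<Sum>x2\<in>?V. chi (B x2 (b * y3 - a * y4)))))"
    by (simp only: sum_distrib_right, simp only: sum_distrib_left)
  also have "\<dots> = (\<Sum>y3\<in>?V. \<Sum>y4\<in>?V. if y3 \<in> W then if y4 \<in> W then of_nat (card ?V ^ 2) else 0 else 0)"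
  proof (intro sum.cong refl)
    fix y3 y4 assume y: "y3 \<in> ?V" "y4 \<in> ?V"
    have v: "a * y3 + b * y4 \<in> ?V" "b * y3 - a * y4 \<in> ?V" using y abn by (auto intro: GF_closed)
    show "chi (Q y3) * chi (Q y4) *
      ((\<Sum>x1\<in>?V. chi (B x1 (a * y3 + b * y4))) * (\<Sum>x2\<in>?V. chi (B x2 (b * y3 - a * y4)))) =
      (if y3 \<in> W then if y4 \<in> W then of_nat (card ?V ^ 2) else 0 else 0)"
      unfolding lin[OF v(1)] lin[OF v(2)] using W_iff[OF y] Q_W by (auto simp: power2_eq_square)
  qed
  also have "\<dots> = of_nat (card ?V ^ 2 * card W ^ 2)"
  proof -
    have VW: "?V \<inter> W = W" by (auto simp: W_def)
    have r: "(\<Sum>y\<in>?V. if y \<in> W then g y else 0) = sum g W" for g :: "'b \<Rightarrow> complex"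
      using sum.inter_restrict[OF finV, of g W] VW by simp
    have "(\<Sum>y3\<in>?V. \<Sum>y4\<in>?V. if y3 \<in> W then if y4 \<in> W then of_nat (card ?V ^ 2) else 0 else (0::complex)) =
       (\<Sum>y3\<in>?V. if y3 \<in> W then \<Sum>y4\<in>?V. if y4 \<in> W then of_nat (card ?V ^ 2) else 0 else 0)"
      by (intro sum.cong refl) simp
    thus ?thesis unfolding r by (simp add: power2_eq_square)
  qed
  finally show ?thesis unfolding S_def .
qed


lemma coeff_two_term_form:
  assumes f: "f = (\<Sum>i\<le>k. \<Sum>j\<le>k. Polynomial.monom (a i j :: 'b) (p ^ i + p ^ j))" and ij: "i \<le> k" "j \<le> k"
  shows "Polynomial.coeff f (p ^ i + p ^ j) = (if i = j then a i i else a i j + a j i)"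
proof -
  have "Polynomial.coeff f (p ^ i + p ^ j) =
      (\<Sum>(i',j')\<in>{..k}\<times>{..k}. if p ^ i' + p ^ j' = p ^ i + p ^ j then a i' j' else 0)"
    unfolding f by (simp add: coeff_sum sum.cartesian_product case_prod_unfold)
  also have "\<dots> = (\<Sum>(i',j')\<in>{(i,j),(j,i)}. a i' j')"
    by (rule sum.mono_neutral_cong_right)
      (use ij p_gt1 in \<open>auto simp: add.commute split: if_splits dest!: prime_power_sum_unique[of p, rotated]\<close>)
  also have "\<dots> = (if i = j then a i i else a i j + a j i)" by simp
  finally show ?thesis .
qed

text \<open>Coprimality excludes two positive exponents. As \<open>a\<close> is not assumed
  symmetric, for i \<noteq> j a coefficient of f determines only the sum
  \<open>a i j + a j i\<close>. These sums are the coefficients of the polar form, and they vanish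
  beyond h because the exponents exceed the degree.\<close>

lemma degree_two_term_form:
  assumes f: "f = (\<Sum>i\<le>k. \<Sum>j\<le>k. Polynomial.monom (a i j :: 'b) (p ^ i + p ^ j))"
    and "f \<noteq> 0" and cop: "coprime (Polynomial.degree f) p"
  obtains h where "h \<le> k" "Polynomial.degree f = 1 + p ^ h" "a 0 h + a h 0 \<noteq> 0"
    "\<And>i j. i \<le> k \<Longrightarrow> j \<le> k \<Longrightarrow> i > h \<or> j > h \<Longrightarrow> a i j + a j i = 0"
proof -
  have "Polynomial.coeff f (Polynomial.degree f) \<noteq> 0" using assms by simp
  moreover have "Polynomial.coeff f D = 0" if "\<not> (\<exists>i\<in>{..k}. \<exists>j\<in>{..k}. D = p ^ i + p ^ j)" for D
    unfolding f coeff_sum coeff_monom using that by (intro sum.neutral ballI) auto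
  ultimately have "\<exists>i\<in>{..k}. \<exists>j\<in>{..k}. Polynomial.degree f = p ^ i + p ^ j" by blast
  then obtain i j where ij: "i \<le> k" "j \<le> k" "Polynomial.degree f = p ^ i + p ^ j" by auto
  have "i = 0 \<or> j = 0"
  proof (rule ccontr)
    assume "\<not> ?thesis"
    hence "p dvd p ^ i + p ^ j" by (auto intro!: dvd_add)
    thus False using cop ij p_gt1 by (metis coprime_common_divisor_nat dvd_refl nat_neq_iff)
  qed
  then obtain h where h: "h \<le> k" "Polynomial.degree f = 1 + p ^ h"
    using ij by (metis add.commute power_0)
  have lead: "Polynomial.coeff f (p ^ 0 + p ^ h) \<noteq> 0" using h assms(2) by (metis leading_coeff_0_iff power_0)
  have "a 0 h + a h 0 \<noteq> 0"
  proof (cases "h = 0")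
    case True
    \<comment> \<open>Here f has degree 2, so p is odd and doubling keeps the coefficient
      nonzero.\<close>
    have "\<not> p dvd 2" using cop h True p_gt1 by (metis coprime_common_divisor_nat dvd_refl nat_neq_iff one_add_one power_0)
    hence "(of_nat 2 :: 'b) \<noteq> 0" using of_nat_eq_0 by blast
    moreover have "a 0 0 \<noteq> 0" using lead coeff_two_term_form[OF f, of 0 h] True by simp
    moreover have "a 0 0 + a 0 0 = of_nat 2 * a 0 0" by simp
    ultimately show ?thesis using True by simp
  qed (use lead coeff_two_term_form[OF f, of 0 h] h in simp)
  moreover have "a i j + a j i = 0" if "i \<le> k" "j \<le> k" "i > h \<or> j > h" for i j
  proof -
    have "p ^ Suc h \<le> p ^ i \<or> p ^ Suc h \<le> p ^ j"
      using that p_gt1 by (metis Suc_leI less_imp_le power_increasing)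
    moreover have "2 * p ^ h \<le> p ^ Suc h" using p_gt1 by (simp add: mult_right_mono)
    moreover have "p ^ h \<ge> 1" "p ^ i \<ge> 1" "p ^ j \<ge> 1" by (simp_all add: Suc_leI One_nat_def)
    ultimately have "1 + p ^ h \<le> p ^ i + p ^ j" by linarith
    moreover have "p ^ i + p ^ j \<noteq> 1 + p ^ h"
      using prime_power_sum_unique[of p i j 0 h] that p_gt1 by auto
    ultimately have "Polynomial.degree f < p ^ i + p ^ j" using h by linarith
    hence "Polynomial.coeff f (p ^ i + p ^ j) = 0" by (rule coeff_eq_0)
    thus ?thesis using coeff_two_term_form[OF f, of i j] that by (auto split: if_splits)
  qed
  ultimately show ?thesis using that h by blast
qed

text \<open>Inside the trace each term of the polar form may be raised to a Frobenius power.
  Normalising the exponent of x to p^h makes the form the trace of x^(p^h) E(z), with E additive of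
  degree p^(2h). As the trace form is nondegenerate, the radical is the root set of E once the field
  contains these roots.\<close>

lemma exp_sum_power4:
  fixes a :: "nat \<Rightarrow> nat \<Rightarrow> 'b"
  assumes f: "f = (\<Sum>i\<le>k. \<Sum>j\<le>k. Polynomial.monom (a i j) (p ^ i + p ^ j))"
    and h: "h \<le> k" "a 0 h + a h 0 \<noteq> 0"
      "\<And>i j. i \<le> k \<Longrightarrow> j \<le> k \<Longrightarrow> i > h \<or> j > h \<Longrightarrow> a i j + a j i = 0"
    and s: "s \<ge> 1" "\<And>i j. a i j \<in> GF s" and c: "c \<in> GF r" "r \<ge> 1" "c \<noteq> 0"
  obtains N where "N \<ge> 1" "s dvd N" "c \<in> GF N" "\<And>n. n \<ge> 1 \<Longrightarrow> N dvd n \<Longrightarrow>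
    (\<Sum>x\<in>GF n. chi (T n (c * poly f x))) ^ 4 = of_nat (p ^ (2 * n) * p ^ (4 * h))"
proof -
  define sg where "sg i j = a i j + a j i" for i j
  \<comment> \<open>The (i, j) term is raised to the power p^(h-i), which takes x to exponent p^h
    and z to exponent p^(j+h-i).\<close>
  define e where "e l = (\<Sum>i\<le>h. \<Sum>j\<le>h. if j + h - i = l then (c * sg i j) ^ (p ^ (h - i)) else 0)" for l
  let ?E = "addpoly e (2 * h)"
  have Ez: "poly ?E z = (\<Sum>i\<le>h. \<Sum>j\<le>h. (c * sg i j) ^ (p ^ (h - i)) * z ^ (p ^ (j + h - i)))" for z
  proof -
    have "poly ?E z = (\<Sum>l\<le>2*h. \<Sum>i\<le>h. \<Sum>j\<le>h. if j + h - i = l then (c * sg i j) ^ (p ^ (h - i)) * z ^ (p ^ l) else 0)"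
      unfolding poly_addpoly e_def sum_distrib_right by (intro sum.cong refl) auto
    also have "\<dots> = (\<Sum>i\<le>h. \<Sum>j\<le>h. \<Sum>l\<le>2*h. if j + h - i = l then (c * sg i j) ^ (p ^ (h - i)) * z ^ (p ^ l) else 0)"
      by (subst sum.swap) (intro sum.cong refl sum.swap)
    also have "\<dots> = (\<Sum>i\<le>h. \<Sum>j\<le>h. (c * sg i j) ^ (p ^ (h - i)) * z ^ (p ^ (j + h - i)))"
      by (intro sum.cong refl) (auto simp: sum.delta)
    finally show ?thesis .
  qed
  have e0: "e 0 = c * sg h 0"
    unfolding e_def by (subst sum_double_delta[of h _ 0]) auto
  have eN: "e (2 * h) = (c * sg 0 h) ^ (p ^ h)"
    unfolding e_def by (subst sum_double_delta[of 0 _ h]) auto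
  have nz: "e 0 \<noteq> 0" "e (2 * h) \<noteq> 0" unfolding e0 eN using c h by (auto simp: sg_def add.commute)
  define R where "R = {z. poly ?E z = 0}"
  have cR: "card R = p ^ (2 * h)" unfolding R_def by (rule card_roots_addpoly) (use nz in auto)
  hence finR: "finite R" by (metis card_eq_0_iff p_neq0 power_not_zero)
  define m where "m = s * r"
  have m: "m \<ge> 1" using s c mult_le_mono[of 1 s 1 r] by (simp add: m_def)
  have sgm: "sg i j \<in> GF m" for i j using s GF_mult by (auto simp: sg_def m_def intro!: GF_closed)
  have cm: "c \<in> GF m" using c(1) GF_dvd[of r m] by (auto simp: m_def)
  have em: "e l \<in> GF m" for l unfolding e_def by (intro GF_sum) (auto intro!: GF_closed cm sgm)
  have "z ^ (p ^ m) \<in> R" if "z \<in> R" for z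
  proof -
    have "poly ?E (z ^ (p ^ m)) = (poly ?E z) ^ (p ^ m)"
      unfolding poly_addpoly frob_sum using em
      by (intro sum.cong refl) (simp add: power_mult_distrib GF_def mult.commute flip: power_mult)
    thus ?thesis using that by (simp add: R_def)
  qed
  then obtain N1 where N1: "N1 \<ge> 1" "R \<subseteq> GF N1" using finite_frob_stable_subset_GF[OF finR _ m] by blast
  define N0 where "N0 = m * N1"
  have N0: "N0 \<ge> 1" using m N1 mult_le_mono[of 1 m 1 N1] by (simp add: N0_def)
  have RN0: "R \<subseteq> GF N0" using N1 GF_dvd[of N1 N0] by (auto simp: N0_def)
  have cN0: "c \<in> GF N0" using cm GF_mult by (simp add: N0_def)
  have aN0: "a i j \<in> GF N0" for i j using s(2)[of i j] GF_dvd[of s N0] by (auto simp: N0_def m_def)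
  have pf: "poly f x = (\<Sum>i\<le>k. \<Sum>j\<le>k. a i j * (x ^ (p ^ i) * x ^ (p ^ j)))" for x
    unfolding f by (simp add: poly_sum poly_monom power_add)
  \<comment> \<open>The factor p in \<open>p * N0\<close> makes the quadratic form vanish on the
    radical: its values there are traces from \<open>GF n\<close> of elements of
    \<open>GF N0\<close>, hence multiples of p.\<close>
  have key: "(\<Sum>x\<in>GF n. chi (T n (c * poly f x))) ^ 4 = of_nat (p ^ (2 * n) * p ^ (4 * h))"
    if n: "n \<ge> 1" "p * N0 dvd n" for n
  proof -
    let ?V = "GF n"
    have N0n: "GF N0 \<subseteq> ?V" by (rule GF_dvd) (use n(2) in \<open>metis dvd_mult_right\<close>)
    have cn: "c \<in> ?V" and an: "a i j \<in> ?V" for i j using N0n cN0 aN0 by auto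
    have sgn: "sg i j \<in> ?V" for i j using an by (auto simp: sg_def intro: GF_closed)
    define Q where "Q x = T n (c * poly f x)" for x
    define bl where "bl x z = (\<Sum>i\<le>k. \<Sum>j\<le>k. c * sg i j * (x ^ (p ^ i) * z ^ (p ^ j)))" for x z
    have fn: "poly f x \<in> ?V" if "x \<in> ?V" for x
      unfolding pf using that an by (intro GF_sum GF_closed)
    have expand: "poly f (x + z) = poly f x + poly f z + (\<Sum>i\<le>k. \<Sum>j\<le>k. sg i j * (x ^ (p ^ i) * z ^ (p ^ j)))" for x z
    proof -
      have "(\<Sum>i\<le>k. \<Sum>j\<le>k. sg i j * (x ^ (p ^ i) * z ^ (p ^ j))) =
          (\<Sum>i\<le>k. \<Sum>j\<le>k. a i j * (x ^ (p ^ i) * z ^ (p ^ j))) + (\<Sum>i\<le>k. \<Sum>j\<le>k. a j i * (x ^ (p ^ i) * z ^ (p ^ j)))"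
        by (simp add: sg_def ring_distribs sum.distrib)
      also have "(\<Sum>i\<le>k. \<Sum>j\<le>k. a j i * (x ^ (p ^ i) * z ^ (p ^ j))) = (\<Sum>i\<le>k. \<Sum>j\<le>k. a i j * (z ^ (p ^ i) * x ^ (p ^ j)))"
        by (subst sum.swap) (simp add: mult.commute)
      finally show ?thesis
        unfolding pf by (simp add: frob_add ring_distribs sum.distrib algebra_simps)
    qed
    have B: "Q (x + z) - Q x - Q z = T n (bl x z)" for x z
      by (simp add: Q_def expand ring_distribs T_add bl_def sum_distrib_left mult.assoc)
    have BE: "T n (bl x z) = T n (x ^ (p ^ h) * poly ?E z)" if xz: "x \<in> ?V" "z \<in> ?V" for x z
    proof -
      have "bl x z = (\<Sum>i\<le>h. \<Sum>j\<le>h. c * sg i j * (x ^ (p ^ i) * z ^ (p ^ j)))"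
      proof -
        have z0: "sg i j = 0" if "i \<le> k" "j \<le> k" "\<not> (i \<le> h \<and> j \<le> h)" for i j
          using h(3)[of i j] that by (auto simp: sg_def)
        have "bl x z = (\<Sum>i\<le>k. \<Sum>j\<le>h. c * sg i j * (x ^ (p ^ i) * z ^ (p ^ j)))"
          unfolding bl_def by (intro sum.cong refl sum.mono_neutral_right) (use h(1) z0 in auto)
        also have "\<dots> = (\<Sum>i\<le>h. \<Sum>j\<le>h. c * sg i j * (x ^ (p ^ i) * z ^ (p ^ j)))"
          by (intro sum.mono_neutral_right) (use h(1) z0 in \<open>auto intro!: sum.neutral\<close>)
        finally show ?thesis .
      qed
      hence "T n (bl x z) = (\<Sum>i\<le>h. \<Sum>j\<le>h. T n (c * sg i j * (x ^ (p ^ i) * z ^ (p ^ j))))"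
        by (simp add: T_sum)
      also have "\<dots> = (\<Sum>i\<le>h. \<Sum>j\<le>h. T n (x ^ (p ^ h) * ((c * sg i j) ^ (p ^ (h - i)) * z ^ (p ^ (j + h - i)))))"
      proof (intro sum.cong refl)
        fix i j assume "i \<in> {..h}" "j \<in> {..h}"
        hence ij: "i + (h - i) = h" "j + (h - i) = j + h - i" by auto
        have "T n (c * sg i j * (x ^ (p ^ i) * z ^ (p ^ j))) = T n ((c * sg i j * (x ^ (p ^ i) * z ^ (p ^ j))) ^ (p ^ (h - i)))"
          by (rule T_frob[symmetric]) (use xz cn sgn in \<open>intro GF_closed\<close>)
        also have "(c * sg i j * (x ^ (p ^ i) * z ^ (p ^ j))) ^ (p ^ (h - i)) =
           x ^ (p ^ h) * ((c * sg i j) ^ (p ^ (h - i)) * z ^ (p ^ (j + h - i)))"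
          using frob_pow_add[of x i "h - i"] frob_pow_add[of z j "h - i"] unfolding ij
          by (simp add: power_mult_distrib mult_ac)
        finally show "T n (c * sg i j * (x ^ (p ^ i) * z ^ (p ^ j))) =
          T n (x ^ (p ^ h) * ((c * sg i j) ^ (p ^ (h - i)) * z ^ (p ^ (j + h - i))))" .
      qed
      also have "\<dots> = T n (x ^ (p ^ h) * poly ?E z)"
        unfolding Ez sum_distrib_left T_sum ..
      finally show ?thesis .
    qed
    have bl_in: "bl x z \<in> ?V" if "x \<in> ?V" "z \<in> ?V" for x z
      unfolding bl_def using that cn sgn by (intro GF_sum GF_closed)
    have En: "poly ?E z \<in> ?V" if "z \<in> ?V" for z
      unfolding Ez using that cn sgn by (intro GF_sum GF_closed)
    have W: "{z \<in> ?V. \<forall>x\<in>?V. T n (bl x z) = 0} = R"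
    proof (intro equalityI subsetI)
      fix z assume z: "z \<in> {z \<in> ?V. \<forall>x\<in>?V. T n (bl x z) = 0}"
      show "z \<in> R"
      proof (rule ccontr)
        assume "z \<notin> R"
        hence "poly ?E z \<noteq> 0" by (simp add: R_def)
        then obtain w where w: "w \<in> ?V" "T n (poly ?E z * w) \<noteq> 0"
          using T_nontrivial[OF n(1) En] z by blast
        obtain n' where n': "n = Suc n'" using n(1) by (cases n) auto
        \<comment> \<open>The n-th power of Frobenius is the identity on \<open>GF n\<close>, so
          with n = n' + 1 this is the p^h-th root of \<open>w\<close>.\<close>
        define x where "x = w ^ (p ^ (n' * h))"
        have "x \<in> ?V" using w by (simp add: x_def GF_closed)
        moreover have "x ^ (p ^ h) = w"
        proof -
          have "x ^ (p ^ h) = w ^ (p ^ (n * h))"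
            using frob_pow_add[of w "n' * h" h] by (simp add: x_def n' add.commute)
          thus ?thesis using GF_mult[OF w(1), of h] by (simp add: GF_def)
        qed
        ultimately show False using BE[of x z] z w by (simp add: mult.commute)
      qed
    next
      fix z assume z: "z \<in> R"
      hence "z \<in> ?V" using RN0 N0n by blast
      thus "z \<in> {z \<in> ?V. \<forall>x\<in>?V. T n (bl x z) = 0}" using z BE by (auto simp: R_def)
    qed
    have QR: "Q w = 0" if "w \<in> R" for w
    proof -
      obtain l where l: "n = N0 * (p * l)" using n(2) by (metis dvdE mult.assoc mult.commute)
      have w: "c * poly f w \<in> GF N0" unfolding pf
        using that RN0 cN0 aN0 by (intro GF_sum GF_closed) auto
      have "(\<Sum>i<p*l. (c * poly f w) ^ (p ^ (N0 * i))) = (\<Sum>i<p*l. c * poly f w)"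
        using GF_mult[OF w] by (intro sum.cong refl) (simp add: GF_def)
      also have "\<dots> = 0" by simp
      finally show ?thesis unfolding Q_def l T_tower by simp
    qed
    have "(\<Sum>x\<in>?V. chi (Q x)) ^ 4 = of_nat (card ?V ^ 2 * card {z \<in> ?V. \<forall>x\<in>?V. Q (x + z) - Q x - Q z = 0} ^ 2)"
    proof (rule quadratic_sum_power4[OF n(1)], unfold B W)
      show "Q x \<in> GF 1" if "x \<in> ?V" for x
        unfolding Q_def using that fn cn by (intro T_in_GF1 GF_closed)
      show "Q (b * x) = b\<^sup>2 * Q x" if "b \<in> GF 1" "x \<in> ?V" for b x
      proof -
        have b: "b ^ (p ^ i) = b" for i using GF_mult[OF that(1), of i] by (simp add: GF_def)
        have "poly f (b * x) = b\<^sup>2 * poly f x" unfolding pf sum_distrib_left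
          by (intro sum.cong refl) (simp add: power_mult_distrib b power2_eq_square mult_ac)
        thus ?thesis using T_scale[of "b\<^sup>2" n "c * poly f x"] that(1) by (simp add: Q_def mult_ac GF_closed)
      qed
      show "T n (bl (x + y) z) = T n (bl x z) + T n (bl y z)" for x y z
        by (simp add: bl_def frob_add ring_distribs sum.distrib T_add)
      show "T n (bl (b * x) z) = b * T n (bl x z)" if "b \<in> GF 1" for b x z
      proof -
        have b: "b ^ (p ^ i) = b" for i using GF_mult[OF that(1), of i] by (simp add: GF_def)
        have "bl (b * x) z = b * bl x z" unfolding bl_def sum_distrib_left
          by (intro sum.cong refl) (simp add: power_mult_distrib b mult_ac)
        thus ?thesis using T_scale[OF that] by simp
      qed
    qed (use QR in auto)
    also have "\<dots> = of_nat (p ^ (2 * n) * p ^ (4 * h))"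
      unfolding B W cR card_GF[OF n(1)] by (simp flip: power_mult add: mult.commute)
    finally show ?thesis by (simp add: Q_def)
  qed
  show ?thesis
  proof (rule that[of "p * N0"])
    show "p * N0 \<ge> 1" using N0 p_gt1 mult_le_mono[of 1 p 1 N0] by simp
    show "s dvd p * N0" by (simp add: N0_def m_def)
    show "c \<in> GF (p * N0)" using cN0 GF_dvd[of N0 "p * N0"] by auto
  qed (rule key)
qed

end

section \<open>Frobenius eigenvalues and the L-series of the curve\<close>

lemma recipX_psum_S:
  assumes "fps_deriv (recipX N) = recipX N * Abs_fps (\<lambda>n. S (Suc n))" "n \<ge> 1"
  shows "S n = - (\<Sum>x\<in>#N. x ^ n :: complex)"
proof -
  have "recipX N \<noteq> 0" using recipX_nth0[of N] by auto
  moreover have "recipX N * (fps_X * Abs_fps (\<lambda>n. S (Suc n))) = recipX N * (- psum N)"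
    using newton_girard[of N] assms(1) by (simp add: mult_ac)
  ultimately have "fps_X * Abs_fps (\<lambda>n. S (Suc n)) = - psum N"
    by (metis mult_left_cancel)
  hence "fps_nth (fps_X * Abs_fps (\<lambda>n. S (Suc n))) n = fps_nth (- psum N) n" by simp
  thus ?thesis using assms(2) by (cases n) (auto simp: psum_def)
qed

lemma reflect_recip:
  assumes "0 \<notin># N" shows "Polynomial.coeff (prodX N) 0 \<noteq> 0"
proof -
  have "poly (prodX N) 0 \<noteq> 0" using assms
    by (induction N) (auto simp del: mult_pCons_left)
  thus ?thesis by (simp add: poly_0_coeff_0)
qed

text \<open>Reversal of a polynomial loses exactly the factors belonging to the root 0.\<close>

lemma recipX_inj:
  assumes "recipX M = recipX N" "0 \<notin># M" "0 \<notin># N" shows "M = N"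
proof -
  have "reflect_poly (prodX M) = reflect_poly (prodX N)"
    using assms(1) by (simp add: recipX_def fps_of_poly_eq_iff)
  hence "prodX M = prodX N"
    by (metis reflect_poly_reflect_poly reflect_recip assms(2,3))
  thus ?thesis by (rule prodX_inj)
qed

text \<open>The power sums with positive exponents are the coefficients of the logarithmic
  derivative, which determines the reciprocal polynomial. Since 0 is excluded, even the number of
  elements is recovered.\<close>

lemma power_sums_inj:
  fixes M N :: "complex multiset"
  assumes "\<And>n. n \<ge> 1 \<Longrightarrow> (\<Sum>x\<in>#M. x ^ n) = (\<Sum>x\<in>#N. x ^ n)" "0 \<notin># M" "0 \<notin># N"
  shows "M = N"
proof -
  have ps: "psum M = psum N" using assms(1) by (intro fps_ext) (simp add: psum_def)
  define H where "H = - Abs_fps (\<lambda>n. fps_nth (psum N) (Suc n))"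
  have H: "fps_X * H = - psum N"
  proof (rule fps_ext)
    fix n
    show "fps_nth (fps_X * H) n = fps_nth (- psum N) n" by (cases n) (auto simp: H_def psum_def)
  qed
  have d: "fps_deriv (recipX K) = recipX K * H" if "psum K = psum N" for K
  proof -
    have "fps_X * fps_deriv (recipX K) = recipX K * (fps_X * H)"
      using newton_girard[of K] that by (simp add: H)
    also have "\<dots> = fps_X * (recipX K * H)" by (simp only: mult_ac)
    finally show ?thesis by simp
  qed
  have "recipX M = recipX N"
    by (rule fps_deriv_eq_unique[OF d[OF ps] d]) (simp_all add: recipX_nth0)
  thus ?thesis using assms recipX_inj by blast
qed

text \<open>Turns an Euler product that is a polynomial into Frobenius eigenvalues: the constant
  term 1 makes its reversal monic, and the eigenvalues are the roots of the reversal.\<close>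

lemma exponential_roots:
  assumes "fps_deriv (Abs_fps A) = Abs_fps A * Abs_fps (\<lambda>n. S (Suc n))" "A 0 = (1::complex)"
    "\<And>n. n > K \<Longrightarrow> A n = 0"
  obtains N where "0 \<notin># N" "Abs_fps A = recipX N" "\<And>n. n \<ge> 1 \<Longrightarrow> S n = - (\<Sum>x\<in>#N. x ^ n)"
proof -
  define P where "P = Abs_poly A"
  have "\<forall>\<^sub>\<infinity>n. A n = 0" using assms(3) unfolding MOST_nat by blast
  hence cP: "Polynomial.coeff P n = A n" for n unfolding P_def by (simp add: Abs_poly_inverse)
  have P0: "Polynomial.coeff P 0 = 1" using cP assms by simp
  hence "reflect_poly (reflect_poly P) = P" by simp
  hence "Polynomial.lead_coeff (reflect_poly P) = 1"
    using P0 coeff_0_reflect_poly[of "reflect_poly P"] by simp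
  then obtain N where N: "prodX N = reflect_poly P" using ex_prodX by blast
  have rN: "Abs_fps A = recipX N"
    unfolding recipX_def N using P0 by (intro fps_ext) (simp add: cP)
  have "poly (prodX N) 0 \<noteq> 0" using N P0 by (auto simp: poly_0_coeff_0)
  moreover have "set_mset N = {x. poly (prodX N) x = 0}"
    using set_count_proots[of "prodX N"] by simp
  ultimately have "0 \<notin># N" by simp
  moreover have "fps_deriv (recipX N) = recipX N * Abs_fps (\<lambda>n. S (Suc n))"
    using assms(1) by (simp only: rN)
  ultimately show ?thesis using that[OF _ rN] recipX_psum_S[of N S] by blast
qed

definition mset_mult :: "complex multiset \<Rightarrow> complex multiset \<Rightarrow> complex multiset" where
  "mset_mult M N = (\<Sum>x\<in>#M. image_mset (\<lambda>y. x * y) N)"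

lemma mset_mult_sum: "(\<Sum>z\<in>#mset_mult M N. z ^ n) = (\<Sum>x\<in>#M. x ^ n) * (\<Sum>x\<in>#N. x ^ n)"
  unfolding mset_mult_def
  by (induction M) (auto simp: image_mset.compositionality comp_def power_mult_distrib ring_distribs sum_mset_distrib_left[symmetric])

lemma mset_mult_mem: "z \<in># mset_mult M N \<longleftrightarrow> (\<exists>x\<in>#M. \<exists>y\<in>#N. z = x * y)"
  unfolding mset_mult_def by (induction M) auto

lemma size_mset_mult: "size (mset_mult M N) = size M * size N"
  unfolding mset_mult_def by (induction M) auto

text \<open>
  The fourth power of a power sum is a power sum of the fourfold products, so these all agree; hence
  all the original numbers agree.
\<close>

lemma power_sum_fourth_power:
  fixes N :: "complex multiset"
  assumes "0 \<notin># N" and "\<And>n. n \<ge> 1 \<Longrightarrow> (\<Sum>x\<in>#N. x ^ n) ^ 4 = of_nat (K ^ 4) * c ^ n" "c \<noteq> 0" "K > 0"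
  obtains \<beta> where "N = replicate_mset K \<beta>" "\<beta> ^ 4 = c"
proof -
  let ?N4 = "mset_mult (mset_mult N N) (mset_mult N N)"
  have "?N4 = replicate_mset (K ^ 4) c"
  proof (rule power_sums_inj)
    fix n :: nat assume "n \<ge> 1"
    thus "(\<Sum>x\<in>#?N4. x ^ n) = (\<Sum>x\<in>#replicate_mset (K ^ 4) c. x ^ n)"
      using assms(2)[of n] by (simp add: mset_mult_sum power4_eq_xxxx mult.assoc)
  qed (use assms in \<open>auto simp: mset_mult_mem\<close>)
  note N4 = this
  have mem: "z = c" if "z \<in># ?N4" for z using that unfolding N4 by (auto split: if_splits)
  have sz: "size N ^ 4 = K ^ 4"
    using arg_cong[OF N4, of size] by (simp add: size_mset_mult power4_eq_xxxx mult.assoc)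
  have szK: "size N = K" using sz by (simp add: power_eq_iff_eq_base)
  then obtain \<beta> where b: "\<beta> \<in># N" using assms(4) by (metis multiset_nonemptyE nonempty_has_size)
  have four: "w * x * (y * z) = c" if "w \<in># N" "x \<in># N" "y \<in># N" "z \<in># N" for w x y z
  proof (rule mem)
    have "w * x \<in># mset_mult N N" "y * z \<in># mset_mult N N" using that by (auto simp: mset_mult_mem)
    thus "w * x * (y * z) \<in># ?N4" using mset_mult_mem[of _ "mset_mult N N" "mset_mult N N"] by blast
  qed
  have "x = \<beta>" if "x \<in># N" for x
  proof -
    have "\<beta> * \<beta> * (\<beta> * x) = \<beta> * \<beta> * (\<beta> * \<beta>)"
      using four[OF b b b that] four[OF b b b b] by simp
    moreover have "\<beta> \<noteq> 0" using b assms(1) by auto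
    ultimately show ?thesis by simp
  qed
  hence "N = replicate_mset K \<beta>" using set_mset_subset_singletonD[of N \<beta>] szK by auto
  moreover have "\<beta> ^ 4 = c" using four[OF b b b b] by (simp add: power4_eq_xxxx mult.assoc)
  ultimately show ?thesis using that by blast
qed


context alg_closed_char
begin

section \<open>Points and divisors on the affine curve\<close>

definition curve_points :: "nat \<Rightarrow> 'b poly \<Rightarrow> nat \<Rightarrow> ('b \<times> 'b) set" where
  "curve_points u f n = {(x, y). x \<in> GF n \<and> y \<in> GF n \<and> y ^ (p ^ u) - y = poly f x}"

lemma finite_curve_points: "n \<ge> 1 \<Longrightarrow> finite (curve_points u f n)"
  by (rule finite_subset[of _ "GF n \<times> GF n"]) (auto simp: curve_points_def finite_GF)

lemma poly_in_GF:
  assumes "\<And>i. Polynomial.coeff f i \<in> GF s" "s dvd n" "x \<in> GF n" shows "poly f x \<in> GF n"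
  unfolding poly_altdef using assms GF_dvd[of s n] by (intro GF_sum GF_closed) auto

lemma card_curve_points:
  assumes "\<And>i. Polynomial.coeff f i \<in> GF s" "s dvd n" "n \<ge> 1" "u \<ge> 1"
  shows "of_nat (card (curve_points u f n)) = of_nat (p ^ n) +
    (\<Sum>c\<in>(GF u - {0}) \<inter> GF n. \<Sum>x\<in>GF n. chi (T n (c * poly f x)))"
proof -
  have fin: "finite (GF n)" using finite_GF assms by simp
  have "curve_points u f n = (SIGMA x:GF n. {y \<in> GF n. y ^ (p ^ u) - y = poly f x})"
    by (auto simp: curve_points_def)
  hence "card (curve_points u f n) = (\<Sum>x\<in>GF n. card {y \<in> GF n. y ^ (p ^ u) - y = poly f x})"
    using fin by (simp add: card_SigmaI)
  hence "of_nat (card (curve_points u f n)) = (\<Sum>x\<in>GF n. \<Sum>c\<in>GF u \<inter> GF n. chi (T n (c * poly f x)))"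
    using card_AS_eq_sum_chi[OF assms(3,4) poly_in_GF[OF assms(1,2)]] by simp
  also have "\<dots> = (\<Sum>c\<in>GF u \<inter> GF n. \<Sum>x\<in>GF n. chi (T n (c * poly f x)))" by (rule sum.swap)
  also have "GF u \<inter> GF n = insert 0 ((GF u - {0}) \<inter> GF n)" by (auto intro: GF_closed)
  also have "(\<Sum>c\<in>\<dots>. \<Sum>x\<in>GF n. chi (T n (c * poly f x))) = of_nat (p ^ n) +
    (\<Sum>c\<in>(GF u - {0}) \<inter> GF n. \<Sum>x\<in>GF n. chi (T n (c * poly f x)))"
    using fin card_GF[OF assms(3)] by (subst sum.insert) auto
  finally show ?thesis .
qed

definition curve_frob :: "nat \<Rightarrow> 'b \<times> 'b \<Rightarrow> 'b \<times> 'b" where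
  "curve_frob s = (\<lambda>(x, y). (x ^ (p ^ s), y ^ (p ^ s)))"

definition curve_divs :: "nat \<Rightarrow> nat \<Rightarrow> 'b poly \<Rightarrow> nat \<Rightarrow> ('b \<times> 'b) multiset set" where
  "curve_divs s u f n = {M. set_mset M \<subseteq> {(x, y). y ^ (p ^ u) - y = poly f x} \<and>
     image_mset (curve_frob s) M = M \<and> size M = n}"

text \<open>Coefficients of (1 - Q T) times the zeta function of the affine curve, Q = p^s. The
  missing point at infinity accounts for the factor 1 - T, so this is the L-series, with
  coefficients that are visibly integers.\<close>

definition L_coeff :: "nat \<Rightarrow> nat \<Rightarrow> 'b poly \<Rightarrow> nat \<Rightarrow> int" where
  "L_coeff s u f n = int (card (curve_divs s u f n)) -
     (if n = 0 then 0 else int (p ^ s) * int (card (curve_divs s u f (n - 1))))"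

lemma curve_frob_funpow: "(curve_frob s ^^ n) (x, y) = (x ^ (p ^ (s * n)), y ^ (p ^ (s * n)))"
proof (induction n)
  case (Suc n)
  thus ?case using frob_pow_add[of x "s * n" s] frob_pow_add[of y "s * n" s]
    by (simp add: curve_frob_def add.commute)
qed simp

text \<open>The Euler product with trivial weight counts stable divisors. The coefficient field is
  left open: the L-polynomial is defined over the rationals, its roots live in the complex
  numbers.\<close>

lemma L_series_integral:
  assumes f: "\<And>i. Polynomial.coeff f i \<in> GF s" and s: "s \<ge> 1"
  shows "fps_exp 1 oo Abs_fps (\<lambda>i. (of_nat (card (curve_points u f (s * i))) - of_nat (p ^ s) ^ i) / of_nat i)
    = Abs_fps (\<lambda>n. of_int (L_coeff s u f n) :: 'c::field_char_0)"
proof -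
  have poly_f: "poly f (x ^ (p ^ s)) = poly f x ^ (p ^ s)" for x
    unfolding poly_altdef frob_sum using f
    by (intro sum.cong refl) (simp add: GF_def power_mult_distrib mult.commute flip: power_mult)
  let ?Om = "{(x, y). y ^ (p ^ u) - y = poly f x}"
  have Fix: "{z \<in> ?Om. (curve_frob s ^^ n) z = z} = curve_points u f (s * n)" for n
    by (auto simp: curve_frob_funpow curve_points_def GF_def)
  interpret E: euler_product ?Om "curve_frob s" "\<lambda>_. 1 :: 'c"
  proof
    fix n :: nat assume n: "n \<ge> 1"
    have "s * n \<ge> 1" using n s mult_le_mono[of 1 s 1 n] by simp
    thus "finite {z \<in> ?Om. (curve_frob s ^^ n) z = z}" unfolding Fix by (rule finite_curve_points)
  next
    fix z assume "z \<in> ?Om"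
    moreover have "(y ^ (p ^ s)) ^ (p ^ u) - y ^ (p ^ s) = (y ^ (p ^ u) - y) ^ (p ^ s)" for y :: 'b
      by (simp add: frob_diff mult.commute flip: power_mult)
    ultimately show "curve_frob s z \<in> ?Om" by (auto simp: curve_frob_def poly_f)
  qed (auto simp: curve_frob_def frob_inj)
  define Q where "Q = (of_nat (p ^ s) :: 'c)"
  let ?N = "\<lambda>i. of_nat (card (curve_points u f (s * i))) :: 'c"
  have S: "E.S n = ?N n" for n unfolding E.S_def E.Fix_def Fix by simp
  have A: "E.A n = of_nat (card (curve_divs s u f n))" for n
    by (simp add: E.A_def E.Div_def curve_divs_def)
  define F where "F = (1 - fps_const Q * fps_X) * Abs_fps E.A"
  have geo: "(1 - fps_const Q * fps_X) * Abs_fps (\<lambda>n. Q ^ Suc n) = fps_const Q"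
  proof (rule fps_ext)
    fix n
    have "(1 - fps_const Q * fps_X) * Abs_fps (\<lambda>n. Q ^ Suc n) =
      Abs_fps (\<lambda>n. Q ^ Suc n) - fps_const Q * (fps_X * Abs_fps (\<lambda>n. Q ^ Suc n))" by (simp add: algebra_simps)
    thus "fps_nth ((1 - fps_const Q * fps_X) * Abs_fps (\<lambda>n. Q ^ Suc n)) n = fps_nth (fps_const Q) n"
      by (cases n) simp_all
  qed
  have d1: "fps_deriv (1 - fps_const Q * fps_X) = - fps_const Q" by simp
  have "fps_deriv F = - (fps_const Q * Abs_fps E.A) + (1 - fps_const Q * fps_X) * (Abs_fps E.A * Abs_fps (\<lambda>n. E.S (Suc n)))"
    unfolding F_def fps_deriv_mult d1 E.fps_deriv_A by (simp only: mult_minus_left add.commute)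
  also have "fps_const Q * Abs_fps E.A = F * Abs_fps (\<lambda>n. Q ^ Suc n)"
    by (subst geo[symmetric]) (simp only: F_def mult_ac)
  also have "- (F * Abs_fps (\<lambda>n. Q ^ Suc n)) + (1 - fps_const Q * fps_X) * (Abs_fps E.A * Abs_fps (\<lambda>n. E.S (Suc n)))
     = F * (Abs_fps (\<lambda>n. E.S (Suc n)) - Abs_fps (\<lambda>n. Q ^ Suc n))"
    unfolding F_def right_diff_distrib by (simp only: mult.assoc uminus_add_conv_diff)
  also have "Abs_fps (\<lambda>n. E.S (Suc n)) - Abs_fps (\<lambda>n. Q ^ Suc n) = Abs_fps (\<lambda>n. ?N (Suc n) - Q ^ Suc n)"
    by (rule fps_ext) (simp add: S)
  finally have "fps_exp 1 oo Abs_fps (\<lambda>i. (?N i - Q ^ i) / of_nat i) = F"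
    by (rule fps_exp_oo_unique) (simp add: F_def E.A_0)
  also have "F = Abs_fps (\<lambda>n. of_int (L_coeff s u f n))"
  proof (rule fps_ext)
    fix n
    have "F = Abs_fps E.A - fps_const Q * (fps_X * Abs_fps E.A)"
      by (simp only: F_def left_diff_distrib mult_1_left mult.assoc)
    thus "fps_nth F n = fps_nth (Abs_fps (\<lambda>n. of_int (L_coeff s u f n))) n"
      by (cases n) (simp_all add: A L_coeff_def Q_def)
  qed
  finally show ?thesis by (simp add: Q_def)
qed

end

section \<open>Divisibility of the coefficients of the L-polynomial\<close>

lemma ex_first_min:
  fixes \<mu> :: "nat \<Rightarrow> int"
  assumes "finite I" "I \<noteq> {}"
  obtains i where "i \<in> I" "\<And>j. j \<in> I \<Longrightarrow> \<mu> i \<le> \<mu> j" "\<And>j. j \<in> I \<Longrightarrow> j < i \<Longrightarrow> \<mu> i < \<mu> j"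
proof -
  define m where "m = Min (\<mu> ` I)"
  have m: "m \<le> \<mu> j" if "j \<in> I" for j using that assms by (simp add: m_def)
  have "m \<in> \<mu> ` I" unfolding m_def using assms by (intro Min_in) auto
  hence ex: "\<exists>i. i \<in> I \<and> \<mu> i = m" by auto
  define i where "i = (LEAST i. i \<in> I \<and> \<mu> i = m)"
  have i: "i \<in> I" "\<mu> i = m" using LeastI_ex[OF ex] by (auto simp: i_def)
  have "\<mu> j \<noteq> m" if "j \<in> I" "j < i" for j using not_less_Least[of j "\<lambda>i. i \<in> I \<and> \<mu> i = m"] that by (simp add: i_def)
  thus ?thesis using that[of i] i m by (metis le_neq_trans)
qed

text \<open>Gauss's lemma for the valuation giving the variable the value \<open>-s/2\<close>.\<close>

lemma gauss_norm_factor: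
  fixes c g r :: "nat \<Rightarrow> int" and p s :: nat
  assumes p: "Factorial_Ring.prime p"
    and c0: "c 0 = 1" and g0: "g 0 = 1" and cK: "\<And>i. i > K \<Longrightarrow> c i = 0" and gK: "\<And>i. i > K' \<Longrightarrow> g i = 0"
    and r: "\<And>n. r n = (\<Sum>i\<le>n. c i * g (n - i))"
    and div: "\<And>n. int p ^ ((s * n + 1) div 2) dvd r n"
  shows "int p ^ ((s * n + 1) div 2) dvd c n"
proof (rule ccontr)
  assume n: "\<not> ?thesis"
  let ?v = "multiplicity (int p)"
  have pi: "Factorial_Ring.prime (int p)" using p by simp
  have vle: "int p ^ e dvd x \<longleftrightarrow> e \<le> ?v x" if "x \<noteq> 0" for e x
    using that pi by (intro power_dvd_iff_le_multiplicity) (auto simp: prime_elem_not_unit)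
  \<comment> \<open>Twice the valuation, so that the slope s/2 stays integral.\<close>
  define mc where "mc i = 2 * int (?v (c i)) - int s * int i" for i
  define mg where "mg i = 2 * int (?v (g i)) - int s * int i" for i
  define I where "I = {i. c i \<noteq> 0}"
  define J where "J = {i. g i \<noteq> 0}"
  have "I \<subseteq> {..K}" "J \<subseteq> {..K'}" using cK gK by (auto simp: I_def J_def not_less[symmetric])
  hence fin: "finite I" "finite J" using finite_subset by blast+
  have ne: "0 \<in> I" "0 \<in> J" using c0 g0 by (auto simp: I_def J_def)
  obtain i0 where i0: "i0 \<in> I" "\<And>j. j \<in> I \<Longrightarrow> mc i0 \<le> mc j" "\<And>j. j \<in> I \<Longrightarrow> j < i0 \<Longrightarrow> mc i0 < mc j"
    using ex_first_min[of I mc] fin ne by blast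
  obtain j0 where j0: "j0 \<in> J" "\<And>j. j \<in> J \<Longrightarrow> mg j0 \<le> mg j" "\<And>j. j \<in> J \<Longrightarrow> j < j0 \<Longrightarrow> mg j0 < mg j"
    using ex_first_min[of J mg] fin ne by blast
  have cn: "c n \<noteq> 0" using n by auto
  hence "?v (c n) < (s * n + 1) div 2" using n vle by force
  hence "2 * ?v (c n) < s * n" by linarith
  hence "2 * int (?v (c n)) < int s * int n" by (metis of_nat_less_iff of_nat_mult of_nat_numeral)
  hence "mc n < 0" by (simp add: mc_def)
  hence mc0: "mc i0 < 0" using i0(2)[of n] cn by (simp add: I_def)
  have "mg 0 = 0" using g0 by (simp add: mg_def)
  hence mg0: "mg j0 \<le> 0" using j0(2)[OF ne(2)] by simp
  define e where "e = ?v (c i0) + ?v (g j0)"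
  let ?N = "i0 + j0"
  \<comment> \<open>Taking the first minimum of each factor makes (i0, j0) the only pair of least
    value among those with this index sum, so its term cannot be cancelled.\<close>
  have rest: "int p ^ Suc e dvd c i * g (?N - i)" if "i \<in> {..?N} - {i0}" for i
  proof (cases "c i = 0 \<or> g (?N - i) = 0")
    case False
    have "mc i0 + mg j0 < mc i + mg (?N - i)"
    proof (cases "i < i0")
      case True
      thus ?thesis using i0(3)[of i] j0(2)[of "?N - i"] False by (simp add: I_def J_def)
    next
      case F: False
      hence "?N - i < j0" using that by auto
      thus ?thesis using i0(2)[of i] j0(3)[of "?N - i"] False by (simp add: I_def J_def)
    qed
    moreover have "int s * int i + int s * int (?N - i) = int s * int i0 + int s * int j0"
      using that by (simp flip: distrib_left of_nat_add)
    ultimately have "int e < int (?v (c i)) + int (?v (g (?N - i)))"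
      by (simp add: mc_def mg_def e_def)
    hence "Suc e \<le> ?v (c i * g (?N - i))"
      using False pi by (simp add: prime_elem_multiplicity_mult_distrib)
    thus ?thesis using vle[of "c i * g (?N - i)" "Suc e"] False by (simp del: power_Suc)
  qed auto
  have "2 * e < s * ?N"
  proof -
    have "2 * int e < int s * int ?N" using mc0 mg0 by (simp add: mc_def mg_def e_def ring_distribs)
    thus ?thesis by (metis of_nat_less_iff of_nat_mult of_nat_numeral)
  qed
  hence "Suc e \<le> (s * ?N + 1) div 2" by linarith
  hence "int p ^ Suc e dvd r ?N" using div[of ?N] by (meson dvd_trans le_imp_power_dvd)
  moreover have "r ?N = c i0 * g j0 + (\<Sum>i\<in>{..?N} - {i0}. c i * g (?N - i))"
    unfolding r by (subst sum.remove[of _ i0]) auto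
  moreover have "int p ^ Suc e dvd (\<Sum>i\<in>{..?N} - {i0}. c i * g (?N - i))" by (rule dvd_sum) (rule rest)
  ultimately have "int p ^ Suc e dvd c i0 * g j0" by (simp add: dvd_add_left_iff)
  moreover have "c i0 * g j0 \<noteq> 0" using i0(1) j0(1) by (simp add: I_def J_def)
  ultimately have "Suc e \<le> ?v (c i0 * g j0)" using vle by blast
  thus False using i0(1) j0(1) pi by (simp add: prime_elem_multiplicity_mult_distrib e_def I_def J_def)
qed

text \<open>Integral coefficients whose valuations lie on or above the line of slope s/2; the
  exponent is s n / 2 rounded up.\<close>

definition ssdiv :: "nat \<Rightarrow> nat \<Rightarrow> complex fps \<Rightarrow> bool" where
  "ssdiv p s F \<longleftrightarrow> (\<forall>n. \<exists>z::int. fps_nth F n = of_int z \<and> int p ^ ((s * n + 1) div 2) dvd z)"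

lemma ssdiv_mult: assumes "ssdiv p s F" "ssdiv p s G" shows "ssdiv p s (F * G)"
  unfolding ssdiv_def
proof
  fix n
  obtain zf where zf: "\<And>n. fps_nth F n = of_int (zf n)" "\<And>n. int p ^ ((s * n + 1) div 2) dvd zf n"
    using assms(1) unfolding ssdiv_def by metis
  obtain zg where zg: "\<And>n. fps_nth G n = of_int (zg n)" "\<And>n. int p ^ ((s * n + 1) div 2) dvd zg n"
    using assms(2) unfolding ssdiv_def by metis
  have "fps_nth (F * G) n = of_int (\<Sum>i=0..n. zf i * zg (n - i))" by (simp add: fps_mult_nth zf zg)
  moreover have "int p ^ ((s * n + 1) div 2) dvd (\<Sum>i=0..n. zf i * zg (n - i))"
  proof (rule dvd_sum)
    fix i assume i: "i \<in> {0..n}"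
    have "s * n = s * i + s * (n - i)" using i by (simp flip: distrib_left)
    hence "(s * n + 1) div 2 \<le> (s * i + 1) div 2 + (s * (n - i) + 1) div 2" by linarith
    hence "int p ^ ((s * n + 1) div 2) dvd int p ^ ((s * i + 1) div 2) * int p ^ ((s * (n - i) + 1) div 2)"
      by (simp add: le_imp_power_dvd flip: power_add)
    thus "int p ^ ((s * n + 1) div 2) dvd zf i * zg (n - i)" using mult_dvd_mono[OF zf(2) zg(2)] dvd_trans by blast
  qed
  ultimately show "\<exists>z. fps_nth (F * G) n = of_int z \<and> int p ^ ((s * n + 1) div 2) dvd z" by blast
qed

lemma ssdiv_1: "ssdiv p s 1"
  unfolding ssdiv_def by (metis dvd_0_right of_int_0 of_int_1 fps_one_nth mult_0_right add_0 div_less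
      one_less_numeral_iff semiring_norm(76) power_0 dvd_refl One_nat_def)

lemma ssdiv_power: "ssdiv p s F \<Longrightarrow> ssdiv p s (F ^ k)"
  by (induction k) (auto intro: ssdiv_1 ssdiv_mult)

lemma integral_quotient:
  fixes F G :: "complex fps"
  assumes "\<And>n. fps_nth F n \<in> \<int>" "\<And>n. fps_nth (F * G) n \<in> \<int>" "fps_nth F 0 = 1"
  shows "fps_nth G n \<in> \<int>"
proof (induction n rule: less_induct)
  case (less n)
  have "fps_nth (F * G) n = fps_nth G n + (\<Sum>i=1..n. fps_nth F i * fps_nth G (n - i))"
    unfolding fps_mult_nth by (subst sum.atLeast_Suc_atMost) (simp_all add: assms(3) One_nat_def)
  moreover have "(\<Sum>i=1..n. fps_nth F i * fps_nth G (n - i)) \<in> \<int>"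
    using less assms(1) by (intro Ints_sum Ints_mult) auto
  ultimately show ?case using assms(2)[of n] by (metis Ints_diff add_diff_cancel_right')
qed

lemma recipX_nth_size:
  "fps_nth (recipX N) (size N) = (\<Prod>x\<in>#N. - x)" "n > size N \<Longrightarrow> fps_nth (recipX N) n = 0"
proof -
  have "poly (prodX N) 0 = (\<Prod>x\<in>#N. - x)"
    by (induction N) (simp_all del: mult_pCons_left)
  thus "fps_nth (recipX N) (size N) = (\<Prod>x\<in>#N. - x)"
    by (simp add: recipX_def coeff_reflect_poly poly_0_coeff_0)
  show "n > size N \<Longrightarrow> fps_nth (recipX N) n = 0"
    by (simp add: recipX_def coeff_reflect_poly)
qed

text \<open>\<open>1 - x T\<close> divides \<open>1 - x\<^sup>m T\<^sup>m\<close>, so the reciprocal polynomial divides a power of \<open>1 - B T\<^sup>m\<close>.\<close>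

lemma recipX_cofactor:
  assumes "\<And>x. x \<in># N \<Longrightarrow> x ^ m = B" "m \<ge> 1"
  obtains G :: "complex poly" where
    "recipX N * fps_of_poly G = (1 - fps_const B * fps_X ^ m) ^ size N" "Polynomial.coeff G 0 = 1"
proof -
  define g where "g x = (\<Sum>i<m. Polynomial.monom (x ^ i) i)" for x :: complex
  have g: "(1 - fps_const x * fps_X) * fps_of_poly (g x) = 1 - fps_const (x ^ m) * fps_X ^ m" for x
  proof -
    have "fps_of_poly (g x) = (\<Sum>i<m. (fps_const x * fps_X) ^ i)"
      by (simp add: g_def fps_of_poly_sum fps_of_poly_monom power_mult_distrib fps_const_power)
    thus ?thesis using power_diff_1_eq[of "fps_const x * fps_X" m]
      by (simp add: power_mult_distrib fps_const_power algebra_simps)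
  qed
  have main: "recipX N * fps_of_poly (\<Prod>x\<in>#N. g x) = (1 - fps_const B * fps_X ^ m) ^ size N"
    using assms(1)
  proof (induction N)
    case empty
    thus ?case by (simp add: recipX_def)
  next
    case (add x N)
    have "recipX (add_mset x N) * fps_of_poly (\<Prod>x\<in>#add_mset x N. g x) =
        ((1 - fps_const x * fps_X) * fps_of_poly (g x)) * (recipX N * fps_of_poly (\<Prod>x\<in>#N. g x))"
      by (simp add: recipX_add fps_of_poly_mult mult_ac)
    thus ?case using add by (simp add: g)
  qed
  have "fps_nth (recipX N * fps_of_poly (\<Prod>x\<in>#N. g x)) 0 = fps_nth ((1 - fps_const B * fps_X ^ m) ^ size N) 0"
    by (simp only: main)
  moreover have "(0::complex) ^ m = 0" using assms(2) by (cases m) auto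
  ultimately have "Polynomial.coeff (\<Prod>x\<in>#N. g x) 0 = 1"
    using recipX_nth0[of N] by (simp add: fps_mult_nth fps_power_zeroth)
  thus ?thesis using that main by blast
qed

context alg_closed_char
begin

text \<open>Over a field containing everything in sight all Frobenius eigenvalues of one character
  coincide, because the fourth powers of the character sums are known.\<close>

lemma exp_sum_eigenvalue:
  assumes c: "c \<noteq> 0" "c \<in> GF M" and M: "M \<ge> 1"
    and f: "\<And>i. Polynomial.coeff f i \<in> GF M" "Polynomial.degree f \<ge> 1" "\<not> p dvd Polynomial.degree f"
    and p4: "\<And>n. n \<ge> 1 \<Longrightarrow> M dvd n \<Longrightarrow>
      (\<Sum>x\<in>GF n. chi (T n (c * poly f x))) ^ 4 = of_nat (p ^ (2 * n) * p ^ (4 * h))"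
    and l: "l \<ge> 1"
  shows "(\<Sum>x\<in>GF (M * (4 * l)). chi (T (M * (4 * l)) (c * poly f x))) = - of_nat (p ^ h) * of_nat (p ^ (2 * M)) ^ l"
proof -
  interpret A: AS_sums p ty M f "{c}"
    by unfold_locales (use c M f in \<open>auto simp: GF_def\<close>)
  have S: "A.EP.S n = (\<Sum>x\<in>GF (M * n). chi (T (M * n) (c * poly f x)))" if "n \<ge> 1" for n
  proof -
    have "{c} \<inter> GF (M * n) = {c}" using c GF_mult by auto
    thus ?thesis using A.EP_S[OF that] by simp
  qed
  obtain N where N: "0 \<notin># N" "\<And>n. n \<ge> 1 \<Longrightarrow> A.EP.S n = - (\<Sum>x\<in>#N. x ^ n)"
    using exponential_roots[OF A.EP.fps_deriv_A A.EP.A_0 A.A_eventually_0] by blast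
  have "(\<Sum>x\<in>#N. x ^ n) ^ 4 = of_nat ((p ^ h) ^ 4) * of_nat (p ^ (2 * M)) ^ n" if n: "n \<ge> 1" for n
  proof -
    have "(\<Sum>x\<in>#N. x ^ n) ^ 4 = A.EP.S n ^ 4" using N(2)[OF n] by simp
    also have "\<dots> = of_nat (p ^ (2 * (M * n)) * p ^ (4 * h))"
      unfolding S[OF n] by (rule p4) (use A.bn_pos[OF n] in auto)
    also have "\<dots> = of_nat ((p ^ h) ^ 4) * of_nat (p ^ (2 * M)) ^ n"
      by (simp add: mult_ac flip: power_mult)
    finally show ?thesis .
  qed
  then obtain \<beta> where b: "N = replicate_mset (p ^ h) \<beta>" "\<beta> ^ 4 = of_nat (p ^ (2 * M))"
    using power_sum_fourth_power[OF N(1)] by (metis of_nat_eq_0_iff p_pos power_not_zero p_neq0 zero_less_power)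
  \<comment> \<open>Only \<beta>^4 is known, so the sum is evaluated over extensions whose degree is
    a multiple of 4.\<close>
  have "4 * l \<ge> 1" using l by simp
  hence "A.EP.S (4 * l) = - of_nat (p ^ h) * of_nat (p ^ (2 * M)) ^ l"
    using N(2)[of "4 * l"] b by (simp add: power_mult)
  thus ?thesis using S[OF \<open>4 * l \<ge> 1\<close>] by simp
qed

text \<open>The sums are explicit only over large extensions, while eigenvalues over the base field
  are wanted. The m-th powers of the latter are the eigenvalues over the extension of degree m, and
  comparing power sums there yields both their common value and their number.\<close>

lemma L_roots:
  fixes a :: "nat \<Rightarrow> nat \<Rightarrow> 'b"
  assumes f: "f = (\<Sum>i\<le>k. \<Sum>j\<le>k. Polynomial.monom (a i j) (p ^ i + p ^ j))"
    and fnz: "f \<noteq> 0" and cop: "coprime (Polynomial.degree f) p"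
    and s: "s \<ge> 1" "\<And>i j. a i j \<in> GF s" and u: "u \<ge> 1"
  obtains \<alpha> :: "complex multiset" and m where "m \<ge> 1" "even m" "0 \<notin># \<alpha>" "size \<alpha> = (p ^ u - 1) * (Polynomial.degree f - 1)"
    "\<And>x. x \<in># \<alpha> \<Longrightarrow> x ^ m = of_nat (p ^ (s * m div 2))"
    "Abs_fps (\<lambda>n. of_int (L_coeff s u f n)) = recipX \<alpha>"
proof -
  obtain h where h: "h \<le> k" "Polynomial.degree f = 1 + p ^ h" "a 0 h + a h 0 \<noteq> 0"
    "\<And>i j. i \<le> k \<Longrightarrow> j \<le> k \<Longrightarrow> i > h \<or> j > h \<Longrightarrow> a i j + a j i = 0"
    using degree_two_term_form[OF f fnz cop] by blast
  define C where "C = GF u - {0}"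
  have finC: "finite C" using finite_GF[OF u] by (simp add: C_def)
  have cardC: "card C = p ^ u - 1"
    unfolding C_def using card_GF[OF u] finite_GF[OF u] by (simp add: GF_closed)
  have "\<exists>N. N \<ge> 1 \<and> s dvd N \<and> c \<in> GF N \<and> (\<forall>n. n \<ge> 1 \<longrightarrow> N dvd n \<longrightarrow>
    (\<Sum>x\<in>GF n. chi (T n (c * poly f x))) ^ 4 = of_nat (p ^ (2 * n) * p ^ (4 * h)))" if "c \<in> C" for c
  proof -
    have "c \<in> GF u" "c \<noteq> 0" using that by (auto simp: C_def)
    show ?thesis
    proof (rule exp_sum_power4[OF f h(1,3,4) s \<open>c \<in> GF u\<close> u \<open>c \<noteq> 0\<close>])
      fix N assume "N \<ge> 1" "s dvd N" "c \<in> GF N" "\<And>n. n \<ge> 1 \<Longrightarrow> N dvd n \<Longrightarrow>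
        (\<Sum>x\<in>GF n. chi (T n (c * poly f x))) ^ 4 = of_nat (p ^ (2 * n) * p ^ (4 * h))"
      thus ?thesis by (intro exI[of _ N] conjI allI impI)
    qed
  qed
  then obtain N where N: "\<And>c. c \<in> C \<Longrightarrow> N c \<ge> 1" "\<And>c. c \<in> C \<Longrightarrow> c \<in> GF (N c)"
    "\<And>c n. c \<in> C \<Longrightarrow> n \<ge> 1 \<Longrightarrow> N c dvd n \<Longrightarrow>
    (\<Sum>x\<in>GF n. chi (T n (c * poly f x))) ^ 4 = of_nat (p ^ (2 * n) * p ^ (4 * h))"
    using bchoice[of C "\<lambda>c N. N \<ge> 1 \<and> s dvd N \<and> c \<in> GF N \<and> (\<forall>n. n \<ge> 1 \<longrightarrow> N dvd n \<longrightarrow>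
    (\<Sum>x\<in>GF n. chi (T n (c * poly f x))) ^ 4 = of_nat (p ^ (2 * n) * p ^ (4 * h)))"] by blast
  \<comment> \<open>A common multiple of the degrees that work for the finitely many parameters
    c.\<close>
  define m1 where "m1 = (\<Prod>c\<in>C. N c)"
  define M where "M = s * m1"
  have m1: "m1 \<ge> 1" unfolding m1_def using N(1) by (intro prod_ge_1) auto
  have M: "M \<ge> 1" using s m1 mult_le_mono[of 1 s 1 m1] by (simp add: M_def)
  have NM: "N c dvd M" if "c \<in> C" for c
    unfolding M_def m1_def using dvd_prodI[OF finC that, of N] by (rule dvd_mult)
  have fs: "Polynomial.coeff f i \<in> GF s" for i
    unfolding f coeff_sum by (intro GF_sum) (auto intro: GF_closed s)
  have fM: "Polynomial.coeff f i \<in> GF M" for i using fs GF_mult by (simp add: M_def)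
  have deg: "Polynomial.degree f \<ge> 1" "\<not> p dvd Polynomial.degree f"
    using h cop p_gt1 by (auto dest: coprime_common_divisor_nat)
  have S4: "(\<Sum>x\<in>GF (M * (4 * l)). chi (T (M * (4 * l)) (c * poly f x))) = - of_nat (p ^ h) * of_nat (p ^ (2 * M)) ^ l"
    if "c \<in> C" "l \<ge> 1" for c l
  proof (rule exp_sum_eigenvalue[OF _ _ M fM deg])
    show "c \<noteq> 0" "c \<in> GF M" using that N(2) GF_dvd[OF NM] by (auto simp: C_def)
    show "(\<Sum>x\<in>GF n. chi (T n (c * poly f x))) ^ 4 = of_nat (p ^ (2 * n) * p ^ (4 * h))"
      if "n \<ge> 1" "M dvd n" for n using N(3)[OF \<open>c \<in> C\<close> that(1)] NM[OF \<open>c \<in> C\<close>] that(2) dvd_trans by blast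
  qed (use that in auto)
  interpret A: AS_sums p ty s f C
  proof unfold_locales
    show "c ^ p ^ s \<in> C" if "c \<in> C" for c using that by (auto simp: C_def GF_closed)
  qed (use s fs deg finC in \<open>auto simp: C_def\<close>)
  have S: "A.EP.S n = of_nat (card (curve_points u f (s * n))) - of_nat (p ^ s) ^ n" if "n \<ge> 1" for n
    using card_curve_points[OF fs dvd_triv_left A.bn_pos[OF that] u] A.EP_S[OF that]
    by (simp add: C_def power_mult)
  have "Abs_fps A.EP.A = fps_exp 1 oo Abs_fps (\<lambda>i. A.EP.S i / of_nat i)"
    by (rule fps_exp_oo_unique[symmetric, OF A.EP.fps_deriv_A]) (simp add: A.EP.A_0)
  also have "(\<lambda>i. A.EP.S i / of_nat i) =
     (\<lambda>i. (of_nat (card (curve_points u f (s * i))) - of_nat (p ^ s) ^ i) / of_nat i)"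
  proof
    fix i show "A.EP.S i / of_nat i = (of_nat (card (curve_points u f (s * i))) - of_nat (p ^ s) ^ i) / of_nat i"
      using S[of i] by (cases "i = 0") auto
  qed
  also have "fps_exp 1 oo Abs_fps \<dots> = Abs_fps (\<lambda>n. of_int (L_coeff s u f n))"
    by (rule L_series_integral[OF fs s(1)])
  finally have L: "Abs_fps A.EP.A = Abs_fps (\<lambda>n. of_int (L_coeff s u f n))" .
  obtain \<alpha> where al: "0 \<notin># \<alpha>" "Abs_fps A.EP.A = recipX \<alpha>" "\<And>n. n \<ge> 1 \<Longrightarrow> A.EP.S n = - (\<Sum>x\<in>#\<alpha>. x ^ n)"
    using exponential_roots[OF A.EP.fps_deriv_A A.EP.A_0 A.A_eventually_0] by metis
  \<comment> \<open>The sums are known for multiples of 4; moreover s m / 2 is then the integer 2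
    M.\<close>
  define m where "m = 4 * m1"
  define g2 where "g2 = (p ^ u - 1) * p ^ h"
  define B where "B = (of_nat (p ^ (2 * M)) :: complex)"
  have "image_mset (\<lambda>x. x ^ m) \<alpha> = replicate_mset g2 B"
  proof (rule power_sums_inj)
    fix l :: nat assume l: "l \<ge> 1"
    have ml: "m * l \<ge> 1" using m1 l mult_le_mono[of 1 m 1 l] by (simp add: m_def)
    have e: "s * (m * l) = M * (4 * l)" by (simp add: m_def M_def)
    have "C \<inter> GF (s * (m * l)) = C" using N(2) NM GF_dvd dvd_mult2 unfolding e by blast
    hence "A.EP.S (m * l) = (\<Sum>c\<in>C. - of_nat (p ^ h) * B ^ l)"
      using A.EP_S[OF ml] S4 l unfolding e B_def by simp
    also have "\<dots> = - (of_nat g2 * B ^ l)" by (simp add: cardC g2_def)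
    finally have "(\<Sum>x\<in>#\<alpha>. x ^ (m * l)) = of_nat g2 * B ^ l" using al(3)[OF ml] by simp
    thus "(\<Sum>x\<in>#image_mset (\<lambda>x. x ^ m) \<alpha>. x ^ l) = (\<Sum>x\<in>#replicate_mset g2 B. x ^ l)"
      by (simp add: image_mset.compositionality comp_def flip: power_mult)
  next
    show "0 \<notin># image_mset (\<lambda>x. x ^ m) \<alpha>" using al(1) m1 by (auto simp: m_def)
  qed (auto simp: B_def)
  note im = this
  have "x ^ m = of_nat (p ^ (s * m div 2))" if "x \<in># \<alpha>" for x
  proof -
    have "x ^ m \<in># image_mset (\<lambda>x. x ^ m) \<alpha>" using that by simp
    hence "x ^ m = B" unfolding im by (auto split: if_splits)
    moreover have "s * m div 2 = 2 * M" by (simp add: m_def M_def)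
    ultimately show ?thesis by (simp add: B_def)
  qed
  moreover have "size \<alpha> = g2" using arg_cong[OF im, of size] by simp
  ultimately show ?thesis using that[of m \<alpha>] m1 al L h(2) by (simp add: m_def g2_def)
qed

text \<open>The cofactor of the L-polynomial in a power of 1 - B T^m has integral coefficients, so
  the valuation bound obvious for that power descends to the L-polynomial. The leading coefficient
  is, up to sign, the product of the eigenvalues.\<close>

theorem L_polynomial_supersingular:
  fixes a :: "nat \<Rightarrow> nat \<Rightarrow> 'b"
  assumes f: "f = (\<Sum>i\<le>k. \<Sum>j\<le>k. Polynomial.monom (a i j) (p ^ i + p ^ j))"
    and fnz: "f \<noteq> 0" and cop: "coprime (Polynomial.degree f) p"
    and s: "s \<ge> 1" "\<And>i j. a i j \<in> GF s" and u: "u \<ge> 1"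
  obtains P :: "int poly" where
    "fps_of_poly (map_poly of_int P) = (fps_exp 1 oo Abs_fps (\<lambda>i.
       (of_nat (card (curve_points u f (s * i))) - of_nat (p ^ s) ^ i) / of_nat i) :: rat fps)"
    "Polynomial.coeff P 0 = 1" "Polynomial.degree P = (p ^ u - 1) * (Polynomial.degree f - 1)"
    "\<And>i. int p ^ ((s * i + 1) div 2) dvd Polynomial.coeff P i"
    "2 * multiplicity (int p) (Polynomial.lead_coeff P) = s * Polynomial.degree P"
proof -
  obtain \<alpha> :: "complex multiset" and m where al: "m \<ge> 1" "even m" "0 \<notin># \<alpha>" "size \<alpha> = (p ^ u - 1) * (Polynomial.degree f - 1)"
    "\<And>x. x \<in># \<alpha> \<Longrightarrow> x ^ m = of_nat (p ^ (s * m div 2))"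
    "Abs_fps (\<lambda>n. of_int (L_coeff s u f n)) = recipX \<alpha>"
    by (rule L_roots[OF f fnz cop s u]) (rule that)
  let ?c = "L_coeff s u f"
  let ?K = "size \<alpha>"
  have c: "of_int (?c n) = fps_nth (recipX \<alpha>) n" for n
    using arg_cong[OF al(6), of "\<lambda>F. fps_nth F n"] by simp
  have cz: "?c n = 0" if "n > ?K" for n
    using c[of n] recipX_nth_size(2)[OF that] by (metis of_int_eq_0_iff)
  have c0: "?c 0 = 1" using c[of 0] recipX_nth0[of \<alpha>] by (metis of_int_eq_1_iff)
  have cK: "of_int (?c ?K) = (\<Prod>x\<in>#\<alpha>. - x)" using c recipX_nth_size(1) by metis
  have "(\<Prod>x\<in>#\<alpha>. - x) \<noteq> 0" using al(3) by (auto simp: prod_mset_zero_iff)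
  hence cKnz: "?c ?K \<noteq> 0" using cK by auto
  define B where "B = (of_nat (p ^ (s * m div 2)) :: complex)"
  obtain G where G: "recipX \<alpha> * fps_of_poly G = (1 - fps_const B * fps_X ^ m) ^ ?K" "Polynomial.coeff G 0 = 1"
    using recipX_cofactor[of \<alpha> m B] al by (auto simp: B_def)
  have "ssdiv p s (1 - fps_const B * fps_X ^ m)"
    unfolding ssdiv_def
  proof
    fix n
    define z where "z = (if n = 0 then 1 else if n = m then - int (p ^ (s * m div 2)) else 0)"
    have "fps_nth (1 - fps_const B * fps_X ^ m) n = of_int z"
      using al(1) by (auto simp: z_def B_def)
    moreover have "(s * m + 1) div 2 = s * m div 2" using al(2) by auto
    hence "int p ^ ((s * n + 1) div 2) dvd z" by (auto simp: z_def)
    ultimately show "\<exists>z. fps_nth (1 - fps_const B * fps_X ^ m) n = of_int z \<and> int p ^ ((s * n + 1) div 2) dvd z"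
      by blast
  qed
  hence "ssdiv p s (recipX \<alpha> * fps_of_poly G)" unfolding G by (rule ssdiv_power)
  then obtain r where r: "\<And>n. fps_nth (recipX \<alpha> * fps_of_poly G) n = of_int (r n)"
      "\<And>n. int p ^ ((s * n + 1) div 2) dvd r n"
    unfolding ssdiv_def by metis
  have "fps_nth (fps_of_poly G) n \<in> \<int>" for n
    by (rule integral_quotient[of "recipX \<alpha>"]) (simp_all add: r(1) recipX_nth0 flip: c)
  hence "\<exists>z. Polynomial.coeff G n = of_int z" for n by (auto elim: Ints_cases)
  then obtain g where g: "\<And>n. Polynomial.coeff G n = of_int (g n)" by metis
  have dv: "int p ^ ((s * n + 1) div 2) dvd ?c n" for n
  proof (rule gauss_norm_factor[OF prime_p, where c = ?c and g = g and r = r and K = ?K and K' = "Polynomial.degree G"])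
    show "g 0 = 1" using G(2) g[of 0] by (metis of_int_eq_1_iff)
    show "g i = 0" if "i > Polynomial.degree G" for i
      using coeff_eq_0[OF that] g[of i] by (metis of_int_eq_0_iff)
    show "r n = (\<Sum>i\<le>n. ?c i * g (n - i))" for n
    proof -
      have "of_int (r n) = (of_int (\<Sum>i\<le>n. ?c i * g (n - i)) :: complex)"
        unfolding r(1)[symmetric] fps_mult_nth by (simp add: c g atMost_atLeast0)
      thus ?thesis by (simp only: of_int_eq_iff)
    qed
  qed (use c0 cz r in auto)
  define P where "P = Abs_poly ?c"
  have "\<forall>\<^sub>\<infinity>n. ?c n = 0" using cz unfolding MOST_nat by blast
  hence cP: "Polynomial.coeff P n = ?c n" for n unfolding P_def by (simp add: Abs_poly_inverse)
  have degP: "Polynomial.degree P = ?K"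
    by (rule antisym) (auto intro!: degree_le le_degree simp: cP cz cKnz)
  have fs: "Polynomial.coeff f i \<in> GF s" for i
    unfolding f coeff_sum by (intro GF_sum) (auto intro: GF_closed s)
  show ?thesis
  proof (rule that[of P])
    show "fps_of_poly (map_poly of_int P) = (fps_exp 1 oo Abs_fps (\<lambda>i.
       (of_nat (card (curve_points u f (s * i))) - of_nat (p ^ s) ^ i) / of_nat i) :: rat fps)"
      unfolding L_series_integral[OF fs s(1)] by (rule fps_ext) (simp add: coeff_map_poly cP)
    \<comment> \<open>Raising to the even power m removes the signs and turns every eigenvalue into
      B, which fixes the valuation exactly.\<close>
    have "(?c ?K) ^ m = int p ^ (s * m div 2 * ?K)"
    proof -
      have "(\<Prod>x\<in>#\<alpha>. - x) ^ m = (\<Prod>x\<in>#\<alpha>. (- x) ^ m)" using al(2)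
        by (induction \<alpha>) (simp_all add: power_mult_distrib uminus_power_if)
      also have "\<dots> = (\<Prod>x\<in>#\<alpha>. B)" using al(2,5) by (intro arg_cong[of _ _ prod_mset] image_mset_cong) (simp add: B_def)
      also have "\<dots> = B ^ ?K" by simp
      finally have "of_int ((?c ?K) ^ m) = (of_int (int p ^ (s * m div 2 * ?K)) :: complex)"
        by (simp add: cK B_def power_mult)
      thus ?thesis by (simp only: of_int_eq_iff)
    qed
    hence "multiplicity (int p) ((?c ?K) ^ m) = s * m div 2 * ?K"
      using prime_p by (simp add: multiplicity_same_power prime_elem_not_unit)
    hence "m * multiplicity (int p) (?c ?K) = s * m div 2 * ?K"
      using prime_p cKnz by (simp add: prime_elem_multiplicity_power_distrib)
    hence "2 * (m * multiplicity (int p) (?c ?K)) = m * (s * ?K)"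
      using al(2) by (auto elim!: evenE)
    hence "m * (2 * multiplicity (int p) (?c ?K)) = m * (s * ?K)" by (metis mult.left_commute)
    thus "2 * multiplicity (int p) (Polynomial.lead_coeff P) = s * Polynomial.degree P"
      using al(1) unfolding degP cP by (metis mult_cancel1 not_one_le_zero)
  qed (use cP c0 degP al(4) dv in auto)
qed

end

section \<open>Expansions into Laurent series\<close>

locale rhom =
  fixes e :: "'a::comm_ring_1 \<Rightarrow> 'b::comm_ring_1"
  assumes hadd: "e (x + y) = e x + e y" and hmult: "e (x * y) = e x * e y" and h1: "e 1 = 1"
begin

lemma h0: "e 0 = 0" using hadd[of 0 0] by simp

lemma hminus: "e (- x) = - e x" using hadd[of x "- x"] h0 by (simp add: eq_neg_iff_add_eq_0 add.commute)

lemma hdiff: "e (x - y) = e x - e y" using hadd[of x "- y"] hminus[of y] by simp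

lemma hpower: "e (x ^ n) = e x ^ n" by (induction n) (auto simp: h1 hmult)

lemma hsum: "e (sum g A) = (\<Sum>x\<in>A. e (g x))"
  by (induction A rule: infinite_finite_induct) (auto simp: h0 hadd)

lemma hof_nat: "e (of_nat n) = of_nat n" by (induction n) (auto simp: h0 h1 hadd)

end

lemma rhom_inj:
  fixes e :: "'a::field \<Rightarrow> 'b::comm_ring_1"
  assumes "rhom e" shows "e x = 0 \<longleftrightarrow> x = 0"
proof
  interpret rhom e by fact
  assume "e x = 0"
  show "x = 0"
  proof (rule ccontr)
    assume "x \<noteq> 0"
    hence "e x * e (inverse x) = 1" using hmult[of x "inverse x"] h1 by simp
    thus False using \<open>e x = 0\<close> by simp
  qed
qed (use assms rhom.h0 in auto)

definition ev1 :: "('a::comm_ring_1 \<Rightarrow> 'b::comm_ring_1) \<Rightarrow> 'b \<Rightarrow> 'a poly \<Rightarrow> 'b" where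
  "ev1 e \<xi> g = poly (map_poly e g) \<xi>"

text \<open>Elements of \<open>'a poly poly\<close> are read as polynomials in y over k[x]: the
  inner variable goes to \<xi>, the outer one to \<eta>.\<close>

definition ev2 :: "('a::comm_ring_1 \<Rightarrow> 'b::comm_ring_1) \<Rightarrow> 'b \<Rightarrow> 'b \<Rightarrow> 'a poly poly \<Rightarrow> 'b" where
  "ev2 e \<xi> \<eta> G = ev1 (ev1 e \<xi>) \<eta> G"

context rhom begin

lemma map_poly_hom_add: "map_poly e (g + h) = map_poly e g + map_poly e h"
  by (rule poly_eqI) (simp add: coeff_map_poly h0 hadd)

lemma map_poly_hom_mult: "map_poly e (g * h) = map_poly e g * map_poly e h"
  by (rule poly_eqI) (simp add: coeff_map_poly h0 hmult Polynomial.coeff_mult hsum)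

lemma rhom_ev1: "rhom (ev1 e \<xi>)"
proof
  have "map_poly e 1 = 1" by (rule poly_eqI) (simp add: coeff_map_poly h0 h1)
  thus "ev1 e \<xi> 1 = 1" by (simp add: ev1_def)
qed (simp_all add: ev1_def map_poly_hom_add map_poly_hom_mult)

lemma ev1_pCons: "ev1 e \<xi> (pCons c g) = e c + \<xi> * ev1 e \<xi> g"
  by (simp add: ev1_def map_poly_pCons h0)

lemma ev1_const [simp]: "ev1 e \<xi> [:c:] = e c" using ev1_pCons[of \<xi> c 0] by (simp add: ev1_def)

lemma ev1_X: "ev1 e \<xi> [:0, 1:] = \<xi>" by (simp add: ev1_pCons h0 h1 flip: one_pCons) (simp add: ev1_def map_poly_pCons h0 h1)

lemma ev1_monom: "ev1 e \<xi> (Polynomial.monom c n) = e c * \<xi> ^ n"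
  by (simp add: ev1_def map_poly_monom h0 poly_monom)

lemma ev1_sum: "ev1 e \<xi> g = (\<Sum>i\<le>Polynomial.degree g. e (Polynomial.coeff g i) * \<xi> ^ i)"
proof -
  interpret E: rhom "ev1 e \<xi>" by (rule rhom_ev1)
  have "ev1 e \<xi> g = ev1 e \<xi> (\<Sum>i\<le>Polynomial.degree g. Polynomial.monom (Polynomial.coeff g i) i)"
    by (simp add: poly_as_sum_of_monoms)
  thus ?thesis by (simp add: E.hsum ev1_monom)
qed

lemma rhom_ev2: "rhom (ev2 e \<xi> \<eta>)"
  unfolding ev2_def by (rule rhom.rhom_ev1[OF rhom_ev1])

lemma ev2_const [simp]: "ev2 e \<xi> \<eta> [:c:] = ev1 e \<xi> c"
  by (simp add: ev2_def rhom.ev1_const[OF rhom_ev1])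

lemma ev2_monom: "ev2 e \<xi> \<eta> (Polynomial.monom c n) = ev1 e \<xi> c * \<eta> ^ n"
  by (simp add: ev2_def rhom.ev1_monom[OF rhom_ev1])

lemma ev2_sum: "ev2 e \<xi> \<eta> G = (\<Sum>j\<le>Polynomial.degree G. ev1 e \<xi> (Polynomial.coeff G j) * \<eta> ^ j)"
  by (simp add: ev2_def rhom.ev1_sum[OF rhom_ev1])

end

section \<open>Hensel's lemma and orders of sums of Laurent series\<close>

lemma poly_taylor:
  fixes P :: "'a::idom poly"
  shows "\<exists>R. poly P (x + h) = poly P x + h * poly (pderiv P) x + h\<^sup>2 * R"
proof (induction P)
  case (pCons c P)
  then obtain R where R: "poly P (x + h) = poly P x + h * poly (pderiv P) x + h\<^sup>2 * R" by blast
  have "poly (pCons c P) (x + h) = poly (pCons c P) x + h * poly (pderiv (pCons c P)) x +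
     h\<^sup>2 * (poly (pderiv P) x + x * R + h * R)"
    unfolding poly_pCons R pderiv_pCons poly_add by (simp add: algebra_simps power2_eq_square)
  thus ?case by blast
qed simp

text \<open>Coefficients are found one at a time: a correction c T^(n+1) changes the next
  coefficient of P(V) by c times the nonzero constant coefficient of P'(V), and leaves the earlier
  ones at zero.\<close>

lemma hensel_fps:
  fixes P :: "'a::field fps poly"
  assumes root: "fps_nth (poly P (fps_const u0)) 0 = 0"
    and simple: "fps_nth (poly (pderiv P) (fps_const u0)) 0 \<noteq> 0"
  obtains U where "poly P U = 0" "fps_nth U 0 = u0"
proof -
  have cong: "\<exists>R. poly Q (V + h) = poly Q V + h * R" for Q :: "'a fps poly" and V h
  proof -
    obtain R where "poly Q (V + h) = poly Q V + h * poly (pderiv Q) V + h\<^sup>2 * R" using poly_taylor by blast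
    hence "poly Q (V + h) = poly Q V + h * (poly (pderiv Q) V + h * R)" by (simp add: algebra_simps power2_eq_square)
    thus ?thesis by blast
  qed
  have nth0: "fps_nth (poly Q V) 0 = fps_nth (poly Q (fps_const u0)) 0" if "fps_nth V 0 = u0" for Q V
  proof -
    obtain R where "poly Q (fps_const u0 + (V - fps_const u0)) = poly Q (fps_const u0) + (V - fps_const u0) * R"
      using cong by blast
    thus ?thesis using that by simp
  qed
  define ok where "ok n V \<longleftrightarrow> fps_nth V 0 = u0 \<and> (\<forall>i\<le>n. fps_nth (poly P V) i = 0)" for n V
  have "\<exists>V. \<forall>n. ok n (V n) \<and> (\<forall>i\<le>n. fps_nth (V (Suc n)) i = fps_nth (V n) i)"
  proof (rule dependent_nat_choice)
    show "\<exists>V. ok 0 V" using root by (intro exI[of _ "fps_const u0"]) (simp add: ok_def)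
  next
    fix V n assume V: "ok n V"
    define c where "c = - fps_nth (poly P V) (Suc n) / fps_nth (poly (pderiv P) V) 0"
    define h where "h = fps_const c * fps_X ^ Suc n"
    obtain R where R: "poly P (V + h) = poly P V + h * poly (pderiv P) V + h\<^sup>2 * R" using poly_taylor by blast
    have d0: "fps_nth (poly (pderiv P) V) 0 \<noteq> 0" using nth0[of V] V simple by (simp add: ok_def)
    have hh: "h * poly (pderiv P) V + h\<^sup>2 * R =
       fps_X ^ Suc n * (fps_const c * poly (pderiv P) V + fps_X ^ Suc n * (fps_const c ^ 2 * R))"
      by (simp add: h_def algebra_simps power2_eq_square)
    have "fps_nth (poly P (V + h)) i = 0" if "i \<le> Suc n" for i
    proof (cases "i = Suc n")
      case True
      have "fps_nth (poly P (V + h)) i = fps_nth (poly P V) (Suc n) + c * fps_nth (poly (pderiv P) V) 0"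
        unfolding R add.assoc hh True by (simp only: fps_add_nth fps_X_power_mult_nth) simp
      thus ?thesis using d0 by (simp add: c_def)
    next
      case False
      hence "i \<le> n" using that by simp
      thus ?thesis unfolding R add.assoc hh using V by (simp only: fps_add_nth fps_X_power_mult_nth) (simp add: ok_def)
    qed
    moreover have "fps_nth (V + h) i = fps_nth V i" if "i \<le> n" for i
      using that by (simp add: h_def fps_X_power_mult_right_nth del: power_Suc)
    ultimately show "\<exists>V'. ok (Suc n) V' \<and> (\<forall>i\<le>n. fps_nth V' i = fps_nth V i)"
      using V by (intro exI[of _ "V + h"]) (auto simp: ok_def)
  qed
  then obtain V where V: "\<And>n. ok n (V n)" "\<And>n i. i \<le> n \<Longrightarrow> fps_nth (V (Suc n)) i = fps_nth (V n) i" by blast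
  have stab: "fps_nth (V (n + k)) i = fps_nth (V n) i" if "i \<le> n" for n k i
    using that by (induction k) (auto simp: V(2))
  define U where "U = Abs_fps (\<lambda>i. fps_nth (V i) i)"
  have UV: "fps_nth U i = fps_nth (V n) i" if "i \<le> n" for n i
    using stab[of i i "n - i"] that by (simp add: U_def)
  have "fps_nth (poly P U) n = 0" for n
  proof -
    have "fps_shift (Suc n) (U - V n) * fps_X ^ Suc n = U - V n"
      by (rule fps_ext) (auto simp: fps_X_power_mult_right_nth UV simp del: power_Suc)
    then obtain W where W: "U - V n = fps_X ^ Suc n * W" by (metis mult.commute)
    obtain R where R: "poly P (V n + (U - V n)) = poly P (V n) + (U - V n) * R" using cong by blast
    have "V n + (U - V n) = U" by simp
    hence "poly P U = poly P (V n) + fps_X ^ Suc n * (W * R)" using R unfolding W by (simp only: mult.assoc)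
    thus ?thesis using V(1)[of n] by (simp only: fps_add_nth fps_X_power_mult_nth) (simp add: ok_def)
  qed
  hence "poly P U = 0" by (intro fps_ext) simp
  moreover have "fps_nth U 0 = u0" using UV[of 0 0] V(1)[of 0] by (simp add: ok_def)
  ultimately show ?thesis using that by blast
qed

lemma fls_nth_sum: "fls_nth (sum F S) n = (\<Sum>i\<in>S. fls_nth (F i) n)"
  by (induction S rule: infinite_finite_induct) auto

text \<open>Without ties the term of lowest order cannot be cancelled.\<close>

lemma fls_sum_distinct:
  fixes F :: "'i \<Rightarrow> 'a::field fls"
  assumes "finite S" "S \<noteq> {}" "\<And>i. i \<in> S \<Longrightarrow> F i \<noteq> 0" "inj_on (\<lambda>i. fls_subdegree (F i)) S"
  shows "sum F S \<noteq> 0" "fls_subdegree (sum F S) = Min ((\<lambda>i. fls_subdegree (F i)) ` S)"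
proof -
  define m where "m = Min ((\<lambda>i. fls_subdegree (F i)) ` S)"
  have "m \<in> (\<lambda>i. fls_subdegree (F i)) ` S" unfolding m_def using assms by (intro Min_in) auto
  then obtain i0 where i0: "i0 \<in> S" "fls_subdegree (F i0) = m" by auto
  have le: "m \<le> fls_subdegree (F i)" if "i \<in> S" for i using that assms by (simp add: m_def)
  have lt: "m < fls_subdegree (F i)" if "i \<in> S - {i0}" for i
    using le[of i] that i0 assms(4) by (auto simp: inj_on_def order_less_le)
  have "fls_nth (sum F S) m = fls_nth (F i0) m + (\<Sum>i\<in>S - {i0}. fls_nth (F i) m)"
    unfolding fls_nth_sum using assms(1) i0(1) by (rule sum.remove)
  also have "(\<Sum>i\<in>S - {i0}. fls_nth (F i) m) = 0" using lt by (intro sum.neutral ballI) simp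
  finally have nz: "fls_nth (sum F S) m \<noteq> 0" using i0 assms(3)[OF i0(1)] nth_fls_subdegree_nonzero[of "F i0"] by simp
  thus "sum F S \<noteq> 0" by auto
  have "fls_nth (sum F S) k = 0" if "k < m" for k
    unfolding fls_nth_sum using that le by (intro sum.neutral ballI) force
  thus "fls_subdegree (sum F S) = Min ((\<lambda>i. fls_subdegree (F i)) ` S)"
    using nz fls_subdegree_eqI m_def by blast
qed

lemma rhom_fls_const: "rhom (fls_const :: 'a::field \<Rightarrow> 'a fls)"
  by unfold_locales (simp_all add: fls_plus_const)

lemma subdegree_ev1:
  fixes \<xi> :: "'b::field fls"
  assumes e: "rhom e" and \<xi>: "\<xi> \<noteq> 0" "fls_subdegree \<xi> < 0" and g: "g \<noteq> (0 :: 'a::field poly)"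
    and e0: "\<And>c. c \<noteq> 0 \<Longrightarrow> e c \<noteq> 0 \<and> fls_subdegree (e c) = 0"
  shows "ev1 e \<xi> g \<noteq> 0" "fls_subdegree (ev1 e \<xi> g) = fls_subdegree \<xi> * int (Polynomial.degree g)"
proof -
  interpret rhom e by fact
  define S where "S = {i. i \<le> Polynomial.degree g \<and> Polynomial.coeff g i \<noteq> 0}"
  have fin: "finite S" by (simp add: S_def)
  have dS: "Polynomial.degree g \<in> S" using g by (simp add: S_def)
  let ?F = "\<lambda>i. e (Polynomial.coeff g i) * \<xi> ^ i"
  have ev: "ev1 e \<xi> g = sum ?F S"
    unfolding ev1_sum by (rule sum.mono_neutral_right) (auto simp: S_def h0)
  have F: "?F i \<noteq> 0" "fls_subdegree (?F i) = fls_subdegree \<xi> * int i" if "i \<in> S" for i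
    using that e0[of "Polynomial.coeff g i"] \<xi> by (auto simp: S_def fls_subdegree_pow)
  have inj: "inj_on (\<lambda>i. fls_subdegree (?F i)) S" using F(2) \<xi> by (auto simp: inj_on_def)
  note D = fls_sum_distinct[OF fin _ F(1) inj]
  show "ev1 e \<xi> g \<noteq> 0" unfolding ev using D(1) dS by blast
  have "fls_subdegree (sum ?F S) = Min ((\<lambda>i. fls_subdegree (?F i)) ` S)" using D(2) dS by blast
  also have "(\<lambda>i. fls_subdegree (?F i)) ` S = (\<lambda>i. fls_subdegree \<xi> * int i) ` S" using F(2) by auto
  also have "Min \<dots> = fls_subdegree \<xi> * int (Polynomial.degree g)"
    using fin dS \<xi> by (intro Min_eqI) (auto simp: S_def intro!: mult_left_mono_neg)
  finally show "fls_subdegree (ev1 e \<xi> g) = fls_subdegree \<xi> * int (Polynomial.degree g)" unfolding ev .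
qed

lemma prime_power_coprime:
  fixes p :: nat
  assumes "Factorial_Ring.prime p" "\<not> p dvd d" shows "coprime (p ^ u) d"
  using assms by (simp add: prime_imp_coprime)

section \<open>The defining equation, pole orders at infinity and irreducibility\<close>

locale AS_curve =
  fixes p u q d :: nat and f :: "'a::{field,finite} poly"
  assumes prime_p: "Factorial_Ring.prime p" and CHAR_a: "CHAR('a) = p" and u: "u \<ge> 1" and q: "q = p ^ u"
    and d: "d = Polynomial.degree f" and d2: "d \<ge> 2" and pd: "\<not> p dvd d"
begin

lemma q2: "q \<ge> 2"
proof -
  have "p ^ 1 \<le> p ^ u" using u prime_gt_0_nat[OF prime_p] by (intro power_increasing) auto
  thus ?thesis using prime_ge_2_nat[OF prime_p] by (simp add: q)
qed

lemma coprime_qd: "coprime q d" unfolding q by (rule prime_power_coprime[OF prime_p pd])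

lemma p_dvd_q: "p dvd q" using u by (simp add: q dvd_power)

lemma of_nat_d: "(of_nat d :: 'a) \<noteq> 0" using pd CHAR_a of_nat_eq_0_iff_char_dvd by metis

lemma of_nat_q: "(of_nat q :: 'a) = 0" using p_dvd_q CHAR_a of_nat_eq_0_iff_char_dvd by metis

lemma lead_f: "Polynomial.coeff f d \<noteq> 0" using d d2 by auto

definition A :: "'a poly poly" where
  "A = Polynomial.monom 1 q - Polynomial.monom 1 1 - [:f:]"

lemma coeff_A: "Polynomial.coeff A i = (if i = q then 1 else if i = 1 then -1 else if i = 0 then - f else 0)"
  using q2 by (cases i) (auto simp: A_def)

lemma degree_A: "Polynomial.degree A = q"
  by (rule antisym; (rule degree_le le_degree)) (use q2 in \<open>auto simp: coeff_A\<close>)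

lemma A_nz: "A \<noteq> 0" using degree_A q2 by auto

lemma lead_A: "Polynomial.lead_coeff A = 1" by (simp add: degree_A coeff_A)

lemma div_A: "\<exists>B C. G = A * B + C \<and> (C = 0 \<or> Polynomial.degree C < q)"
proof -
  obtain B C where BC: "pseudo_divmod G A = (B, C)" by force
  have "G = A * B + C" using pseudo_divmod(1)[OF A_nz BC] unfolding lead_A by simp
  moreover have "C = 0 \<or> Polynomial.degree C < q" using pseudo_divmod(2)[OF A_nz BC] unfolding degree_A .
  ultimately show ?thesis by blast
qed

text \<open>A generic point of the curve with coordinates in \<open>'l\<close>: the constants are
  mapped by \<open>e\<close>, \<xi> is transcendental over them, and the pair satisfies the
  equation. Each such point gives an embedding of the function field.\<close>

definition sol :: "('a \<Rightarrow> 'l::field) \<Rightarrow> 'l \<Rightarrow> 'l \<Rightarrow> bool" where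
  "sol e \<xi> \<eta> \<longleftrightarrow> rhom e \<and> (\<forall>g. ev1 e \<xi> g = 0 \<longrightarrow> g = 0) \<and> \<eta> ^ q - \<eta> = ev1 e \<xi> f"

lemma ev2_A: "sol e \<xi> \<eta> \<Longrightarrow> ev2 e \<xi> \<eta> A = 0"
proof -
  assume s: "sol e \<xi> \<eta>"
  interpret e: rhom e using s by (simp add: sol_def)
  interpret E1: rhom "ev1 e \<xi>" by (rule e.rhom_ev1)
  interpret E2: rhom "ev2 e \<xi> \<eta>" by (rule e.rhom_ev2)
  show ?thesis using s unfolding A_def E2.hdiff e.ev2_monom e.ev2_const by (simp add: E1.h1 sol_def)
qed

text \<open>The weighted degree with weights q for x and d for y: the pole order at infinity of a
  polynomial of degree below q in y.\<close>

definition wd :: "'a poly poly \<Rightarrow> nat" where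
  "wd C = Max ((\<lambda>j. q * Polynomial.degree (Polynomial.coeff C j) + d * j) ` {j. Polynomial.coeff C j \<noteq> 0})"

lemma finite_coeffs: "finite {j. Polynomial.coeff C j \<noteq> (0::'c::zero)}"
  by (rule finite_subset[of _ "{..Polynomial.degree C}"]) (auto intro: le_degree)

lemma wd_le_iff: "C \<noteq> 0 \<Longrightarrow> wd C \<le> n \<longleftrightarrow> (\<forall>j. Polynomial.coeff C j \<noteq> 0 \<longrightarrow> q * Polynomial.degree (Polynomial.coeff C j) + d * j \<le> n)"
  unfolding wd_def using finite_coeffs[of C]
  by (subst Max_le_iff) (auto simp: poly_eq_iff)

text \<open>Equal weights make q divide d (j' - j), and q is coprime to d.\<close>

lemma wd_inj:
  assumes "q * a + d * j = q * b + d * j'" "j < q" "j' < q" shows "j = j'"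
proof -
  have "j = j'" if "q * a + d * j = q * b + d * j'" "j < q" "j' < q" "j \<le> j'" for a b j j'
  proof -
    have "d * j' = d * j + d * (j' - j)" using that by (simp flip: distrib_left)
    hence "q * a = q * b + d * (j' - j)" using that(1) by linarith
    hence "q dvd d * (j' - j)" by (metis dvd_add_right_iff dvd_triv_left)
    hence "q dvd j' - j" using coprime_qd by (simp add: coprime_dvd_mult_right_iff)
    thus ?thesis using that by (auto dest: dvd_imp_le)
  qed
  from this[of a j b j'] this[of b j' a j] show ?thesis using assms by (cases "j \<le> j'") auto
qed

text \<open>By \<open>wd_inj\<close> the contributions of different powers of y have different
  orders, so the largest pole survives.\<close>

lemma subdegree_ev2:
  fixes \<xi> \<eta> :: "'a fls"
  assumes s: "fls_subdegree \<xi> = - int q" "fls_subdegree \<eta> = - int d" and C: "C \<noteq> 0" "Polynomial.degree C < q"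
  shows "ev2 fls_const \<xi> \<eta> C \<noteq> 0" "fls_subdegree (ev2 fls_const \<xi> \<eta> C) = - int (wd C)"
proof -
  interpret e: rhom "fls_const :: 'a \<Rightarrow> 'a fls" by (rule rhom_fls_const)
  interpret E1: rhom "ev1 fls_const \<xi>" by (rule e.rhom_ev1)
  have xn: "\<xi> \<noteq> 0" "fls_subdegree \<xi> < 0" "\<eta> \<noteq> 0" using s q2 d2 by auto
  define S where "S = {j. Polynomial.coeff C j \<noteq> 0}"
  have fin: "finite S" unfolding S_def by (rule finite_coeffs)
  have ne: "S \<noteq> {}" using C(1) by (auto simp: S_def poly_eq_iff)
  let ?F = "\<lambda>j. ev1 fls_const \<xi> (Polynomial.coeff C j) * \<eta> ^ j"
  have sub: "S \<subseteq> {..Polynomial.degree C}" by (auto simp: S_def intro: le_degree)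
  have ev: "ev2 fls_const \<xi> \<eta> C = sum ?F S"
    unfolding e.ev2_sum by (rule sum.mono_neutral_right) (use sub in \<open>auto simp: S_def E1.h0\<close>)
  have F: "?F j \<noteq> 0" "fls_subdegree (?F j) = - int (q * Polynomial.degree (Polynomial.coeff C j) + d * j)" if "j \<in> S" for j
    using that subdegree_ev1[OF rhom_fls_const xn(1,2), of "Polynomial.coeff C j"] xn s
    by (auto simp: S_def fls_subdegree_pow fls_const_nonzero)
  have inj: "inj_on (\<lambda>j. fls_subdegree (?F j)) S"
  proof (rule inj_onI)
    fix i j assume ij: "i \<in> S" "j \<in> S" "fls_subdegree (?F i) = fls_subdegree (?F j)"
    have "i < q" "j < q" using ij sub C(2) by force+
    thus "i = j" using ij(3) F(2)[OF ij(1)] F(2)[OF ij(2)] wd_inj by (simp only: neg_equal_iff_equal of_nat_eq_iff)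
  qed
  note D = fls_sum_distinct[OF fin ne F(1) inj]
  show "ev2 fls_const \<xi> \<eta> C \<noteq> 0" unfolding ev by (rule D(1))
  have "fls_subdegree (sum ?F S) = Min ((\<lambda>j. fls_subdegree (?F j)) ` S)" by (rule D(2))
  also have "\<dots> = - int (wd C)"
  proof (rule Min_eqI)
    let ?w = "\<lambda>j. q * Polynomial.degree (Polynomial.coeff C j) + d * j"
    have "wd C \<in> ?w ` S" unfolding wd_def S_def[symmetric] using fin ne by (intro Max_in) auto
    then obtain j where "j \<in> S" "wd C = ?w j" by auto
    thus "- int (wd C) \<in> (\<lambda>j. fls_subdegree (?F j)) ` S" using F(2)[of j] by (intro image_eqI[of _ _ j]) simp_all
    fix y assume "y \<in> (\<lambda>j. fls_subdegree (?F j)) ` S"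
    then obtain j where j: "j \<in> S" "y = - int (?w j)" using F(2) by auto
    have "?w j \<le> wd C" unfolding wd_def S_def[symmetric] using fin j by (intro Max_ge) auto
    thus "- int (wd C) \<le> y" using j by linarith
  qed (use fin in simp)
  finally show "fls_subdegree (ev2 fls_const \<xi> \<eta> C) = - int (wd C)" unfolding ev .
qed

text \<open>
  A local parametrisation at the point at infinity: with a parameter \<open>w\<close> put \<open>y = l w\<^sup>-\<^sup>d\<close> and
  \<open>x = U w\<^sup>-\<^sup>q\<close>; clearing denominators, Hensel's lemma applies to \<open>U\<close> as \<open>p\<close> does not divide \<open>d\<close>.
\<close>

lemma ex_infinite_solution:
  obtains \<xi> \<eta> :: "'a fls" where "sol fls_const \<xi> \<eta>" "fls_subdegree \<xi> = - int q" "fls_subdegree \<eta> = - int d"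
proof -
  define a where "a = Polynomial.coeff f d"
  have a: "a \<noteq> 0" unfolding a_def by (rule lead_f)
  \<comment> \<open>With q i = d j + 1 the choices l = a^i and u0 = a^j satisfy a u0^d = l^q, the
    equation between leading coefficients.\<close>
  obtain i j where ij: "q * i = d * j + 1"
    using bezout_nat[of q d] q2 coprime_qd by (auto simp: coprime_iff_gcd_eq_1)
  define l where "l = a ^ i"
  define u0 where "u0 = a ^ j"
  have "l ^ q = a ^ (q * i)" by (simp add: l_def mult.commute flip: power_mult)
  moreover have "a * u0 ^ d = a ^ (d * j + 1)" by (simp add: u0_def power_add mult.commute flip: power_mult)
  ultimately have lu: "a * u0 ^ d = l ^ q" "l \<noteq> 0" "u0 \<noteq> 0" using ij a by (simp_all add: l_def u0_def)
  \<comment> \<open>The equation multiplied by w^(q d): the terms of f(U w^(-q)) become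
    \<open>c i\<close> times U^i, and the left side with y = l w^(-d) becomes
    \<open>rhs\<close>.\<close>
  define c where "c i = fps_const (Polynomial.coeff f i) * fps_X ^ (q * (d - i))" for i
  define rhs where "rhs = fps_const (l ^ q) - fps_const l * fps_X ^ (d * (q - 1))"
  define P where "P = (\<Sum>i\<le>d. Polynomial.monom (c i) i) - [:rhs:]"
  have polyP: "poly P V = (\<Sum>i\<le>d. c i * V ^ i) - rhs" for V
    by (simp add: P_def poly_sum poly_monom)
  have c0: "fps_nth (c i) 0 = (if i = d then a else 0)" if "i \<le> d" for i
    using that q2 by (auto simp: c_def a_def)
  have pow0: "fps_nth (fps_const u0 ^ n) 0 = u0 ^ n" for n by (simp add: fps_const_power)
  have root: "fps_nth (poly P (fps_const u0)) 0 = 0"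
  proof -
    have "fps_nth (\<Sum>i\<le>d. c i * fps_const u0 ^ i) 0 = (\<Sum>i\<le>d. (if i = d then a * u0 ^ d else 0))"
      unfolding fps_sum_nth by (intro sum.cong refl) (simp add: c0 pow0)
    moreover have "fps_nth rhs 0 = l ^ q" using d2 q2 by (simp add: rhs_def)
    ultimately show ?thesis by (simp add: polyP lu)
  qed
  have pdP: "poly (pderiv P) V = (\<Sum>i\<le>d. of_nat i * c i * V ^ (i - 1))" for V
  proof -
    have ps: "pderiv (\<Sum>i\<in>S. g i) = (\<Sum>i\<in>S. pderiv (g i :: 'a fps poly))" for S :: "nat set" and g
      by (induction S rule: infinite_finite_induct) (auto simp: pderiv_add)
    show ?thesis by (simp add: P_def pderiv_diff ps pderiv_monom poly_sum poly_monom pderiv_pCons)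
  qed
  have simple: "fps_nth (poly (pderiv P) (fps_const u0)) 0 \<noteq> 0"
  proof -
    have "fps_nth (poly (pderiv P) (fps_const u0)) 0 = (\<Sum>i\<le>d. (if i = d then of_nat d * a * u0 ^ (d - 1) else 0))"
      unfolding pdP fps_sum_nth by (intro sum.cong refl) (simp add: c0 pow0 fps_of_nat[symmetric])
    thus ?thesis using of_nat_d a lu by simp
  qed
  obtain U where U: "poly P U = 0" "fps_nth U 0 = u0" using hensel_fps[OF root simple] by blast
  let ?W = "fls_X_inv :: 'a fls"
  define \<xi> where "\<xi> = fps_to_fls U * ?W ^ q"
  define \<eta> where "\<eta> = fls_const l * ?W ^ d"
  have WW: "fls_X * ?W = 1" by (rule fls_eqI) (simp add: fls_X_times_conv_shift(1))
  have WWn: "fls_X ^ n * ?W ^ n = 1" for n using WW by (metis power_mult_distrib power_one)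
  have Unz: "fps_to_fls U \<noteq> 0" "fls_subdegree (fps_to_fls U) = 0"
    using U lu by (auto simp: fls_subdegree_fls_to_fps subdegree_eq_0_iff)
  have sx: "fls_subdegree \<xi> = - int q" unfolding \<xi>_def using Unz by simp
  have sy: "fls_subdegree \<eta> = - int d" unfolding \<eta>_def using lu by simp
  interpret e: rhom "fls_const :: 'a \<Rightarrow> 'a fls" by (rule rhom_fls_const)
  have ps: "fps_to_fls (\<Sum>i\<in>S. g i) = (\<Sum>i\<in>S. fps_to_fls (g i :: 'a fps))" for S :: "nat set" and g
    by (induction S rule: infinite_finite_induct) auto
  have eq: "(\<Sum>i\<le>d. fls_const (Polynomial.coeff f i) * fls_X ^ (q * (d - i)) * fps_to_fls U ^ i) =
    fls_const (l ^ q) - fls_const l * fls_X ^ (d * (q - 1))"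
  proof -
    have "(\<Sum>i\<le>d. c i * U ^ i) = rhs" using U(1) polyP by simp
    hence "fps_to_fls (\<Sum>i\<le>d. c i * U ^ i) = fps_to_fls rhs" by simp
    thus ?thesis by (simp add: ps c_def rhs_def fls_times_fps_to_fls fps_to_fls_power)
  qed
  have "ev1 fls_const \<xi> f = (\<Sum>i\<le>d. fls_const (Polynomial.coeff f i) * \<xi> ^ i)"
    unfolding e.ev1_sum d ..
  also have "\<dots> = (\<Sum>i\<le>d. fls_const (Polynomial.coeff f i) * fls_X ^ (q * (d - i)) * fps_to_fls U ^ i) * ?W ^ (q * d)"
    unfolding sum_distrib_right
  proof (intro sum.cong refl)
    fix i assume "i \<in> {..d}"
    hence "q * d = q * (d - i) + q * i" by (simp flip: distrib_left)
    hence "fls_X ^ (q * (d - i)) * ?W ^ (q * d) = ?W ^ (q * i)"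
      using WWn[of "q * (d - i)"] by (simp add: power_add mult.assoc[symmetric])
    hence "fls_const (Polynomial.coeff f i) * fps_to_fls U ^ i * (fls_X ^ (q * (d - i)) * ?W ^ (q * d)) =
      fls_const (Polynomial.coeff f i) * fps_to_fls U ^ i * ?W ^ (q * i)" by simp
    thus "fls_const (Polynomial.coeff f i) * \<xi> ^ i =
      fls_const (Polynomial.coeff f i) * fls_X ^ (q * (d - i)) * fps_to_fls U ^ i * ?W ^ (q * d)"
      unfolding \<xi>_def power_mult_distrib power_mult[of ?W q i, symmetric] by (simp only: mult_ac)
  qed
  also have "\<dots> = fls_const (l ^ q) * ?W ^ (q * d) - fls_const l * (fls_X ^ (d * (q - 1)) * ?W ^ (q * d))"
    unfolding eq by (simp add: algebra_simps)
  also have "fls_X ^ (d * (q - 1)) * ?W ^ (q * d) = ?W ^ d"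
  proof -
    have "q * d = d * (q - 1) + d" using q2 by (simp add: diff_mult_distrib2 mult.commute)
    thus ?thesis using WWn[of "d * (q - 1)"] by (simp add: power_add mult.assoc[symmetric])
  qed
  also have "fls_const (l ^ q) * ?W ^ (q * d) - fls_const l * ?W ^ d = \<eta> ^ q - \<eta>"
    by (simp add: \<eta>_def power_mult_distrib fls_const_power mult.commute[of q] flip: power_mult)
  finally have "\<eta> ^ q - \<eta> = ev1 fls_const \<xi> f" by simp
  moreover have "\<xi> \<noteq> 0" using sx q2 by auto
  hence "g = 0" if "ev1 fls_const \<xi> g = 0" for g
    using subdegree_ev1(1)[OF rhom_fls_const, of \<xi> g] that sx q2 by (auto simp: fls_const_nonzero)
  ultimately have "sol fls_const \<xi> \<eta>" unfolding sol_def using rhom_fls_const by blast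
  thus ?thesis using that sx sy by blast
qed

text \<open>\<open>A\<close> is irreducible: a proper factor would have to vanish at the point at infinity.\<close>

lemma A_bezout:
  assumes C: "C \<noteq> 0" "Polynomial.degree C < q"
  obtains G c where "c \<noteq> 0" "A dvd C * G - [:c:]"
proof -
  define I where "I = {D. D \<noteq> 0 \<and> (\<exists>G. A dvd C * G - D)}"
  have "C \<in> I" using C unfolding I_def by (auto intro!: exI[of _ 1])
  then obtain D where D: "D \<in> I" "\<And>E. E \<in> I \<Longrightarrow> Polynomial.degree D \<le> Polynomial.degree E"
    using ex_has_least_nat[of "\<lambda>D. D \<in> I" C Polynomial.degree] by blast
  have degD: "Polynomial.degree D < q" using D(2)[OF \<open>C \<in> I\<close>] C by simp
  obtain G where G: "A dvd C * G - D" and Dnz: "D \<noteq> 0" using D(1) by (auto simp: I_def)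
  show ?thesis
  proof (cases "Polynomial.degree D = 0")
    case True
    then obtain c where "D = [:c:]" by (metis degree_eq_zeroE)
    thus ?thesis using that[of c G] G Dnz by simp
  next
    case False
    obtain E R where ER: "pseudo_divmod A D = (E, R)" by force
    define lc where "lc = Polynomial.lead_coeff D ^ (Suc (Polynomial.degree A) - Polynomial.degree D)"
    have eq: "Polynomial.smult lc A = D * E + R" and R: "R = 0 \<or> Polynomial.degree R < Polynomial.degree D"
      using pseudo_divmod[OF Dnz ER] by (simp_all add: lc_def)
    have lcnz: "lc \<noteq> 0" using Dnz by (simp add: lc_def)
    \<comment> \<open>A nonzero remainder would lie in \<open>I\<close> with smaller degree; so
      \<open>D\<close> divides \<open>A\<close> up to a factor from k[x].\<close>
    have "R = 0"
    proof (rule ccontr)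
      assume "R \<noteq> 0"
      have "C * (- G * E) - R = - (E * (C * G - D)) - Polynomial.smult lc A"
        unfolding eq by (simp add: algebra_simps)
      moreover have "A dvd - (E * (C * G - D)) - Polynomial.smult lc A" using G by (intro dvd_diff) (auto intro: dvd_smult)
      ultimately have "R \<in> I" using \<open>R \<noteq> 0\<close> unfolding I_def by (metis (mono_tags, lifting) mem_Collect_eq)
      thus False using D(2)[of R] R \<open>R \<noteq> 0\<close> by auto
    qed
    hence eq: "Polynomial.smult lc A = D * E" using eq by simp
    hence Enz: "E \<noteq> 0" using lcnz A_nz by auto
    have "Polynomial.degree A = Polynomial.degree D + Polynomial.degree E"
      using arg_cong[OF eq, of Polynomial.degree] lcnz Dnz Enz by (simp add: Polynomial.degree_mult_eq)
    hence degE: "Polynomial.degree E < q" using False degree_A by simp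
    obtain \<xi> \<eta> :: "'a fls" where s: "sol fls_const \<xi> \<eta>" "fls_subdegree \<xi> = - int q" "fls_subdegree \<eta> = - int d"
      using ex_infinite_solution by blast
    interpret e: rhom "fls_const :: 'a \<Rightarrow> 'a fls" by (rule rhom_fls_const)
    interpret E2: rhom "ev2 fls_const \<xi> \<eta>" by (rule e.rhom_ev2)
    have "ev2 fls_const \<xi> \<eta> D * ev2 fls_const \<xi> \<eta> E = ev2 fls_const \<xi> \<eta> ([:lc:] * A)"
      using eq by (simp flip: E2.hmult)
    also have "\<dots> = 0" unfolding E2.hmult ev2_A[OF s(1)] by simp
    finally show ?thesis using subdegree_ev2(1)[OF s(2,3) Dnz degD] subdegree_ev2(1)[OF s(2,3) Enz degE] by simp
  qed
qed

text \<open>If the remainder modulo \<open>A\<close> were nonzero, Bezout would produce a nonzero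
  polynomial in x alone vanishing at \<xi>. So all generic points satisfy the same
  relations.\<close>

lemma ev2_eq_0_iff:
  assumes "sol e \<xi> \<eta>" shows "ev2 e \<xi> \<eta> G = 0 \<longleftrightarrow> A dvd G"
proof
  interpret e: rhom e using assms by (simp add: sol_def)
  interpret E1: rhom "ev1 e \<xi>" by (rule e.rhom_ev1)
  interpret E2: rhom "ev2 e \<xi> \<eta>" by (rule e.rhom_ev2)
  show "ev2 e \<xi> \<eta> G = 0" if "A dvd G"
    using that ev2_A[OF assms] by (auto simp: E2.hmult elim!: dvdE)
  assume G0: "ev2 e \<xi> \<eta> G = 0"
  obtain B C where BC: "G = A * B + C" "C = 0 \<or> Polynomial.degree C < q" using div_A by blast
  have C0: "ev2 e \<xi> \<eta> C = 0" using G0 ev2_A[OF assms] by (simp add: BC E2.hadd E2.hmult)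
  have "C = 0"
  proof (rule ccontr)
    assume "C \<noteq> 0"
    with BC have "Polynomial.degree C < q" by simp
    from A_bezout[OF \<open>C \<noteq> 0\<close> this] obtain H c where H: "c \<noteq> 0" "A dvd C * H - [:c:]" by metis
    then obtain K where "C * H - [:c:] = A * K" by (elim dvdE)
    hence "ev2 e \<xi> \<eta> (C * H - [:c:]) = ev2 e \<xi> \<eta> (A * K)" by simp
    hence "ev1 e \<xi> c = 0" by (simp add: E2.hmult E2.hdiff C0 ev2_A[OF assms])
    thus False using H(1) assms by (auto simp: sol_def)
  qed
  thus "A dvd G" using BC by simp
qed

end

section \<open>The function field\<close>

lemma rhom_comp: "rhom e \<Longrightarrow> rhom h \<Longrightarrow> rhom (\<lambda>c. h (e c))"
  by (simp add: rhom_def)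

lemma hom_ev1:
  assumes "rhom e" "rhom h" shows "h (ev1 e \<xi> g) = ev1 (\<lambda>c. h (e c)) (h \<xi>) g"
proof -
  interpret e: rhom e by fact
  interpret h: rhom h by fact
  interpret he: rhom "\<lambda>c. h (e c)" by (rule rhom_comp[OF assms])
  show ?thesis
  proof (induction g)
    case 0
    show ?case by (simp add: ev1_def h.h0)
  next
    case (pCons c g)
    thus ?case by (simp add: e.ev1_pCons he.ev1_pCons h.hadd h.hmult)
  qed
qed

lemma hom_ev2:
  assumes "rhom e" "rhom h" shows "h (ev2 e \<xi> \<eta> G) = ev2 (\<lambda>c. h (e c)) (h \<xi>) (h \<eta>) G"
  unfolding ev2_def hom_ev1[OF rhom.rhom_ev1[OF assms(1)] assms(2)] hom_ev1[OF assms] ..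

lemma (in rhom) ev2_smult: "ev2 e \<xi> \<eta> (Polynomial.smult c G) = ev1 e \<xi> c * ev2 e \<xi> \<eta> G"
proof -
  interpret E2: rhom "ev2 e \<xi> \<eta>" by (rule rhom_ev2)
  have "Polynomial.smult c G = [:c:] * G" by simp
  thus ?thesis by (simp only: E2.hmult ev2_const)
qed

lemma is_subringD:
  assumes "is_subring V"
  shows "0 \<in> V" "1 \<in> V" "a \<in> V \<Longrightarrow> b \<in> V \<Longrightarrow> a - b \<in> V" "a \<in> V \<Longrightarrow> b \<in> V \<Longrightarrow> a * b \<in> V"
    "a \<in> V \<Longrightarrow> - a \<in> V" "a \<in> V \<Longrightarrow> b \<in> V \<Longrightarrow> a + b \<in> V" "a \<in> V \<Longrightarrow> a ^ n \<in> V"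
proof -
  show 1: "1 \<in> V" and m: "\<And>a b. a \<in> V \<Longrightarrow> b \<in> V \<Longrightarrow> a * b \<in> V"
    and s: "\<And>a b. a \<in> V \<Longrightarrow> b \<in> V \<Longrightarrow> a - b \<in> V" using assms by (auto simp: is_subring_def)
  show 0: "0 \<in> V" using s[OF 1 1] by simp
  show n: "- a \<in> V" if "a \<in> V" for a using s[OF 0 that] by simp
  show "a + b \<in> V" if "a \<in> V" "b \<in> V" for a b using s[OF that(1) n[OF that(2)]] by simp
  show "a ^ n \<in> V" if "a \<in> V" for a n by (induction n) (use 1 m that in auto)
qed

lemma is_subring_sum: "is_subring V \<Longrightarrow> (\<And>i. i \<in> I \<Longrightarrow> g i \<in> V) \<Longrightarrow> sum g I \<in> V"
  by (induction I rule: infinite_finite_induct) (auto intro: is_subringD)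

lemma rhom_const: "rhom (const :: 'a::field \<Rightarrow> 'a ambient)"
  by unfold_locales (simp_all add: const_simps)

lemma ev1_xcoord: "ev1 const xcoord g = to_ac (to_fract (g :: 'a::field poly))"
proof (induction g)
  case 0
  show ?case by (simp add: ev1_def)
next
  case (pCons c g)
  interpret rhom "const :: 'a \<Rightarrow> 'a ambient" by (rule rhom_const)
  have "pCons c g = [:c:] + [:0, 1:] * g" by simp
  hence "to_ac (to_fract (pCons c g)) = const c + xcoord * to_ac (to_fract g)"
    unfolding const_def xcoord_def by (metis to_ac_add to_ac_mult to_fract_add to_fract_mult)
  thus ?case using pCons by (simp add: ev1_pCons)
qed

lemma fls_deriv_ev1:
  fixes \<xi> :: "'b::field fls"
  assumes "rhom e" "\<And>c. fls_deriv (e c) = 0"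
  shows "fls_deriv (ev1 e \<xi> (g :: 'a::field poly)) = ev1 e \<xi> (pderiv g) * fls_deriv \<xi>"
proof (induction g)
  case 0
  show ?case by (simp add: ev1_def)
next
  case (pCons c g)
  interpret e: rhom e by fact
  interpret E1: rhom "ev1 e \<xi>" by (rule e.rhom_ev1)
  show ?case by (simp add: e.ev1_pCons pCons.IH assms(2) pderiv_pCons E1.hadd e.h0 algebra_simps)
qed

locale AS_point = AS_curve p u q d f for p u q d and f :: "'a::{field,finite} poly" +
  fixes y :: "'a ambient"
  assumes y: "y ^ q - y = ev1 const xcoord f"
begin

abbreviation FF :: "'a ambient set" where "FF \<equiv> function_field y"

abbreviation rr :: "'a poly poly \<Rightarrow> 'a ambient" where "rr G \<equiv> ev2 const xcoord y G"

abbreviation kx :: "'a poly \<Rightarrow> 'a ambient" where "kx c \<equiv> ev1 const xcoord c"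

sublocale C: rhom "const :: 'a \<Rightarrow> 'a ambient" by (rule rhom_const)
sublocale K: rhom kx by (rule C.rhom_ev1)
sublocale RR: rhom rr by (rule C.rhom_ev2)

lemma kx_eq_0_iff: "kx g = 0 \<longleftrightarrow> g = 0" by (simp add: ev1_xcoord)

lemma sol_y: "sol const xcoord y"
  by (simp add: sol_def rhom_const kx_eq_0_iff y)

lemma rr_eq_0_iff: "rr G = 0 \<longleftrightarrow> A dvd G" by (rule ev2_eq_0_iff[OF sol_y])

lemma rr_mod: obtains C where "rr C = rr G" "C = 0 \<or> Polynomial.degree C < q"
proof -
  obtain B C where BC: "G = A * B + C" "C = 0 \<or> Polynomial.degree C < q" using div_A by blast
  have "rr G = rr C" using ev2_A[OF sol_y] by (simp add: BC(1) RR.hadd RR.hmult)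
  thus ?thesis using that BC by metis
qed

definition frac :: "'a poly poly \<Rightarrow> 'a poly \<Rightarrow> 'a ambient" where "frac G c = rr G / kx c"

lemma frac_diff: "c \<noteq> 0 \<Longrightarrow> c' \<noteq> 0 \<Longrightarrow> frac G c - frac G' c' = frac (G * [:c':] - G' * [:c:]) (c * c')"
  by (simp add: frac_def RR.hdiff RR.hmult K.hmult kx_eq_0_iff C.ev2_smult field_simps)

lemma frac_mult: "frac G c * frac G' c' = frac (G * G') (c * c')"
  by (simp add: frac_def RR.hmult K.hmult)

text \<open>Bezout modulo \<open>A\<close> moves y out of the denominator, so denominators from k[x]
  suffice for the whole function field.\<close>

lemma frac_inverse:
  assumes "rr G \<noteq> 0" obtains G' c' where "c' \<noteq> 0" "inverse (frac G c) = frac G' c'"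
proof -
  obtain C where C: "rr C = rr G" "C = 0 \<or> Polynomial.degree C < q" by (rule rr_mod)
  hence "C \<noteq> 0" using assms RR.h0 by auto
  with C have "Polynomial.degree C < q" by simp
  from A_bezout[OF \<open>C \<noteq> 0\<close> this] obtain H c' where H: "c' \<noteq> 0" "A dvd C * H - [:c':]" by metis
  have "rr (C * H - [:c':]) = 0" using H(2) rr_eq_0_iff by blast
  hence "rr C * rr H = kx c'" by (simp add: RR.hdiff RR.hmult)
  hence "inverse (frac G c) = frac (H * [:c:]) c'"
    using assms H(1) by (simp add: frac_def C RR.hmult kx_eq_0_iff C.ev2_smult field_simps)
  thus ?thesis using that H(1) by blast
qed

definition fracs :: "'a ambient set" where "fracs = {frac G c | G c. c \<noteq> 0}"

lemma fracsI: "c \<noteq> 0 \<Longrightarrow> z = frac G c \<Longrightarrow> z \<in> fracs" by (auto simp: fracs_def)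

lemma is_subfield_fracs: "is_subfield fracs"
  unfolding is_subfield_def is_subring_def
proof (intro conjI ballI)
  have "1 = frac 1 1" by (simp add: frac_def RR.h1 K.h1)
  thus "1 \<in> fracs" by (rule fracsI[rotated]) simp
  show "a - b \<in> fracs" "a * b \<in> fracs" if "a \<in> fracs" "b \<in> fracs" for a b
    using that frac_diff frac_mult by (fastforce simp: fracs_def)+
  show "inverse a \<in> fracs" if aF: "a \<in> fracs" for a
  proof -
    obtain G c where a: "a = frac G c" "c \<noteq> 0" using aF by (auto simp: fracs_def)
    show ?thesis
    proof (cases "rr G = 0")
      case True
      have "inverse a = frac 0 1" using True by (simp add: a frac_def RR.h0)
      thus ?thesis by (rule fracsI[rotated]) simp
    next
      case False
      then obtain G' c' where "c' \<noteq> 0" "inverse (frac G c) = frac G' c'" by (rule frac_inverse)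
      thus ?thesis unfolding a by (rule fracsI)
    qed
  qed
qed

lemma hull_induct:
  assumes "is_subfield S" "range const \<subseteq> S" "xcoord \<in> S" "y \<in> S" shows "FF \<subseteq> S"
  unfolding function_field_def by (rule hull_minimal) (use assms in auto)

lemma is_subfield_FF: "is_subfield FF"
  unfolding function_field_def by (rule hull_in) (auto simp: is_subfield_def is_subring_def)

lemma is_subring_FF: "is_subring FF" using is_subfield_FF by (simp add: is_subfield_def)

lemmas FF_ring = is_subringD[OF is_subring_FF]

lemma FF_inverse: "a \<in> FF \<Longrightarrow> inverse a \<in> FF" using is_subfield_FF by (simp add: is_subfield_def)

lemma FF_divide: "a \<in> FF \<Longrightarrow> b \<in> FF \<Longrightarrow> a / b \<in> FF"
  by (simp add: divide_inverse FF_ring FF_inverse)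

lemma FF_gens: "const c \<in> FF" "xcoord \<in> FF" "y \<in> FF"
  unfolding function_field_def by (auto intro: hull_inc)

lemma kx_FF: "kx g \<in> FF"
  unfolding C.ev1_sum by (intro is_subring_sum[OF is_subring_FF] FF_ring FF_gens)

lemma rr_FF: "rr G \<in> FF"
  unfolding C.ev2_sum by (intro is_subring_sum[OF is_subring_FF] FF_ring FF_gens kx_FF)

lemma rr_X: "rr [:[:0, 1:]:] = xcoord" by (simp add: C.ev1_X)

lemma rr_Y: "rr (Polynomial.monom 1 1) = y" by (simp add: C.ev2_monom K.h1)

lemma FF_eq: "FF = fracs"
proof
  have "const c = frac [:[:c:]:] 1" for c by (simp add: frac_def K.h1)
  hence 1: "const c \<in> fracs" for c by (rule fracsI[rotated]) simp
  have "xcoord = frac [:[:0,1:]:] 1" unfolding frac_def rr_X by (simp add: K.h1)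
  hence 2: "xcoord \<in> fracs" by (rule fracsI[rotated]) simp
  have "y = frac (Polynomial.monom 1 1) 1" unfolding frac_def rr_Y by (simp add: K.h1)
  hence 3: "y \<in> fracs" by (rule fracsI[rotated]) simp
  show "FF \<subseteq> fracs" using 1 2 3 by (intro hull_induct is_subfield_fracs) auto
  show "fracs \<subseteq> FF" by (auto simp: fracs_def frac_def intro: FF_divide rr_FF kx_FF)
qed

lemma FF_frac: "z \<in> FF \<Longrightarrow> \<exists>G c. c \<noteq> 0 \<and> z = frac G c" by (auto simp: FF_eq fracs_def)

lemma FF_frac_reduced:
  assumes "z \<in> FF"
  obtains G c where "c \<noteq> 0" "z = frac G c" "G = 0 \<or> Polynomial.degree G < q"
proof -
  obtain G c where G: "c \<noteq> 0" "z = frac G c" using FF_frac[OF assms] by blast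
  obtain C where "rr C = rr G" "C = 0 \<or> Polynomial.degree C < q" by (rule rr_mod)
  thus ?thesis using that[of c C] G by (simp add: frac_def)
qed

text \<open>The embedding of the function field sending x, y to \<xi>, \<eta>. It is well defined on
  fractions because the relations at every generic point are the multiples of
  \<open>A\<close>.\<close>

definition iota :: "('a \<Rightarrow> 'l::field) \<Rightarrow> 'l \<Rightarrow> 'l \<Rightarrow> 'a ambient \<Rightarrow> 'l" where
  "iota e \<xi> \<eta> z = (THE w. \<exists>G c. c \<noteq> 0 \<and> z = frac G c \<and> w = ev2 e \<xi> \<eta> G / ev1 e \<xi> c)"

context
  fixes e :: "'a \<Rightarrow> 'l::field" and \<xi> \<eta> :: 'l
  assumes s: "sol e \<xi> \<eta>"
begin

lemma rhom_e: "rhom e" using s by (simp add: sol_def)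

interpretation e: rhom e by (rule rhom_e)
interpretation E1: rhom "ev1 e \<xi>" by (rule e.rhom_ev1)
interpretation E2: rhom "ev2 e \<xi> \<eta>" by (rule e.rhom_ev2)

lemma e1_nz: "c \<noteq> 0 \<Longrightarrow> ev1 e \<xi> c \<noteq> 0" using s by (auto simp: sol_def)

lemma iota_frac:
  assumes "c \<noteq> 0" shows "iota e \<xi> \<eta> (frac G c) = ev2 e \<xi> \<eta> G / ev1 e \<xi> c"
  unfolding iota_def
proof (rule the_equality)
  show "\<exists>G' c'. c' \<noteq> 0 \<and> frac G c = frac G' c' \<and> ev2 e \<xi> \<eta> G / ev1 e \<xi> c = ev2 e \<xi> \<eta> G' / ev1 e \<xi> c'"
    using assms by blast
  fix w assume "\<exists>G' c'. c' \<noteq> 0 \<and> frac G c = frac G' c' \<and> w = ev2 e \<xi> \<eta> G' / ev1 e \<xi> c'"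
  then obtain G' c' where G': "c' \<noteq> 0" "frac G c = frac G' c'" "w = ev2 e \<xi> \<eta> G' / ev1 e \<xi> c'" by blast
  have "rr (G * [:c':] - G' * [:c:]) = 0"
    using G'(1,2) assms by (simp add: frac_def RR.hdiff RR.hmult kx_eq_0_iff C.ev2_smult field_simps)
  hence "ev2 e \<xi> \<eta> (G * [:c':] - G' * [:c:]) = 0"
    by (simp add: rr_eq_0_iff ev2_eq_0_iff[OF s])
  hence "ev2 e \<xi> \<eta> G * ev1 e \<xi> c' = ev2 e \<xi> \<eta> G' * ev1 e \<xi> c" by (simp add: E2.hdiff E2.hmult e.ev2_smult mult.commute)
  thus "w = ev2 e \<xi> \<eta> G / ev1 e \<xi> c"
    unfolding G'(3) using G'(1) assms e1_nz by (simp add: frac_eq_eq mult.commute)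
qed

lemma iota_rr: "iota e \<xi> \<eta> (rr G) = ev2 e \<xi> \<eta> G"
  using iota_frac[of 1 G] by (simp add: frac_def K.h1 E1.h1)

lemma iota_kx: "iota e \<xi> \<eta> (kx c) = ev1 e \<xi> c"
  using iota_rr[of "[:c:]"] by simp

lemma iota_gens: "iota e \<xi> \<eta> (const c) = e c" "iota e \<xi> \<eta> xcoord = \<xi>" "iota e \<xi> \<eta> y = \<eta>"
  using iota_kx[of "[:c:]"] iota_kx[of "[:0,1:]"] iota_rr[of "Polynomial.monom 1 1"]
  by (simp_all add: C.ev1_X e.ev1_X rr_Y e.ev2_monom E1.h1)

lemma iota_1: "iota e \<xi> \<eta> 1 = 1" using iota_rr[of 1] by (simp add: RR.h1 E2.h1)

lemma iota_0: "iota e \<xi> \<eta> 0 = 0" using iota_rr[of 0] by (simp add: RR.h0 E2.h0)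

lemma iota_diff: "z \<in> FF \<Longrightarrow> w \<in> FF \<Longrightarrow> iota e \<xi> \<eta> (z - w) = iota e \<xi> \<eta> z - iota e \<xi> \<eta> w"
proof -
  assume "z \<in> FF" "w \<in> FF"
  then obtain G c G' c' where z: "c \<noteq> 0" "z = frac G c" "c' \<noteq> 0" "w = frac G' c'" using FF_frac by metis
  hence "iota e \<xi> \<eta> (z - w) = ev2 e \<xi> \<eta> (G * [:c':] - G' * [:c:]) / ev1 e \<xi> (c * c')"
    using iota_frac[of "c * c'"] by (simp add: frac_diff)
  also have "\<dots> = iota e \<xi> \<eta> z - iota e \<xi> \<eta> w"
    using z e1_nz by (simp add: iota_frac E2.hdiff E2.hmult E1.hmult e.ev2_smult field_simps)
  finally show ?thesis .
qed

lemma iota_mult: "z \<in> FF \<Longrightarrow> w \<in> FF \<Longrightarrow> iota e \<xi> \<eta> (z * w) = iota e \<xi> \<eta> z * iota e \<xi> \<eta> w"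
proof -
  assume "z \<in> FF" "w \<in> FF"
  then obtain G c G' c' where z: "c \<noteq> 0" "z = frac G c" "c' \<noteq> 0" "w = frac G' c'" using FF_frac by metis
  thus ?thesis using iota_frac[of "c * c'"] by (simp add: frac_mult iota_frac E2.hmult E1.hmult)
qed

lemma iota_add: "z \<in> FF \<Longrightarrow> w \<in> FF \<Longrightarrow> iota e \<xi> \<eta> (z + w) = iota e \<xi> \<eta> z + iota e \<xi> \<eta> w"
  using iota_diff[of z "- w"] iota_diff[of 0 w] iota_0 by (simp add: FF_ring)

lemma iota_eq_0_iff: "z \<in> FF \<Longrightarrow> iota e \<xi> \<eta> z = 0 \<longleftrightarrow> z = 0"
  using iota_mult[of z "inverse z"] iota_1 iota_0 FF_inverse[of z] by (cases "z = 0") auto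

lemma iota_inverse: "z \<in> FF \<Longrightarrow> iota e \<xi> \<eta> (inverse z) = inverse (iota e \<xi> \<eta> z)"
  using iota_mult[of z "inverse z"] iota_1 iota_0 FF_inverse[of z] iota_eq_0_iff[of z]
  by (cases "z = 0") (auto simp: field_simps)

lemma iota_power: "z \<in> FF \<Longrightarrow> iota e \<xi> \<eta> (z ^ n) = iota e \<xi> \<eta> z ^ n"
  by (induction n) (auto simp: iota_1 iota_mult FF_ring)

end

text \<open>The preimage of the power series ring under the embedding.\<close>

definition plc :: "('a \<Rightarrow> 'k::field fls) \<Rightarrow> 'k fls \<Rightarrow> 'k fls \<Rightarrow> 'a ambient set" where
  "plc e \<xi> \<eta> = {z \<in> FF. 0 \<le> fls_subdegree (iota e \<xi> \<eta> z)}"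

lemma fls_nonneg_diff:
  "0 \<le> fls_subdegree (a - b :: 'k::field fls)" if "0 \<le> fls_subdegree a" "0 \<le> fls_subdegree b"
  using that by (intro fls_subdegree_ge0I) simp

context
  fixes e :: "'a \<Rightarrow> 'k::field fls" and \<xi> \<eta> :: "'k fls"
  assumes s: "sol e \<xi> \<eta>" and ec: "\<And>c. 0 \<le> fls_subdegree (e c)"
    and nontriv: "\<exists>z\<in>FF. fls_subdegree (iota e \<xi> \<eta> z) < 0"
begin

lemma plc_place: "plc e \<xi> \<eta> \<in> places FF"
  unfolding places_def
proof (intro CollectI conjI ballI)
  show "is_subring (plc e \<xi> \<eta>)"
    unfolding is_subring_def plc_def using fls_nonneg_diff fls_mult_subdegree_ge_0
    by (auto simp: iota_diff[OF s] iota_mult[OF s] iota_1[OF s] FF_ring)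
  show "range const \<subseteq> plc e \<xi> \<eta>" using ec by (auto simp: plc_def iota_gens[OF s] FF_gens)
  show "plc e \<xi> \<eta> \<subset> FF" using nontriv by (force simp: plc_def)
  show "z \<in> plc e \<xi> \<eta> \<or> inverse z \<in> plc e \<xi> \<eta>" if "z \<in> FF" for z
    using that by (auto simp: plc_def iota_inverse[OF s] FF_inverse fls_inverse_subdegree)
qed

text \<open>An element z of negative order has powers that absorb any pole, so a ring containing the
  place and z is the whole field.\<close>

lemma plc_maximal:
  assumes V: "V \<in> places FF" "plc e \<xi> \<eta> \<subseteq> V" shows "V = plc e \<xi> \<eta>"
proof (rule ccontr)
  assume "V \<noteq> plc e \<xi> \<eta>"
  then obtain z where z: "z \<in> V" "z \<notin> plc e \<xi> \<eta>" using V(2) by blast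
  have rV: "is_subring V" "V \<subset> FF" using V(1) by (auto simp: places_def)
  hence zF: "z \<in> FF" using z by blast
  hence neg: "fls_subdegree (iota e \<xi> \<eta> z) < 0" using z by (auto simp: plc_def)
  hence nz: "iota e \<xi> \<eta> z \<noteq> 0" by auto
  hence z0: "z \<noteq> 0" using iota_0[OF s] by auto
  have "h \<in> V" if h: "h \<in> FF" for h
  proof (cases "h = 0")
    case False
    define n where "n = nat \<bar>fls_subdegree (iota e \<xi> \<eta> h)\<bar>"
    have hn: "h / z ^ n \<in> FF" using h zF by (intro FF_divide FF_ring)
    have "iota e \<xi> \<eta> (h / z ^ n) = iota e \<xi> \<eta> h * inverse (iota e \<xi> \<eta> z ^ n)"
      using h zF by (simp add: divide_inverse iota_mult[OF s] iota_inverse[OF s] iota_power[OF s] FF_ring FF_inverse)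
    also have "fls_subdegree \<dots> = fls_subdegree (iota e \<xi> \<eta> h) - int n * fls_subdegree (iota e \<xi> \<eta> z)"
      using nz False iota_eq_0_iff[OF s h] by (simp add: fls_subdegree_pow)
    also have "\<dots> \<ge> 0"
    proof -
      have "int n * 1 \<le> int n * - fls_subdegree (iota e \<xi> \<eta> z)" using neg by (intro mult_left_mono) auto
      thus ?thesis by (simp add: n_def)
    qed
    finally have "h / z ^ n \<in> V" using V(2) hn by (auto simp: plc_def)
    hence "(h / z ^ n) * z ^ n \<in> V" using z rV by (intro is_subringD)
    thus ?thesis using z0 by simp
  qed (use rV in \<open>auto intro: is_subringD\<close>)
  thus False using rV by blast
qed

end

text \<open>Induction over the field generated by the constants, x and y; it serves to construct
  d/dx and to compare other derivations with it.\<close>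

lemma is_subfield_deriv_set:
  fixes e :: "'a \<Rightarrow> 'k::field fls"
  assumes s: "sol e \<xi> \<eta>"
    and D: "\<And>a b. a \<in> FF \<Longrightarrow> b \<in> FF \<Longrightarrow> P a \<Longrightarrow> P b \<Longrightarrow> P (a - b)"
      "\<And>a b. a \<in> FF \<Longrightarrow> b \<in> FF \<Longrightarrow> P a \<Longrightarrow> P b \<Longrightarrow> P (a * b)"
      "\<And>a. a \<in> FF \<Longrightarrow> P a \<Longrightarrow> a \<noteq> 0 \<Longrightarrow> P (inverse a)" "\<And>c. P (const c)" "P xcoord" "P y"
    and z: "z \<in> FF"
  shows "P z"
proof -
  have P01: "P 0" "P 1" using D(4)[of 0] D(4)[of 1] by (simp_all add: const_simps)
  have "is_subfield {z \<in> FF. P z}"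
    unfolding is_subfield_def is_subring_def
  proof (intro conjI ballI)
    fix a assume "a \<in> {z \<in> FF. P z}"
    thus "inverse a \<in> {z \<in> FF. P z}" using D(3)[of a] P01 FF_inverse[of a] by (cases "a = 0") auto
  qed (use D(1,2) P01 FF_ring in auto)
  hence "FF \<subseteq> {z \<in> FF. P z}" using D FF_gens by (intro hull_induct) auto
  thus ?thesis using z by auto
qed

text \<open>As q vanishes in k, differentiating the equation gives dy = - f'(x) dx.\<close>

lemma deriv_gen:
  fixes e :: "'a \<Rightarrow> 'k::field fls"
  assumes s: "sol e \<xi> \<eta>" and e': "\<And>c. fls_deriv (e c) = 0"
  shows "fls_deriv \<eta> = - (ev1 e \<xi> (pderiv f) * fls_deriv \<xi>)"
proof -
  have re: "rhom e" using s by (simp add: sol_def)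
  have "(of_nat q :: 'k fls) = 0" using rhom.hof_nat[OF re, of q] of_nat_q rhom.h0[OF re] by simp
  hence "fls_deriv (\<eta> ^ q) = 0" by (simp add: fls_deriv_power)
  hence "- fls_deriv \<eta> = fls_deriv (\<eta> ^ q - \<eta>)" by simp
  also have "\<dots> = ev1 e \<xi> (pderiv f) * fls_deriv \<xi>"
    using s fls_deriv_ev1[OF re e', of \<xi> f] by (simp add: sol_def)
  finally show ?thesis by (metis minus_minus)
qed

end

lemma field_power_card:
  fixes x :: "'a::{field,finite}"
  shows "x ^ CARD('a) = x"
proof (cases "x = 0")
  case False
  have "(\<Prod>y\<in>UNIV-{0}. x * y) = (\<Prod>y\<in>UNIV-{0::'a}. y)"
    by (rule prod.reindex_bij_witness[of _ "\<lambda>y. y / x" "\<lambda>y. x * y"]) (use False in auto)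
  hence "x ^ (CARD('a) - 1) * \<Prod>(UNIV-{0::'a}) = \<Prod>(UNIV-{0})" by (simp add: prod.distrib)
  hence "x ^ (CARD('a) - 1) = 1" by simp
  moreover have "CARD('a) > 0" by simp
  ultimately show ?thesis by (metis One_nat_def Suc_pred mult.right_neutral power_Suc)
qed (simp add: power_0_left)

lemma sum_blocks: "(\<Sum>i<m * k. g i) = (\<Sum>j<k. \<Sum>i<m. g (i + j * m :: nat))"
  for g :: "nat \<Rightarrow> 'c::comm_monoid_add"
proof (induction k)
  case (Suc k)
  have "(\<Sum>i<m * Suc k. g i) = (\<Sum>i<m * k + m. g i)" by (simp add: add.commute)
  also have "\<dots> = (\<Sum>i<m * k. g i) + (\<Sum>i<m. g (m * k + i))" by (rule sum_lessThan_add)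
  finally show ?case using Suc by (simp add: add.commute mult.commute)
qed simp

section \<open>Congruences modulo x^N - x over a finite base field\<close>

locale AS_place = AS_point p u q d f y for p u q d and f :: "'a::{field,finite} poly" and y +
  fixes s :: nat
  assumes card_a: "CARD('a) = p ^ s" and s: "s \<ge> 1"
begin

lemma CHAR_ambient: "CHAR('a ambient) = p"
proof (rule CHAR_eqI)
  show "of_nat p = (0 :: 'a ambient)" by (metis C.hof_nat C.h0 CHAR_a of_nat_CHAR)
  show "p dvd n" if "of_nat n = (0 :: 'a ambient)" for n
    using that by (metis C.hof_nat rhom_inj[OF rhom_const] CHAR_a of_nat_eq_0_iff_char_dvd)
qed

sublocale AC: alg_closed_char p "TYPE('a ambient)"
  by unfold_locales (rule CHAR_ambient, rule prime_p)

lemma const_ext_eq: "const_ext n = AC.GF (s * n)"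
  by (simp add: const_ext_def AC.GF_def card_a power_mult)

lemma const_GF: "const c \<in> AC.GF s"
  using C.hpower[of c "CARD('a)"] field_power_card[of c] by (simp add: AC.GF_def card_a)

lemma ev1_const_ext:
  assumes "a \<in> const_ext n" shows "ev1 const a (g :: 'a poly) \<in> const_ext n"
  using assms AC.GF_mult[OF const_GF] unfolding C.ev1_sum const_ext_eq
  by (intro AC.GF_sum AC.GF_closed) auto

lemma ev2_const_ext:
  assumes "a \<in> const_ext n" "b \<in> const_ext n" shows "ev2 const a b (G :: 'a poly poly) \<in> const_ext n"
  using assms ev1_const_ext[OF assms(1)] unfolding C.ev2_sum const_ext_eq
  by (intro AC.GF_sum AC.GF_closed) auto

text \<open>An explicit power such that every element of \<open>k[x, y]\<close> is congruent to its power modulo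
  \<open>x\<^sup>N - x\<close>: the quotient ring is a product of finite fields.\<close>

definition W :: "nat \<Rightarrow> nat" where "W n = q ^ (s * n * p)"

context
  fixes n :: nat
  assumes n: "n \<ge> 1"
begin

definition N where "N = p ^ (s * n)"

text \<open>Vanishes to order exactly 1 at every affine point whose x-coordinate \<alpha> lies in
  the extension of degree n. It replaces the local parameter x - \<alpha>, whose coefficients need
  not lie in k.\<close>

definition tau :: "'a ambient" where "tau = xcoord ^ N - xcoord"

definition dv :: "'a ambient \<Rightarrow> bool" where "dv z \<longleftrightarrow> (\<exists>G. z = tau * rr G)"

lemma dv_add: "dv z \<Longrightarrow> dv w \<Longrightarrow> dv (z + w)"
  unfolding dv_def by (metis RR.hadd distrib_left)

lemma dv_0: "dv 0" unfolding dv_def by (metis RR.h0 mult_zero_right)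

lemma dv_mult: "dv z \<Longrightarrow> dv (z * rr G)"
  unfolding dv_def by (metis RR.hmult mult.assoc)

lemma dv_sum: "(\<And>i. i \<in> I \<Longrightarrow> dv (g i)) \<Longrightarrow> dv (sum g I)"
  by (induction I rule: infinite_finite_induct) (auto intro: dv_add dv_0)

lemma dv_power: "dv z \<Longrightarrow> z = rr G \<Longrightarrow> k \<ge> 1 \<Longrightarrow> dv (z ^ k)"
proof (induction k)
  case (Suc k)
  thus ?case using dv_mult[of z "G ^ k"] by (simp add: RR.hpower)
qed simp

lemma N_pos: "N \<ge> 1" using AC.p_pos by (simp add: N_def Suc_leI One_nat_def)

lemma ring_power_dv:
  assumes c: "\<And>c :: 'a. const c ^ (p ^ j) = const c" and x: "dv (xcoord ^ (p ^ j) - xcoord)"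
  shows "dv (kx g ^ (p ^ j) - kx g)"
proof (induction g)
  case 0
  show ?case by (simp add: K.h0 AC.frob_0 dv_0)
next
  case (pCons c g)
  have "kx (pCons c g) ^ (p ^ j) - kx (pCons c g) =
      (xcoord ^ (p ^ j) - xcoord) * rr [:g ^ (p ^ j):] + (kx g ^ (p ^ j) - kx g) * rr [:[:0,1:]:]"
    unfolding rr_X unfolding C.ev1_pCons AC.frob_add power_mult_distrib c C.ev2_const K.hpower
    by (simp add: algebra_simps)
  thus ?case using dv_add[OF dv_mult[OF x] dv_mult[OF pCons.IH]] by (simp only:)
qed

lemma const_N: "const (c :: 'a) ^ N = const c"
  using AC.GF_mult[OF const_GF, of c n] by (simp add: AC.GF_def N_def)

lemma N_pow: "N ^ l = p ^ (s * n * l)" by (simp add: N_def power_mult)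

lemma const_N_pow: "const (c :: 'a) ^ (N ^ l) = const c"
  by (induction l) (simp_all add: const_N power_mult)

lemma x_N_pow: "dv (xcoord ^ (N ^ l) - xcoord)"
proof (induction l)
  case 0
  show ?case by (simp add: dv_0)
next
  case (Suc l)
  have "xcoord ^ (N ^ l) - xcoord = rr [:Polynomial.monom 1 (N ^ l) - [:0, 1:]:]"
    by (simp add: K.hdiff C.ev1_monom C.ev1_X C.h1)
  hence "dv ((xcoord ^ (N ^ l) - xcoord) ^ N)" using Suc dv_power N_pos by blast
  moreover have "(xcoord ^ (N ^ l) - xcoord :: 'a ambient) ^ N = xcoord ^ (N ^ Suc l) - xcoord ^ N"
  proof -
    have "(a - b) ^ N = a ^ N - b ^ N" for a b :: "'a ambient" by (simp add: N_def AC.frob_diff)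
    moreover have "(xcoord ^ (N ^ l)) ^ N = (xcoord :: 'a ambient) ^ (N ^ Suc l)" by (simp add: mult.commute flip: power_mult)
    ultimately show ?thesis by simp
  qed
  moreover have "dv tau" unfolding dv_def by (rule exI[of _ 1]) (simp add: RR.h1)
  ultimately have "dv (xcoord ^ (N ^ Suc l) - xcoord ^ N + tau)" by (intro dv_add) simp_all
  thus ?case by (simp add: tau_def)
qed

lemma kx_N_pow: "dv (kx g ^ (N ^ l) - kx g)"
  unfolding N_pow by (rule ring_power_dv) (use const_N_pow[of _ l] x_N_pow[of l] in \<open>simp_all only: N_pow\<close>)

lemma y_pow: "y ^ (q ^ m) - y = (\<Sum>i<m. kx f ^ (q ^ i))"
proof (induction m)
  case (Suc m)
  have "y ^ (q ^ Suc m) - y = (y ^ q - y) ^ (q ^ m) + (y ^ (q ^ m) - y)"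
  proof -
    have qm: "q ^ m = p ^ (u * m)" by (simp add: q power_mult)
    have "(y ^ q - y) ^ (q ^ m) = (y ^ q) ^ (q ^ m) - y ^ (q ^ m)" unfolding qm by (rule AC.frob_diff)
    thus ?thesis by (simp add: power_mult)
  qed
  thus ?case unfolding Suc y by simp
qed simp

lemma W_eq: "W n = N ^ (u * p)" "W n = p ^ (u * (s * n * p))"
  unfolding W_def N_def by (simp_all add: q mult_ac flip: power_mult)

text \<open>The terms f^(q^i) of the telescoping sum for y^(q^m) - y repeat modulo
  \<open>tau\<close> with period s n, since q^(s n) is a power of N. Over p periods the sum is p
  times one period, hence 0; this is the origin of the exponent s n p in \<open>W\<close>.\<close>

lemma y_W: "dv (y ^ W n - y)"
proof -
  let ?m = "s * n"
  have "y ^ W n - y = (\<Sum>i<?m * p. kx f ^ (q ^ i))" unfolding W_def by (rule y_pow)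
  also have "\<dots> = (\<Sum>j<p. \<Sum>i<?m. kx f ^ (q ^ (i + j * ?m)))"
    by (rule sum_blocks)
  also have "\<dots> = (\<Sum>j<p. \<Sum>i<?m. kx f ^ (q ^ (i + j * ?m)) - kx f ^ (q ^ i)) + (\<Sum>j<p. \<Sum>i<?m. kx f ^ (q ^ i))"
    by (simp add: sum_subtractf)
  also have "(\<Sum>j<p. \<Sum>i<?m. kx f ^ (q ^ i)) = 0" by simp
  finally have eq: "y ^ W n - y = (\<Sum>j<p. \<Sum>i<?m. kx f ^ (q ^ (i + j * ?m)) - kx f ^ (q ^ i))" by simp
  have "dv (kx f ^ (q ^ (i + j * ?m)) - kx f ^ (q ^ i))" for i j
  proof -
    have "q ^ (i + j * ?m) = q ^ i * N ^ (u * j)" by (simp add: power_add q N_def mult_ac flip: power_mult)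
    hence "kx f ^ (q ^ (i + j * ?m)) = kx (f ^ (q ^ i)) ^ (N ^ (u * j))" by (simp add: K.hpower power_mult)
    thus ?thesis using kx_N_pow[of "f ^ (q ^ i)" "u * j"] by (simp add: K.hpower)
  qed
  thus ?thesis unfolding eq by (intro dv_sum)
qed

lemma rr_W: "dv (rr G ^ W n - rr G)"
proof (induction G)
  case 0
  show ?case by (simp add: RR.h0 W_eq(2) AC.frob_0 dv_0)
next
  case (pCons g G)
  have rp: "rr (pCons g G) = kx g + y * rr G"
    unfolding ev2_def by (rule rhom.ev1_pCons[OF C.rhom_ev1])
  have "rr (pCons g G) ^ W n - rr (pCons g G) =
     (kx g ^ W n - kx g) + ((y ^ W n - y) * rr (G ^ W n) + (rr G ^ W n - rr G) * rr (Polynomial.monom 1 1))"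
    unfolding rp rr_Y W_eq(2) AC.frob_add power_mult_distrib RR.hpower by (simp add: algebra_simps)
  moreover have "dv (kx g ^ W n - kx g)" unfolding W_eq(1) by (rule kx_N_pow)
  ultimately show ?case using dv_add dv_mult[OF y_W] dv_mult[OF pCons.IH] by metis
qed

lemma W_ge2: "W n \<ge> 2"
proof -
  have "q ^ 1 \<le> q ^ (s * n * p)" using q2 s n AC.p_pos by (intro power_increasing) (auto simp: Suc_leI One_nat_def)
  thus ?thesis using q2 by (simp add: W_def)
qed

text \<open>Modulo \<open>tau\<close> the element 1 - G^(W-1) is an idempotent: it is annihilated by
  \<open>G\<close> and takes the value 1 wherever \<open>G\<close> vanishes. It isolates the zeros
  of \<open>G\<close> without leaving k[x, y].\<close>

lemma rr_uniformizer:
  obtains G' where "rr (1 - G ^ (W n - 1)) * rr G = tau * rr G'"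
proof -
  have "rr G * rr G ^ (W n - 1) = rr G ^ W n" using W_ge2 by (metis One_nat_def Suc_pred not_numeral_le_zero power_Suc zero_less_iff_neq_zero)
  hence e: "rr (1 - G ^ (W n - 1)) * rr G = - (rr G ^ W n - rr G)" by (simp add: RR.hdiff RR.h1 RR.hpower algebra_simps)
  obtain K where "rr G ^ W n - rr G = tau * rr K" using rr_W unfolding dv_def by blast
  hence "rr (1 - G ^ (W n - 1)) * rr G = tau * rr (- K)" using e by (simp add: RR.hminus)
  thus ?thesis by (rule that)
qed

end


lemma dv_exists_uniformizer:
  assumes "n \<ge> 1"
  obtains E G' where "rr E * rr G = (xcoord ^ (p ^ (s * n)) - xcoord) * rr G'" "E = 1 - G ^ (W n - 1)" "W n \<ge> 2"
proof -
  obtain K where "rr (1 - G ^ (W n - 1)) * rr G = tau n * rr K" by (rule rr_uniformizer[OF assms])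
  thus ?thesis using that[of "1 - G ^ (W n - 1)" K] W_ge2[OF assms] by (simp add: tau_def[OF assms] N_def[OF assms])
qed

section \<open>Local expansions at affine points\<close>

definition ea :: "'a \<Rightarrow> 'a ambient fls" where "ea c = fls_const (const c)"

definition xa :: "'a ambient \<Rightarrow> 'a ambient fls" where "xa \<alpha> = fps_to_fls (fps_const \<alpha> + fps_X)"

lemma rhom_fps_to_fls: "rhom (fps_to_fls :: 'b::field fps \<Rightarrow> 'b fls)"
  by unfold_locales (simp_all add: fls_times_fps_to_fls)

lemma rhom_fps_const: "rhom (fps_const :: 'b::field \<Rightarrow> 'b fps)"
  by unfold_locales simp_all

lemma rhom_fps_nth0: "rhom (\<lambda>F :: 'b::field fps. fps_nth F 0)"
  by unfold_locales simp_all

lemma rhom_ef: "rhom (\<lambda>c :: 'a. fps_const (const c))"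
  by (rule rhom_comp[OF rhom_const rhom_fps_const])

lemma ea_eq: "ea = (\<lambda>c. fps_to_fls (fps_const (const c)))"
  by (simp add: ea_def fun_eq_iff)

lemma ev1_ea: "ev1 ea (fps_to_fls t) g = fps_to_fls (ev1 (\<lambda>c. fps_const (const c)) t g)"
  unfolding ea_eq by (rule hom_ev1[OF rhom_ef rhom_fps_to_fls, symmetric])

lemma ev2_ea: "ev2 ea (fps_to_fls t) (fps_to_fls Z) G = fps_to_fls (ev2 (\<lambda>c. fps_const (const c)) t Z G)"
  unfolding ea_eq by (rule hom_ev2[OF rhom_ef rhom_fps_to_fls, symmetric])

lemma nth0_ev1: "fps_nth (ev1 (\<lambda>c. fps_const (const c)) t g) 0 = ev1 const (fps_nth t 0) (g :: 'a poly)"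
  using hom_ev1[OF rhom_ef rhom_fps_nth0, of t g] by simp

lemma nth0_ev2: "fps_nth (ev2 (\<lambda>c. fps_const (const c)) t Z G) 0 = ev2 const (fps_nth t 0) (fps_nth Z 0) (G :: 'a poly poly)"
  using hom_ev2[OF rhom_ef rhom_fps_nth0, of t Z G] by simp

lemma ev1_ea_eq_0:
  assumes "ev1 ea (xa \<alpha>) g = 0" shows "g = 0"
proof -
  have rl: "rhom (\<lambda>c :: 'a ambient. [:c:])" by unfold_locales simp_all
  have rp: "rhom (fps_of_poly :: 'a ambient poly \<Rightarrow> _)"
    by unfold_locales (simp_all add: fps_of_poly_add fps_of_poly_mult)
  have rc: "rhom (\<lambda>c :: 'a. [:const c:])" by (rule rhom_comp[OF rhom_const rl])
  have t: "fps_of_poly [:\<alpha>, 1:] = fps_const \<alpha> + fps_X" by (simp add: fps_of_poly_linear add.commute)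
  have "fps_of_poly (ev1 (\<lambda>c. [:const c:]) [:\<alpha>, 1:] g) = ev1 (\<lambda>c. fps_const (const c)) (fps_const \<alpha> + fps_X) g"
    using hom_ev1[OF rc rp, of "[:\<alpha>, 1:]" g] by (simp add: fps_of_poly_const t)
  moreover have "ev1 (\<lambda>c. fps_const (const c)) (fps_const \<alpha> + fps_X) g = 0"
    using assms unfolding xa_def ev1_ea by simp
  ultimately have "ev1 (\<lambda>c. [:const c:]) [:\<alpha>, 1:] g = 0" by (metis fps_of_poly_eq_iff fps_of_poly_0)
  moreover have "ev1 (\<lambda>c. [:const c:]) [:\<alpha>, 1:] g = pcompose (map_poly const g) [:\<alpha>, 1:]"
    unfolding ev1_def pcompose_altdef by (rule arg_cong[of _ _ "\<lambda>P. poly P _"], rule poly_eqI) (simp add: coeff_map_poly C.h0)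
  ultimately have "map_poly const g = 0" by (simp add: pcompose_eq_0_iff)
  hence "const (Polynomial.coeff g i) = 0" for i by (metis C.h0 coeff_map_poly Polynomial.coeff_0)
  hence "Polynomial.coeff g i = 0" for i using rhom_inj[OF rhom_const, of "Polynomial.coeff g i"] by blast
  thus ?thesis by (intro poly_eqI) simp
qed

text \<open>The y-derivative of the equation is -1 everywhere, so at every affine point y is a power
  series in the local parameter x - \<alpha>.\<close>

lemma ex_affine_sol:
  assumes "\<beta> ^ q - \<beta> = ev1 const \<alpha> f"
  shows "\<exists>Z. sol ea (xa \<alpha>) (fps_to_fls Z) \<and> fps_nth Z 0 = \<beta>"
proof -
  let ?D = "ev1 (\<lambda>c. fps_const (const c)) (fps_const \<alpha> + fps_X) f"
  let ?P = "Polynomial.monom 1 q - Polynomial.monom 1 1 - [:?D:] :: 'a ambient fps poly"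
  have P: "poly ?P V = V ^ q - V - ?D" for V by (simp add: poly_monom)
  have q0: "(of_nat q :: 'a ambient fps) = 0"
    using rhom.hof_nat[OF rhom_ef, of q] of_nat_q rhom.h0[OF rhom_ef] by simp
  have "pderiv ?P = - 1"
    by (simp add: pderiv_diff pderiv_monom pderiv_pCons q0 one_pCons)
  hence "fps_nth (poly (pderiv ?P) (fps_const \<beta>)) 0 \<noteq> 0" by simp
  moreover have "fps_nth (poly ?P (fps_const \<beta>)) 0 = 0"
    unfolding P using assms by (simp add: nth0_ev1 fps_const_power)
  ultimately obtain Z where Z: "poly ?P Z = 0" "fps_nth Z 0 = \<beta>" by (metis hensel_fps)
  have "Z ^ q - Z = ?D" using Z(1) unfolding P by simp
  hence "fps_to_fls Z ^ q - fps_to_fls Z = ev1 ea (xa \<alpha>) f"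
    unfolding xa_def ev1_ea by (simp flip: fps_to_fls_power fps_to_fls_minus)
  moreover have "rhom ea" unfolding ea_eq by (rule rhom_comp[OF rhom_ef rhom_fps_to_fls])
  ultimately have "sol ea (xa \<alpha>) (fps_to_fls Z)" using ev1_ea_eq_0 by (simp add: sol_def)
  thus ?thesis using Z(2) by blast
qed

definition Za :: "'a ambient \<Rightarrow> 'a ambient \<Rightarrow> 'a ambient fps" where
  "Za \<alpha> \<beta> = (SOME Z. sol ea (xa \<alpha>) (fps_to_fls Z) \<and> fps_nth Z 0 = \<beta>)"

definition on_curve :: "'a ambient \<Rightarrow> 'a ambient \<Rightarrow> bool" where
  "on_curve \<alpha> \<beta> \<longleftrightarrow> \<beta> ^ q - \<beta> = ev1 const \<alpha> f"

definition ia :: "'a ambient \<Rightarrow> 'a ambient \<Rightarrow> 'a ambient \<Rightarrow> 'a ambient fls" where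
  "ia \<alpha> \<beta> = iota ea (xa \<alpha>) (fps_to_fls (Za \<alpha> \<beta>))"

definition Va :: "'a ambient \<Rightarrow> 'a ambient \<Rightarrow> 'a ambient set" where
  "Va \<alpha> \<beta> = plc ea (xa \<alpha>) (fps_to_fls (Za \<alpha> \<beta>))"

context
  fixes \<alpha> \<beta> :: "'a ambient"
  assumes ab: "on_curve \<alpha> \<beta>"
begin

lemma sol_a: "sol ea (xa \<alpha>) (fps_to_fls (Za \<alpha> \<beta>))" and Za0: "fps_nth (Za \<alpha> \<beta>) 0 = \<beta>"
  using someI_ex[OF ex_affine_sol[OF ab[unfolded on_curve_def]]] by (auto simp: Za_def)

lemma ia_rr: obtains H where "ia \<alpha> \<beta> (rr G) = fps_to_fls H" "fps_nth H 0 = ev2 const \<alpha> \<beta> G"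
  using that[of "ev2 (\<lambda>c. fps_const (const c)) (fps_const \<alpha> + fps_X) (Za \<alpha> \<beta>) G"]
  unfolding ia_def iota_rr[OF sol_a] unfolding xa_def ev2_ea by (simp add: nth0_ev2 Za0)

lemma ia_rr_nth: "fls_nth (ia \<alpha> \<beta> (rr G)) 0 = ev2 const \<alpha> \<beta> G" "0 \<le> fls_subdegree (ia \<alpha> \<beta> (rr G))"
  by (rule ia_rr[of G]; simp add: fls_subdegree_fls_to_fps_gt0)+

lemma rr_Va: "rr G \<in> Va \<alpha> \<beta>"
  using ia_rr_nth(2) by (simp add: Va_def plc_def rr_FF ia_def)

text \<open>In characteristic p the difference (\<alpha> + T)^(p^m) - (\<alpha> + T) is T^(p^m) -
  T.\<close>

lemma ia_tau:
  assumes "\<alpha> ^ (p ^ m) = \<alpha>" "m \<ge> 1"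
  shows "fls_subdegree (ia \<alpha> \<beta> (xcoord ^ (p ^ m) - xcoord)) = 1"
proof -
  have pm: "p ^ m > 1" using AC.p_gt1 assms(2) by (intro one_less_power) auto
  have cf: "CHAR('a ambient fps) = p" by (simp only: semiring_char_fps CHAR_ambient)
  let ?T = "fps_const \<alpha> + fps_X :: 'a ambient fps"
  have "?T ^ (p ^ m) = fps_const \<alpha> ^ (p ^ m) + fps_X ^ (p ^ m)"
    by (rule freshmans_dream') (use prime_p cf in simp_all)
  also have "fps_const \<alpha> ^ (p ^ m) = fps_const \<alpha>" by (simp only: fps_const_power assms(1))
  finally have d: "?T ^ (p ^ m) - ?T = fps_X ^ (p ^ m) - fps_X" by (simp only: add_diff_cancel_left)
  have "ia \<alpha> \<beta> (xcoord ^ (p ^ m) - xcoord) = fps_to_fls (fps_X ^ (p ^ m) - fps_X)"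
    unfolding ia_def iota_diff[OF sol_a FF_ring(7)[OF FF_gens(2)] FF_gens(2)] iota_power[OF sol_a FF_gens(2)]
      iota_gens(2)[OF sol_a]
    unfolding xa_def by (simp only: fps_to_fls_power[symmetric] fps_to_fls_minus[symmetric] d)
  also have "fls_subdegree \<dots> = 1"
    by (rule fls_subdegree_eqI) (use pm in \<open>auto simp: fps_to_fls_nth nat_less_iff\<close>)
  finally show ?thesis .
qed

text \<open>The valuation ring at an affine point is the local ring of the point on the plane curve.\<close>

lemma Va_local:
  assumes n: "n \<ge> 1" and \<alpha>n: "\<alpha> \<in> const_ext n" and z: "z \<in> Va \<alpha> \<beta>"
  obtains G H where "ev2 const \<alpha> \<beta> H \<noteq> 0" "z = rr G / rr H"
proof -
  let ?v = "\<lambda>G. fls_subdegree (ia \<alpha> \<beta> (rr G))"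
  interpret E: rhom "ev2 const \<alpha> \<beta> :: 'a poly poly \<Rightarrow> _" by (rule C.rhom_ev2)
  have sn: "s * n \<ge> 1" using s n mult_le_mono[of 1 s 1 n] by simp
  have atau: "\<alpha> ^ (p ^ (s * n)) = \<alpha>" using \<alpha>n by (simp add: const_ext_eq AC.GF_def)
  let ?t = "xcoord ^ (p ^ (s * n)) - xcoord :: 'a ambient"
  have tF: "?t \<in> FF" by (intro FF_ring FF_gens)
  have vt: "fls_subdegree (ia \<alpha> \<beta> ?t) = 1" by (rule ia_tau[OF atau sn])
  have t0: "?t \<noteq> 0" using vt iota_0[OF sol_a] by (auto simp: ia_def)
  \<comment> \<open>Descent on the order of the denominator at the point.\<close>
  have claim: "\<exists>G' H'. ev2 const \<alpha> \<beta> H' \<noteq> 0 \<and> rr G / rr H = rr G' / rr H'"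
    if "rr H \<noteq> 0" "rr G / rr H \<in> Va \<alpha> \<beta>" "nat (?v H) = k" for G H k
    using that
  proof (induction k arbitrary: G H rule: less_induct)
    case (less k)
    show ?case
    proof (cases "ev2 const \<alpha> \<beta> H = 0")
      case True
      have "ev2 const \<alpha> \<beta> G = 0"
      proof -
        have "rr G = (rr G / rr H) * rr H" using less.prems(1) by simp
        hence "ia \<alpha> \<beta> (rr G) = ia \<alpha> \<beta> (rr G / rr H) * ia \<alpha> \<beta> (rr H)"
          unfolding ia_def by (metis iota_mult[OF sol_a] FF_divide rr_FF)
        moreover obtain h where h: "ia \<alpha> \<beta> (rr H) = fps_to_fls h" "fps_nth h 0 = ev2 const \<alpha> \<beta> H" by (rule ia_rr)
        moreover obtain g where g: "ia \<alpha> \<beta> (rr G) = fps_to_fls g" "fps_nth g 0 = ev2 const \<alpha> \<beta> G" by (rule ia_rr)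
        moreover have "ia \<alpha> \<beta> (rr G / rr H) = fps_to_fls (fls_regpart (ia \<alpha> \<beta> (rr G / rr H)))"
          using less.prems(2) by (simp add: Va_def plc_def ia_def)
        ultimately have "fps_to_fls g = fps_to_fls (fls_regpart (ia \<alpha> \<beta> (rr G / rr H)) * h)"
          by (metis fls_times_fps_to_fls)
        hence "g = fls_regpart (ia \<alpha> \<beta> (rr G / rr H)) * h" by simp
        hence "fps_nth g 0 = fps_nth (fls_regpart (ia \<alpha> \<beta> (rr G / rr H))) 0 * fps_nth h 0" by simp
        thus ?thesis using g h True by simp
      qed
      \<comment> \<open>Both \<open>G\<close> and \<open>H\<close> vanish at the point, and
        \<open>E1\<close>, \<open>E2\<close> take the value 1 there. After multiplication by these
        units a common factor x^N - x cancels, which lowers the order of the denominator by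
        1.\<close>
      obtain E1 G1 where E1: "rr E1 * rr G = ?t * rr G1" "E1 = 1 - G ^ (W n - 1)" "W n \<ge> 2"
        by (rule dv_exists_uniformizer[OF n])
      obtain E2 H1 where E2: "rr E2 * rr H = ?t * rr H1" "E2 = 1 - H ^ (W n - 1)"
        by (rule dv_exists_uniformizer[OF n])
      have e1: "ev2 const \<alpha> \<beta> E1 = 1"
        unfolding E1(2) using \<open>ev2 const \<alpha> \<beta> G = 0\<close> E1(3) by (simp add: E.hdiff E.h1 E.hpower power_0_left)
      have e2: "ev2 const \<alpha> \<beta> E2 = 1"
        unfolding E2(2) using True E1(3) by (simp add: E.hdiff E.h1 E.hpower power_0_left)
      have nz: "rr E1 \<noteq> 0" "rr E2 \<noteq> 0" using e1 e2 ia_rr_nth(1)[of E1] ia_rr_nth(1)[of E2] iota_0[OF sol_a] by (auto simp: ia_def)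
      have H1: "rr H1 \<noteq> 0" using E2(1) nz less.prems(1) by auto
      have eq: "rr G / rr H = rr (G1 * E2) / rr (H1 * E1)"
      proof -
        have "?t * (rr G * (rr H1 * rr E1)) = (rr E1 * rr G) * (?t * rr H1)" by (simp only: mult_ac)
        also have "\<dots> = (?t * rr G1) * (rr E2 * rr H)" by (simp only: E1(1) E2(1))
        also have "\<dots> = ?t * (rr G1 * rr E2 * rr H)" by (simp only: mult_ac)
        finally have "rr G * (rr H1 * rr E1) = rr G1 * rr E2 * rr H" using t0 by (metis mult_left_cancel)
        thus ?thesis using nz H1 less.prems(1) by (simp add: RR.hmult frac_eq_eq)
      qed
      have v0: "?v E = 0" if "ev2 const \<alpha> \<beta> E = 1" for E
        using fls_subdegree_leI[of "ia \<alpha> \<beta> (rr E)" 0] ia_rr_nth[of E] that by simp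
      have vmul: "fls_subdegree (ia \<alpha> \<beta> (a * b)) = fls_subdegree (ia \<alpha> \<beta> a) + fls_subdegree (ia \<alpha> \<beta> b)"
        if "a \<in> FF" "b \<in> FF" "a \<noteq> 0" "b \<noteq> 0" for a b
        using that by (simp add: ia_def iota_mult[OF sol_a] iota_eq_0_iff[OF sol_a])
      have "?v E2 + ?v H = 1 + ?v H1"
        using arg_cong[OF E2(1), of "\<lambda>z. fls_subdegree (ia \<alpha> \<beta> z)"] nz less.prems(1) t0 H1 vt
        by (simp add: vmul rr_FF tF)
      hence "?v H = 1 + ?v H1" using v0[OF e2] by simp
      moreover have "?v (H1 * E1) = ?v H1" using H1 nz v0[OF e1] by (simp add: RR.hmult vmul rr_FF)
      moreover have "?v H1 \<ge> 0" by (rule ia_rr_nth(2))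
      ultimately have "nat (?v (H1 * E1)) < k" using less.prems(3) by linarith
      moreover have "rr (H1 * E1) \<noteq> 0" using H1 nz by (simp add: RR.hmult)
      moreover have "rr (G1 * E2) / rr (H1 * E1) \<in> Va \<alpha> \<beta>" using less.prems(2) eq by simp
      ultimately show ?thesis unfolding eq using less.IH by blast
    qed blast
  qed
  have "z \<in> FF" using z by (simp add: Va_def plc_def)
  then obtain G c where "c \<noteq> 0" "z = frac G c" using FF_frac by blast
  hence "rr [:c:] \<noteq> 0" "z = rr G / rr [:c:]" by (simp_all add: frac_def kx_eq_0_iff)
  thus ?thesis using claim[of "[:c:]" G] z that by blast
qed

end

end

section \<open>Places and rational points\<close>

lemma fls_nth0_mult:
  fixes a b :: "'k::field fls"
  assumes "0 \<le> fls_subdegree a" "0 \<le> fls_subdegree b"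
  shows "fls_nth (a * b) 0 = fls_nth a 0 * fls_nth b 0"
proof -
  have "a = fps_to_fls (fls_regpart a)" "b = fps_to_fls (fls_regpart b)" using assms by simp_all
  hence "a * b = fps_to_fls (fls_regpart a * fls_regpart b)" by (metis fls_times_fps_to_fls)
  thus ?thesis by simp
qed

definition unit_in :: "'c::field set \<Rightarrow> 'c \<Rightarrow> bool" where
  "unit_in V z \<longleftrightarrow> z \<in> V \<and> z \<noteq> 0 \<and> inverse z \<in> V"

locale valuation_ring =
  fixes V F :: "'c::field set"
  assumes ring: "is_subring V" and sub: "V \<subseteq> F" and field: "is_subfield F"
    and val: "z \<in> F \<Longrightarrow> z \<in> V \<or> inverse z \<in> V"
begin

lemmas vr = is_subringD[OF ring]

lemma unit_1: "unit_in V 1" using vr by (simp add: unit_in_def)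

lemma unit_factor: "a \<in> V \<Longrightarrow> b \<in> V \<Longrightarrow> unit_in V (a * b) \<Longrightarrow> unit_in V a"
proof -
  assume a: "a \<in> V" "b \<in> V" "unit_in V (a * b)"
  hence i: "inverse (a * b) \<in> V" "a \<noteq> 0" "b \<noteq> 0" by (auto simp: unit_in_def)
  have "inverse a = b * inverse (a * b)" using i by (simp add: field_simps)
  hence "inverse a \<in> V" using vr(4)[OF a(2) i(1)] by (simp only:)
  thus ?thesis using a i by (simp add: unit_in_def)
qed

lemma unit_minus: "unit_in V (- a) \<longleftrightarrow> unit_in V a"
  using vr(5)[of a] vr(5)[of "- a"] vr(5)[of "inverse a"] vr(5)[of "- inverse a"]
  by (auto simp: unit_in_def)

lemma nonunit_power: "a \<in> V \<Longrightarrow> \<not> unit_in V a \<Longrightarrow> n \<ge> 1 \<Longrightarrow> \<not> unit_in V (a ^ n)"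
  using unit_factor[of a "a ^ (n - 1)"] vr by (cases n) auto

lemma nonunit_add:
  assumes "a \<in> V" "b \<in> V" "\<not> unit_in V a" "\<not> unit_in V b" shows "\<not> unit_in V (a + b)"
proof
  assume u: "unit_in V (a + b)"
  have *: "unit_in V b" if "a / b \<in> V" "a \<in> V" "b \<in> V" "unit_in V (a + b)" "b \<noteq> 0" for a b
  proof -
    have "b * (1 + a / b) = a + b" using that by (simp add: field_simps)
    thus ?thesis using unit_factor[of b "1 + a / b"] that vr by simp
  qed
  have ab: "a \<noteq> 0" "b \<noteq> 0" using u assms by auto
  have "a / b \<in> F" using sub field assms unfolding divide_inverse is_subfield_def
    by (intro is_subringD(4)) auto
  hence "a / b \<in> V \<or> b / a \<in> V" using val[of "a / b"] by simp
  thus False using *[of a b] *[of b a] assms u ab by (auto simp: add.commute)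
qed

lemma unit_add_nonunit:
  assumes "unit_in V a" "b \<in> V" "\<not> unit_in V b" shows "unit_in V (a + b)"
proof (rule ccontr)
  assume n: "\<not> unit_in V (a + b)"
  have "a \<in> V" using assms by (simp add: unit_in_def)
  moreover have "\<not> unit_in V (- b)" using assms(3) by (simp add: unit_minus)
  ultimately have "\<not> unit_in V ((a + b) + (- b))" using n assms vr by (intro nonunit_add[of "a + b" "- b"]) auto
  thus False using assms by simp
qed

lemma root_in: "z \<in> F \<Longrightarrow> z ^ n \<in> V \<Longrightarrow> n \<ge> 1 \<Longrightarrow> z \<in> V"
proof -
  assume z: "z \<in> F" "z ^ n \<in> V" "n \<ge> 1"
  show ?thesis
  proof (cases "z = 0")
    case False
    have "inverse z \<in> V \<Longrightarrow> z ^ n * inverse z ^ (n - 1) \<in> V" using z vr by simp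
    moreover have "z ^ n * inverse z ^ (n - 1) = z" using z(3) False by (cases n) (auto simp: power_inverse)
    ultimately show ?thesis using val[OF z(1)] by auto
  qed (use vr in simp)
qed

end

context AS_place
begin

lemma place_vr: "V \<in> places FF \<Longrightarrow> valuation_ring V FF"
  using is_subfield_FF by unfold_locales (auto simp: places_def)

lemma place_const: "V \<in> places FF \<Longrightarrow> const c \<in> V" by (auto simp: places_def)

lemma place_const_unit: "V \<in> places FF \<Longrightarrow> c \<noteq> 0 \<Longrightarrow> unit_in V (const c)"
proof -
  assume V: "V \<in> places FF" and c: "c \<noteq> 0"
  have "const c * const (inverse c) = 1" using c C.hmult[of c "inverse c"] C.h1 by simp
  hence "inverse (const c) = const (inverse c)" by (rule inverse_unique)
  thus ?thesis using place_const[OF V] c rhom_inj[OF rhom_const, of c] by (simp add: unit_in_def)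
qed

text \<open>Integrality over k[x]: with 1/y the place would contain y = (1/y)^(q-2) + f(x)
  (1/y)^(q-1).\<close>

lemma y_in_place: "V \<in> places FF \<Longrightarrow> xcoord \<in> V \<Longrightarrow> y \<in> V"
proof -
  assume V: "V \<in> places FF" and x: "xcoord \<in> V"
  interpret V: valuation_ring V FF by (rule place_vr[OF V])
  have "kx f \<in> V" unfolding C.ev1_sum using place_const[OF V] x by (intro is_subring_sum[OF V.ring] V.vr)
  show ?thesis
  proof (rule ccontr)
    assume n: "y \<notin> V"
    hence i: "inverse y \<in> V" using V.val FF_gens by blast
    have y0: "y \<noteq> 0" using n V.vr by auto
    have "y = (y ^ q) * inverse y ^ (q - 1)"
      using q2 y0 by (cases q) (auto simp: power_inverse)
    also have "y ^ q = y + kx f" using y by (simp add: algebra_simps)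
    also have "(y + kx f) * inverse y ^ (q - 1) = inverse y ^ (q - 2) + kx f * inverse y ^ (q - 1)"
    proof -
      have "q - 1 = Suc (q - 2)" using q2 by simp
      thus ?thesis using y0 by (simp add: ring_distribs)
    qed
    also have "\<dots> \<in> V" using i \<open>kx f \<in> V\<close> by (intro V.vr)
    finally show False using n by simp
  qed
qed

lemma kx_in_place: "V \<in> places FF \<Longrightarrow> xcoord \<in> V \<Longrightarrow> kx g \<in> V"
  using place_vr[of V] place_const[of V] unfolding C.ev1_sum valuation_ring_def
  by (intro is_subring_sum is_subringD) auto

lemma rr_in_place: "V \<in> places FF \<Longrightarrow> xcoord \<in> V \<Longrightarrow> rr G \<in> V"
  using place_vr[of V] kx_in_place[of V] y_in_place[of V] unfolding C.ev2_sum valuation_ring_def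
  by (intro is_subring_sum is_subringD) auto

context
  fixes n V \<phi>
  assumes n: "n \<ge> 1" and pt: "(V, \<phi>) \<in> rational_points FF n"
begin

lemma V_place: "V \<in> places FF"
  and phi_ext: "\<phi> \<in> V \<rightarrow>\<^sub>E const_ext n"
  and phi_add: "a \<in> V \<Longrightarrow> b \<in> V \<Longrightarrow> \<phi> (a + b) = \<phi> a + \<phi> b"
  and phi_mult: "a \<in> V \<Longrightarrow> b \<in> V \<Longrightarrow> \<phi> (a * b) = \<phi> a * \<phi> b"
  and phi_const: "\<phi> (const c) = const c"
  using pt by (auto simp: rational_points_def)

interpretation V: valuation_ring V FF by (rule place_vr[OF V_place])

lemma phi_in: "a \<in> V \<Longrightarrow> \<phi> a \<in> const_ext n" using phi_ext by auto

lemma phi_1: "\<phi> 1 = 1" using phi_const[of 1] by (simp add: const_simps)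
lemma phi_0: "\<phi> 0 = 0" using phi_const[of 0] by (simp add: const_simps)

lemma phi_diff: "a \<in> V \<Longrightarrow> b \<in> V \<Longrightarrow> \<phi> (a - b) = \<phi> a - \<phi> b"
  using phi_add[of "a - b" b] V.vr by simp

lemma phi_power: "a \<in> V \<Longrightarrow> \<phi> (a ^ m) = \<phi> a ^ m"
  by (induction m) (auto simp: phi_1 phi_mult V.vr)

text \<open>Let m + 1 be the size of the extension. A non-unit \<open>w\<close> with nonzero image
  puts 1 - w^m into the kernel, so this is a non-unit too; then 1 = (1 - w^m) + w^m would be a sum
  of two non-units of a valuation ring.\<close>

lemma phi_unit:
  assumes w: "w \<in> V" "\<phi> w \<noteq> 0" shows "unit_in V w"
proof (rule ccontr)
  assume nu: "\<not> unit_in V w"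
  have "CARD('a) > 1" using one_less_power[OF AC.p_gt1, of s] s card_a by simp
  hence M: "CARD('a) ^ n > 1" using n by (intro one_less_power) auto
  define m where "m = CARD('a) ^ n - 1"
  have m: "m \<ge> 1" "CARD('a) ^ n = Suc m" using M by (auto simp: m_def One_nat_def)
  have "\<phi> w ^ Suc m = \<phi> w" using phi_in[OF w(1)] m(2) by (simp add: const_ext_def)
  hence "\<phi> w ^ m = 1" using w(2) by simp
  hence k: "\<phi> (1 - w ^ m) = 0" using w(1) V.vr by (simp add: phi_diff phi_power phi_1)
  have "\<not> unit_in V (1 - w ^ m)"
  proof
    assume u: "unit_in V (1 - w ^ m)"
    hence "\<phi> ((1 - w ^ m) * inverse (1 - w ^ m)) = 0" using k by (subst phi_mult) (auto simp: unit_in_def)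
    thus False using u phi_1 by (simp add: unit_in_def)
  qed
  hence "\<not> unit_in V ((1 - w ^ m) + w ^ m)"
    using V.nonunit_power[OF w(1) nu m(1)] w(1) V.vr by (intro V.nonunit_add) auto
  thus False using V.unit_1 by simp
qed

lemma phi_kx: "xcoord \<in> V \<Longrightarrow> \<phi> (kx g) = ev1 const (\<phi> xcoord) g"
proof (induction g)
  case 0
  show ?case by (simp add: ev1_def phi_0)
next
  case (pCons c g)
  thus ?case using kx_in_place[OF V_place, of g] place_const[OF V_place] V.vr
    by (simp add: C.ev1_pCons phi_add phi_mult phi_const)
qed

lemma phi_rr: "xcoord \<in> V \<Longrightarrow> \<phi> (rr G) = ev2 const (\<phi> xcoord) (\<phi> y) G"
proof (induction G)
  case 0
  show ?case by (simp add: ev2_def ev1_def phi_0)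
next
  case (pCons g G)
  have p: "ev2 const a b (pCons g G) = ev1 const a g + b * ev2 const a b G" for a b :: "'a ambient"
    unfolding ev2_def by (rule rhom.ev1_pCons[OF C.rhom_ev1])
  show ?case unfolding p using pCons kx_in_place[OF V_place pCons.prems] rr_in_place[OF V_place pCons.prems]
      y_in_place[OF V_place pCons.prems] V.vr by (simp add: phi_add phi_mult phi_kx)
qed

end

definition curve_pts :: "nat \<Rightarrow> ('a ambient \<times> 'a ambient) set" where
  "curve_pts n = {(\<alpha>, \<beta>). \<alpha> \<in> const_ext n \<and> \<beta> \<in> const_ext n \<and> on_curve \<alpha> \<beta>}"

definition pa :: "'a ambient \<times> 'a ambient \<Rightarrow> 'a ambient set \<times> ('a ambient \<Rightarrow> 'a ambient)" where
  "pa P = (case P of (\<alpha>, \<beta>) \<Rightarrow> (Va \<alpha> \<beta>, restrict (\<lambda>z. fls_nth (ia \<alpha> \<beta> z) 0) (Va \<alpha> \<beta>)))"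

lemma Va_place_max:
  assumes ab: "on_curve \<alpha> \<beta>" and n: "n \<ge> 1" and an: "\<alpha> \<in> const_ext n"
  shows "Va \<alpha> \<beta> \<in> places FF" "\<And>V. V \<in> places FF \<Longrightarrow> Va \<alpha> \<beta> \<subseteq> V \<Longrightarrow> V = Va \<alpha> \<beta>"
proof -
  have ec: "0 \<le> fls_subdegree (ea c)" for c by (simp add: ea_def)
  let ?t = "xcoord ^ (p ^ (s * n)) - xcoord :: 'a ambient"
  have tF: "?t \<in> FF" by (intro FF_ring FF_gens)
  have sn: "s * n \<ge> 1" using s n mult_le_mono[of 1 s 1 n] by simp
  have "fls_subdegree (ia \<alpha> \<beta> ?t) = 1"
    using an by (intro ia_tau[OF ab _ sn]) (simp add: const_ext_eq AC.GF_def)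
  hence "fls_subdegree (ia \<alpha> \<beta> (inverse ?t)) < 0"
    using tF by (simp add: ia_def iota_inverse[OF sol_a[OF ab]])
  hence nt: "\<exists>z\<in>FF. fls_subdegree (iota ea (xa \<alpha>) (fps_to_fls (Za \<alpha> \<beta>)) z) < 0"
    using FF_inverse[OF tF] by (auto simp: ia_def)
  show "Va \<alpha> \<beta> \<in> places FF" unfolding Va_def by (rule plc_place[OF sol_a[OF ab] ec nt])
  show "\<And>V. V \<in> places FF \<Longrightarrow> Va \<alpha> \<beta> \<subseteq> V \<Longrightarrow> V = Va \<alpha> \<beta>"
    unfolding Va_def by (rule plc_maximal[OF sol_a[OF ab] ec nt])
qed

lemma ia_hom:
  assumes "on_curve \<alpha> \<beta>" "a \<in> Va \<alpha> \<beta>" "b \<in> Va \<alpha> \<beta>"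
  shows "fls_nth (ia \<alpha> \<beta> (a + b)) 0 = fls_nth (ia \<alpha> \<beta> a) 0 + fls_nth (ia \<alpha> \<beta> b) 0"
    "fls_nth (ia \<alpha> \<beta> (a * b)) 0 = fls_nth (ia \<alpha> \<beta> a) 0 * fls_nth (ia \<alpha> \<beta> b) 0"
  using assms by (auto simp: ia_def Va_def plc_def iota_add[OF sol_a] iota_mult[OF sol_a] fls_nth0_mult)

lemma ia_quotient:
  assumes ab: "on_curve \<alpha> \<beta>" and z: "z \<in> Va \<alpha> \<beta>" "z = rr G / rr H" and H: "ev2 const \<alpha> \<beta> H \<noteq> 0"
  shows "fls_nth (ia \<alpha> \<beta> z) 0 = ev2 const \<alpha> \<beta> G / ev2 const \<alpha> \<beta> H"
proof -
  have "rr H \<noteq> 0" using H ia_rr_nth(1)[OF ab, of H] iota_0[OF sol_a[OF ab]] by (auto simp: ia_def)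
  hence "rr G = z * rr H" using z by simp
  hence "fls_nth (ia \<alpha> \<beta> (rr G)) 0 = fls_nth (ia \<alpha> \<beta> z) 0 * fls_nth (ia \<alpha> \<beta> (rr H)) 0"
    using ia_hom(2)[OF ab z(1) rr_Va[OF ab]] by simp
  thus ?thesis using H by (simp add: ia_rr_nth(1)[OF ab])
qed

text \<open>That residues lie in the extension of degree n is seen from the description of z as a
  quotient of polynomials whose denominator does not vanish at the point.\<close>

lemma pa_rational:
  assumes n: "n \<ge> 1" and P: "(\<alpha>, \<beta>) \<in> curve_pts n"
  shows "pa (\<alpha>, \<beta>) \<in> rational_points FF n"
proof -
  have ab: "on_curve \<alpha> \<beta>" "\<alpha> \<in> const_ext n" "\<beta> \<in> const_ext n" using P by (auto simp: curve_pts_def)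
  note pl = Va_place_max[OF ab(1) n ab(2)]
  interpret V: valuation_ring "Va \<alpha> \<beta>" FF by (rule place_vr[OF pl(1)])
  have val: "fls_nth (ia \<alpha> \<beta> z) 0 \<in> const_ext n" if z: "z \<in> Va \<alpha> \<beta>" for z
  proof -
    obtain G H where GH: "ev2 const \<alpha> \<beta> H \<noteq> 0" "z = rr G / rr H" by (rule Va_local[OF ab(1) n ab(2) z])
    show ?thesis unfolding ia_quotient[OF ab(1) z GH(2,1)]
      using ev2_const_ext[OF ab(2,3)] unfolding const_ext_eq by (intro AC.GF_closed)
  qed
  have "const c \<in> Va \<alpha> \<beta>" for c by (rule place_const[OF pl(1)])
  moreover have "fls_nth (ia \<alpha> \<beta> (const c)) 0 = const c" for c
    by (simp add: ia_def iota_gens[OF sol_a[OF ab(1)]] ea_def)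
  ultimately show ?thesis using pl(1) val V.vr
    by (auto simp: rational_points_def pa_def ia_hom[OF ab(1)])
qed

lemma pa_inj: "inj_on pa (curve_pts n)"
proof (rule inj_onI)
  fix P P' assume PP: "P \<in> curve_pts n" "P' \<in> curve_pts n" "pa P = pa P'"
  obtain \<alpha> \<beta> \<alpha>' \<beta>' where P: "P = (\<alpha>, \<beta>)" "P' = (\<alpha>', \<beta>')" by fastforce
  have ab: "on_curve \<alpha> \<beta>" "on_curve \<alpha>' \<beta>'" using PP by (auto simp: P curve_pts_def)
  have v: "snd (pa (a, b)) xcoord = a \<and> snd (pa (a, b)) y = b" if o: "on_curve a b" for a b
  proof -
    have "xcoord \<in> Va a b" "y \<in> Va a b" using rr_Va[OF o] rr_X rr_Y by metis+
    thus ?thesis using Za0[OF o]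
      by (simp add: pa_def ia_def iota_gens[OF sol_a[OF o]]) (simp add: xa_def)
  qed
  show "P = P'" using v[OF ab(1)] v[OF ab(2)] PP(3) P by metis
qed

text \<open>Polynomials not vanishing at the images \<alpha>, \<beta> of x, y are units of
  \<open>V\<close> by \<open>phi_unit\<close>. So \<open>V\<close> contains the local ring at this
  point and equals it by maximality; there the homomorphism is determined by \<alpha>,
  \<beta>.\<close>

lemma rational_affine:
  assumes n: "n \<ge> 1" and pt: "(V, \<phi>) \<in> rational_points FF n" and x: "xcoord \<in> V"
  shows "(V, \<phi>) \<in> pa ` curve_pts n"
proof -
  note PL = V_place[OF n pt]
  interpret V: valuation_ring V FF by (rule place_vr[OF PL])
  have yV: "y \<in> V" by (rule y_in_place[OF PL x])
  define \<alpha> \<beta> where "\<alpha> = \<phi> xcoord" and "\<beta> = \<phi> y"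
  have an: "\<alpha> \<in> const_ext n" "\<beta> \<in> const_ext n" using phi_in[OF n pt] x yV by (auto simp: \<alpha>_def \<beta>_def)
  have "\<phi> (y ^ q - y) = \<phi> (kx f)" by (simp only: y)
  hence ab: "on_curve \<alpha> \<beta>"
    using x yV V.vr by (simp add: on_curve_def \<alpha>_def \<beta>_def phi_diff[OF n pt] phi_power[OF n pt] phi_kx[OF n pt])
  have rep: "unit_in V (rr H) \<and> \<phi> (rr H) = ev2 const \<alpha> \<beta> H" if "ev2 const \<alpha> \<beta> H \<noteq> 0" for H
    using phi_unit[OF n pt rr_in_place[OF PL x], of H] that phi_rr[OF n pt x, of H] by (simp add: \<alpha>_def \<beta>_def)
  have sub: "Va \<alpha> \<beta> \<subseteq> V"
  proof
    fix z assume z: "z \<in> Va \<alpha> \<beta>"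
    obtain G H where GH: "ev2 const \<alpha> \<beta> H \<noteq> 0" "z = rr G / rr H" by (rule Va_local[OF ab n an(1) z])
    show "z \<in> V" unfolding GH(2) divide_inverse
      using rep[OF GH(1)] rr_in_place[OF PL x] by (intro V.vr) (auto simp: unit_in_def)
  qed
  have V: "V = Va \<alpha> \<beta>" by (rule Va_place_max(2)[OF ab n an(1) PL sub])
  have "\<phi> z = fls_nth (ia \<alpha> \<beta> z) 0" if z: "z \<in> V" for z
  proof -
    have zV: "z \<in> Va \<alpha> \<beta>" using z V by simp
    obtain G H where GH: "ev2 const \<alpha> \<beta> H \<noteq> 0" "z = rr G / rr H" by (rule Va_local[OF ab n an(1) zV])
    have "rr H \<noteq> 0" using rep[OF GH(1)] by (simp add: unit_in_def)
    hence "\<phi> z * \<phi> (rr H) = \<phi> (rr G)"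
      using GH(2) phi_mult[OF n pt z rr_in_place[OF PL x], of H] by simp
    hence "\<phi> z * ev2 const \<alpha> \<beta> H = ev2 const \<alpha> \<beta> G" using phi_rr[OF n pt x] by (simp add: \<alpha>_def \<beta>_def)
    thus ?thesis unfolding ia_quotient[OF ab zV GH(2,1)] using GH(1) by (simp add: field_simps)
  qed
  hence "\<phi> = restrict (\<lambda>z. fls_nth (ia \<alpha> \<beta> z) 0) (Va \<alpha> \<beta>)"
    using phi_ext[OF n pt] unfolding V by (intro extensionalityI[of _ "Va \<alpha> \<beta>"]) (auto simp: PiE_def)
  hence "(V, \<phi>) = pa (\<alpha>, \<beta>)" using V by (simp add: pa_def)
  moreover have "(\<alpha>, \<beta>) \<in> curve_pts n" using ab an by (simp add: curve_pts_def)
  ultimately show ?thesis by blast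
qed

section \<open>The place at infinity\<close>

definition xi_eta :: "'a fls \<times> 'a fls" where
  "xi_eta = (SOME (\<xi>, \<eta>). sol fls_const \<xi> \<eta> \<and> fls_subdegree \<xi> = - int q \<and> fls_subdegree \<eta> = - int d)"

definition xi :: "'a fls" where "xi = fst xi_eta"
definition eta :: "'a fls" where "eta = snd xi_eta"

lemma sol_inf: "sol fls_const xi eta" and subdegree_xi: "fls_subdegree xi = - int q"
  and subdegree_eta: "fls_subdegree eta = - int d"
proof -
  have "\<exists>P. case P of (\<xi>, \<eta>) \<Rightarrow> sol fls_const \<xi> \<eta> \<and> fls_subdegree \<xi> = - int q \<and> fls_subdegree \<eta> = - int d"
    by (rule ex_infinite_solution) blast
  from someI_ex[OF this] have "case xi_eta of (\<xi>, \<eta>) \<Rightarrow> sol fls_const \<xi> \<eta> \<and> fls_subdegree \<xi> = - int q \<and> fls_subdegree \<eta> = - int d"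
    unfolding xi_eta_def .
  thus "sol fls_const xi eta" "fls_subdegree xi = - int q" "fls_subdegree eta = - int d"
    by (auto simp: xi_def eta_def split: prod.splits)
qed

definition ii :: "'a ambient \<Rightarrow> 'a fls" where "ii = iota fls_const xi eta"
definition Vi :: "'a ambient set" where "Vi = plc fls_const xi eta"

lemma ii_x: "ii xcoord = xi" and ii_y: "ii y = eta" and ii_const: "ii (const c) = fls_const c"
  by (simp_all add: ii_def iota_gens[OF sol_inf])

lemma nontriv_inf: "\<exists>z\<in>FF. fls_subdegree (iota fls_const xi eta z) < 0"
  using FF_gens subdegree_xi q2 ii_x by (intro bexI[of _ xcoord]) (auto simp: ii_def)

lemma const_inf: "0 \<le> fls_subdegree (fls_const c :: 'a fls)" by simp

lemma Vi_place: "Vi \<in> places FF"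
  unfolding Vi_def by (rule plc_place[OF sol_inf const_inf nontriv_inf])

lemma x_notin_Vi: "xcoord \<notin> Vi"
  using subdegree_xi q2 ii_x by (auto simp: Vi_def plc_def ii_def)

lemma subdegree_ii_frac:
  assumes "c \<noteq> 0" "G \<noteq> 0" "Polynomial.degree G < q"
  shows "fls_subdegree (ii (frac G c)) = int (q * Polynomial.degree c) - int (wd G)"
proof -
  have "xi \<noteq> 0" using subdegree_xi q2 by auto
  hence "ev1 fls_const xi c \<noteq> 0" "fls_subdegree (ev1 fls_const xi c) = - int q * int (Polynomial.degree c)"
    using subdegree_ev1[OF rhom_fls_const, of xi c] assms(1) subdegree_xi q2 by (auto simp: fls_const_nonzero)
  thus ?thesis using subdegree_ev2[OF subdegree_xi subdegree_eta assms(2,3)]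
    by (simp add: ii_def iota_frac[OF sol_inf assms(1)] divide_inverse)
qed

text \<open>If x has a pole at \<open>V\<close>, a polynomial in x behaves like its leading power,
  and the equation bounds y^q by x^d. So what is regular at \<open>Vi\<close> is regular at
  \<open>V\<close>, and maximality of \<open>Vi\<close> applies.\<close>

lemma Vi_unique:
  assumes V: "V \<in> places FF" and x: "xcoord \<notin> V" shows "V = Vi"
proof -
  interpret V: valuation_ring V FF by (rule place_vr[OF V])
  let ?t = "inverse xcoord :: 'a ambient"
  have x0: "(xcoord :: 'a ambient) \<noteq> 0" using x V.vr by auto
  have t: "?t \<in> V" "\<not> unit_in V ?t" using V.val[OF FF_gens(2)] x by (auto simp: unit_in_def)
  have ug: "unit_in V (kx g * ?t ^ Polynomial.degree g)" if "g \<noteq> 0" for g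
    using that
  proof (induction g)
    case (pCons c g)
    show ?case
    proof (cases "g = 0")
      case True
      thus ?thesis using pCons place_const_unit[OF V, of c] by (simp add: C.ev1_const)
    next
      case False
      have "kx (pCons c g) * ?t ^ Polynomial.degree (pCons c g) =
          kx g * ?t ^ Polynomial.degree g + const c * ?t ^ Suc (Polynomial.degree g)"
      proof -
        have xt: "xcoord * ?t = 1" using x0 by simp
        have "(a + x * K) * (t * b) = (x * t) * (K * b) + a * (t * b)" for a x t K b :: "'a ambient"
          by (simp add: algebra_simps)
        from this[of _ xcoord _ ?t] show ?thesis unfolding xt C.ev1_pCons degree_pCons_eq[OF False] power_Suc by simp
      qed
      moreover have "\<not> unit_in V (?t * (const c * ?t ^ Polynomial.degree g))"
        using V.unit_factor[of ?t "const c * ?t ^ Polynomial.degree g"] t place_const[OF V] V.vr by auto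
      hence "\<not> unit_in V (const c * ?t ^ Suc (Polynomial.degree g))" by (simp add: mult_ac)
      ultimately show ?thesis using pCons False t place_const[OF V] V.vr by (auto intro!: V.unit_add_nonunit)
    qed
  qed simp
  have f0: "f \<noteq> 0" using lead_f by auto
  have yq: "y ^ q * ?t ^ d \<in> V"
  proof -
    have fu: "unit_in V (kx f * ?t ^ d)" using ug[OF f0] d by simp
    have "y \<notin> V"
    proof
      assume "y \<in> V"
      hence "kx f \<in> V" unfolding y[symmetric] by (intro V.vr)
      hence "unit_in V (?t ^ d)" using V.unit_factor[of "?t ^ d" "kx f"] fu t V.vr by (simp add: mult.commute)
      thus False using V.nonunit_power[OF t, of d] d2 by simp
    qed
    hence r: "inverse y \<in> V" "\<not> unit_in V (inverse y)" using V.val[OF FF_gens(3)] by (auto simp: unit_in_def)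
    have y0: "y \<noteq> 0" using \<open>y \<notin> V\<close> V.vr by auto
    have "\<not> unit_in V (inverse y ^ (q - 1))" using V.nonunit_power[OF r] q2 by simp
    hence "\<not> unit_in V (- (inverse y ^ (q - 1)))" by (subst V.unit_minus)
    hence "unit_in V (1 + - (inverse y ^ (q - 1)))" using r V.vr by (intro V.unit_add_nonunit V.unit_1) auto
    hence u: "unit_in V (1 - inverse y ^ (q - 1))" by simp
    have "y ^ q * (1 - inverse y ^ (q - 1)) = kx f"
    proof -
      have "y ^ q * inverse y ^ (q - 1) = y" using q2 y0 by (cases q) (auto simp: power_inverse)
      thus ?thesis using y by (simp add: right_diff_distrib)
    qed
    hence "y ^ q = kx f * inverse (1 - inverse y ^ (q - 1))"
      using u by (simp add: unit_in_def field_simps)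
    hence e: "y ^ q * ?t ^ d = (kx f * ?t ^ d) * inverse (1 - inverse y ^ (q - 1))" by (simp only: mult_ac)
    have "kx f * ?t ^ d \<in> V" using fu by (simp add: unit_in_def)
    moreover have "inverse (1 - inverse y ^ (q - 1)) \<in> V" using u by (simp add: unit_in_def)
    ultimately show ?thesis unfolding e by (rule V.vr(4))
  qed
  have "Vi \<subseteq> V"
  proof
    fix z assume z: "z \<in> Vi"
    hence zF: "z \<in> FF" by (simp add: Vi_def plc_def)
    obtain G c where G: "c \<noteq> 0" "z = frac G c" "G = 0 \<or> Polynomial.degree G < q" by (rule FF_frac_reduced[OF zF])
    show "z \<in> V"
    proof (cases "G = 0")
      case True
      thus ?thesis using G V.vr by (simp add: frac_def RR.h0)
    next
      case False
      let ?D = "Polynomial.degree c"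
      have "0 \<le> fls_subdegree (ii (frac G c))" using z G by (simp add: Vi_def plc_def ii_def)
      hence wd: "wd G \<le> q * ?D" using subdegree_ii_frac[OF G(1) False] False G(3)
        by (metis diff_ge_0_iff_ge of_nat_le_iff)
      let ?uc = "kx c * ?t ^ ?D"
      have uc: "unit_in V ?uc" by (rule ug[OF G(1)])
      have kc: "kx c = ?uc * xcoord ^ ?D" using x0 by (simp add: power_inverse)
      \<comment> \<open>Passing to z^q splits the sum by Frobenius and replaces y by y^q, which is
        comparable with x^d. The weight bound then controls every term, and z^q in \<open>V\<close>
        gives z in \<open>V\<close>.\<close>
      have "z ^ q * kx c ^ q = (rr G) ^ q" using G(1,2) kx_eq_0_iff[of c] by (simp add: frac_def power_divide)
      also have "\<dots> = (\<Sum>j\<le>Polynomial.degree G. kx (Polynomial.coeff G j) ^ q * (y ^ q) ^ j)"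
        unfolding C.ev2_sum q AC.frob_sum by (simp add: power_mult_distrib mult.commute flip: power_mult)
      finally have zq: "z ^ q * kx c ^ q = \<dots>" .
      have "z ^ q = z ^ q * kx c ^ q * (?t ^ (q * ?D) * inverse ?uc ^ q)"
      proof -
        have "kx c ^ q * (?t ^ (q * ?D) * inverse ?uc ^ q) = (kx c * ?t ^ ?D * inverse ?uc) ^ q"
          by (simp only: power_mult_distrib mult_ac flip: power_mult)
        also have "kx c * ?t ^ ?D * inverse ?uc = 1" using uc unfolding unit_in_def by (intro right_inverse) auto
        finally show ?thesis by (simp add: mult.assoc)
      qed
      also have "\<dots> = (\<Sum>j\<le>Polynomial.degree G. kx (Polynomial.coeff G j) ^ q * (y ^ q) ^ j * (?t ^ (q * ?D) * inverse ?uc ^ q))"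
        unfolding zq sum_distrib_right ..
      also have "\<dots> \<in> V"
      proof (rule is_subring_sum[OF V.ring])
        fix j assume "j \<in> {..Polynomial.degree G}"
        show "kx (Polynomial.coeff G j) ^ q * (y ^ q) ^ j * (?t ^ (q * ?D) * inverse ?uc ^ q) \<in> V"
        proof (cases "Polynomial.coeff G j = 0")
          case True
          have "(0 :: 'a ambient) ^ q = 0" using q2 by (simp add: power_0_left)
          thus ?thesis unfolding True K.h0 using V.vr(1) by (simp only: mult_zero_left)
        next
          case nz: False
          let ?g = "Polynomial.coeff G j"
          have "q * Polynomial.degree ?g + d * j \<le> q * ?D" using wd wd_le_iff[OF False] nz by blast
          then obtain k where k: "q * ?D = q * Polynomial.degree ?g + d * j + k" using le_Suc_ex by blast
          have "kx ?g ^ q * (y ^ q) ^ j * (?t ^ (q * ?D) * inverse ?uc ^ q) =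
             (kx ?g * ?t ^ Polynomial.degree ?g) ^ q * ((y ^ q * ?t ^ d) ^ j * (?t ^ k * inverse ?uc ^ q))"
            unfolding k by (simp only: power_mult_distrib power_add mult_ac flip: power_mult)
          also have "\<dots> \<in> V"
          proof -
            have gV: "kx ?g * ?t ^ Polynomial.degree ?g \<in> V" using ug[OF nz] by (simp only: unit_in_def)
            have cV: "inverse ?uc \<in> V" using uc by (simp only: unit_in_def)
            show ?thesis
              by (rule V.vr(4)[OF V.vr(7)[OF gV] V.vr(4)[OF V.vr(7)[OF yq] V.vr(4)[OF V.vr(7)[OF t(1)] V.vr(7)[OF cV]]]])
          qed
          finally show ?thesis .
        qed
      qed
      finally have "z ^ q \<in> V" .
      thus ?thesis using V.root_in[OF zF] q2 by simp
    qed
  qed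
  thus ?thesis using plc_maximal[OF sol_inf const_inf nontriv_inf V] by (simp add: Vi_def)
qed

definition pinf :: "'a ambient set \<times> ('a ambient \<Rightarrow> 'a ambient)" where
  "pinf = (Vi, restrict (\<lambda>z. const (fls_nth (ii z) 0)) Vi)"

lemma pinf_rational: "pinf \<in> rational_points FF n"
proof -
  interpret V: valuation_ring Vi FF by (rule place_vr[OF Vi_place])
  have "const c \<in> const_ext n" for c :: 'a
    unfolding const_ext_eq by (rule AC.GF_mult[OF const_GF])
  moreover have "fls_nth (ii (a + b)) 0 = fls_nth (ii a) 0 + fls_nth (ii b) 0"
    "fls_nth (ii (a * b)) 0 = fls_nth (ii a) 0 * fls_nth (ii b) 0" if "a \<in> Vi" "b \<in> Vi" for a b
    using that by (auto simp: ii_def Vi_def plc_def iota_add[OF sol_inf] iota_mult[OF sol_inf] fls_nth0_mult)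
  ultimately show ?thesis using Vi_place V.vr place_const[OF Vi_place]
    by (auto simp: rational_points_def pinf_def const_simps ii_const)
qed

text \<open>Subtracting the residue leaves a non-unit at infinity, which every homomorphism kills by
  \<open>phi_unit\<close>.\<close>

lemma rational_inf:
  assumes n: "n \<ge> 1" and pt: "(V, \<phi>) \<in> rational_points FF n" and x: "xcoord \<notin> V"
  shows "(V, \<phi>) = pinf"
proof -
  note PL = V_place[OF n pt]
  have V: "V = Vi" by (rule Vi_unique[OF PL x])
  interpret V: valuation_ring V FF by (rule place_vr[OF PL])
  have "\<phi> z = const (fls_nth (ii z) 0)" if z: "z \<in> V" for z
  proof -
    let ?w = "z - const (fls_nth (ii z) 0)"
    have zF: "z \<in> FF" using z V.sub by blast
    have w: "?w \<in> V" using z place_const[OF PL] by (intro V.vr)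
    have iw: "ii ?w = ii z - fls_const (fls_nth (ii z) 0)"
      using zF FF_gens by (simp add: ii_def iota_diff[OF sol_inf] iota_gens[OF sol_inf])
    have "\<phi> ?w = 0"
    proof (rule ccontr)
      assume "\<phi> ?w \<noteq> 0"
      hence u: "unit_in V ?w" by (rule phi_unit[OF n pt w])
      have "?w \<in> FF" using w V.sub by blast
      hence "ii (inverse ?w) = inverse (ii ?w)" by (simp add: ii_def iota_inverse[OF sol_inf])
      hence "0 \<le> - fls_subdegree (ii ?w)" using u V by (simp add: unit_in_def Vi_def plc_def ii_def)
      moreover have "ii ?w \<noteq> 0" using u \<open>?w \<in> FF\<close> by (simp add: ii_def iota_eq_0_iff[OF sol_inf] unit_in_def)
      moreover have "0 \<le> fls_subdegree (ii ?w)" using w V by (simp add: Vi_def plc_def ii_def)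
      ultimately have "fls_nth (ii ?w) 0 \<noteq> 0" using nth_fls_subdegree_nonzero[of "ii ?w"] by simp
      thus False unfolding iw by simp
    qed
    thus ?thesis using phi_diff[OF n pt z place_const[OF PL]] phi_const[OF n pt] by simp
  qed
  hence "\<phi> = restrict (\<lambda>z. const (fls_nth (ii z) 0)) Vi"
    using phi_ext[OF n pt] unfolding V by (intro extensionalityI[of _ Vi]) (auto simp: PiE_def)
  thus ?thesis using V by (simp add: pinf_def)
qed

theorem card_rational_points:
  assumes n: "n \<ge> 1"
  shows "card (rational_points FF n) = 1 + card (curve_pts n)"
proof -
  have sn: "s * n \<ge> 1" using s n mult_le_mono[of 1 s 1 n] by simp
  have fin: "finite (curve_pts n)"
    by (rule finite_subset[of _ "const_ext n \<times> const_ext n"])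
      (auto simp: curve_pts_def const_ext_eq AC.finite_GF[OF sn])
  have "rational_points FF n = insert pinf (pa ` curve_pts n)"
  proof (intro equalityI subsetI)
    fix R assume "R \<in> rational_points FF n"
    moreover obtain V \<phi> where "R = (V, \<phi>)" by fastforce
    ultimately show "R \<in> insert pinf (pa ` curve_pts n)"
      using rational_affine[OF n, of V \<phi>] rational_inf[OF n, of V \<phi>] by blast
  next
    fix R assume "R \<in> insert pinf (pa ` curve_pts n)"
    thus "R \<in> rational_points FF n" using pinf_rational pa_rational[OF n] by auto
  qed
  moreover have "pinf \<notin> pa ` curve_pts n"
  proof
    assume "pinf \<in> pa ` curve_pts n"
    then obtain \<alpha> \<beta> where "on_curve \<alpha> \<beta>" "Vi = Va \<alpha> \<beta>" by (auto simp: pinf_def pa_def curve_pts_def)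
    thus False using rr_Va rr_X x_notin_Vi by metis
  qed
  ultimately show ?thesis using fin pa_inj by (simp add: card_image)
qed

end

section \<open>Regular differentials and the genus\<close>

lemma fls_deriv_nonneg: "0 \<le> fls_subdegree F \<Longrightarrow> 0 \<le> fls_subdegree (fls_deriv (F :: 'b::field fls))"
proof (rule fls_subdegree_ge0I)
  fix k :: int assume "0 \<le> fls_subdegree F" "k < 0"
  thus "fls_nth (fls_deriv F) k = 0" by (cases "k = -1") auto
qed

context AS_point begin

text \<open>Says w = dz/dx after expansion in a parameter T, by the chain rule dz/dT =
  (dz/dx)(dx/dT).\<close>

definition deriv_pair :: "('a \<Rightarrow> 'k::field fls) \<Rightarrow> 'k fls \<Rightarrow> 'k fls \<Rightarrow> 'a ambient \<Rightarrow> 'a ambient \<Rightarrow> bool" where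
  "deriv_pair e \<xi> \<eta> z w \<longleftrightarrow> fls_deriv (iota e \<xi> \<eta> z) = iota e \<xi> \<eta> w * fls_deriv \<xi>"

context
  fixes e :: "'a \<Rightarrow> 'k::field fls" and \<xi> \<eta> :: "'k fls"
  assumes s: "sol e \<xi> \<eta>" and e': "\<And>c. fls_deriv (e c) = 0"
begin

lemma deriv_pair_gens:
  "deriv_pair e \<xi> \<eta> (const c) 0" "deriv_pair e \<xi> \<eta> xcoord 1" "deriv_pair e \<xi> \<eta> y (- kx (pderiv f))"
proof -
  have "iota e \<xi> \<eta> (- kx (pderiv f)) = - ev1 e \<xi> (pderiv f)"
    using iota_diff[OF s, of 0 "kx (pderiv f)"] FF_ring kx_FF by (simp add: iota_0[OF s] iota_kx[OF s])
  thus "deriv_pair e \<xi> \<eta> y (- kx (pderiv f))"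
    using deriv_gen[OF s e'] by (simp add: deriv_pair_def iota_gens[OF s])
qed (simp_all add: deriv_pair_def iota_gens[OF s] iota_0[OF s] iota_1[OF s] e')

lemma deriv_pair_diff:
  assumes "a \<in> FF" "b \<in> FF" "w \<in> FF" "v \<in> FF" "deriv_pair e \<xi> \<eta> a w" "deriv_pair e \<xi> \<eta> b v"
  shows "deriv_pair e \<xi> \<eta> (a - b) (w - v)"
  using assms by (simp add: deriv_pair_def iota_diff[OF s] left_diff_distrib)

lemma deriv_pair_mult:
  assumes "a \<in> FF" "b \<in> FF" "w \<in> FF" "v \<in> FF" "deriv_pair e \<xi> \<eta> a w" "deriv_pair e \<xi> \<eta> b v"
  shows "deriv_pair e \<xi> \<eta> (a * b) (a * v + b * w)"
  using assms by (simp add: deriv_pair_def iota_mult[OF s] iota_add[OF s] FF_ring distrib_left distrib_right mult_ac)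

lemma deriv_pair_inverse:
  assumes "a \<in> FF" "a \<noteq> 0" "w \<in> FF" "deriv_pair e \<xi> \<eta> a w"
  shows "deriv_pair e \<xi> \<eta> (inverse a) (- (inverse a)\<^sup>2 * w)"
proof -
  let ?i = "iota e \<xi> \<eta>"
  have nz: "?i a \<noteq> 0" using assms iota_eq_0_iff[OF s] by simp
  have "?i a * ?i (inverse a) = 1" using assms nz by (simp add: iota_inverse[OF s])
  hence "fls_deriv (?i a * ?i (inverse a)) = fls_deriv 1" by (rule arg_cong)
  hence "?i a * fls_deriv (?i (inverse a)) + fls_deriv (?i a) * ?i (inverse a) = 0"
    by (simp only: fls_deriv_mult fls_deriv_one)
  hence e1: "?i a * fls_deriv (?i (inverse a)) = - (fls_deriv (?i a) * ?i (inverse a))"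
    by (simp add: eq_neg_iff_add_eq_0)
  have "fls_deriv (?i (inverse a)) = inverse (?i a) * (?i a * fls_deriv (?i (inverse a)))"
    using nz by (simp flip: mult.assoc)
  also have "\<dots> = - (inverse (?i a) * inverse (?i a) * ?i w * fls_deriv \<xi>)"
    unfolding e1 using assms by (simp add: deriv_pair_def iota_inverse[OF s] mult_ac)
  also have "inverse (?i a) * inverse (?i a) * ?i w = ?i ((inverse a)\<^sup>2 * w)"
    using assms by (simp add: iota_mult[OF s] iota_inverse[OF s] FF_ring FF_inverse power2_eq_square)
  also have "- (?i ((inverse a)\<^sup>2 * w) * fls_deriv \<xi>) = ?i (0 - (inverse a)\<^sup>2 * w) * fls_deriv \<xi>"
    using assms by (subst iota_diff[OF s]) (auto simp: iota_0[OF s] FF_ring FF_inverse)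
  finally show ?thesis by (simp add: deriv_pair_def)
qed

end

lemma derivationD:
  assumes "D \<in> derivations FF"
  shows "a \<in> FF \<Longrightarrow> D a \<in> FF" "a \<notin> FF \<Longrightarrow> D a = 0"
    "a \<in> FF \<Longrightarrow> b \<in> FF \<Longrightarrow> D (a + b) = D a + D b"
    "a \<in> FF \<Longrightarrow> b \<in> FF \<Longrightarrow> D (a * b) = a * D b + b * D a" "D (const c) = 0"
  using assms unfolding derivations_def by blast+

lemma derivation_diff:
  assumes D: "D \<in> derivations FF" and "a \<in> FF" "b \<in> FF" shows "D (a - b) = D a - D b"
  using derivationD(3)[OF D, of "a - b" b] assms FF_ring by simp

lemma derivation_inverse:
  assumes D: "D \<in> derivations FF" and "a \<in> FF" "a \<noteq> 0" shows "D (inverse a) = - (inverse a)\<^sup>2 * D a"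
proof -
  have "a * inverse a = const 1" using assms by (simp add: const_simps)
  hence "D (a * inverse a) = 0" using derivationD(5)[OF D] by metis
  hence "a * D (inverse a) + inverse a * D a = 0"
    unfolding derivationD(4)[OF D assms(2) FF_inverse[OF assms(2)]] .
  hence "a * D (inverse a) = - (inverse a * D a)" by (simp add: eq_neg_iff_add_eq_0)
  hence "inverse a * (a * D (inverse a)) = - ((inverse a)\<^sup>2 * D a)" by (simp add: power2_eq_square)
  thus ?thesis using assms(3) by (simp flip: mult.assoc)
qed

lemma derivation_power:
  assumes D: "D \<in> derivations FF" and "a \<in> FF" shows "D (a ^ n) = of_nat n * a ^ (n - 1) * D a"
proof (induction n)
  case 0
  show ?case using derivationD(5)[OF D, of 1] by (simp add: const_simps)
next
  case (Suc n)
  show ?case using derivationD(4)[OF D, of a "a ^ n"] assms FF_ring Suc by (cases n) (auto simp: algebra_simps)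
qed

lemma derivation_kx:
  assumes D: "D \<in> derivations FF" shows "D (kx g) = kx (pderiv g) * D xcoord"
proof (induction g)
  case 0
  show ?case using derivationD(5)[OF D, of 0] by (simp add: const_simps K.h0)
next
  case (pCons c g)
  have "D (kx (pCons c g)) = D (const c) + D (xcoord * kx g)"
    unfolding C.ev1_pCons by (intro derivationD(3)[OF D] FF_ring FF_gens kx_FF)
  also have "D (xcoord * kx g) = xcoord * D (kx g) + kx g * D xcoord"
    by (intro derivationD(4)[OF D] FF_gens kx_FF)
  finally show ?case using pCons.IH by (simp add: derivationD(5)[OF D] pderiv_pCons K.hadd C.ev1_pCons C.h0 distrib_right mult.assoc)
qed

lemma derivation_y:
  assumes D: "D \<in> derivations FF" shows "D y = - (kx (pderiv f)) * D xcoord"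
proof -
  have "(of_nat q :: 'a ambient) = 0" using C.hof_nat[of q] of_nat_q C.h0 by simp
  hence "D (y ^ q) = 0" using derivation_power[OF D FF_gens(3), of q] by simp
  moreover have "D (y ^ q - y) = D (y ^ q) - D y" by (intro derivation_diff[OF D] FF_ring FF_gens)
  ultimately have "- D y = kx (pderiv f) * D xcoord" using derivation_kx[OF D, of f] y by simp
  thus ?thesis by (metis minus_minus mult_minus_left)
qed

end

context AS_place begin

text \<open>The order of dx at infinity; it equals (q - 1)(d - 1) - 2 = 2 g - 2.\<close>

abbreviation mu :: int where "mu \<equiv> int (q * (d - 1)) - int d - 1"

lemma const_deriv: "fls_deriv (fls_const (c :: 'a)) = 0" "fls_deriv (ea c) = 0"
  by (simp_all add: ea_def)

text \<open>The pole order q of \<open>xi\<close> is divisible by p and hides the order of its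
  derivative. That order is read off from \<open>eta\<close>, whose pole order d is prime to p,
  through dy = - f'(x) dx.\<close>

lemma xi_deriv: "fls_deriv xi \<noteq> 0" "fls_subdegree (fls_deriv xi) = mu"
proof -
  have "(of_int (- int d) :: 'a) \<noteq> 0" using of_nat_d by simp
  hence e: "fls_subdegree (fls_deriv eta) = - int d - 1"
    using fls_subdegree_deriv'[of eta] unfolding subdegree_eta by blast
  hence e0: "fls_deriv eta \<noteq> 0" by auto
  have g: "fls_deriv eta = - (ev1 fls_const xi (pderiv f) * fls_deriv xi)"
    by (rule deriv_gen[OF sol_inf const_deriv(1)])
  have "Polynomial.coeff (pderiv f) (d - 1) = of_nat d * Polynomial.coeff f d" using d2 by (simp add: coeff_pderiv)
  hence c: "Polynomial.coeff (pderiv f) (d - 1) \<noteq> 0" using of_nat_d lead_f by simp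
  have "Polynomial.degree (pderiv f) \<le> d - 1" by (rule degree_le) (auto simp: coeff_pderiv coeff_eq_0 d)
  hence dg: "Polynomial.degree (pderiv f) = d - 1" "pderiv f \<noteq> 0" using c le_degree[OF c] by auto
  have "xi \<noteq> 0" using subdegree_xi q2 by auto
  hence "ev1 fls_const xi (pderiv f) \<noteq> 0 \<and> fls_subdegree (ev1 fls_const xi (pderiv f)) = - int q * int (d - 1)"
    using subdegree_ev1[OF rhom_fls_const, of xi "pderiv f"] dg subdegree_xi q2 by (auto simp: fls_const_nonzero)
  thus x0: "fls_deriv xi \<noteq> 0" "fls_subdegree (fls_deriv xi) = mu"
    using g e e0 by auto
qed

lemma xa_deriv: "fls_deriv (xa \<alpha>) = 1"
  by (simp add: xa_def fls_deriv_fps_to_fls)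

text \<open>One element must serve as dz/dx at infinity and at all affine points at once, so that
  the local computations concern the same form.\<close>

definition compat :: "'a ambient \<Rightarrow> 'a ambient \<Rightarrow> bool" where
  "compat z w \<longleftrightarrow> w \<in> FF \<and> deriv_pair fls_const xi eta z w \<and>
    (\<forall>\<alpha> \<beta>. on_curve \<alpha> \<beta> \<longrightarrow> deriv_pair ea (xa \<alpha>) (fps_to_fls (Za \<alpha> \<beta>)) z w)"

lemma ex_compat:
  assumes "z \<in> FF" shows "\<exists>w. compat z w"
proof (rule is_subfield_deriv_set[OF sol_inf _ _ _ _ _ _ assms])
  note gi = deriv_pair_gens[OF sol_inf const_deriv(1)] and ga = deriv_pair_gens[OF sol_a const_deriv(2)]
  have kF: "- kx (pderiv f) \<in> FF" "0 \<in> FF" "1 \<in> FF" by (intro FF_ring kx_FF)+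
  show "\<exists>w. compat (const c) w" for c using gi(1) ga(1) kF unfolding compat_def by blast
  show "\<exists>w. compat xcoord w" using gi(2) ga(2) kF unfolding compat_def by blast
  show "\<exists>w. compat y w" using gi(3) ga(3) kF unfolding compat_def by blast
next
  fix a b assume F: "a \<in> FF" "b \<in> FF" and "\<exists>w. compat a w" "\<exists>w. compat b w"
  then obtain w v where wv: "compat a w" "compat b v" by blast
  hence wF: "w \<in> FF" "v \<in> FF" by (auto simp: compat_def)
  have "compat (a - b) (w - v)"
    using wv F wF deriv_pair_diff[OF sol_inf const_deriv(1) F wF] deriv_pair_diff[OF sol_a const_deriv(2) F wF] FF_ring(3)[OF wF]
    unfolding compat_def by blast
  thus "\<exists>w. compat (a - b) w" by blast
  have "a * v + b * w \<in> FF" using F wF by (intro FF_ring)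
  hence "compat (a * b) (a * v + b * w)"
    using wv F wF deriv_pair_mult[OF sol_inf const_deriv(1) F wF] deriv_pair_mult[OF sol_a const_deriv(2) F wF]
    unfolding compat_def by blast
  thus "\<exists>w. compat (a * b) w" by blast
next
  fix a assume F: "a \<in> FF" "a \<noteq> 0" and "\<exists>w. compat a w"
  then obtain w where w: "compat a w" by blast
  hence wF: "w \<in> FF" by (auto simp: compat_def)
  have "- (inverse a)\<^sup>2 * w \<in> FF" using F wF by (intro FF_ring FF_inverse)
  hence "compat (inverse a) (- (inverse a)\<^sup>2 * w)"
    using w F wF deriv_pair_inverse[OF sol_inf const_deriv(1) F wF] deriv_pair_inverse[OF sol_a const_deriv(2) F wF]
    unfolding compat_def by blast
  thus "\<exists>w. compat (inverse a) w" by blast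
qed

definition Dx :: "'a ambient \<Rightarrow> 'a ambient" where
  "Dx z = (if z \<in> FF then SOME w. compat z w else 0)"

lemma Dx: "z \<in> FF \<Longrightarrow> compat z (Dx z)"
  using someI_ex[OF ex_compat] by (simp add: Dx_def)

lemma Dx_FF: "Dx z \<in> FF" using Dx[of z] FF_ring by (cases "z \<in> FF") (auto simp: compat_def Dx_def)

lemma Dx_ii: "z \<in> FF \<Longrightarrow> fls_deriv (ii z) = ii (Dx z) * fls_deriv xi"
  using Dx by (simp add: compat_def deriv_pair_def ii_def)

lemma Dx_ia: "z \<in> FF \<Longrightarrow> on_curve \<alpha> \<beta> \<Longrightarrow> fls_deriv (ia \<alpha> \<beta> z) = ia \<alpha> \<beta> (Dx z)"
  using Dx[of z] by (simp add: compat_def deriv_pair_def ia_def xa_deriv)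

lemma Dx_eqI:
  assumes "z \<in> FF" "w \<in> FF" "deriv_pair fls_const xi eta z w" shows "Dx z = w"
proof -
  have "ii w * fls_deriv xi = ii (Dx z) * fls_deriv xi"
    using Dx_ii[OF assms(1)] assms(3) unfolding deriv_pair_def ii_def by (simp only:)
  hence "ii (Dx z - w) = 0" using xi_deriv(1) Dx_FF[of z] assms(2) by (simp add: ii_def iota_diff[OF sol_inf])
  thus ?thesis using iota_eq_0_iff[OF sol_inf, of "Dx z - w"] FF_ring(3)[OF Dx_FF[of z] assms(2)] by (simp add: ii_def)
qed

lemma Dx_derivation: "Dx \<in> derivations FF"
proof -
  have Dp: "deriv_pair fls_const xi eta z (Dx z)" if "z \<in> FF" for z using Dx[OF that] by (simp add: compat_def)
  have c: "Dx (const c) = 0" for c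
    using deriv_pair_gens(1)[OF sol_inf const_deriv(1)] FF_ring FF_gens by (intro Dx_eqI)
  have df: "Dx (a - b) = Dx a - Dx b" if "a \<in> FF" "b \<in> FF" for a b
    using that by (intro Dx_eqI FF_ring Dx_FF deriv_pair_diff[OF sol_inf const_deriv(1)] Dp)
  have "Dx (a + b) = Dx a + Dx b" if F: "a \<in> FF" "b \<in> FF" for a b
    using df[of "a + b" b] that FF_ring by simp
  moreover have "Dx (a * b) = a * Dx b + b * Dx a" if "a \<in> FF" "b \<in> FF" for a b
    using that by (intro Dx_eqI FF_ring Dx_FF deriv_pair_mult[OF sol_inf const_deriv(1)] Dp)
  moreover have "a \<notin> FF \<Longrightarrow> Dx a = 0" for a by (simp add: Dx_def)
  ultimately show ?thesis using c Dx_FF unfolding derivations_def by blast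
qed

lemma Dx_x: "Dx xcoord = 1"
  using deriv_pair_gens(2)[OF sol_inf const_deriv(1)] FF_ring FF_gens by (intro Dx_eqI)

text \<open>Both sides agree on the constants, x and y and obey the same rules. So d/dx spans the
  derivations, and each a db is a multiple of dx.\<close>

lemma derivation_eq:
  assumes D: "D \<in> derivations FF" and b: "b \<in> FF" shows "D b = Dx b * D xcoord"
proof (rule is_subfield_deriv_set[OF sol_inf _ _ _ _ _ _ b])
  note X = Dx_derivation
  show "D (const c) = Dx (const c) * D xcoord" for c by (simp add: derivationD(5)[OF D] derivationD(5)[OF X])
  show "D xcoord = Dx xcoord * D xcoord" by (simp add: Dx_x)
  show "D y = Dx y * D xcoord" by (simp add: derivation_y[OF D] derivation_y[OF X] Dx_x)
  show "D (a - b) = Dx (a - b) * D xcoord" if "a \<in> FF" "b \<in> FF" "D a = Dx a * D xcoord" "D b = Dx b * D xcoord" for a b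
    using that by (simp add: derivation_diff[OF D] derivation_diff[OF X] left_diff_distrib)
  show "D (a * b) = Dx (a * b) * D xcoord" if "a \<in> FF" "b \<in> FF" "D a = Dx a * D xcoord" "D b = Dx b * D xcoord" for a b
    using that by (simp add: derivationD(4)[OF D] derivationD(4)[OF X] distrib_right mult.assoc)
  show "D (inverse a) = Dx (inverse a) * D xcoord" if "a \<in> FF" "D a = Dx a * D xcoord" "a \<noteq> 0" for a
    using that by (simp add: derivation_inverse[OF D] derivation_inverse[OF X] mult.assoc)
qed

abbreviation om :: "'a ambient \<Rightarrow> 'a form" where "om h \<equiv> differential FF h xcoord"

lemma differential_eq: "b \<in> FF \<Longrightarrow> differential FF a b = om (a * Dx b)"
  using derivation_eq by (auto simp: differential_def fun_eq_iff mult.assoc)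

lemma om_Dx: "om h Dx = h" by (simp add: differential_def Dx_derivation Dx_x)

lemma om_eq_iff: "om h = om h' \<longleftrightarrow> h = h'" by (metis om_Dx)

lemma om_0: "om 0 = 0" by (auto simp: differential_def fun_eq_iff)

lemma om_add: "om (a + b) = om a + om b" by (auto simp: differential_def fun_eq_iff distrib_right)

lemma om_scale: "scale_form c (om h) = om (const c * h)" by (auto simp: differential_def scale_form_def fun_eq_iff mult.assoc)

lemma om_sum: "om (\<Sum>i\<in>I. g i) = (\<Sum>i\<in>I. om (g i))"
  by (induction I rule: infinite_finite_induct) (auto simp: om_0 om_add)

interpretation VS: vector_space "scale_form :: 'a \<Rightarrow> 'a form \<Rightarrow> 'a form" by (rule vector_space_scale_form)

text \<open>The forms h dx with h in \<open>S\<close> are a subspace containing the generators a db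
  = a (db/dx) dx; applied with \<open>S\<close> given by an order condition, this bounds the regular
  forms from above.\<close>

lemma regular_form:
  assumes V: "V \<in> places FF" and S: "0 \<in> S" "\<And>a b. a \<in> S \<Longrightarrow> b \<in> S \<Longrightarrow> a + b \<in> S" "\<And>c a. a \<in> S \<Longrightarrow> const c * a \<in> S"
    and D: "\<And>a b. a \<in> V \<Longrightarrow> b \<in> V \<Longrightarrow> a * Dx b \<in> S" and \<omega>: "\<omega> \<in> regular_at FF V"
  shows "\<exists>h\<in>S. \<omega> = om h"
proof -
  have sub: "V \<subseteq> FF" using V by (auto simp: places_def)
  have "VS.span {differential FF a b | a b. a \<in> V \<and> b \<in> V} \<subseteq> {om h | h. h \<in> S}"
  proof (rule VS.span_minimal)
    show "{differential FF a b | a b. a \<in> V \<and> b \<in> V} \<subseteq> {om h | h. h \<in> S}"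
    proof
      fix \<omega> assume "\<omega> \<in> {differential FF a b | a b. a \<in> V \<and> b \<in> V}"
      then obtain a b where ab: "a \<in> V" "b \<in> V" "\<omega> = differential FF a b" by blast
      hence "\<omega> = om (a * Dx b)" using sub differential_eq by blast
      thus "\<omega> \<in> {om h | h. h \<in> S}" using D[OF ab(1,2)] by blast
    qed
    show "VS.subspace {om h | h. h \<in> S}"
    proof (rule VS.subspaceI)
      show "0 \<in> {om h | h. h \<in> S}" using S(1) om_0[symmetric] by blast
      fix \<omega> \<eta> :: "'a form" and c assume "\<omega> \<in> {om h | h. h \<in> S}"
      then obtain h where h: "h \<in> S" "\<omega> = om h" by blast
      thus "scale_form c \<omega> \<in> {om h | h. h \<in> S}" using S(3)[OF h(1), of c] om_scale by blast
      assume "\<eta> \<in> {om h | h. h \<in> S}"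
      then obtain h' where h': "h' \<in> S" "\<eta> = om h'" by blast
      have "\<omega> + \<eta> = om (h + h')" unfolding h(2) h'(2) om_add ..
      thus "\<omega> + \<eta> \<in> {om h | h. h \<in> S}" using S(2)[OF h(1) h'(1)] by blast
    qed
  qed
  thus ?thesis using \<omega> by (auto simp: regular_at_def)
qed

lemma regular_base:
  assumes "V \<in> places FF" "a \<in> V" "b \<in> V" shows "om (a * Dx b) \<in> regular_at FF V"
proof -
  have "b \<in> FF" using assms by (auto simp: places_def)
  hence "om (a * Dx b) = differential FF a b" by (rule differential_eq[symmetric])
  thus ?thesis using assms unfolding regular_at_def by (intro VS.span_base) blast
qed

end

text \<open>The half turn taking (a, b) to (d - a, q - b) exchanges the lattice points of the open
  rectangle below and above the diagonal; coprimality keeps the diagonal free of them.\<close>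

lemma card_triangle:
  fixes q d :: nat
  assumes cop: "coprime q d" and q: "q \<ge> 1" and d: "d \<ge> 1"
  shows "2 * card {(a, b). a \<ge> 1 \<and> b \<ge> 1 \<and> q * a + d * b < q * d} = (q - 1) * (d - 1)"
proof -
  let ?R = "{1..d - 1} \<times> {1..q - 1}"
  let ?S = "{(a, b). a \<ge> 1 \<and> b \<ge> 1 \<and> q * a + d * b < q * d}"
  let ?T = "{(a, b) \<in> ?R. q * d < q * a + d * b}"
  have SR: "?S \<subseteq> ?R"
  proof
    fix z assume z: "z \<in> ?S"
    obtain a b where ab: "z = (a, b)" by fastforce
    have 1: "a \<ge> 1" "b \<ge> 1" "q * a + d * b < q * d" using z ab by auto
    have "q * a < q * d" "d * b < d * q" using 1(3) mult.commute[of q d] by linarith+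
    hence "a < d" "b < q" by simp_all
    thus "z \<in> ?R" using 1 ab by auto
  qed
  have "bij_betw (\<lambda>(a, b). (d - a, q - b)) ?S ?T"
  proof (rule bij_betw_byWitness[where f' = "\<lambda>(a, b). (d - a, q - b)"])
    have eq: "q * (d - a) + d * (q - b) + (q * a + d * b) = 2 * (q * d)" if le: "a \<le> d" "b \<le> q" for a b
    proof -
      obtain a' where "d = a + a'" using le_Suc_ex[OF le(1)] by blast
      moreover obtain b' where "q = b + b'" using le_Suc_ex[OF le(2)] by blast
      ultimately show ?thesis by (simp add: algebra_simps)
    qed
    have bd: "a \<ge> 1 \<and> a < d \<and> b \<ge> 1 \<and> b < q" if "(a, b) \<in> ?R" for a b using that by auto
    show "\<forall>z\<in>?S. (\<lambda>(a, b). (d - a, q - b)) ((\<lambda>(a, b). (d - a, q - b)) z) = z"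
      using SR by fastforce
    show "\<forall>z\<in>?T. (\<lambda>(a, b). (d - a, q - b)) ((\<lambda>(a, b). (d - a, q - b)) z) = z"
      by fastforce
    show "(\<lambda>(a, b). (d - a, q - b)) ` ?S \<subseteq> ?T"
    proof (rule image_subsetI)
      fix z assume z: "z \<in> ?S"
      obtain a b where ab: "z = (a, b)" by fastforce
      have 1: "q * a + d * b < q * d" using z ab by simp
      have 2: "a \<ge> 1 \<and> a < d \<and> b \<ge> 1 \<and> b < q" using z ab SR bd by blast
      have "q * d < q * (d - a) + d * (q - b)" using eq[of a b] 1 2 by linarith
      moreover have "(d - a, q - b) \<in> ?R" using 2 by auto
      ultimately show "(\<lambda>(a, b). (d - a, q - b)) z \<in> ?T" by (simp add: ab)
    qed
    show "(\<lambda>(a, b). (d - a, q - b)) ` ?T \<subseteq> ?S"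
    proof (rule image_subsetI)
      fix z assume z: "z \<in> ?T"
      obtain a b where ab: "z = (a, b)" by fastforce
      have 1: "q * d < q * a + d * b" using z ab by simp
      have 2: "a \<ge> 1 \<and> a < d \<and> b \<ge> 1 \<and> b < q" using z ab bd by blast
      have "q * (d - a) + d * (q - b) < q * d" using eq[of a b] 1 2 by linarith
      moreover have "1 \<le> d - a" "1 \<le> q - b" using 2 by auto
      ultimately show "(\<lambda>(a, b). (d - a, q - b)) z \<in> ?S" by (simp add: ab)
    qed
  qed
  hence cST: "card ?S = card ?T" by (rule bij_betw_same_card)
  have ne: "q * a + d * b \<noteq> q * d" if "(a, b) \<in> ?R" for a b
  proof
    assume e: "q * a + d * b = q * d"
    hence "d dvd q * a" by (metis dvd_add_left_iff dvd_triv_left dvd_triv_right)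
    hence "d dvd a" using cop by (simp add: coprime_dvd_mult_right_iff coprime_commute)
    thus False using that by (auto dest: dvd_imp_le)
  qed
  have RST: "?R = ?S \<union> ?T"
  proof (intro equalityI subsetI)
    fix z assume z: "z \<in> ?R"
    obtain a b where "z = (a, b)" by fastforce
    thus "z \<in> ?S \<union> ?T" using z ne[of a b] by (cases "q * a + d * b < q * d") auto
  qed (use SR in auto)
  have fin: "finite ?S" "finite ?T"
    by (rule finite_subset[OF SR], simp) (rule finite_subset[of _ ?R], auto)
  have "card ?R = card (?S \<union> ?T)" using RST by (rule arg_cong)
  also have "\<dots> = card ?S + card ?T" by (rule card_Un_disjoint[OF fin]) auto
  finally have "card ?R = card ?S + card ?T" .
  moreover have "card ?R = (d - 1) * (q - 1)" by simp
  ultimately show ?thesis using cST by (simp add: mult.commute)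
qed

context AS_place begin

interpretation VS: vector_space "scale_form :: 'a \<Rightarrow> 'a form \<Rightarrow> 'a form" by (rule vector_space_scale_form)

section \<open>An explicit basis of the regular differentials\<close>

lemma root_const_ext:
  assumes c: "c \<noteq> (0 :: 'a poly)" "ev1 const \<alpha> c = 0"
  obtains n where "n \<ge> 1" "\<alpha> \<in> const_ext n"
proof -
  let ?P = "map_poly const c"
  let ?g = "\<lambda>i. \<alpha> ^ (p ^ (s * i))"
  have "Polynomial.coeff ?P (Polynomial.degree c) \<noteq> 0"
    using c(1) rhom_inj[OF rhom_const, of "Polynomial.lead_coeff c"] by (simp add: coeff_map_poly C.h0)
  hence "?P \<noteq> 0" by auto
  hence fin: "finite {z. poly ?P z = 0}" by (rule poly_roots_finite)
  have "?g i \<in> {z. poly ?P z = 0}" for i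
  proof -
    have cs: "const a ^ (p ^ (s * i)) = const a" for a :: 'a
      using AC.GF_mult[OF const_GF, of a i] by (simp add: AC.GF_def)
    have "ev1 const (?g i) c = ev1 const \<alpha> c ^ (p ^ (s * i))"
      unfolding C.ev1_sum AC.frob_sum power_mult_distrib cs by (simp add: mult.commute flip: power_mult)
    thus ?thesis using c(2) by (simp add: ev1_def)
  qed
  hence "range ?g \<subseteq> {z. poly ?P z = 0}" by blast
  hence "finite (range ?g)" using fin by (rule finite_subset)
  hence "\<not> inj ?g" using finite_imageD[of ?g UNIV] infinite_UNIV_nat by blast
  then obtain i j where ij: "i \<noteq> j" "?g i = ?g j" by (auto simp: inj_def)
  have *: "\<exists>n\<ge>1. \<alpha> \<in> const_ext n" if "i < j" "?g i = ?g j" for i j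
  proof -
    define m where "m = j - i"
    have m: "j = m + i" "m \<ge> 1" using that(1) by (auto simp: m_def)
    have "(\<alpha> ^ (p ^ (s * m))) ^ (p ^ (s * i)) = \<alpha> ^ (p ^ (s * i))"
      using that(2) AC.frob_pow_add[of \<alpha> "s * m" "s * i"] by (simp add: m(1) distrib_left)
    hence "\<alpha> ^ (p ^ (s * m)) = \<alpha>" by (simp only: AC.frob_inj)
    thus ?thesis using m(2) by (auto simp: const_ext_eq AC.GF_def)
  qed
  show ?thesis using *[of i j] *[of j i] ij that by (metis linorder_less_linear)
qed

lemma ex_minimal_annihilator:
  assumes c: "c \<noteq> (0 :: 'a poly)" "ev1 const \<alpha> c = 0"
  obtains \<pi> where "Polynomial.degree \<pi> \<ge> 1" "\<And>g. ev1 const \<alpha> g = 0 \<Longrightarrow> \<pi> dvd g"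
proof -
  interpret E1: rhom "ev1 const \<alpha> :: 'a poly \<Rightarrow> 'a ambient" by (rule C.rhom_ev1)
  obtain \<pi> :: "'a poly" where \<pi>: "\<pi> \<noteq> 0 \<and> ev1 const \<alpha> \<pi> = 0"
    and min: "\<And>g. g \<noteq> 0 \<and> ev1 const \<alpha> g = 0 \<Longrightarrow> Polynomial.degree \<pi> \<le> Polynomial.degree g"
    using ex_has_least_nat[of "\<lambda>g. g \<noteq> 0 \<and> ev1 const \<alpha> g = 0" c Polynomial.degree] c by blast
  have "Polynomial.degree \<pi> \<noteq> 0"
  proof
    assume "Polynomial.degree \<pi> = 0"
    then obtain a where "\<pi> = [:a:]" by (rule degree_eq_zeroE)
    thus False using \<pi> rhom_inj[OF rhom_const] by auto
  qed
  moreover have "\<pi> dvd g" if g: "ev1 const \<alpha> g = 0" for g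
  proof -
    have "ev1 const \<alpha> g = ev1 const \<alpha> (g div \<pi> * \<pi> + g mod \<pi>)" by simp
    hence "ev1 const \<alpha> (g mod \<pi>) = 0" using g \<pi> by (simp only: E1.hadd E1.hmult) simp
    moreover have "g mod \<pi> = 0 \<or> Polynomial.degree (g mod \<pi>) < Polynomial.degree \<pi>" using \<pi> by (intro degree_mod_less) auto
    ultimately have "g mod \<pi> = 0" using min[of "g mod \<pi>"] by (meson linorder_not_less)
    thus ?thesis by (simp add: mod_eq_0_iff_dvd)
  qed
  ultimately show ?thesis using that[of \<pi>] by (simp add: One_nat_def)
qed

text \<open>Let the denominator \<open>c\<close> have minimal degree. Over a root \<alpha> of it lie
  q distinct points, all of them zeros of G(\<alpha>, y), which has degree below q and so vanishes
  identically. The minimal polynomial of \<alpha> then cancels from \<open>G\<close> and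
  \<open>c\<close>.\<close>

lemma regular_affine:
  assumes hF: "h \<in> FF" and reg: "\<And>\<alpha> \<beta> n. n \<ge> 1 \<Longrightarrow> \<alpha> \<in> const_ext n \<Longrightarrow> on_curve \<alpha> \<beta> \<Longrightarrow> h \<in> Va \<alpha> \<beta>"
  obtains G where "h = rr G" "G = 0 \<or> Polynomial.degree G < q"
proof -
  let ?Q = "\<lambda>(G, c). c \<noteq> 0 \<and> h = frac G c \<and> (G = 0 \<or> Polynomial.degree G < q)"
  have "\<exists>P. ?Q P" by (rule FF_frac_reduced[OF hF]) auto
  then obtain P where P: "?Q P" "\<And>R. ?Q R \<Longrightarrow> Polynomial.degree (snd P) \<le> Polynomial.degree (snd R)"
    using ex_has_least_nat[of ?Q _ "\<lambda>P. Polynomial.degree (snd P)"] by blast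
  obtain G c where Gc: "P = (G, c)" by fastforce
  have G: "c \<noteq> 0" "h = frac G c" "G = 0 \<or> Polynomial.degree G < q" using P(1) Gc by auto
  have "Polynomial.degree c = 0"
  proof (rule ccontr)
    assume dc: "Polynomial.degree c \<noteq> 0"
    have "Polynomial.degree (map_poly const c) = Polynomial.degree c"
      using rhom_inj[OF rhom_const] by (intro degree_map_poly) auto
    then obtain \<alpha> where \<alpha>: "ev1 const \<alpha> c = 0" using alg_closed_imp_poly_has_root[of "map_poly const c"] dc by (auto simp: ev1_def)
    obtain n where n: "n \<ge> 1" "\<alpha> \<in> const_ext n" by (rule root_const_ext[OF G(1) \<alpha>])
    let ?B = "{\<beta> :: 'a ambient. \<beta> ^ q - \<beta> = ev1 const \<alpha> f}"
    have cB: "card ?B = q" unfolding q using AC.card_AS[OF u] .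
    let ?R = "map_poly (ev1 const \<alpha>) G"
    interpret E1: rhom "ev1 const \<alpha> :: 'a poly \<Rightarrow> 'a ambient" by (rule C.rhom_ev1)
    have "poly ?R \<beta> = 0" if "\<beta> \<in> ?B" for \<beta>
    proof -
      have oc: "on_curve \<alpha> \<beta>" using that by (simp add: on_curve_def)
      have hV: "h \<in> Va \<alpha> \<beta>" by (rule reg[OF n oc])
      have e: "rr G = h * rr [:c:]" using G(1) by (simp add: G(2) frac_def kx_eq_0_iff)
      have "ev2 const \<alpha> \<beta> G = fls_nth (ia \<alpha> \<beta> h) 0 * ev2 const \<alpha> \<beta> [:c:]"
        using ia_hom(2)[OF oc hV rr_Va[OF oc], of "[:c:]"] unfolding e[symmetric] ia_rr_nth(1)[OF oc] .
      hence "ev2 const \<alpha> \<beta> G = 0" using \<alpha> by simp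
      thus ?thesis by (simp add: ev2_def ev1_def[of "ev1 const \<alpha>"])
    qed
    hence BR: "?B \<subseteq> {\<beta>. poly ?R \<beta> = 0}" by blast
    have "?R = 0"
    proof (rule ccontr)
      assume R0: "?R \<noteq> 0"
      hence "G \<noteq> 0" by auto
      hence "Polynomial.degree ?R < q" using G(3) map_poly_degree_leq[of "ev1 const \<alpha>" G] by simp
      moreover have "q \<le> card {\<beta>. poly ?R \<beta> = 0}" using card_mono[OF poly_roots_finite[OF R0] BR] cB by simp
      ultimately show False using card_poly_roots_bound[OF R0] by linarith
    qed
    hence Gj: "ev1 const \<alpha> (Polynomial.coeff G j) = 0" for j
      by (metis coeff_map_poly E1.h0 Polynomial.coeff_0)
    obtain \<pi> where \<pi>: "Polynomial.degree \<pi> \<ge> 1" "\<And>g. ev1 const \<alpha> g = 0 \<Longrightarrow> \<pi> dvd g"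
      by (rule ex_minimal_annihilator[OF G(1) \<alpha>]) blast
    obtain c' where c': "c = \<pi> * c'" using \<pi>(2)[OF \<alpha>] by (auto elim: dvdE)
    define G' where "G' = map_poly (\<lambda>g. g div \<pi>) G"
    have G': "G = Polynomial.smult \<pi> G'"
      using \<pi>(2)[OF Gj] by (intro poly_eqI) (simp add: G'_def coeff_map_poly)
    have c0: "c' \<noteq> 0" "\<pi> \<noteq> 0" using c' G(1) by auto
    have "h = frac G' c'" using c0 by (simp add: G(2) frac_def c' G' C.ev2_smult K.hmult kx_eq_0_iff)
    moreover have "G' = 0 \<or> Polynomial.degree G' < q" using G(3) c0 G' by auto
    ultimately have "?Q (G', c')" using c0 by simp
    hence "Polynomial.degree c \<le> Polynomial.degree c'" using P(2) Gc by fastforce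
    thus False using c' c0 \<pi>(1) by (simp add: Polynomial.degree_mult_eq)
  qed
  then obtain a where a: "c = [:a:]" by (rule degree_eq_zeroE)
  have "h = rr (Polynomial.smult [:inverse a:] G)"
  proof -
    have "kx [:inverse a:] * kx [:a:] = 1" using G(1) a C.hmult[of "inverse a" a] by (simp add: C.h1)
    hence "kx [:inverse a:] = inverse (kx c)" using a by (metis inverse_unique mult.commute)
    thus ?thesis by (simp only: G(2) frac_def C.ev2_smult divide_inverse mult.commute)
  qed
  moreover have "Polynomial.smult [:inverse a:] G = 0 \<or> Polynomial.degree (Polynomial.smult [:inverse a:] G) < q"
    using G(3) le_less_trans[OF degree_smult_le] by auto
  ultimately show ?thesis by (rule that)
qed

text \<open>The condition q i + d j <= 2 g - 2, arranged so that d + 1 is not subtracted.\<close>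

definition J :: "(nat \<times> nat) set" where
  "J = {(i, j). q * i + d * j + d + 1 \<le> q * (d - 1)}"

definition xy :: "nat \<times> nat \<Rightarrow> 'a ambient" where "xy = (\<lambda>(i, j). xcoord ^ i * y ^ j)"

lemma J_less: "(i, j) \<in> J \<Longrightarrow> j < q"
proof -
  assume "(i, j) \<in> J"
  hence "d * j < q * (d - 1)" by (auto simp: J_def)
  also have "\<dots> \<le> d * q" by simp
  finally show "j < q" by simp
qed

text \<open>Raising both exponents by 1 turns the condition into the strict interior of a right
  triangle with legs d and q.\<close>

lemma card_J: "2 * card J = (q - 1) * (d - 1)"
proof -
  let ?S = "{(a, b). a \<ge> 1 \<and> b \<ge> 1 \<and> q * a + d * b < q * d}"
  have *: "(i, j) \<in> J \<longleftrightarrow> q * (i + 1) + d * (j + 1) < q * d" for i j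
  proof -
    have "q * d = q * (d - 1) + q" using d2 by (simp add: algebra_simps)
    thus ?thesis by (auto simp: J_def algebra_simps)
  qed
  have "bij_betw (\<lambda>(i, j). (i + 1, j + 1)) J ?S"
    by (rule bij_betw_byWitness[where f' = "\<lambda>(a, b). (a - 1, b - 1)"]) (auto simp: *)
  thus ?thesis using card_triangle[OF coprime_qd] q2 d2 by (simp add: bij_betw_same_card)
qed

lemma finite_J: "finite J"
proof (rule finite_subset[of _ "{..q * (d - 1)} \<times> {..q * (d - 1)}"])
  have "a \<le> q * (d - 1) \<and> b \<le> q * (d - 1)" if "(a, b) \<in> J" for a b
  proof -
    have "1 * a \<le> q * a" "1 * b \<le> d * b" using q2 d2 by (intro mult_le_mono1; simp)+
    hence "a \<le> q * a" "b \<le> d * b" by (simp_all only: mult_1)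
    moreover have "q * a + d * b + d + 1 \<le> q * (d - 1)" using that by (simp add: J_def)
    ultimately show ?thesis by linarith
  qed
  thus "J \<subseteq> {..q * (d - 1)} \<times> {..q * (d - 1)}" by auto
qed simp

lemma ii_xy: "ii (xy (i, j)) = xi ^ i * eta ^ j"
  by (simp add: xy_def ii_def iota_mult[OF sol_inf] iota_power[OF sol_inf] iota_gens[OF sol_inf] FF_ring FF_gens)

lemma rr_xy: "xy (i, j) = rr (Polynomial.monom (Polynomial.monom 1 i) j)"
  by (simp add: xy_def C.ev2_monom C.ev1_monom C.h1)

lemma xi_eta_nz: "xi \<noteq> 0" "eta \<noteq> 0"
  using subdegree_xi subdegree_eta q2 d2 by auto

text \<open>Where x is regular the form has the required shape a dx. At infinity dx is written as dt
  divided by dt/dx for a local parameter t, and the orders add up.\<close>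

lemma regular_xy:
  assumes V: "V \<in> places FF" and ij: "(i, j) \<in> J"
  shows "om (xy (i, j)) \<in> regular_at FF V"
proof (cases "xcoord \<in> V")
  case True
  have "xy (i, j) \<in> V" unfolding rr_xy by (rule rr_in_place[OF V True])
  from regular_base[OF V this True] show ?thesis by (simp add: Dx_x)
next
  case False
  hence Vi: "V = Vi" by (rule Vi_unique[OF V])
  \<comment> \<open>Exponents with d b - q a = 1 make t = x^a / y^b vanish to order exactly 1 at
    infinity.\<close>
  obtain b a where ba: "d * b = q * a + 1"
    using bezout_nat[of d q] d2 coprime_qd by (auto simp: coprime_iff_gcd_eq_1 gcd.commute)
  define t where "t = xcoord ^ a * inverse (y ^ b)"
  have tF: "t \<in> FF" unfolding t_def by (intro FF_ring FF_inverse FF_gens)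
  have "ii t = xi ^ a * inverse (eta ^ b)"
    by (simp add: t_def ii_def iota_mult[OF sol_inf] iota_power[OF sol_inf] iota_gens[OF sol_inf] iota_inverse[OF sol_inf] FF_ring FF_gens FF_inverse)
  hence st: "fls_subdegree (ii t) = 1"
  proof -
    have "int d * int b = int q * int a + 1" using arg_cong[OF ba, of int] by simp
    thus ?thesis using \<open>ii t = _\<close> xi_eta_nz subdegree_xi subdegree_eta by (simp add: fls_subdegree_pow mult.commute)
  qed
  have tV: "t \<in> Vi" using tF st by (simp add: Vi_def plc_def ii_def)
  have sdt: "fls_subdegree (fls_deriv (ii t)) = 0" "fls_deriv (ii t) \<noteq> 0"
  proof -
    have nz: "fls_nth (ii t) 1 \<noteq> 0" using st nth_fls_subdegree_zero_iff[of "ii t"] by (metis fls_zero_subdegree zero_neq_one)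
    show "fls_subdegree (fls_deriv (ii t)) = 0" using fls_subdegree_deriv'[of "ii t"] st by simp
    have "fls_nth (fls_deriv (ii t)) 0 = fls_nth (ii t) 1" by simp
    thus "fls_deriv (ii t) \<noteq> 0" using nz by (metis fls_zero_nth)
  qed
  have nz: "ii (Dx t) \<noteq> 0" and sD: "fls_subdegree (ii (Dx t)) = - mu"
  proof -
    show "ii (Dx t) \<noteq> 0" using sdt Dx_ii[OF tF] by auto
    thus "fls_subdegree (ii (Dx t)) = - mu" using sdt Dx_ii[OF tF] xi_deriv by simp
  qed
  have D0: "Dx t \<noteq> 0" using nz iota_0[OF sol_inf] by (auto simp: ii_def)
  have xyF: "xy (i, j) \<in> FF" unfolding rr_xy by (rule rr_FF)
  have "ii (xy (i, j) * inverse (Dx t)) = (xi ^ i * eta ^ j) * inverse (ii (Dx t))"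
    using ii_xy[of i j] iota_mult[OF sol_inf xyF FF_inverse[OF Dx_FF[of t]]] iota_inverse[OF sol_inf Dx_FF[of t]]
    by (simp add: ii_def)
  hence "fls_subdegree (ii (xy (i, j) * inverse (Dx t))) = mu - int q * int i - int d * int j"
    using nz sD xi_eta_nz subdegree_xi subdegree_eta by (simp add: fls_subdegree_pow mult.commute)
  also have "\<dots> \<ge> 0"
  proof -
    have "q * i + d * j + d + 1 \<le> q * (d - 1)" using ij by (simp add: J_def)
    hence "int q * int i + int d * int j + int d + 1 \<le> int (q * (d - 1))"
      using of_nat_le_iff[of "q * i + d * j + d + 1" "q * (d - 1)", where 'a = int] by (simp del: of_nat_le_iff)
    thus ?thesis by linarith
  qed
  finally have "xy (i, j) * inverse (Dx t) \<in> Vi"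
    using FF_ring(4)[OF xyF FF_inverse[OF Dx_FF[of t]]] by (simp add: Vi_def plc_def ii_def)
  from regular_base[OF Vi_place this tV] show ?thesis using D0 Vi by (simp add: mult.assoc)
qed

text \<open>Regularity at the affine places makes h a polynomial in x and y; regularity at infinity
  bounds its weighted degree by the order of dx. As pole orders do not cancel, every single monomial
  obeys the bound.\<close>

lemma regular_imp_span:
  assumes \<omega>: "\<omega> \<in> (\<Inter>V\<in>places FF. regular_at FF V)"
  shows "\<omega> \<in> VS.span ((\<lambda>z. om (xy z)) ` J)"
proof -
  let ?S = "{h \<in> FF. 0 \<le> fls_subdegree (ii h * fls_deriv xi)}"
  have "\<exists>h\<in>?S. \<omega> = om h"
  proof (rule regular_form[OF Vi_place])
    show "0 \<in> ?S" using FF_ring iota_0[OF sol_inf] by (simp add: ii_def)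
    show "a + b \<in> ?S" if "a \<in> ?S" "b \<in> ?S" for a b
    proof -
      have "0 \<le> fls_subdegree (ii a * fls_deriv xi - (- (ii b * fls_deriv xi)))"
        using that by (intro fls_nonneg_diff) simp_all
      thus ?thesis using that FF_ring by (simp add: ii_def iota_add[OF sol_inf] distrib_right)
    qed
    show "const c * a \<in> ?S" if "a \<in> ?S" for c a
    proof -
      have "ii (const c * a) = fls_const c * ii a"
        using that FF_gens(1)[of c] by (simp add: ii_def iota_mult[OF sol_inf] iota_gens[OF sol_inf])
      thus ?thesis using that FF_ring FF_gens(1)[of c] fls_mult_subdegree_ge_0[of "fls_const c" "ii a * fls_deriv xi"]
        by (simp add: mult.assoc)
    qed
    show "a * Dx b \<in> ?S" if "a \<in> Vi" "b \<in> Vi" for a b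
    proof -
      have F: "a \<in> FF" "b \<in> FF" "0 \<le> fls_subdegree (ii a)" "0 \<le> fls_subdegree (ii b)" using that by (auto simp: Vi_def plc_def ii_def)
      have "ii (a * Dx b) * fls_deriv xi = ii a * fls_deriv (ii b)"
        using F(1) Dx_FF[of b] by (simp add: Dx_ii[OF F(2)] mult.assoc) (simp add: ii_def iota_mult[OF sol_inf])
      thus ?thesis using FF_ring(4)[OF F(1) Dx_FF[of b]] fls_mult_subdegree_ge_0[OF F(3) fls_deriv_nonneg[OF F(4)]] by simp
    qed
    show "\<omega> \<in> regular_at FF Vi" using \<omega> Vi_place by blast
  qed
  then obtain h where h: "h \<in> FF" "0 \<le> fls_subdegree (ii h * fls_deriv xi)" "\<omega> = om h" by blast
  have aff: "h \<in> Va \<alpha> \<beta>" if n: "n \<ge> 1" "\<alpha> \<in> const_ext n" "on_curve \<alpha> \<beta>" for \<alpha> \<beta> n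
  proof -
    note PL = Va_place_max(1)[OF n(3,1,2)]
    interpret V: valuation_ring "Va \<alpha> \<beta>" FF by (rule place_vr[OF PL])
    have "\<exists>h'\<in>Va \<alpha> \<beta>. \<omega> = om h'"
    proof (rule regular_form[OF PL])
      show "a * Dx b \<in> Va \<alpha> \<beta>" if ab: "a \<in> Va \<alpha> \<beta>" "b \<in> Va \<alpha> \<beta>" for a b
      proof -
        have b: "b \<in> FF" "0 \<le> fls_subdegree (ia \<alpha> \<beta> b)" using ab by (auto simp: Va_def plc_def ia_def)
        have "0 \<le> fls_subdegree (ia \<alpha> \<beta> (Dx b))" using fls_deriv_nonneg[OF b(2)] unfolding Dx_ia[OF b(1) n(3)] .
        hence "Dx b \<in> Va \<alpha> \<beta>" using Dx_FF[of b] by (simp add: Va_def plc_def ia_def)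
        thus ?thesis using ab V.vr by blast
      qed
      show "\<omega> \<in> regular_at FF (Va \<alpha> \<beta>)" using \<omega> PL by blast
    qed (use V.vr place_const[OF PL] in auto)
    thus ?thesis using h(3) om_eq_iff by metis
  qed
  obtain G where G: "h = rr G" "G = 0 \<or> Polynomial.degree G < q" by (rule regular_affine[OF h(1) aff])
  show ?thesis
  proof (cases "G = 0")
    case True
    hence "\<omega> = 0" using h(3) G(1) by (simp add: RR.h0 om_0)
    thus ?thesis by (simp add: VS.span_zero)
  next
    case False
    have "ii h = ev2 fls_const xi eta G" by (simp add: G(1) ii_def iota_rr[OF sol_inf])
    hence "ii h \<noteq> 0" "fls_subdegree (ii h) = - int (wd G)"
      using subdegree_ev2[OF subdegree_xi subdegree_eta False] G(2) False by auto
    hence "fls_subdegree (ii h * fls_deriv xi) = - int (wd G) + mu"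
      using xi_deriv fls_subdegree_mult by metis
    hence "int (wd G) \<le> mu" using h(2) by linarith
    hence "int (wd G + d + 1) \<le> int (q * (d - 1))" by linarith
    hence "wd G \<le> q * (d - 1) - (d + 1)" "d + 1 \<le> q * (d - 1)" unfolding of_nat_le_iff by linarith+
    hence wd: "q * Polynomial.degree (Polynomial.coeff G j) + d * j + d + 1 \<le> q * (d - 1)" if "Polynomial.coeff G j \<noteq> 0" for j
      using wd_le_iff[OF False, of "q * (d - 1) - (d + 1)"] that by fastforce
    have "h = (\<Sum>j\<le>Polynomial.degree G. \<Sum>i\<le>Polynomial.degree (Polynomial.coeff G j).
        const (Polynomial.coeff (Polynomial.coeff G j) i) * xy (i, j))"
      unfolding G(1) C.ev2_sum C.ev1_sum sum_distrib_right by (simp add: xy_def mult.assoc)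
    hence "\<omega> = (\<Sum>j\<le>Polynomial.degree G. \<Sum>i\<le>Polynomial.degree (Polynomial.coeff G j).
        scale_form (Polynomial.coeff (Polynomial.coeff G j) i) (om (xy (i, j))))"
      unfolding h(3) by (simp only: om_sum om_scale)
    also have "\<dots> \<in> VS.span ((\<lambda>z. om (xy z)) ` J)"
    proof (intro VS.span_sum)
      fix j i assume i: "i \<in> {..Polynomial.degree (Polynomial.coeff G j)}"
      show "scale_form (Polynomial.coeff (Polynomial.coeff G j) i) (om (xy (i, j))) \<in> VS.span ((\<lambda>z. om (xy z)) ` J)"
      proof (cases "Polynomial.coeff G j = 0")
        case False
        have "q * i \<le> q * Polynomial.degree (Polynomial.coeff G j)" using i by (intro mult_le_mono2) simp
        hence "q * i + d * j + d + 1 \<le> q * (d - 1)" using wd[OF False] by linarith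
        hence "(i, j) \<in> J" by (simp add: J_def)
        thus ?thesis by (intro VS.span_scale VS.span_base) auto
      qed (simp add: VS.span_zero)
    qed
    finally show ?thesis .
  qed
qed

text \<open>A linear relation is a polynomial of degree below q in y that is divisible by
  \<open>A\<close>, which is monic of degree q.\<close>

lemma xy_independent:
  assumes z: "(\<Sum>z\<in>J. const (g z) * xy z) = 0" and m: "m \<in> J" shows "g m = 0"
proof -
  define G where "G = (\<Sum>(i, j)\<in>J. Polynomial.monom (Polynomial.monom (g (i, j)) i) j)"
  have "rr G = (\<Sum>z\<in>J. const (g z) * xy z)"
    unfolding G_def RR.hsum by (intro sum.cong) (auto simp: C.ev2_monom C.ev1_monom xy_def mult.assoc)
  hence "A dvd G" using z rr_eq_0_iff by simp
  have "Polynomial.degree G \<le> q - 1"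
    unfolding G_def
  proof (rule degree_sum_le[OF finite_J])
    fix z assume "z \<in> J"
    thus "Polynomial.degree (case z of (i, j) \<Rightarrow> Polynomial.monom (Polynomial.monom (g (i, j)) i) j) \<le> q - 1"
      using J_less[of "fst z" "snd z"] order_trans[OF degree_monom_le, of "snd z" "q - 1" "Polynomial.monom (g z) (fst z)"]
      by (cases z) auto
  qed
  hence "G = 0" using \<open>A dvd G\<close> dvd_imp_degree_le[of A G] degree_A q2 by fastforce
  obtain i j where ij: "m = (i, j)" by fastforce
  have "Polynomial.coeff (Polynomial.coeff G j) i = (\<Sum>z\<in>J. if z = (i, j) then g z else 0)"
    unfolding G_def Polynomial.coeff_sum by (intro sum.cong) (auto split: prod.splits)
  also have "\<dots> = g (i, j)" using m ij finite_J by (simp add: sum.delta)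
  finally show ?thesis using \<open>G = 0\<close> ij by simp
qed

lemma inj_om_xy: "inj_on (\<lambda>z. om (xy z)) J"
proof (rule inj_onI)
  fix z w assume zw: "z \<in> J" "w \<in> J" "om (xy z) = om (xy w)"
  obtain i j k l where ij: "z = (i, j)" "w = (k, l)" by fastforce
  have "xi ^ i * eta ^ j = xi ^ k * eta ^ l" using zw(3) om_eq_iff ij ii_xy by metis
  hence "fls_subdegree (xi ^ i * eta ^ j) = fls_subdegree (xi ^ k * eta ^ l)" by simp
  hence "int q * int i + int d * int j = int q * int k + int d * int l"
    using xi_eta_nz subdegree_xi subdegree_eta by (simp add: fls_subdegree_pow mult.commute)
  hence e: "q * i + d * j = q * k + d * l" by (metis of_nat_add of_nat_mult of_nat_eq_iff)
  hence "j = l" using wd_inj J_less zw(1,2) ij by blast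
  thus "z = w" using e q2 ij by simp
qed

theorem genus_FF: "2 * genus FF = (q - 1) * (d - 1)"
proof -
  let ?I = "\<Inter>V\<in>places FF. regular_at FF V"
  let ?B = "(\<lambda>z. om (xy z)) ` J"
  have sub: "VS.subspace ?I" unfolding regular_at_def by (intro VS.subspace_Int VS.subspace_span)
  have "?B \<subseteq> ?I" using regular_xy by auto
  hence "VS.span ?B \<subseteq> ?I" using sub by (rule VS.span_minimal)
  moreover have "?I \<subseteq> VS.span ?B" using regular_imp_span by blast
  ultimately have span: "VS.span ?B = VS.span ?I" using sub VS.span_eq_iff by (metis subset_antisym)
  have ind: "g \<omega> = 0" if z: "(\<Sum>x\<in>?B. scale_form (g x) x) = 0" and "\<omega> \<in> ?B" for g \<omega>
  proof -
    obtain m where m: "m \<in> J" "\<omega> = om (xy m)" using \<open>\<omega> \<in> ?B\<close> by blast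
    have "om (\<Sum>z\<in>J. const (g (om (xy z))) * xy z) = (\<Sum>x\<in>?B. scale_form (g x) x)"
      unfolding sum.reindex[OF inj_om_xy] by (simp add: om_sum om_scale)
    hence "om (\<Sum>z\<in>J. const (g (om (xy z))) * xy z) = om 0" unfolding z by (simp only: om_0)
    hence "(\<Sum>z\<in>J. const (g (om (xy z))) * xy z) = 0" by (simp only: om_eq_iff)
    from xy_independent[of "\<lambda>z. g (om (xy z))" m, OF this m(1)] show ?thesis by (simp add: m(2))
  qed
  have "VS.independent ?B"
    apply (rule VS.independent_if_scalars_zero)
    subgoal using finite_J by simp
    subgoal for g \<omega> by (rule ind[of g \<omega>])
    done
  with span have "genus FF = card ?B" unfolding genus_def by (rule VS.dim_eq_card)
  thus ?thesis using card_J by (simp add: card_image[OF inj_om_xy])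
qed

end

section \<open>The Newton polygon\<close>

text \<open>The half strip above the line of slope 1/2 is convex and so contains the hull, while the
  two end points put the whole segment into the hull.\<close>

lemma lower_convex_hull_segment:
  assumes S: "S \<subseteq> {(t, v). 0 \<le> t \<and> t \<le> 2 * g \<and> t / 2 \<le> v}" and ends: "(0, 0) \<in> S" "(2 * g, g) \<in> S"
  shows "lower_convex_hull S = closed_segment (0, 0) (2 * g, g)"
proof -
  let ?H = "{(t, v). 0 \<le> t \<and> t \<le> 2 * g \<and> t / 2 \<le> (v :: real)}"
  have cH: "convex ?H"
  proof (rule convexI)
    fix z w :: "real \<times> real" and u v :: real
    assume z: "z \<in> ?H" and w: "w \<in> ?H" and uv: "0 \<le> u" "0 \<le> v" "u + v = 1"
    obtain t t' x x' where e: "z = (t, x)" "w = (t', x')" by fastforce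
    have le: "t \<le> 2 * g" "t' \<le> 2 * g" "0 \<le> t" "0 \<le> t'" "t / 2 \<le> x" "t' / 2 \<le> x'" using z w e by auto
    have "u * t \<le> u * (2 * g)" "v * t' \<le> v * (2 * g)" "0 \<le> u * t" "0 \<le> v * t'"
      "u * (t / 2) \<le> u * x" "v * (t' / 2) \<le> v * x'"
      by (intro mult_left_mono mult_nonneg_nonneg le uv)+
    moreover have "u * (2 * g) + v * (2 * g) = 2 * g" using uv(3) by (metis distrib_right mult_1)
    ultimately have "0 \<le> u * t + v * t'" "u * t + v * t' \<le> 2 * g" "(u * t + v * t') / 2 \<le> u * x + v * x'" by simp_all
    thus "u *\<^sub>R z + v *\<^sub>R w \<in> ?H" by (simp add: e)
  qed
  have hull: "convex hull S \<subseteq> ?H" using S cH by (rule hull_minimal)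
  have seg: "closed_segment (0, 0) (2 * g, g) \<subseteq> convex hull S"
    using ends by (intro closed_segment_subset_convex_hull hull_inc)
  have in_seg: "(t, t / 2) \<in> closed_segment (0, 0) (2 * g, g)" if "0 \<le> t" "t \<le> 2 * g" for t
  proof (cases "g = 0")
    case True
    thus ?thesis using that by simp
  next
    case False
    hence "(t, t / 2) = (1 - t / (2 * g)) *\<^sub>R (0, 0) + (t / (2 * g)) *\<^sub>R (2 * g, g)" "0 \<le> t / (2 * g)" "t / (2 * g) \<le> 1"
      using that by (auto simp: divide_simps)
    thus ?thesis unfolding closed_segment_def by blast
  qed
  have seg_half: "v = t / 2" if "(t, v) \<in> closed_segment (0, 0) (2 * g, g)" for t v
    using that by (auto simp: closed_segment_def)
  show ?thesis
  proof (intro equalityI subsetI)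
    fix z assume z: "z \<in> lower_convex_hull S"
    obtain t v where e: "z = (t, v)" by fastforce
    have l: "(t, v) \<in> convex hull S" "\<And>w. (t, w) \<in> convex hull S \<Longrightarrow> v \<le> w"
      using z e by (auto simp: lower_convex_hull_def)
    have t: "0 \<le> t" "t \<le> 2 * g" "t / 2 \<le> v" using l(1) hull by auto
    have "v \<le> t / 2" using in_seg[OF t(1,2)] seg l(2) by blast
    thus "z \<in> closed_segment (0, 0) (2 * g, g)" using in_seg[OF t(1,2)] t e by simp
  next
    fix z assume z: "z \<in> closed_segment (0, 0) (2 * g, g)"
    obtain t v where e: "z = (t, v)" by fastforce
    have "v = t / 2" using seg_half z e by blast
    moreover have "t / 2 \<le> w" if "(t, w) \<in> convex hull S" for w using that hull by auto
    ultimately show "z \<in> lower_convex_hull S" using z e seg by (auto simp: lower_convex_hull_def)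
  qed
qed

context AS_place begin

lemma curve_pts_eq: "curve_pts n = AC.curve_points u (map_poly const f) (s * n)"
  unfolding curve_pts_def AC.curve_points_def const_ext_eq on_curve_def ev1_def by (simp only: q)

lemma L_series_eq:
  "L_series FF = (fps_exp 1 oo Abs_fps (\<lambda>i.
     (of_nat (card (AC.curve_points u (map_poly const f) (s * i))) - of_nat (p ^ s) ^ i) / of_nat i) :: rat fps)"
proof -
  have e: "(of_nat (card (rational_points FF i)) - of_nat CARD('a) ^ i - 1) / of_nat i =
      ((of_nat (card (AC.curve_points u (map_poly const f) (s * i))) - of_nat (p ^ s) ^ i) / of_nat i :: rat)" for i
  proof (cases "i = 0")
    case False
    hence "i \<ge> 1" by simp
    thus ?thesis using card_rational_points[of i] by (simp add: curve_pts_eq card_a)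
  qed simp
  show ?thesis unfolding L_series_def e ..
qed

theorem supersingular_FF:
  assumes f: "f = (\<Sum>i\<le>k. \<Sum>j\<le>k. Polynomial.monom (a i j) (p ^ i + p ^ j))"
  shows "supersingular p s FF"
proof -
  let ?F = "map_poly const f"
  have F: "?F = (\<Sum>i\<le>k. \<Sum>j\<le>k. Polynomial.monom (const (a i j)) (p ^ i + p ^ j))"
  proof (rule poly_eqI)
    fix n
    have "const (if b then c else 0) = (if b then const c else 0)" for b and c :: 'a by (simp add: C.h0)
    thus "Polynomial.coeff ?F n = Polynomial.coeff (\<Sum>i\<le>k. \<Sum>j\<le>k. Polynomial.monom (const (a i j)) (p ^ i + p ^ j)) n"
      by (simp add: f coeff_map_poly C.h0 Polynomial.coeff_sum C.hsum)
  qed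
  have dF: "Polynomial.degree ?F = d"
    using rhom_inj[OF rhom_const] by (subst degree_map_poly) (auto simp: d)
  have F0: "?F \<noteq> 0" using dF d2 by auto
  have cop: "coprime (Polynomial.degree ?F) p"
    unfolding dF using prime_imp_coprime[OF prime_p pd] by (simp add: coprime_commute)
  obtain P :: "int poly" where P: "fps_of_poly (map_poly of_int P) = L_series FF"
    "Polynomial.coeff P 0 = 1" "Polynomial.degree P = (p ^ u - 1) * (Polynomial.degree ?F - 1)"
    "\<And>i. int p ^ ((s * i + 1) div 2) dvd Polynomial.coeff P i"
    "2 * multiplicity (int p) (Polynomial.lead_coeff P) = s * Polynomial.degree P"
  proof (rule AC.L_polynomial_supersingular[OF F F0 cop s const_GF u, folded L_series_eq])
    fix P :: "int poly"
    assume "fps_of_poly (map_poly of_int P) = L_series FF" "Polynomial.coeff P 0 = 1"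
      "Polynomial.degree P = (p ^ u - 1) * (Polynomial.degree ?F - 1)"
      "\<And>i. int p ^ ((s * i + 1) div 2) dvd Polynomial.coeff P i"
      "2 * multiplicity (int p) (Polynomial.lead_coeff P) = s * Polynomial.degree P"
    thus thesis by (rule that)
  qed
  have L: "L_polynomial FF = P"
    unfolding L_polynomial_def
  proof (rule the_equality)
    fix R :: "int poly" assume "fps_of_poly (map_poly of_int R) = L_series FF"
    hence "map_poly of_int R = (map_poly of_int P :: rat poly)" using P(1) by (simp flip: fps_of_poly_eq_iff)
    hence "(of_int (Polynomial.coeff R n) :: rat) = of_int (Polynomial.coeff P n)" for n
      by (metis coeff_map_poly of_int_0)
    thus "R = P" by (intro poly_eqI) simp
  qed (rule P(1))
  have g: "Polynomial.degree P = 2 * genus FF" using P(3) by (simp add: dF genus_FF flip: q)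
  have "P \<noteq> 0" using P(2) by auto
  have nz: "Polynomial.lead_coeff P \<noteq> 0" using \<open>P \<noteq> 0\<close> by simp
  have s0: "real s > 0" using s by simp
  have slope: "real i / 2 \<le> real (multiplicity (int p) (Polynomial.coeff P i)) / real s" if i: "Polynomial.coeff P i \<noteq> 0" for i
  proof -
    have "\<not> is_unit (int p)" using prime_gt_1_nat[OF prime_p] by simp
    hence "(s * i + 1) div 2 \<le> multiplicity (int p) (Polynomial.coeff P i)"
      using P(4)[of i] i by (intro multiplicity_geI) auto
    hence "s * i \<le> 2 * multiplicity (int p) (Polynomial.coeff P i)" by linarith
    hence "real (s * i) \<le> real (2 * multiplicity (int p) (Polynomial.coeff P i))" by (simp only: of_nat_le_iff)
    thus ?thesis using s0 by (simp add: field_simps)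
  qed
  have "newton_polygon p s FF = closed_segment (0, 0) (2 * real (genus FF), real (genus FF))"
    unfolding newton_polygon_def
  proof (rule lower_convex_hull_segment)
    show "newton_points p s FF \<subseteq> {(t, v). 0 \<le> t \<and> t \<le> 2 * real (genus FF) \<and> t / 2 \<le> v}"
    proof
      fix z assume "z \<in> newton_points p s FF"
      then obtain i where "z = (real i, real (multiplicity (int p) (Polynomial.coeff P i)) / real s)"
        "i \<le> 2 * genus FF" "Polynomial.coeff P i \<noteq> 0"
        by (auto simp: newton_points_def L)
      thus "z \<in> {(t, v). 0 \<le> t \<and> t \<le> 2 * real (genus FF) \<and> t / 2 \<le> v}" using slope[of i] by simp
    qed
    have "(real 0, real (multiplicity (int p) (Polynomial.coeff P 0)) / real s) \<in> newton_points p s FF"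
      using P(2) unfolding newton_points_def L by (intro CollectI exI[of _ 0]) simp
    thus "(0, 0) \<in> newton_points p s FF" by (simp add: P(2))
    have "multiplicity (int p) (Polynomial.lead_coeff P) = s * genus FF" using P(5) g by simp
    moreover have "(real (2 * genus FF), real (multiplicity (int p) (Polynomial.coeff P (2 * genus FF))) / real s) \<in> newton_points p s FF"
      using nz unfolding newton_points_def L g by (intro CollectI exI[of _ "2 * genus FF"]) simp
    ultimately show "(2 * real (genus FF), real (genus FF)) \<in> newton_points p s FF"
      using s0 by (simp add: g)
  qed
  thus ?thesis by (simp add: supersingular_def)
qed

end

lemma CHAR_eq_of_CARD:
  assumes "Factorial_Ring.prime p" "CARD('a::{field,finite}) = p ^ s" shows "CHAR('a) = p"
proof -
  have pos: "CHAR('a) > 0" by (rule finite_imp_CHAR_pos) simp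
  hence pr: "Factorial_Ring.prime CHAR('a)" by (rule prime_CHAR_semidom)
  have "CHAR('a) dvd CARD('a)" by (rule CHAR_dvd_CARD)
  hence "CHAR('a) dvd p" using pr assms(2) prime_dvd_power by metis
  thus ?thesis using pr assms(1) by (simp add: primes_dvd_imp_eq)
qed

theorem theorem3:
  fixes p u s k q :: nat
    and f :: "'a::{field,finite} poly"
    and a :: "nat \<Rightarrow> nat \<Rightarrow> 'a"
    and y :: "'a ambient"
  assumes "Factorial_Ring.prime p" and "u \<ge> 1" and "s \<ge> 1"
    and "q = p ^ u"
    and "CARD('a) = p ^ s"
    and "f = (\<Sum>i\<le>k. \<Sum>j\<le>k. Polynomial.monom (a i j) (p ^ i + p ^ j))"
    and "f \<noteq> 0"
    and "coprime (Polynomial.degree f) p"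
    and "y ^ q - y = poly (map_poly const f) xcoord"
  shows "supersingular p s (function_field y)"
proof -
  \<comment> \<open>Every exponent that occurs is a sum of two positive integers, so the degree is
    at least 2.\<close>
  have "Polynomial.coeff f (Polynomial.degree f) \<noteq> 0" using assms by simp
  moreover have "Polynomial.coeff f m = 0" if "\<not> (\<exists>i j. m = p ^ i + p ^ j)" for m
    unfolding assms(6) coeff_sum coeff_monom using that by (intro sum.neutral ballI) auto
  ultimately obtain i j where "Polynomial.degree f = p ^ i + p ^ j" by blast
  moreover have "p ^ i > 0" "p ^ j > 0" using prime_gt_0_nat[OF assms(1)] by simp_all
  ultimately have d2: "Polynomial.degree f \<ge> 2" by linarith
  have pd: "\<not> p dvd Polynomial.degree f"
    using assms(1,8) by (metis coprime_common_divisor dvd_refl not_prime_unit)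
  interpret AS_place p u q "Polynomial.degree f" f y s
    using assms d2 pd CHAR_eq_of_CARD[OF assms(1,5)] by unfold_locales (simp_all add: ev1_def)
  show ?thesis by (rule supersingular_FF[OF assms(6)])
qed

end
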